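(* Let $K$ be a discrete valuation field with valuation ring $\mathcal{O}_K$, uniformiser $\pi$, algebraically closed residue field $k$, and $S=\mathrm{Spec}\,\mathcal{O}_K$. Let $\Phi\in X_5(\mathcal{O}_K)$ be nonsingular with reduction $\phi\in X_5(k)$. Suppose $\mathcal{C}=\mathcal{C}_\Phi$ is a fibred surface and the entries of $\phi$ span the $k$-vector space $\langle x_1,\dots,x_5\rangle$ of linear forms. Then $\mathcal{C}$ is a local complete intersection and $\omega_{\mathcal{C}/S}=\omega_\Phi\,\mathcal{O}_{\mathcal{C}}$.
   Context: A Pfaffian model over a ring $R$ is a $5\times5$ alternating matrix $\Phi=(\Phi_{ij})$ of linear forms in $R[x_1,\dots,x_5]$; $X_5(R)$ is the set of these. The row vector of submaximal Pfaffians is $P=\mathrm{Pf}(\Phi)=(p_1,\dots,p_5)$ with $p_i=(-1)^i\,\mathrm{pf}(\Phi^{\{i\}})$, where $\Phi^{\{i\}}$ is $\Phi$ with $i$th row and column deleted and $\mathrm{pf}$ of a $4\times4$ alternating matrix $(a_{ij})$ is $a_{12}a_{34}-a_{13}a_{24}+a_{14}a_{23}$. For $\Phi\in X_5(K)$, $C_\Phi\subset\mathbb{P}^4_K$ is defined by $p_1,\dots,p_5$, and $\Phi$ is nonsingular if $C_\Phi$ is a smooth genus one curve. For $\Phi\in X_5(\mathcal{O}_K)$, $\mathcal{C}_\Phi\subset\mathbb{P}^4_S$ is the closed subscheme defined by $p_1,\dots,p_5$; $\phi$ is the reduction of $\Phi$ mod $\pi$. A fibred surface over $S$ is an integral projective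 flat $S$-scheme of dimension $2$. For nonsingular $\Phi$, $\omega_\Phi$ is the invariant differential on $C_\Phi$ given by $\omega_\Phi=x_i^2\,d(x_j/x_i)/Q$ with $Q=\frac{\partial P}{\partial x_k}\frac{\partial\Phi}{\partial x_l}\frac{\partial P^T}{\partial x_m}$ (matrices of partial derivatives), for any even permutation $(i,j,k,l,m)$ of $(1,2,3,4,5)$; this is independent of the choice. $\omega_{\mathcal{C}/S}$ denotes the canonical sheaf of the local complete intersection $\mathcal{C}/S$, and $\omega_\Phi\mathcal{O}_{\mathcal{C}}$ the subsheaf of rational differentials generated by $\omega_\Phi$. *)

theory Defs
  imports
    "HOL-Analysis.Analysis"
    "HOL-Library.Poly_Mapping"
    "HOL-Combinatorics.Permutations"
    "HOL-Computational_Algebra.Polynomial_Factorial"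
    "HOL-Algebra.Algebra"
    "HOL-Algebra.Algebraic_Closure_Type"
begin

section \<open>The polynomial ring in five variables\<close>

text \<open>Variables, rows and columns are indexed by the five-element type; the elements
  0, 1, 2, 3, 4 stand for the indices 1, 2, 3, 4, 5 of the usual notation.\<close>

type_synonym 'r poly5 = "(5 \<Rightarrow>\<^sub>0 nat) \<Rightarrow>\<^sub>0 'r"

definition pconst :: "'r::comm_ring_1 \<Rightarrow> 'r poly5" where
  "pconst c = Poly_Mapping.single 0 c"

definition pvar :: "5 \<Rightarrow> 'r::comm_ring_1 poly5" where
  "pvar i = Poly_Mapping.single (Poly_Mapping.single i 1) 1"

definition homogeneous :: "nat \<Rightarrow> 'r::comm_ring_1 poly5 \<Rightarrow> bool" where
  "homogeneous d f \<longleftrightarrow> (\<forall>m \<in> Poly_Mapping.keys f. (\<Sum>i\<in>UNIV. Poly_Mapping.lookup m i) = d)"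

definition pdiff :: "5 \<Rightarrow> 'r::comm_ring_1 poly5 \<Rightarrow> 'r poly5" where
  "pdiff j f = (\<Sum>m\<in>Poly_Mapping.keys f.
     Poly_Mapping.single (m - Poly_Mapping.single j 1) (of_nat (Poly_Mapping.lookup m j) * Poly_Mapping.lookup f m))"

definition ideal_of :: "'a::comm_ring_1 set \<Rightarrow> 'a set" where
  "ideal_of = module.span (*)"

section \<open>Closed subschemes of projective 4-space\<close>

text \<open>A set F of homogeneous polynomials over R is identified with the closed subscheme of
  \<open>\<bbbP>\<^sup>4\<close> over R that it defines, that is Proj of the quotient of the polynomial ring by
  \<^term>\<open>ideal_of F\<close>.  Its points are homogeneous primes of the polynomial ring containing F
  and not containing all variables.\<close>

definition homogeneous_prime :: "'r::comm_ring_1 poly5 set \<Rightarrow> bool" where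
  "homogeneous_prime \<pp> \<longleftrightarrow>
     module.subspace (*) \<pp> \<and> 1 \<notin> \<pp> \<and> (\<forall>f g. f * g \<in> \<pp> \<longrightarrow> f \<in> \<pp> \<or> g \<in> \<pp>) \<and>
     \<pp> = ideal_of {f \<in> \<pp>. \<exists>d. homogeneous d f}"

definition points :: "'r::comm_ring_1 poly5 set \<Rightarrow> 'r poly5 set set" where
  "points F = {\<pp>. homogeneous_prime \<pp> \<and> F \<subseteq> \<pp> \<and> \<not> range pvar \<subseteq> \<pp>}"

definition zariski :: "'r::comm_ring_1 poly5 set \<Rightarrow> 'r poly5 set topology" where
  "zariski F = topology (\<lambda>U. \<exists>G. (\<forall>g\<in>G. \<exists>d. homogeneous d g) \<and> U = {\<pp> \<in> points F. \<not> G \<subseteq> \<pp>})"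

definition generic_point :: "'r::comm_ring_1 poly5 set \<Rightarrow> 'r poly5 set" where
  "generic_point F = (THE \<pp>. \<pp> \<in> points F \<and> zariski F closure_of {\<pp>} = points F)"

text \<open>The local ring at a point is the degree-0 part of the localisation of the homogeneous
  coordinate ring at the homogeneous elements outside the prime.\<close>

definition fractions_at :: "'r::comm_ring_1 poly5 set \<Rightarrow> ('r poly5 \<times> 'r poly5) set" where
  "fractions_at \<pp> = {(a, s). (\<exists>d. homogeneous d a \<and> homogeneous d s) \<and> s \<notin> \<pp>}"

definition germ :: "'r::comm_ring_1 poly5 set \<Rightarrow> 'r poly5 set \<Rightarrow> 'r poly5 \<times> 'r poly5
    \<Rightarrow> ('r poly5 \<times> 'r poly5) set" where
  "germ F \<pp> = (\<lambda>(a, s). {(b, t) \<in> fractions_at \<pp>.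
     \<exists>u d. homogeneous d u \<and> u \<notin> \<pp> \<and> u * (a * t - b * s) \<in> ideal_of F})"

definition stalk :: "'r::comm_ring_1 poly5 set \<Rightarrow> 'r poly5 set
    \<Rightarrow> ('r poly5 \<times> 'r poly5) set ring" where
  "stalk F \<pp> =
    \<lparr>carrier = germ F \<pp> ` fractions_at \<pp>,
     monoid.mult = (\<lambda>U V. \<Union>(a, s)\<in>U. \<Union>(b, t)\<in>V. germ F \<pp> (a * b, s * t)),
     monoid.one = germ F \<pp> (1, 1),
     ring.zero = germ F \<pp> (0, 1),
     ring.add = (\<lambda>U V. \<Union>(a, s)\<in>U. \<Union>(b, t)\<in>V. germ F \<pp> (a * t + b * s, s * t))\<rparr>"

definition scalar_germ :: "'r::comm_ring_1 poly5 set \<Rightarrow> 'r poly5 set \<Rightarrow> 'r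
    \<Rightarrow> ('r poly5 \<times> 'r poly5) set" where
  "scalar_germ F \<pp> c = germ F \<pp> (pconst c, 1)"

section \<open>Topological and algebraic properties\<close>

definition irreducible_in :: "'a topology \<Rightarrow> 'a set \<Rightarrow> bool" where
  "irreducible_in T Z \<longleftrightarrow> Z \<subseteq> topspace T \<and> Z \<noteq> {} \<and>
     (\<forall>A B. closedin T A \<longrightarrow> closedin T B \<longrightarrow> Z \<subseteq> A \<union> B \<longrightarrow> Z \<subseteq> A \<or> Z \<subseteq> B)"

definition irreducible_chain :: "'a topology \<Rightarrow> nat \<Rightarrow> (nat \<Rightarrow> 'a set) \<Rightarrow> bool" where
  "irreducible_chain T n Z \<longleftrightarrow>
     (\<forall>i\<le>n. closedin T (Z i) \<and> irreducible_in T (Z i)) \<and> (\<forall>i<n. Z i \<subset> Z (Suc i))"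

definition has_krull_dim :: "'a topology \<Rightarrow> nat \<Rightarrow> bool" where
  "has_krull_dim T n \<longleftrightarrow> (\<exists>Z. irreducible_chain T n Z) \<and> (\<nexists>Z. irreducible_chain T (Suc n) Z)"

definition reduced_ring :: "('a, 'm) ring_scheme \<Rightarrow> bool" where
  "reduced_ring A \<longleftrightarrow> (\<forall>a\<in>carrier A. \<forall>n::nat. a [^]\<^bsub>A\<^esub> n = \<zero>\<^bsub>A\<^esub> \<longrightarrow> a = \<zero>\<^bsub>A\<^esub>)"

definition integral_scheme :: "'r::comm_ring_1 poly5 set \<Rightarrow> bool" where
  "integral_scheme F \<longleftrightarrow>
     irreducible_in (zariski F) (points F) \<and> (\<forall>x\<in>points F. reduced_ring (stalk F x))"

text \<open>For N a submodule of R and M an R-module (with scalar action \<open>act\<close>), the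
  tensor product of N and M is the free abelian group on \<open>N \<times> M\<close> modulo \<open>tensor_rel N M act\<close>.\<close>

inductive_set tensor_rel :: "'r::comm_ring_1 set \<Rightarrow> ('a, 'm) ring_scheme \<Rightarrow> ('r \<Rightarrow> 'a \<Rightarrow> 'a)
    \<Rightarrow> ('r \<times> 'a \<Rightarrow>\<^sub>0 int) set"
  for N M act where
  zero: "0 \<in> tensor_rel N M act"
| diff: "s \<in> tensor_rel N M act \<Longrightarrow> t \<in> tensor_rel N M act \<Longrightarrow> s - t \<in> tensor_rel N M act"
| add_left: "n \<in> N \<Longrightarrow> n' \<in> N \<Longrightarrow> m \<in> carrier M \<Longrightarrow>
    Poly_Mapping.single (n + n', m) 1 - Poly_Mapping.single (n, m) 1 - Poly_Mapping.single (n', m) 1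
      \<in> tensor_rel N M act"
| add_right: "n \<in> N \<Longrightarrow> m \<in> carrier M \<Longrightarrow> m' \<in> carrier M \<Longrightarrow>
    Poly_Mapping.single (n, m \<oplus>\<^bsub>M\<^esub> m') 1 - Poly_Mapping.single (n, m) 1 - Poly_Mapping.single (n, m') 1
      \<in> tensor_rel N M act"
| balance: "n \<in> N \<Longrightarrow> m \<in> carrier M \<Longrightarrow>
    Poly_Mapping.single (c * n, m) 1 - Poly_Mapping.single (n, act c m) 1 \<in> tensor_rel N M act"

text \<open>Flatness: for every ideal N of R the map from the tensor product of N and M to that of
  R and M is injective.\<close>

definition flat_module :: "('a, 'm) ring_scheme \<Rightarrow> ('r::comm_ring_1 \<Rightarrow> 'a \<Rightarrow> 'a) \<Rightarrow> bool" where
  "flat_module M act \<longleftrightarrow>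
     (\<forall>N. module.subspace (*) N \<longrightarrow>
       (\<forall>t. Poly_Mapping.keys t \<subseteq> N \<times> carrier M \<and> t \<in> tensor_rel UNIV M act \<longrightarrow> t \<in> tensor_rel N M act))"

text \<open>Over an affine base Spec R, flatness of the local rings over the local rings of Spec R is
  the same as flatness over R.\<close>

definition flat_scheme :: "'r::comm_ring_1 poly5 set \<Rightarrow> bool" where
  "flat_scheme F \<longleftrightarrow>
     (\<forall>x\<in>points F. flat_module (stalk F x) (\<lambda>c m. scalar_germ F x c \<otimes>\<^bsub>stalk F x\<^esub> m))"

text \<open>Projectivity over Spec R is built in, since F denotes a closed subscheme of projective space.\<close>

definition fibred_surface :: "'r::comm_ring_1 poly5 set \<Rightarrow> bool" where
  "fibred_surface F \<longleftrightarrow> integral_scheme F \<and> flat_scheme F \<and> has_krull_dim (zariski F) 2"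

section \<open>Differentials\<close>

text \<open>The module of Kaehler differentials of a ring A relative to a set B of constants: a finitely
  supported function m from A to A stands for the sum of the \<open>m b \<cdot> db\<close>, and these formal
  sums are taken modulo the submodule \<open>kaehler_rel\<close>.\<close>

definition formal_sums :: "('a, 'm) ring_scheme \<Rightarrow> ('a \<Rightarrow> 'a) set" where
  "formal_sums A = {m. (\<forall>b. m b \<in> carrier A) \<and> (\<forall>b. b \<notin> carrier A \<longrightarrow> m b = \<zero>\<^bsub>A\<^esub>)
     \<and> finite {b. m b \<noteq> \<zero>\<^bsub>A\<^esub>}}"

definition dsym :: "('a, 'm) ring_scheme \<Rightarrow> 'a \<Rightarrow> 'a \<Rightarrow> 'a" where
  "dsym A b = (\<lambda>x. if x = b then \<one>\<^bsub>A\<^esub> else \<zero>\<^bsub>A\<^esub>)"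

inductive_set kaehler_rel :: "('a, 'm) ring_scheme \<Rightarrow> 'a set \<Rightarrow> ('a \<Rightarrow> 'a) set"
  for A B where
  zero: "(\<lambda>_. \<zero>\<^bsub>A\<^esub>) \<in> kaehler_rel A B"
| add: "m \<in> kaehler_rel A B \<Longrightarrow> n \<in> kaehler_rel A B \<Longrightarrow> (\<lambda>x. m x \<oplus>\<^bsub>A\<^esub> n x) \<in> kaehler_rel A B"
| smult: "a \<in> carrier A \<Longrightarrow> m \<in> kaehler_rel A B \<Longrightarrow> (\<lambda>x. a \<otimes>\<^bsub>A\<^esub> m x) \<in> kaehler_rel A B"
| sum_rule: "a \<in> carrier A \<Longrightarrow> b \<in> carrier A \<Longrightarrow>
    (\<lambda>x. dsym A (a \<oplus>\<^bsub>A\<^esub> b) x \<ominus>\<^bsub>A\<^esub> (dsym A a x \<oplus>\<^bsub>A\<^esub> dsym A b x)) \<in> kaehler_rel A B"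
| product_rule: "a \<in> carrier A \<Longrightarrow> b \<in> carrier A \<Longrightarrow>
    (\<lambda>x. dsym A (a \<otimes>\<^bsub>A\<^esub> b) x \<ominus>\<^bsub>A\<^esub> (a \<otimes>\<^bsub>A\<^esub> dsym A b x \<oplus>\<^bsub>A\<^esub> b \<otimes>\<^bsub>A\<^esub> dsym A a x))
      \<in> kaehler_rel A B"
| const_rule: "c \<in> B \<Longrightarrow> dsym A c \<in> kaehler_rel A B"

definition kaehler_class :: "('a, 'm) ring_scheme \<Rightarrow> 'a set \<Rightarrow> ('a \<Rightarrow> 'a) \<Rightarrow> ('a \<Rightarrow> 'a) set" where
  "kaehler_class A B m = {n \<in> formal_sums A. (\<lambda>x. n x \<ominus>\<^bsub>A\<^esub> m x) \<in> kaehler_rel A B}"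

text \<open>The fields \<open>mult\<close> and \<open>one\<close> of the record type of modules are irrelevant.\<close>

definition kaehler :: "('a, 'm) ring_scheme \<Rightarrow> 'a set \<Rightarrow> ('a, ('a \<Rightarrow> 'a) set) module" where
  "kaehler A B =
    \<lparr>carrier = kaehler_class A B ` formal_sums A,
     monoid.mult = undefined,
     monoid.one = undefined,
     ring.zero = kaehler_class A B (\<lambda>_. \<zero>\<^bsub>A\<^esub>),
     ring.add = (\<lambda>U V. \<Union>m\<in>U. \<Union>n\<in>V. kaehler_class A B (\<lambda>x. m x \<oplus>\<^bsub>A\<^esub> n x)),
     module.smult = (\<lambda>a U. \<Union>m\<in>U. kaehler_class A B (\<lambda>x. a \<otimes>\<^bsub>A\<^esub> m x))\<rparr>"

definition kaehler_d :: "('a, 'm) ring_scheme \<Rightarrow> 'a set \<Rightarrow> 'a \<Rightarrow> ('a \<Rightarrow> 'a) set" where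
  "kaehler_d A B b = kaehler_class A B (dsym A b)"

definition omega_stalk where
  "omega_stalk F x = kaehler (stalk F x) (range (scalar_germ F x))"

text \<open>For an integral subscheme: the function field, the local rings as subrings of it, and the
  rational differentials.  If R is a domain with fraction field K whose elements are invertible in
  the function field, differentials relative to R and relative to K agree.\<close>

definition function_field where
  "function_field F = stalk F (generic_point F)"

definition local_functions where
  "local_functions F x = germ F (generic_point F) ` fractions_at x"

definition rational_differentials where
  "rational_differentials F = omega_stalk F (generic_point F)"

definition rational_d where
  "rational_d F = kaehler_d (function_field F) (range (scalar_germ F (generic_point F)))"

definition coordinate_ratio :: "'r::comm_ring_1 poly5 set \<Rightarrow> 5 \<Rightarrow> 5 \<Rightarrow> ('r poly5 \<times> 'r poly5) set" where
  "coordinate_ratio F i j = germ F (generic_point F) (pvar j, pvar i)"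

section \<open>Smooth curves of genus one\<close>

text \<open>Geometrically integral of dimension 1, with sheaf of differentials locally free of rank 1.\<close>

definition smooth_curve :: "'k::field poly5 set \<Rightarrow> bool" where
  "smooth_curve F \<longleftrightarrow>
     integral_scheme F \<and> integral_scheme (Poly_Mapping.map to_ac ` F) \<and>
     has_krull_dim (zariski F) 1 \<and>
     (\<forall>x\<in>points F. \<exists>w\<in>carrier (omega_stalk F x).
        bij_betw (\<lambda>a. a \<odot>\<^bsub>omega_stalk F x\<^esub> w) (carrier (stalk F x)) (carrier (omega_stalk F x)))"

definition regular_differentials_at where
  "regular_differentials_at F x =
     {w. \<exists>(n::nat) a b. (\<forall>i<n. a i \<in> local_functions F x \<and> b i \<in> local_functions F x) \<and>
       w = finsum (rational_differentials F)
             (\<lambda>i. a i \<odot>\<^bsub>rational_differentials F\<^esub> rational_d F (b i)) {..<n}}"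

text \<open>On a smooth integral curve the sheaf of differentials is invertible, hence a subsheaf of the
  constant sheaf of rational differentials; its global sections are taken inside the latter.\<close>

definition global_differentials where
  "global_differentials F =
     {w \<in> carrier (rational_differentials F). \<forall>x\<in>points F. w \<in> regular_differentials_at F x}"

text \<open>The genus of a smooth curve is the dimension of its space of global differentials.\<close>

definition smooth_genus_one_curve :: "'k::field poly5 set \<Rightarrow> bool" where
  "smooth_genus_one_curve F \<longleftrightarrow> smooth_curve F \<and>
     (\<exists>w\<in>global_differentials F.
        bij_betw (\<lambda>c. scalar_germ F (generic_point F) c \<odot>\<^bsub>rational_differentials F\<^esub> w)
          UNIV (global_differentials F))"

section \<open>Local complete intersections and the canonical sheaf\<close>

definition regular_sequence :: "('a, 'm) ring_scheme \<Rightarrow> 'a list \<Rightarrow> bool" where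
  "regular_sequence A fs \<longleftrightarrow> set fs \<subseteq> carrier A \<and> genideal A (set fs) \<noteq> carrier A \<and>
     (\<forall>n<length fs. \<forall>a\<in>carrier A.
        a \<otimes>\<^bsub>A\<^esub> (fs ! n) \<in> genideal A (set (take n fs)) \<longrightarrow> a \<in> genideal A (set (take n fs)))"

text \<open>Representatives of the elements of the kernel of the map from the local ring of projective
  space at x to the local ring of the subscheme; \<^term>\<open>stalk {} x\<close> is the former ring.\<close>

definition ideal_fractions_at ::
    "'r::comm_ring_1 poly5 set \<Rightarrow> 'r poly5 set \<Rightarrow> ('r poly5 \<times> 'r poly5) set" where
  "ideal_fractions_at F x = {(a, s) \<in> fractions_at x. a \<in> ideal_of F}"

text \<open>The immersion into the smooth scheme \<open>\<bbbP>\<^sup>4\<close> over Spec R is regular at every point.\<close>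

definition local_complete_intersection :: "'r::comm_ring_1 poly5 set \<Rightarrow> bool" where
  "local_complete_intersection F \<longleftrightarrow>
     (\<forall>x\<in>points F. \<exists>fs. regular_sequence (stalk {} x) fs \<and>
        germ {} x ` ideal_fractions_at F x = genideal (stalk {} x) (set fs))"

definition det5 :: "('a, 'm) ring_scheme \<Rightarrow> (5 \<Rightarrow> 5 \<Rightarrow> 'a) \<Rightarrow> 'a" where
  "det5 A M = finsum A (\<lambda>\<sigma>.
     (if evenperm \<sigma> then \<one>\<^bsub>A\<^esub> else \<ominus>\<^bsub>A\<^esub> \<one>\<^bsub>A\<^esub>) \<otimes>\<^bsub>A\<^esub> finprod A (\<lambda>r. M r (\<sigma> r)) UNIV)
     {\<sigma>. \<sigma> permutes UNIV}"

text \<open>On the chart where the i-th coordinate is invertible, with affine coordinates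
  \<open>u\<^sub>j = x\<^sub>j / x\<^sub>i\<close>, the derivative of a/s with respect to \<open>u\<^sub>j\<close>, as a rational function
  on the subscheme.\<close>

definition chart_diff :: "'r::comm_ring_1 poly5 set \<Rightarrow> 5 \<Rightarrow> 5 \<Rightarrow> 'r poly5 \<times> 'r poly5
    \<Rightarrow> ('r poly5 \<times> 'r poly5) set" where
  "chart_diff F i j = (\<lambda>(a, s).
     germ F (generic_point F) (pvar i * (s * pdiff j a - a * pdiff j s), s * s))"

text \<open>The coefficient (up to sign) of \<open>df\<^sub>1 \<and> df\<^sub>2 \<and> df\<^sub>3 \<and> (\<Sum>j. h\<^sub>j du\<^sub>j)\<close> with respect to the
  exterior product of the four \<open>du\<^sub>j\<close> on the i-th chart; the first row removes column i.\<close>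

definition wedge_coefficient where
  "wedge_coefficient F i f1 f2 f3 h = det5 (function_field F) (\<lambda>r j.
     if r = 0 then (if j = i then \<one>\<^bsub>function_field F\<^esub> else \<zero>\<^bsub>function_field F\<^esub>)
     else if r = 1 then chart_diff F i j f1
     else if r = 2 then chart_diff F i j f2
     else if r = 3 then chart_diff F i j f3
     else h j)"

text \<open>Let I be the ideal sheaf of an integral local complete intersection C of relative dimension 1
  with smooth generic fibre in \<open>P = \<bbbP>\<^sup>4\<close> over Spec R.  The canonical sheaf
  \<open>det(I/I\<^sup>2)\<^sup>\<or> \<otimes> \<Omega>\<^sup>4\<^bsub>P/R\<^esub>|\<^sub>C\<close> consists of the alternating trilinear maps from I (modulo \<open>I\<^sup>2\<close>) to
  \<open>\<Omega>\<^sup>4\<^bsub>P/R\<^esub>|\<^sub>C\<close>.  At the generic point the exact sequence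
  \<open>0 \<rightarrow> I/I\<^sup>2 \<rightarrow> \<Omega>\<^bsub>P\<^esub>|\<^sub>C \<rightarrow> \<Omega>\<^bsub>C\<^esub> \<rightarrow> 0\<close> identifies a rational differential w with the
  map \<open>(f\<^sub>1, f\<^sub>2, f\<^sub>3) \<mapsto> df\<^sub>1 \<and> df\<^sub>2 \<and> df\<^sub>3 \<and> w\<close>, where w is lifted to \<open>\<Omega>\<^bsub>P\<^esub>|\<^sub>C\<close>.  Hence the
  stalk at x of the canonical sheaf, as a submodule of the rational differentials, consists of
  those w whose map takes values in \<open>\<Omega>\<^sup>4\<^bsub>P/R,x\<^esub>|\<^sub>C\<close>, the free module over the local ring of C
  generated by the exterior product of the \<open>du\<^sub>j\<close>.\<close>

definition canonical_stalk where
  "canonical_stalk F x =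
     {w \<in> carrier (rational_differentials F). \<forall>i. pvar i \<notin> x \<longrightarrow>
       (\<exists>h. (\<forall>j. h j \<in> carrier (function_field F)) \<and>
          w = finsum (rational_differentials F)
                (\<lambda>j. h j \<odot>\<^bsub>rational_differentials F\<^esub> rational_d F (coordinate_ratio F i j)) (- {i}) \<and>
          (\<forall>f1\<in>ideal_fractions_at F x. \<forall>f2\<in>ideal_fractions_at F x. \<forall>f3\<in>ideal_fractions_at F x.
             wedge_coefficient F i f1 f2 f3 h \<in> local_functions F x))}"

definition generated_stalk where
  "generated_stalk F w x = (\<lambda>g. g \<odot>\<^bsub>rational_differentials F\<^esub> w) ` local_functions F x"

section \<open>Pfaffian models\<close>

type_synonym 'r matrix5 = "5 \<Rightarrow> 5 \<Rightarrow> 'r poly5"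

definition X5 :: "'r::comm_ring_1 matrix5 set" where
  "X5 = {\<Phi>. (\<forall>i j. homogeneous 1 (\<Phi> i j)) \<and> (\<forall>i. \<Phi> i i = 0) \<and> (\<forall>i j. \<Phi> j i = - \<Phi> i j)}"

definition map_model :: "('r::comm_ring_1 \<Rightarrow> 's::comm_ring_1) \<Rightarrow> 'r matrix5 \<Rightarrow> 's matrix5" where
  "map_model g \<Phi> = (\<lambda>i j. Poly_Mapping.map g (\<Phi> i j))"

definition pf4 :: "'r::comm_ring_1 matrix5 \<Rightarrow> 5 \<Rightarrow> 5 \<Rightarrow> 5 \<Rightarrow> 5 \<Rightarrow> 'r poly5" where
  "pf4 \<Phi> a b c d = \<Phi> a b * \<Phi> c d - \<Phi> a c * \<Phi> b d + \<Phi> a d * \<Phi> b c"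

text \<open>The signs are \<open>(-1)\<^sup>i\<close> for the usual indices 1 to 5, here shifted to 0 to 4.\<close>

definition Pf :: "'r::comm_ring_1 matrix5 \<Rightarrow> 5 \<Rightarrow> 'r poly5" where
  "Pf \<Phi> i =
     (if i = 0 then - pf4 \<Phi> 1 2 3 4
      else if i = 1 then pf4 \<Phi> 0 2 3 4
      else if i = 2 then - pf4 \<Phi> 0 1 3 4
      else if i = 3 then pf4 \<Phi> 0 1 2 4
      else - pf4 \<Phi> 0 1 2 3)"

definition pfaffian_scheme :: "'r::comm_ring_1 matrix5 \<Rightarrow> 'r poly5 set" where
  "pfaffian_scheme \<Phi> = range (Pf \<Phi>)"

definition nonsingular_model :: "'k::field matrix5 \<Rightarrow> bool" where
  "nonsingular_model \<Phi> \<longleftrightarrow> smooth_genus_one_curve (pfaffian_scheme \<Phi>)"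

definition Q_form :: "'r::comm_ring_1 matrix5 \<Rightarrow> 5 \<Rightarrow> 5 \<Rightarrow> 5 \<Rightarrow> 'r poly5" where
  "Q_form \<Phi> k l m = (\<Sum>a\<in>UNIV. \<Sum>b\<in>UNIV. pdiff k (Pf \<Phi> a) * pdiff l (\<Phi> a b) * pdiff m (Pf \<Phi> b))"

text \<open>The formula \<open>x\<^sub>i\<^sup>2 d(x\<^sub>j/x\<^sub>i) / Q\<close> is required for all even permutations for which it is
  meaningful: in small characteristic \<open>d(x\<^sub>j/x\<^sub>i)\<close> and Q may both vanish identically on the
  curve for some of them.\<close>

definition invariant_differential where
  "invariant_differential \<Phi> = (let F = pfaffian_scheme \<Phi>; \<xi> = generic_point F in
     THE w. w \<in> carrier (rational_differentials F) \<and>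
       (\<forall>\<sigma>. \<sigma> permutes (UNIV :: 5 set) \<and> evenperm \<sigma> \<longrightarrow>
          (let i = \<sigma> 0; j = \<sigma> 1; Q = Q_form \<Phi> (\<sigma> 2) (\<sigma> 3) (\<sigma> 4) in
           pvar i \<notin> \<xi> \<and> Q \<notin> \<xi> \<longrightarrow>
           w = germ F \<xi> (pvar i ^ 2, Q) \<odot>\<^bsub>rational_differentials F\<^esub>
                 rational_d F (coordinate_ratio F i j))))"

definition linear_span :: "'k::field poly5 set \<Rightarrow> 'k poly5 set" where
  "linear_span = module.span (\<lambda>c f. pconst c * f)"

section \<open>Discrete valuation fields\<close>

definition discrete_valuation :: "('a::field \<Rightarrow> int) \<Rightarrow> bool" where
  "discrete_valuation v \<longleftrightarrow>
     (\<forall>x y. x \<noteq> 0 \<longrightarrow> y \<noteq> 0 \<longrightarrow> v (x * y) = v x + v y) \<and>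
     (\<forall>x y. x \<noteq> 0 \<longrightarrow> y \<noteq> 0 \<longrightarrow> x + y \<noteq> 0 \<longrightarrow> min (v x) (v y) \<le> v (x + y)) \<and>
     v ` (- {0}) = UNIV"

definition valuation_ring :: "('a::field \<Rightarrow> int) \<Rightarrow> 'a set" where
  "valuation_ring v = {x. x = 0 \<or> 0 \<le> v x}"

text \<open>\<open>red\<close> exhibits its codomain as the residue ring of R modulo \<open>\<pi>\<close>.\<close>

definition reduction_map :: "'r::comm_ring_1 \<Rightarrow> ('r \<Rightarrow> 'k::field) \<Rightarrow> bool" where
  "reduction_map \<pi> red \<longleftrightarrow>
     red 1 = 1 \<and> (\<forall>a b. red (a + b) = red a + red b) \<and> (\<forall>a b. red (a * b) = red a * red b) \<and>
     surj red \<and> (\<forall>a. red a = 0 \<longleftrightarrow> \<pi> dvd a)"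

end

theory Submission
  imports Defs
begin

text \<open>Since the entries of \<open>\<phi>\<close> span the linear forms, Nakayama's lemma provides at every point x
  an entry \<open>\<Phi>\<^sub>a\<^sub>b\<close> outside x, and \<open>P \<Phi> = 0\<close> then shows that near x the ideal I of the scheme is generated
  by the three Pfaffians \<open>p\<^sub>c, p\<^sub>d, p\<^sub>e\<close> whose index is neither a nor b.  As \<open>\<pi>\<close> does not vanish at
  the generic point, the special fibre has dimension at most 1; Noether normalisation and Nakayama's
  lemma give, in suitable coordinates, monic equations in I for three of the variables over the other
  two, of which one, y, is outside x.  Adding their squares to multiples \<open>y\<^sup>m p\<close> of the three
  Pfaffians gives local generators whose top forms are powers of the three variables, and these form a
  regular sequence.

  At the generic point \<open>\<Phi>\<close> has rank 2, so that \<open>\<Phi>\<^sub>a\<^sub>b Q\<close> is, up to a sign depending only on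
  \<open>(a, b, c, d, e)\<close>, a \<open>3 \<times> 3\<close> minor of the Jacobian matrix of \<open>(p\<^sub>c, p\<^sub>d, p\<^sub>e)\<close>.  Some minor is
  nonzero, since otherwise two independent tangent vectors would contradict smoothness of the generic
  fibre; Cramer's rule and Euler's formula show that the expressions \<open>x\<^sub>i\<^sup>2 d(x\<^sub>j/x\<^sub>i) / Q\<close> agree.
  Hence \<open>dp\<^sub>c \<and> dp\<^sub>d \<and> dp\<^sub>e \<and> \<omega>\<^sub>\<Phi>\<close> is a unit at x times the generator of the top forms, while all other
  triples in I are combinations of \<open>p\<^sub>c, p\<^sub>d, p\<^sub>e\<close> near x.\<close>

section \<open>Ideals\<close>

text \<open>Regularity of a sequence is obtained by exhibiting elements whose top forms are
  prescribed, because for such elements it becomes a statement about exponents of monomials. The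
  dimension hypothesis is a bound on chains of closed sets, so it has to be contradicted by actual
  points of the special fibre; comparing the growth of two counts of forms of degree n shows that
  enough such points exist. Smoothness concerns a curve over the field of fractions, whereas
  \<open>\<omega>\<close> of \<open>\<Phi>\<close> lives at the generic point \<open>\<xi>\<close>
  of the surface. The generic point of the curve is contracted to a prime of the polynomial ring
  over the valuation ring. This prime contains \<open>\<xi>\<close>, so that nonvanishing over the
  field of fractions descends to \<open>\<xi>\<close>. Identities at \<open>\<xi>\<close> are proved
  as congruences modulo that prime and become equalities of germs because the local ring there is
  reduced. They are identities over an arbitrary commutative ring and never divide by 2, so residue
  characteristic 2 is included.\<close>

interpretation ring_mult: Modules.module "(*) :: 'a::comm_ring_1 \<Rightarrow> 'a \<Rightarrow> 'a"
  by unfold_locales (simp_all add: algebra_simps)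

declare ring_mult.scale_scale [simp del]

abbreviation is_ideal :: "'a::comm_ring_1 set \<Rightarrow> bool" where
  "is_ideal \<equiv> module.subspace (*)"

lemma is_idealI:
  assumes "0 \<in> I" "\<And>a b. a \<in> I \<Longrightarrow> b \<in> I \<Longrightarrow> a + b \<in> I" "\<And>c a. a \<in> I \<Longrightarrow> c * a \<in> I"
  shows "is_ideal (I :: 'a::comm_ring_1 set)"
  using assms by (simp add: ring_mult.subspace_def)

context
  fixes I :: "'a::comm_ring_1 set"
  assumes I: "is_ideal I"
begin

lemma ideal_0: "0 \<in> I"
  using I by (rule ring_mult.subspace_0)

lemma ideal_add: "a \<in> I \<Longrightarrow> b \<in> I \<Longrightarrow> a + b \<in> I"
  using I by (rule ring_mult.subspace_add)

lemma ideal_mult: "a \<in> I \<Longrightarrow> c * a \<in> I"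
  using I by (rule ring_mult.subspace_scale)

lemma ideal_mult_right: "a \<in> I \<Longrightarrow> a * c \<in> I"
  using ideal_mult by (simp add: mult.commute)

lemma ideal_diff: "a \<in> I \<Longrightarrow> b \<in> I \<Longrightarrow> a - b \<in> I"
  using I by (rule ring_mult.subspace_diff)

lemma ideal_uminus: "a \<in> I \<Longrightarrow> - a \<in> I"
  using I by (rule ring_mult.subspace_neg)

lemma ideal_uminus_iff: "- a \<in> I \<longleftrightarrow> a \<in> I"
  using ideal_uminus by force

lemma ideal_sum: "(\<And>i. i \<in> A \<Longrightarrow> f i \<in> I) \<Longrightarrow> sum f A \<in> I"
  using I by (rule ring_mult.subspace_sum)

lemma ideal_diff_cong: "a - b \<in> I \<Longrightarrow> a \<in> I \<longleftrightarrow> b \<in> I"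
  by (metis add_diff_cancel_left' diff_add_cancel ideal_add ideal_diff)

lemma ideal_cong_mult:
  assumes "a - b \<in> I" "c - d \<in> I"
  shows "a * c - b * d \<in> I"
proof -
  have "a * c - b * d = c * (a - b) + b * (c - d)" by (simp add: algebra_simps)
  then show ?thesis using assms by (simp add: ideal_add ideal_mult)
qed

lemma ideal_cong_prod:
  assumes "\<And>i. i \<in> A \<Longrightarrow> f i - g i \<in> I"
  shows "prod f A - prod g A \<in> I"
  using assms by (induction A rule: infinite_finite_induct) (auto simp: ideal_0 ideal_cong_mult)

lemma ideal_cong_sum:
  assumes "\<And>i. i \<in> A \<Longrightarrow> f i - g i \<in> I"
  shows "sum f A - sum g A \<in> I"
  using ideal_sum[of A "\<lambda>i. f i - g i"] assms by (simp add: sum_subtractf)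

end

lemma is_ideal_ideal_of [simp]: "is_ideal (ideal_of F)"
  by (simp add: ideal_of_def)

lemma ideal_of_superset: "F \<subseteq> ideal_of F"
  by (simp add: ideal_of_def ring_mult.span_superset)

lemma ideal_of_base: "f \<in> F \<Longrightarrow> f \<in> ideal_of F"
  using ideal_of_superset by blast

lemma ideal_of_least: "is_ideal I \<Longrightarrow> F \<subseteq> I \<Longrightarrow> ideal_of F \<subseteq> I"
  by (simp add: ideal_of_def ring_mult.span_minimal)

lemma ideal_of_mono: "F \<subseteq> G \<Longrightarrow> ideal_of F \<subseteq> ideal_of G"
  by (simp add: ideal_of_def ring_mult.span_mono)

lemma ideal_of_ideal [simp]: "is_ideal I \<Longrightarrow> ideal_of I = I"
  by (simp add: ideal_of_def ring_mult.span_eq_iff)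

lemma ideal_of_empty [simp]: "ideal_of {} = {0}"
  by (simp add: ideal_of_def)

lemma ideal_of_image:
  fixes p :: "'i \<Rightarrow> 'a::comm_ring_1"
  assumes "finite A"
  shows "ideal_of (p ` A) = {(\<Sum>i\<in>A. c i * p i) | c. True}" (is "_ = ?R")
proof
  have "is_ideal ?R"
  proof (rule is_idealI)
    show "0 \<in> ?R" by (force intro: exI[of _ "\<lambda>_. 0"])
  next
    fix a b assume "a \<in> ?R" "b \<in> ?R"
    then obtain c d where "a = (\<Sum>i\<in>A. c i * p i)" "b = (\<Sum>i\<in>A. d i * p i)" by blast
    then have "a + b = (\<Sum>i\<in>A. (c i + d i) * p i)"
      by (simp add: algebra_simps sum.distrib)
    then have "\<exists>c'. a + b = (\<Sum>i\<in>A. c' i * p i)" by (rule exI[of _ "\<lambda>i. c i + d i"])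
    then show "a + b \<in> ?R" by simp
  next
    fix r a assume "a \<in> ?R"
    then obtain c where "a = (\<Sum>i\<in>A. c i * p i)" by blast
    then have "r * a = (\<Sum>i\<in>A. (r * c i) * p i)"
      by (simp add: sum_distrib_left mult.assoc)
    then have "\<exists>c'. r * a = (\<Sum>i\<in>A. c' i * p i)" by (rule exI[of _ "\<lambda>i. r * c i"])
    then show "r * a \<in> ?R" by simp
  qed
  moreover have "p i \<in> ?R" if "i \<in> A" for i
  proof -
    have "p i = (\<Sum>j\<in>A. (if j = i then 1 else 0) * p j)"
      using that assms by (simp add: if_distrib[of "\<lambda>x. x * _"] cong: if_cong)
    then have "\<exists>c'. p i = (\<Sum>j\<in>A. c' j * p j)" by (rule exI[of _ "\<lambda>j. if j = i then 1 else 0"])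
    then show ?thesis by simp
  qed
  ultimately show "ideal_of (p ` A) \<subseteq> ?R" by (intro ideal_of_least) auto
next
  show "?R \<subseteq> ideal_of (p ` A)"
    using ideal_of_base[of _ "p ` A"]
    by (auto intro!: ideal_sum[OF is_ideal_ideal_of] ideal_mult[OF is_ideal_ideal_of])
qed

lemma ideal_of_insert:
  "ideal_of (insert a (F :: 'a::comm_ring_1 set)) = {c * a + f | c f. f \<in> ideal_of F}"
proof -
  have "\<exists>k. c * a + f - k * a \<in> ring_mult.span F" if "f \<in> ring_mult.span F" for c f
    using that by (intro exI[of _ c]) simp
  moreover have "\<exists>c f. x = c * a + f \<and> f \<in> ring_mult.span F" if "x - k * a \<in> ring_mult.span F" for x k
    using that by (intro exI[of _ k] exI[of _ "x - k * a"]) simp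
  ultimately show ?thesis unfolding ideal_of_def ring_mult.span_insert by auto
qed

lemma is_ideal_plus_principal:
  assumes "is_ideal (I :: 'a::comm_ring_1 set)"
  shows "ideal_of (insert a I) = {c * a + f | c f. f \<in> I}"
  using ideal_of_insert[of a I] assms by simp

section \<open>Polynomials in five variables\<close>

abbreviation mdeg :: "(5 \<Rightarrow>\<^sub>0 nat) \<Rightarrow> nat" where
  "mdeg m \<equiv> (\<Sum>i\<in>UNIV. Poly_Mapping.lookup m i)"

lemma mdeg_add: "mdeg (m + n) = mdeg m + mdeg n"
  by (simp add: lookup_add sum.distrib)

lemma mdeg_single [simp]: "mdeg (Poly_Mapping.single i k) = k"
  by (simp add: lookup_single when_def)

lemma poly5_eq_sum_singles: "f = (\<Sum>m\<in>Poly_Mapping.keys f. Poly_Mapping.single m (Poly_Mapping.lookup f m))"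
  by (rule poly_mapping_eqI)
    (simp add: lookup_sum lookup_single when_def in_keys_iff)

lemma poly5_induct [case_names zero add single]:
  assumes "P 0" "\<And>f g. P f \<Longrightarrow> P g \<Longrightarrow> P (f + g)" "\<And>m c. P (Poly_Mapping.single m c)"
  shows "P (f :: 'r::comm_ring_1 poly5)"
proof -
  have "P (\<Sum>m\<in>A. Poly_Mapping.single m (Poly_Mapping.lookup f m))" if "finite A" for A
    using that by induction (auto intro: assms)
  then show ?thesis by (subst poly5_eq_sum_singles) simp
qed

lemma pconst_0 [simp]: "pconst 0 = 0" and pconst_1 [simp]: "pconst 1 = 1"
  by (simp_all add: pconst_def)

lemma pconst_add: "pconst (a + b) = pconst a + pconst b"
  and pconst_mult: "pconst (a * b) = pconst a * pconst b"
  and pconst_diff: "pconst (a - b) = pconst a - pconst b"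
  by (simp_all add: pconst_def single_add mult_single single_uminus single_diff)

lemma pconst_power: "pconst (a ^ n) = pconst a ^ n"
  by (induction n) (simp_all add: pconst_mult)

lemma pconst_prod: "pconst (prod f A) = (\<Prod>i\<in>A. pconst (f i))"
  by (induction A rule: infinite_finite_induct) (simp_all add: pconst_mult)

lemma pconst_sum: "pconst (sum f A) = (\<Sum>i\<in>A. pconst (f i))"
  by (induction A rule: infinite_finite_induct) (simp_all add: pconst_add)

lemma pconst_eq_0_iff [simp]: "pconst a = 0 \<longleftrightarrow> a = 0"
  by (metis lookup_single_eq lookup_zero pconst_0 pconst_def)

lemma pconst_mult_single: "pconst a * Poly_Mapping.single m b = Poly_Mapping.single m (a * b)"
  by (simp add: pconst_def mult_single)

lemma lookup_pconst_mult: "Poly_Mapping.lookup (pconst a * f) m = a * Poly_Mapping.lookup f m"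
  by (induction f rule: poly5_induct)
    (simp_all add: distrib_left lookup_add pconst_mult_single lookup_single when_def)

subsection \<open>Linear maps given on monomials\<close>

text \<open>Homogeneous components, partial derivatives, substitutions and the bijection
  \<open>mlin lift\<close> used for regular sequences all have this shape, so additivity and
  linearity over the constants are proved once.\<close>

definition mlin :: "((5 \<Rightarrow>\<^sub>0 nat) \<Rightarrow> 'r poly5) \<Rightarrow> 'r::comm_ring_1 poly5 \<Rightarrow> 'r poly5" where
  "mlin \<phi> f = (\<Sum>m\<in>Poly_Mapping.keys f. pconst (Poly_Mapping.lookup f m) * \<phi> m)"

lemma mlin_superset:
  assumes "finite A" "Poly_Mapping.keys f \<subseteq> A"
  shows "mlin \<phi> f = (\<Sum>m\<in>A. pconst (Poly_Mapping.lookup f m) * \<phi> m)"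
  unfolding mlin_def by (rule sum.mono_neutral_left) (use assms in \<open>auto simp: in_keys_iff\<close>)

lemma mlin_0 [simp]: "mlin \<phi> 0 = 0"
  by (simp add: mlin_def)

lemma mlin_single [simp]: "mlin \<phi> (Poly_Mapping.single m c) = pconst c * \<phi> m"
  by (subst mlin_superset[of "{m}"]) auto

lemma mlin_add: "mlin \<phi> (f + g) = mlin \<phi> f + mlin \<phi> g"
proof -
  let ?A = "Poly_Mapping.keys f \<union> Poly_Mapping.keys g"
  have "mlin \<phi> (f + g) = (\<Sum>m\<in>?A. pconst (Poly_Mapping.lookup (f + g) m) * \<phi> m)"
    by (rule mlin_superset) (auto simp: Poly_Mapping.keys_add)
  also have "\<dots> = mlin \<phi> f + mlin \<phi> g"
    by (simp add: mlin_superset[of ?A f] mlin_superset[of ?A g] lookup_add pconst_add distrib_right sum.distrib)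
  finally show ?thesis .
qed

lemma mlin_pconst_mult: "mlin \<phi> (pconst c * f) = pconst c * mlin \<phi> f"
proof (induction f rule: poly5_induct)
  case (single m c')
  then show ?case by (simp only: pconst_mult_single mlin_single pconst_mult mult.assoc)
qed (simp_all add: mlin_add distrib_left)

lemma mlin_uminus: "mlin \<phi> (- f) = - mlin \<phi> f"
  using mlin_add[of \<phi> f "- f"] by (simp add: eq_neg_iff_add_eq_0 add.commute)

lemma mlin_diff: "mlin \<phi> (f - g) = mlin \<phi> f - mlin \<phi> g"
  using mlin_add[of \<phi> f "- g"] by (simp add: mlin_uminus)

lemma mlin_sum: "mlin \<phi> (sum f A) = (\<Sum>i\<in>A. mlin \<phi> (f i))"
  by (induction A rule: infinite_finite_induct) (simp_all add: mlin_add)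

lemma mlin_monomials: "mlin (\<lambda>m. Poly_Mapping.single m 1) f = f"
  by (induction f rule: poly5_induct) (simp_all add: mlin_add pconst_mult_single)

subsection \<open>Homogeneous components\<close>

definition hcomp :: "nat \<Rightarrow> 'r::comm_ring_1 poly5 \<Rightarrow> 'r poly5" where
  "hcomp d = mlin (\<lambda>m. if mdeg m = d then Poly_Mapping.single m 1 else 0)"

lemma hcomp_add: "hcomp d (f + g) = hcomp d f + hcomp d g"
  and hcomp_diff: "hcomp d (f - g) = hcomp d f - hcomp d g"
  and hcomp_0 [simp]: "hcomp d 0 = 0"
  and hcomp_sum: "hcomp d (sum h A) = (\<Sum>i\<in>A. hcomp d (h i))"
  and hcomp_pconst_mult: "hcomp d (pconst c * f) = pconst c * hcomp d f"
  by (simp_all add: hcomp_def mlin_add mlin_diff mlin_sum mlin_pconst_mult)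

lemma lookup_hcomp: "Poly_Mapping.lookup (hcomp d f) m = (if mdeg m = d then Poly_Mapping.lookup f m else 0)"
  by (induction f rule: poly5_induct)
    (auto simp: hcomp_def mlin_add lookup_add pconst_mult_single lookup_single when_def)

lemma homogeneous_iff: "homogeneous d f \<longleftrightarrow> (\<forall>m. mdeg m \<noteq> d \<longrightarrow> Poly_Mapping.lookup f m = 0)"
  unfolding homogeneous_def by (auto simp: in_keys_iff)

lemma homogeneous_hcomp [simp]: "homogeneous d (hcomp d f)"
  by (simp add: homogeneous_iff lookup_hcomp)

lemma hcomp_homogeneous: "homogeneous d f \<Longrightarrow> hcomp e f = (if e = d then f else 0)"
  by (rule poly_mapping_eqI) (auto simp: lookup_hcomp homogeneous_iff)

lemma homogeneous_0 [simp]: "homogeneous d 0"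
  by (simp add: homogeneous_iff)

lemma homogeneous_add: "homogeneous d f \<Longrightarrow> homogeneous d g \<Longrightarrow> homogeneous d (f + g)"
  by (simp add: homogeneous_iff lookup_add)

lemma homogeneous_uminus: "homogeneous d f \<Longrightarrow> homogeneous d (- f)"
  by (simp add: homogeneous_iff)

lemma homogeneous_diff: "homogeneous d f \<Longrightarrow> homogeneous d g \<Longrightarrow> homogeneous d (f - g)"
  by (simp add: homogeneous_iff lookup_minus)

lemma homogeneous_sum: "(\<And>i. i \<in> A \<Longrightarrow> homogeneous d (f i)) \<Longrightarrow> homogeneous d (sum f A)"
  by (induction A rule: infinite_finite_induct) (auto intro: homogeneous_add)

lemma homogeneous_single: "homogeneous (mdeg m) (Poly_Mapping.single m c)"
  by (auto simp: homogeneous_iff lookup_single when_def)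

lemma homogeneous_pconst [simp]: "homogeneous 0 (pconst c)"
  using homogeneous_single[of 0 c] by (simp add: pconst_def)

lemma homogeneous_1 [simp]: "homogeneous 0 1"
  using homogeneous_pconst[of 1] by simp

lemma homogeneous_pvar [simp]: "homogeneous 1 (pvar i)"
  using homogeneous_single[of "Poly_Mapping.single i 1" 1] unfolding pvar_def mdeg_single .

lemma homogeneous_mult:
  assumes "homogeneous d f" "homogeneous e g"
  shows "homogeneous (d + e) (f * g)"
  using Poly_Mapping.keys_mult[of f g] assms unfolding homogeneous_def by (fastforce simp: mdeg_add)

lemma homogeneous_pconst_mult: "homogeneous d f \<Longrightarrow> homogeneous d (pconst c * f)"
  using homogeneous_mult[OF homogeneous_pconst, of d f c] by simp

lemma homogeneous_power: "homogeneous d f \<Longrightarrow> homogeneous (n * d) (f ^ n)"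
  by (induction n) (simp_all add: homogeneous_mult)

lemma homogeneous_prod:
  "(\<And>i. i \<in> A \<Longrightarrow> homogeneous (d i) (f i)) \<Longrightarrow> homogeneous (sum d A) (prod f A)"
  by (induction A rule: infinite_finite_induct) (auto intro: homogeneous_mult)

lemma hcomp_mult_homogeneous:
  assumes "homogeneous d f"
  shows "hcomp e (f * g) = (if d \<le> e then f * hcomp (e - d) g else 0)"
proof (induction g rule: poly5_induct)
  case (single m c)
  have 1: "homogeneous (d + mdeg m) (f * Poly_Mapping.single m c)"
    by (rule homogeneous_mult[OF assms homogeneous_single])
  have 2: "homogeneous (mdeg m) (Poly_Mapping.single m c)" by (rule homogeneous_single)
  show ?case by (auto simp: hcomp_homogeneous[OF 1] hcomp_homogeneous[OF 2])
qed (auto simp: distrib_left hcomp_add)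

lemma sum_hcomp: "f = (\<Sum>d\<in>mdeg ` Poly_Mapping.keys f. hcomp d f)"
proof (rule poly_mapping_eqI)
  fix m
  show "Poly_Mapping.lookup f m = Poly_Mapping.lookup (\<Sum>d\<in>mdeg ` Poly_Mapping.keys f. hcomp d f) m"
    by (cases "m \<in> Poly_Mapping.keys f") (auto simp: lookup_sum lookup_hcomp in_keys_iff)
qed

lemma hcomp_outside: "d \<notin> mdeg ` Poly_Mapping.keys f \<Longrightarrow> hcomp d f = 0"
  by (rule poly_mapping_eqI) (auto simp: lookup_hcomp in_keys_iff)

lemma homogeneous_induct [consumes 1, case_names zero add single]:
  assumes "homogeneous d f" and "P 0"
    and "\<And>f g. homogeneous d f \<Longrightarrow> homogeneous d g \<Longrightarrow> P f \<Longrightarrow> P g \<Longrightarrow> P (f + g)"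
    and "\<And>m c. mdeg m = d \<Longrightarrow> P (Poly_Mapping.single m c)"
  shows "P f"
proof -
  have "P (hcomp d f)"
  proof (induction f rule: poly5_induct)
    case zero then show ?case using assms(2) by simp
  next
    case (add f g) then show ?case using assms(3) by (simp add: hcomp_add)
  next
    case (single m c)
    then show ?case using assms(2,4)
      by (auto simp: hcomp_homogeneous[OF homogeneous_single])
  qed
  then show ?thesis using assms(1) by (simp add: hcomp_homogeneous)
qed

subsection \<open>Graded ideals\<close>

text \<open>Stability under components is the form that calculations use.
  \<open>graded_ideal_of\<close> and \<open>graded_eq_ideal_of_homogeneous\<close> identify it with
  generation by homogeneous elements, the form that occurs in
  \<open>homogeneous_prime_def\<close>.\<close>

definition graded :: "'r::comm_ring_1 poly5 set \<Rightarrow> bool" where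
  "graded I \<longleftrightarrow> is_ideal I \<and> (\<forall>f\<in>I. \<forall>d. hcomp d f \<in> I)"

lemma gradedD: "graded I \<Longrightarrow> is_ideal I" "graded I \<Longrightarrow> f \<in> I \<Longrightarrow> hcomp d f \<in> I"
  by (simp_all add: graded_def)

text \<open>The polynomials all of whose components lie in the ideal form an ideal: multiplication
  by a monomial merely shifts components.\<close>

lemma graded_ideal_of:
  assumes "\<And>f. f \<in> F \<Longrightarrow> \<exists>d. homogeneous d f"
  shows "graded (ideal_of F)"
proof -
  have "is_ideal {f. \<forall>d. hcomp d f \<in> ideal_of F}"
  proof (rule is_idealI)
    fix c a assume a: "a \<in> {f. \<forall>d. hcomp d f \<in> ideal_of F}"
    show "c * a \<in> {f. \<forall>d. hcomp d f \<in> ideal_of F}"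
    proof (induction c rule: poly5_induct)
      case (single m c)
      then show ?case using a
        by (auto simp: hcomp_mult_homogeneous[OF homogeneous_single] intro!: ideal_mult ideal_0)
    qed (auto simp: distrib_right hcomp_add intro: ideal_add ideal_0)
  qed (auto simp: hcomp_add intro: ideal_add ideal_0)
  moreover have "F \<subseteq> {f. \<forall>d. hcomp d f \<in> ideal_of F}"
  proof
    fix f assume "f \<in> F"
    moreover from this obtain d where "homogeneous d f" using assms by blast
    ultimately show "f \<in> {f. \<forall>d. hcomp d f \<in> ideal_of F}"
      by (auto simp: hcomp_homogeneous ideal_of_base ideal_0)
  qed
  ultimately have "ideal_of F \<subseteq> {f. \<forall>d. hcomp d f \<in> ideal_of F}" by (rule ideal_of_least)
  then show ?thesis by (auto simp: graded_def)
qed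

lemma graded_eq_ideal_of_homogeneous:
  assumes "graded I"
  shows "I = ideal_of {f \<in> I. \<exists>d. homogeneous d f}"
proof
  show "I \<subseteq> ideal_of {f \<in> I. \<exists>d. homogeneous d f}"
  proof
    fix f assume "f \<in> I"
    then have "(\<Sum>d\<in>mdeg ` Poly_Mapping.keys f. hcomp d f) \<in> ideal_of {f \<in> I. \<exists>d. homogeneous d f}"
      using assms by (intro ideal_sum ideal_of_base) (auto intro: gradedD homogeneous_hcomp)
    then show "f \<in> ideal_of {f \<in> I. \<exists>d. homogeneous d f}" by (simp flip: sum_hcomp)
  qed
next
  show "ideal_of {f \<in> I. \<exists>d. homogeneous d f} \<subseteq> I"
    using assms by (intro ideal_of_least) (auto intro: gradedD)
qed

lemma homogeneous_prime_iff:
  "homogeneous_prime \<pp> \<longleftrightarrow> graded \<pp> \<and> 1 \<notin> \<pp> \<and> (\<forall>f g. f * g \<in> \<pp> \<longrightarrow> f \<in> \<pp> \<or> g \<in> \<pp>)"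
  (is "?L \<longleftrightarrow> ?R")
proof
  assume L: ?L
  then have "graded (ideal_of {f \<in> \<pp>. \<exists>d. homogeneous d f})" by (intro graded_ideal_of) auto
  then show ?R using L by (simp add: homogeneous_prime_def)
next
  assume ?R then show ?L
    using graded_eq_ideal_of_homogeneous by (auto simp: homogeneous_prime_def graded_def)
qed

lemma graded_insert:
  assumes "graded I" "homogeneous d f"
  shows "graded (ideal_of (insert f I))"
proof -
  let ?I = "{f \<in> I. \<exists>d. homogeneous d f}"
  have "graded (ideal_of (insert f ?I))" using assms(2) by (intro graded_ideal_of) auto
  moreover have "ideal_of (insert f ?I) = ideal_of (insert f I)"
  proof (rule antisym[OF ideal_of_mono ideal_of_least])
    have "I \<subseteq> ideal_of (insert f ?I)"
      using graded_eq_ideal_of_homogeneous[OF assms(1)] ideal_of_mono[of ?I "insert f ?I"] by blast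
    then show "insert f I \<subseteq> ideal_of (insert f ?I)" using ideal_of_base by blast
  qed auto
  ultimately show ?thesis by simp
qed

lemma graded_ideal_Union:
  assumes "\<And>f. f \<in> F \<Longrightarrow> \<exists>d. homogeneous d f" "graded I"
  shows "graded (ideal_of (I \<union> F))"
proof -
  let ?I = "{f \<in> I. \<exists>d. homogeneous d f}"
  have "graded (ideal_of (?I \<union> F))" using assms(1) by (intro graded_ideal_of) auto
  moreover have "ideal_of (?I \<union> F) = ideal_of (I \<union> F)"
  proof (rule antisym[OF ideal_of_mono ideal_of_least])
    have "I \<subseteq> ideal_of (?I \<union> F)"
      using graded_eq_ideal_of_homogeneous[OF assms(2)] ideal_of_mono[of ?I "?I \<union> F"] by blast
    then show "I \<union> F \<subseteq> ideal_of (?I \<union> F)" using ideal_of_base by blast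
  qed auto
  ultimately show ?thesis by simp
qed

text \<open>Comparing the components of top degree outside the ideal, primality need only be tested on
  homogeneous elements.\<close>

lemma graded_prime_if_homogeneous_prime:
  assumes gr: "graded \<pp>"
    and pr: "\<And>f g d e. homogeneous d f \<Longrightarrow> homogeneous e g \<Longrightarrow> f * g \<in> \<pp> \<Longrightarrow> f \<in> \<pp> \<or> g \<in> \<pp>"
    and fg: "f * g \<in> \<pp>"
  shows "f \<in> \<pp> \<or> g \<in> \<pp>"
proof (rule ccontr)
  assume "\<not> (f \<in> \<pp> \<or> g \<in> \<pp>)"
  then have nf: "f \<notin> \<pp>" and ng: "g \<notin> \<pp>" by auto
  note id = gradedD(1)[OF gr]
  define top where "top h = Max {d. hcomp d h \<notin> \<pp>}" for h
  have fin: "finite {d. hcomp d h \<notin> \<pp>}" for h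
    by (rule finite_subset[of _ "mdeg ` Poly_Mapping.keys h"])
      (auto simp: hcomp_outside ideal_0[OF id] intro: ccontr)
  have ex: "\<exists>d. hcomp d h \<notin> \<pp>" if "h \<notin> \<pp>" for h
  proof (rule ccontr)
    assume "\<nexists>d. hcomp d h \<notin> \<pp>"
    then have "(\<Sum>d\<in>mdeg ` Poly_Mapping.keys h. hcomp d h) \<in> \<pp>" by (intro ideal_sum[OF id]) auto
    then show False using that by (simp flip: sum_hcomp)
  qed
  have top: "hcomp (top h) h \<notin> \<pp>" "\<And>d. top h < d \<Longrightarrow> hcomp d h \<in> \<pp>" if "h \<notin> \<pp>" for h
    using Max_in[OF fin, of h] Max_ge[OF fin, of _ h] ex[OF that] unfolding top_def
    by (auto simp: not_le[symmetric])
  let ?d = "top f" and ?e = "top g"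
  \<comment> \<open>A component of f above \<open>?d\<close> lies in the ideal by the choice of
    \<open>?d\<close>; one below \<open>?d\<close> meets a component of g above \<open>?e\<close>,
    which lies in the ideal as well.\<close>
  have "hcomp (?d + ?e) (f * g) - hcomp ?d f * hcomp ?e g \<in> \<pp>"
  proof -
    let ?A = "mdeg ` Poly_Mapping.keys f \<union> {?d}"
    have f: "f = (\<Sum>d\<in>?A. hcomp d f)"
      by (subst sum_hcomp, rule sum.mono_neutral_left) (auto simp: hcomp_outside)
    have "hcomp (?d + ?e) (f * g) = (\<Sum>d\<in>?A. hcomp (?d + ?e) (hcomp d f * g))"
      by (subst f) (simp add: sum_distrib_right hcomp_sum)
    also have "\<dots> = hcomp (?d + ?e) (hcomp ?d f * g) + (\<Sum>d\<in>?A - {?d}. hcomp (?d + ?e) (hcomp d f * g))"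
      by (subst sum.remove[of _ ?d]) auto
    also have "hcomp (?d + ?e) (hcomp ?d f * g) = hcomp ?d f * hcomp ?e g"
      by (simp add: hcomp_mult_homogeneous[OF homogeneous_hcomp])
    finally have "hcomp (?d + ?e) (f * g) - hcomp ?d f * hcomp ?e g =
      (\<Sum>d\<in>?A - {?d}. hcomp (?d + ?e) (hcomp d f * g))" by simp
    also have "\<dots> \<in> \<pp>"
    proof (rule ideal_sum[OF id])
      fix d assume d: "d \<in> ?A - {?d}"
      show "hcomp (?d + ?e) (hcomp d f * g) \<in> \<pp>"
      proof (cases "d > ?d")
        case True
        then show ?thesis
          by (intro gradedD(2)[OF gr] ideal_mult_right[OF id] top(2)[OF nf])
      next
        case False
        with d have "d < ?d" by auto
        then have "hcomp (?d + ?e - d) g \<in> \<pp>" by (intro top(2)[OF ng]) auto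
        then show ?thesis
          by (auto simp: hcomp_mult_homogeneous[OF homogeneous_hcomp] ideal_0[OF id] intro: ideal_mult[OF id])
      qed
    qed
    finally show ?thesis .
  qed
  then have "hcomp ?d f * hcomp ?e g \<in> \<pp>"
    using gradedD(2)[OF gr fg] ideal_diff_cong[OF id] by blast
  then show False using pr[OF homogeneous_hcomp homogeneous_hcomp] top(1)[OF nf] top(1)[OF ng] by blast
qed

text \<open>A graded ideal that is maximal among those avoiding a multiplicative set of homogeneous
  elements is prime.\<close>

lemma exists_homogeneous_prime:
  fixes I :: "'r::comm_ring_1 poly5 set"
  assumes gr: "graded I"
    and hom: "\<And>s. s \<in> S \<Longrightarrow> \<exists>d. homogeneous d s"
    and one: "1 \<in> S" and mult: "\<And>s t. s \<in> S \<Longrightarrow> t \<in> S \<Longrightarrow> s * t \<in> S"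
    and disj: "I \<inter> S = {}"
  obtains \<pp> where "homogeneous_prime \<pp>" "I \<subseteq> \<pp>" "\<pp> \<inter> S = {}"
proof -
  define \<A> where "\<A> = {J. graded J \<and> I \<subseteq> J \<and> J \<inter> S = {}}"
  have "\<exists>M\<in>\<A>. \<forall>J\<in>\<A>. M \<subseteq> J \<longrightarrow> J = M"
  proof (rule subset_Zorn_nonempty)
    show "\<A> \<noteq> {}" using gr disj by (auto simp: \<A>_def)
  next
    fix \<C> assume ne: "\<C> \<noteq> {}" and ch: "subset.chain \<A> \<C>"
    have C: "\<And>J. J \<in> \<C> \<Longrightarrow> J \<in> \<A>" using ch by (auto simp: subset.chain_def)
    have "graded (\<Union>\<C>)" unfolding graded_def
    proof (intro conjI is_idealI ballI allI)
      obtain J where "J \<in> \<C>" using ne by blast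
      then show "0 \<in> \<Union>\<C>" using C[of J] ideal_0[OF gradedD(1), of J] by (auto simp: \<A>_def)
    next
      fix a b assume "a \<in> \<Union>\<C>" "b \<in> \<Union>\<C>"
      then obtain J K where J: "a \<in> J" "J \<in> \<C>" and K: "b \<in> K" "K \<in> \<C>" by blast
      then have "J \<subseteq> K \<or> K \<subseteq> J" using ch by (auto simp: subset.chain_def)
      then obtain L where "L \<in> \<C>" "a \<in> L" "b \<in> L" using J K by blast
      then show "a + b \<in> \<Union>\<C>" using C[of L] by (auto simp: \<A>_def intro: ideal_add gradedD(1))
    next
      fix c a assume "a \<in> \<Union>\<C>" then show "c * a \<in> \<Union>\<C>"
        using C by (auto simp: \<A>_def intro: ideal_mult gradedD(1))
    next
      fix f d assume "f \<in> \<Union>\<C>" then show "hcomp d f \<in> \<Union>\<C>"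
        using C by (auto simp: \<A>_def intro: gradedD(2))
    qed
    then show "\<Union>\<C> \<in> \<A>" using C ne by (auto simp: \<A>_def)
  qed
  then obtain M where M: "M \<in> \<A>" and max: "\<And>J. J \<in> \<A> \<Longrightarrow> M \<subseteq> J \<Longrightarrow> J = M" by blast
  have grM: "graded M" and IM: "I \<subseteq> M" and MS: "M \<inter> S = {}" using M by (auto simp: \<A>_def)
  note idM = gradedD(1)[OF grM]
  \<comment> \<open>By maximality, adjoining a homogeneous element outside M produces an ideal that
    meets S, so some element of S is a multiple of a modulo M.\<close>
  have meets: "\<exists>c s. s \<in> S \<and> s - c * a \<in> M" if "homogeneous d a" "a \<notin> M" for a d
  proof -
    let ?J = "ideal_of (insert a M)"
    have "?J \<notin> \<A>"
    proof
      assume "?J \<in> \<A>"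
      then have "?J = M" using ideal_of_superset[of "insert a M"] by (intro max) auto
      then show False using that(2) ideal_of_base[of a "insert a M"] by auto
    qed
    moreover have "graded ?J" "I \<subseteq> ?J"
      using graded_insert[OF grM that(1)] IM ideal_of_superset[of "insert a M"] by auto
    ultimately obtain s where "s \<in> S" "s \<in> ?J" by (auto simp: \<A>_def)
    then obtain c f where "s = c * a + f" "f \<in> M" unfolding is_ideal_plus_principal[OF idM] by auto
    then have "s - c * a \<in> M" by simp
    then show ?thesis using \<open>s \<in> S\<close> by blast
  qed
  have "f \<in> M \<or> g \<in> M" if fg: "homogeneous d f" "homogeneous e g" "f * g \<in> M" for f g d e
  proof (rule ccontr)
    assume "\<not> (f \<in> M \<or> g \<in> M)"
    then obtain c s c' s' where s: "s \<in> S" "s - c * f \<in> M" and s': "s' \<in> S" "s' - c' * g \<in> M"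
      using meets fg(1,2) by metis
    have "s * s' - (c * f) * (c' * g) \<in> M" by (rule ideal_cong_mult[OF idM s(2) s'(2)])
    moreover have "(c * f) * (c' * g) \<in> M"
      using ideal_mult[OF idM fg(3), of "c * c'"] by (simp add: mult_ac)
    ultimately have "s * s' \<in> M" using ideal_diff_cong[OF idM] by blast
    then show False using mult[OF s(1) s'(1)] MS by blast
  qed
  from graded_prime_if_homogeneous_prime[OF grM this]
  have "\<forall>f g. f * g \<in> M \<longrightarrow> f \<in> M \<or> g \<in> M" by simp
  then have "homogeneous_prime M" using grM one MS by (auto simp: homogeneous_prime_iff)
  then show ?thesis using that IM MS by blast
qed

subsection \<open>The index type\<close>

lemma exhaust_5: "(x :: 5) = 0 \<or> x = 1 \<or> x = 2 \<or> x = 3 \<or> x = 4"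
proof (induct x)
  case (of_int z)
  then have "0 \<le> z" and "z < 5" by simp_all
  then have "z = 0 \<or> z = 1 \<or> z = 2 \<or> z = 3 \<or> z = 4" by arith
  then show ?case by auto
qed

lemma UNIV_5: "(UNIV :: 5 set) = {0, 1, 2, 3, 4}"
  using exhaust_5 by auto

lemma forall_5: "(\<forall>i :: 5. P i) \<longleftrightarrow> P 0 \<and> P 1 \<and> P 2 \<and> P 3 \<and> P 4"
  by (metis exhaust_5)

lemma sum_5: "(\<Sum>i\<in>(UNIV :: 5 set). f i) = f 0 + f 1 + f 2 + f 3 + (f 4 :: 'a::comm_monoid_add)"
  unfolding UNIV_5 by (simp add: add.assoc)

lemma prod_5: "(\<Prod>i\<in>(UNIV :: 5 set). f i) = f 0 * f 1 * f 2 * f 3 * (f 4 :: 'a::comm_monoid_mult)"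
  unfolding UNIV_5 by (simp add: mult.assoc)

subsection \<open>Partial derivatives\<close>

lemma pdiff_eq_mlin:
  "pdiff j = mlin (\<lambda>m. Poly_Mapping.single (m - Poly_Mapping.single j 1) (of_nat (Poly_Mapping.lookup m j)))"
  by (rule ext) (simp add: pdiff_def mlin_def pconst_mult_single mult.commute)

lemma pdiff_add: "pdiff j (f + g) = pdiff j f + pdiff j g"
  and pdiff_diff: "pdiff j (f - g) = pdiff j f - pdiff j g"
  and pdiff_uminus: "pdiff j (- f) = - pdiff j f"
  and pdiff_0 [simp]: "pdiff j 0 = 0"
  and pdiff_sum: "pdiff j (sum h A) = (\<Sum>i\<in>A. pdiff j (h i))"
  by (simp_all add: pdiff_eq_mlin mlin_add mlin_diff mlin_uminus mlin_sum mlin_pconst_mult)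

lemma pdiff_single:
  "pdiff j (Poly_Mapping.single m c) =
     Poly_Mapping.single (m - Poly_Mapping.single j 1) (of_nat (Poly_Mapping.lookup m j) * c)"
  by (simp add: pdiff_eq_mlin pconst_mult_single mult.commute)

lemma pdiff_pconst [simp]: "pdiff j (pconst c) = 0"
  by (simp add: pconst_def pdiff_single)

lemma pdiff_1 [simp]: "pdiff j 1 = 0"
  using pdiff_pconst[of j 1] by simp

lemma pdiff_pvar: "pdiff j (pvar i) = (if i = j then 1 else 0)"
  by (simp add: pvar_def pdiff_single lookup_single when_def)

text \<open>Subtraction of exponents is truncated, and a positive exponent of j makes the shift
  exact. In the product rule the remaining case is harmless, since the coefficient is then
  0.\<close>

lemma add_minus_single_nat:
  fixes m n :: "'a \<Rightarrow>\<^sub>0 nat"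
  assumes "Poly_Mapping.lookup n j \<noteq> 0"
  shows "m + (n - Poly_Mapping.single j 1) = m + n - Poly_Mapping.single j 1"
  using assms by (intro poly_mapping_eqI) (auto simp: lookup_add lookup_minus lookup_single when_def)

lemma pdiff_mult: "pdiff j (f * g) = f * pdiff j g + g * pdiff j f"
proof (induction f rule: poly5_induct)
  case (single m a)
  show ?case
  proof (induction g rule: poly5_induct)
    case (single n b)
    have *: "Poly_Mapping.single m a * Poly_Mapping.single (n - Poly_Mapping.single j 1) (of_nat (Poly_Mapping.lookup n j) * b)
      = Poly_Mapping.single (m + n - Poly_Mapping.single j 1) (of_nat (Poly_Mapping.lookup n j) * (a * b))"
      for m n and a b :: 'a
      by (cases "Poly_Mapping.lookup n j = 0") (simp_all only: mult_single add_minus_single_nat mult_ac of_nat_0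
          mult_zero_left single_zero mult_zero_right not_False_eq_True)
    show ?case
      unfolding pdiff_single * unfolding mult_single pdiff_single add.commute[of n m] mult.commute[of b a]
      by (simp add: lookup_add distrib_right flip: single_add) (simp only: add.commute)
  qed (simp_all add: distrib_left distrib_right pdiff_add algebra_simps)
qed (simp_all add: distrib_left distrib_right pdiff_add algebra_simps)

lemma homogeneous_pdiff: "homogeneous d f \<Longrightarrow> homogeneous (d - 1) (pdiff j f)"
proof (induction rule: homogeneous_induct)
  case (single m c)
  show ?case
  proof (cases "Poly_Mapping.lookup m j = 0")
    case False
    then have "m = Poly_Mapping.single j 1 + (m - Poly_Mapping.single j 1)"
      by (intro poly_mapping_eqI) (auto simp: lookup_add lookup_minus lookup_single when_def)
    then have "mdeg m = mdeg (Poly_Mapping.single j 1) + mdeg (m - Poly_Mapping.single j 1)"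
      using mdeg_add by metis
    then have "mdeg (m - Poly_Mapping.single j 1) = d - 1"
      using single unfolding mdeg_single by linarith
    then show ?thesis
      using homogeneous_single[of "m - Poly_Mapping.single j 1"] by (simp add: pdiff_single)
  qed (simp add: pdiff_single)
qed (simp_all add: pdiff_add homogeneous_add)

lemma euler_formula:
  "homogeneous d f \<Longrightarrow> (\<Sum>j\<in>UNIV. pvar j * pdiff j f) = pconst (of_nat d) * f"
proof (induction rule: homogeneous_induct)
  case (single m c)
  have "pvar j * pdiff j (Poly_Mapping.single m c) = Poly_Mapping.single m (of_nat (Poly_Mapping.lookup m j) * c)" for j
  proof (cases "Poly_Mapping.lookup m j = 0")
    case False
    then have "Poly_Mapping.single j 1 + (m - Poly_Mapping.single j 1) = m"
      by (intro poly_mapping_eqI) (auto simp: lookup_add lookup_minus lookup_single when_def)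
    then show ?thesis by (simp add: pdiff_single pvar_def mult_single)
  qed (simp add: pdiff_single)
  then show ?case
    unfolding single[symmetric] by (simp add: sum_5 pconst_mult_single single_add distrib_right)
qed (simp_all add: pdiff_add distrib_left sum.distrib)

subsection \<open>Substitution\<close>

lemma prod_single_1: "(\<Prod>i\<in>A. Poly_Mapping.single (n i) (1::'r::comm_ring_1)) = Poly_Mapping.single (\<Sum>i\<in>A. n i) 1"
  by (induction A rule: infinite_finite_induct) (simp_all add: mult_single)

lemma pvar_power: "pvar i ^ k = Poly_Mapping.single (Poly_Mapping.single i k) (1::'r::comm_ring_1)"
  by (induction k) (simp_all add: pvar_def mult_single single_add[symmetric])

lemma single_eq_prod_pvar:
  "Poly_Mapping.single m c = pconst c * (\<Prod>i\<in>UNIV. pvar i ^ Poly_Mapping.lookup m i)"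
proof -
  have "(\<Sum>i\<in>UNIV. Poly_Mapping.single i (Poly_Mapping.lookup m i)) = m"
    by (rule poly_mapping_eqI) (simp add: lookup_sum lookup_single when_def)
  then show ?thesis by (simp add: pvar_power prod_single_1 pconst_mult_single)
qed

definition psubst :: "(5 \<Rightarrow> 'r poly5) \<Rightarrow> 'r::comm_ring_1 poly5 \<Rightarrow> 'r poly5" where
  "psubst l = mlin (\<lambda>m. \<Prod>i\<in>UNIV. l i ^ Poly_Mapping.lookup m i)"

lemma psubst_add: "psubst l (f + g) = psubst l f + psubst l g"
  and psubst_diff: "psubst l (f - g) = psubst l f - psubst l g"
  and psubst_0 [simp]: "psubst l 0 = 0"
  by (simp_all add: psubst_def mlin_add mlin_diff mlin_uminus mlin_sum)

lemma psubst_single: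
  "psubst l (Poly_Mapping.single m c) = pconst c * (\<Prod>i\<in>UNIV. l i ^ Poly_Mapping.lookup m i)"
  by (simp add: psubst_def)

lemma psubst_pconst [simp]: "psubst l (pconst c) = pconst c"
  unfolding pconst_def psubst_single by (simp add: pconst_def)

lemma psubst_1 [simp]: "psubst l 1 = 1"
  using psubst_pconst[of l 1] by simp

lemma psubst_mult: "psubst l (f * g) = psubst l f * psubst l g"
proof (induction f rule: poly5_induct)
  case (single m a)
  show ?case
  proof (induction g rule: poly5_induct)
    case (single n b)
    show ?case
      by (simp add: mult_single psubst_single lookup_add power_add prod.distrib pconst_mult mult_ac)
  qed (simp_all add: distrib_left psubst_add)
qed (simp_all add: distrib_right psubst_add)

lemma psubst_power: "psubst l (f ^ n) = psubst l f ^ n"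
  by (induction n) (simp_all add: psubst_mult)

lemma psubst_prod: "psubst l (prod h A) = (\<Prod>i\<in>A. psubst l (h i))"
  by (induction A rule: infinite_finite_induct) (simp_all add: psubst_mult)

lemma psubst_pvar [simp]: "psubst l (pvar i) = l i"
  unfolding pvar_def psubst_single
  by (simp add: lookup_single when_def if_distrib[of "\<lambda>k. _ ^ k"] prod.delta cong: if_cong)

lemma psubst_psubst: "psubst l (psubst l' f) = psubst (\<lambda>i. psubst l (l' i)) f"
  by (induction f rule: poly5_induct)
    (simp_all add: psubst_add psubst_single psubst_mult psubst_prod psubst_power)

lemma psubst_id [simp]: "psubst pvar f = f"
  by (induction f rule: poly5_induct) (simp_all add: psubst_add psubst_single flip: single_eq_prod_pvar)

lemma homogeneous_psubst:
  assumes "\<And>i. homogeneous 1 (l i)"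
  shows "homogeneous d f \<Longrightarrow> homogeneous d (psubst l f)"
proof (induction rule: homogeneous_induct)
  case (single m c)
  have "homogeneous (\<Sum>i\<in>UNIV. Poly_Mapping.lookup m i * 1) (\<Prod>i\<in>UNIV. l i ^ Poly_Mapping.lookup m i)"
    by (intro homogeneous_prod homogeneous_power assms)
  then show ?case using single by (simp add: psubst_single homogeneous_pconst_mult)
qed (simp_all add: psubst_add homogeneous_add)

text \<open>A linear automorphism is carried together with its inverse, so that it can be undone
  without a determinant that is a unit of the ring.\<close>

definition coord_change :: "(5 \<Rightarrow> 'r::comm_ring_1 poly5) \<Rightarrow> (5 \<Rightarrow> 'r poly5) \<Rightarrow> bool" where
  "coord_change l l' \<longleftrightarrow> (\<forall>i. homogeneous 1 (l i)) \<and> (\<forall>i. homogeneous 1 (l' i)) \<and>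
     (\<forall>i. psubst l (l' i) = pvar i) \<and> (\<forall>i. psubst l' (l i) = pvar i)"

lemma coord_change_id: "coord_change pvar pvar"
  using homogeneous_pvar by (auto simp: coord_change_def)

lemma coord_change_inverse:
  assumes "coord_change l l'"
  shows "psubst l (psubst l' f) = f" "psubst l' (psubst l f) = f"
  using assms by (simp_all add: coord_change_def psubst_psubst)

lemma coord_change_sym: "coord_change l l' \<Longrightarrow> coord_change l' l"
  by (simp add: coord_change_def)

lemma coord_change_compose:
  assumes "coord_change l l'" "coord_change k k'"
  shows "coord_change (\<lambda>i. psubst l (k i)) (\<lambda>i. psubst k' (l' i))"
  using assms unfolding coord_change_def
  by (auto intro: homogeneous_psubst
      simp: psubst_psubst[symmetric] coord_change_inverse[OF assms(1)] coord_change_inverse[OF assms(2)])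

lemma coord_change_homogeneous:
  "coord_change l l' \<Longrightarrow> homogeneous d f \<Longrightarrow> homogeneous d (psubst l f)"
  using homogeneous_psubst unfolding coord_change_def by blast

lemma hcomp_psubst:
  assumes "\<And>i. homogeneous 1 (l i)"
  shows "hcomp d (psubst l f) = psubst l (hcomp d f)"
proof (induction f rule: poly5_induct)
  case (single m c)
  have 2: "homogeneous (mdeg m) (Poly_Mapping.single m c)" by (rule homogeneous_single)
  show ?case by (auto simp: hcomp_homogeneous[OF 2] hcomp_homogeneous[OF homogeneous_psubst[OF assms 2]])
qed (simp_all add: psubst_add hcomp_add)

lemma ideal_vimage_psubst:
  assumes "is_ideal I"
  shows "is_ideal {f. psubst l f \<in> I}"
  using assms by (intro is_idealI) (auto simp: psubst_add psubst_mult ideal_0 ideal_add ideal_mult)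

lemma graded_vimage_psubst:
  assumes "graded I" "\<And>i. homogeneous 1 (l i)"
  shows "graded {f. psubst l f \<in> I}"
  using assms ideal_vimage_psubst[of I l]
  by (auto simp: graded_def hcomp_psubst[OF assms(2), symmetric])

subsection \<open>Coefficient maps\<close>

text \<open>Serves both reduction modulo \<open>\<pi>\<close> and the inclusion of the valuation
  ring in its field of fractions.\<close>

locale coefficient_map =
  fixes g :: "'r::comm_ring_1 \<Rightarrow> 's::comm_ring_1"
  assumes hom_add: "g (a + b) = g a + g b" and hom_mult: "g (a * b) = g a * g b" and hom_1 [simp]: "g 1 = 1"
begin

lemma hom_0 [simp]: "g 0 = 0"
  using hom_add[of 0 0] by simp

lemma hom_uminus: "g (- a) = - g a"
  using hom_add[of a "- a"] by (simp add: eq_neg_iff_add_eq_0 add.commute)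

lemma hom_diff: "g (a - b) = g a - g b"
  using hom_add[of a "- b"] by (simp add: hom_uminus)

lemma hom_of_nat: "g (of_nat n) = of_nat n"
  by (induction n) (simp_all add: hom_add)

lemma hom_power: "g (a ^ n) = g a ^ n"
  by (induction n) (simp_all add: hom_mult)

lemma hom_prod: "g (prod f A) = (\<Prod>i\<in>A. g (f i))"
  by (induction A rule: infinite_finite_induct) (simp_all add: hom_mult)

lemma hom_sum: "g (sum f A) = (\<Sum>i\<in>A. g (f i))"
  by (induction A rule: infinite_finite_induct) (simp_all add: hom_add)

abbreviation pmap :: "'r poly5 \<Rightarrow> 's poly5" where
  "pmap \<equiv> Poly_Mapping.map g"

lemma lookup_pmap: "Poly_Mapping.lookup (pmap f) m = g (Poly_Mapping.lookup f m)"
  by (simp add: Poly_Mapping.map.rep_eq when_def)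

lemma pmap_add: "pmap (f + h) = pmap f + pmap h"
  and pmap_diff: "pmap (f - h) = pmap f - pmap h"
  and pmap_uminus: "pmap (- f) = - pmap f"
  by (rule poly_mapping_eqI; simp add: lookup_pmap lookup_add lookup_minus hom_add hom_diff hom_uminus)+

lemma pmap_0 [simp]: "pmap 0 = 0"
  by (rule poly_mapping_eqI) (simp add: lookup_pmap)

lemma pmap_single [simp]: "pmap (Poly_Mapping.single m c) = Poly_Mapping.single m (g c)"
  by (rule poly_mapping_eqI) (simp add: lookup_pmap lookup_single when_def)

lemma pmap_pconst [simp]: "pmap (pconst c) = pconst (g c)"
  by (simp add: pconst_def)

lemma pmap_1 [simp]: "pmap 1 = 1"
  using pmap_pconst[of 1] by simp

lemma pmap_pvar [simp]: "pmap (pvar i) = pvar i"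
  by (simp add: pvar_def)

lemma pmap_mult: "pmap (f * h) = pmap f * pmap h"
proof (induction f rule: poly5_induct)
  case (single m a)
  show ?case
  proof (induction h rule: poly5_induct)
    case (single n b)
    show ?case by (simp add: mult_single hom_mult)
  qed (simp_all add: distrib_left pmap_add)
qed (simp_all add: distrib_right pmap_add)

lemma pmap_sum: "pmap (sum f A) = (\<Sum>i\<in>A. pmap (f i))"
  by (induction A rule: infinite_finite_induct) (simp_all add: pmap_add)

lemma homogeneous_pmap: "homogeneous d f \<Longrightarrow> homogeneous d (pmap f)"
  by (simp add: homogeneous_iff lookup_pmap)

lemma hcomp_pmap: "hcomp d (pmap f) = pmap (hcomp d f)"
  by (rule poly_mapping_eqI) (simp add: lookup_hcomp lookup_pmap)

lemma pdiff_pmap: "pdiff j (pmap f) = pmap (pdiff j f)"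
  by (induction f rule: poly5_induct)
    (simp_all add: pdiff_add pmap_add pdiff_single hom_mult hom_of_nat)

end

subsection \<open>Evaluation\<close>

definition peval :: "(5 \<Rightarrow> 'r) \<Rightarrow> 'r::comm_ring_1 poly5 \<Rightarrow> 'r" where
  "peval t f = (\<Sum>m\<in>Poly_Mapping.keys f. Poly_Mapping.lookup f m * (\<Prod>i\<in>UNIV. t i ^ Poly_Mapping.lookup m i))"

lemma peval_scale:
  assumes "homogeneous d f"
  shows "peval (\<lambda>i. c * t i) f = c ^ d * peval t f"
proof -
  have "(\<Prod>i\<in>UNIV. (c * t i) ^ Poly_Mapping.lookup m i) = c ^ d * (\<Prod>i\<in>UNIV. t i ^ Poly_Mapping.lookup m i)"
    if "m \<in> Poly_Mapping.keys f" for m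
  proof -
    have "mdeg m = d" using that assms by (simp add: homogeneous_def)
    then show ?thesis by (simp add: power_mult_distrib prod.distrib flip: power_sum)
  qed
  then show ?thesis by (simp add: peval_def sum_distrib_left mult_ac)
qed

lemma (in coefficient_map) peval_pmap: "peval (\<lambda>i. g (t i)) (pmap f) = g (peval t f)"
proof -
  have "peval (\<lambda>i. g (t i)) (pmap f) = (\<Sum>m\<in>Poly_Mapping.keys f.
      g (Poly_Mapping.lookup f m) * (\<Prod>i\<in>UNIV. g (t i) ^ Poly_Mapping.lookup m i))"
    unfolding peval_def lookup_pmap
    by (rule sum.mono_neutral_left) (auto simp: in_keys_iff lookup_pmap)
  then show ?thesis by (simp add: peval_def hom_sum hom_mult hom_prod hom_power)
qed

text \<open>Kronecker substitution \<open>t\<^sub>i = s ^ (D ^ i)\<close> reduces non-vanishing to one variable.\<close>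

lemma exists_peval_nonzero:
  fixes f :: "'k::field poly5"
  assumes inf: "infinite (UNIV :: 'k set)" and f: "f \<noteq> 0"
  obtains t where "\<And>i. t i \<noteq> 0" "peval t f \<noteq> 0"
proof -
  \<comment> \<open>D exceeds all exponents occurring in f, so the exponents of a monomial are the
    digits of \<open>E m\<close> in base D and different monomials get different powers of
    s.\<close>
  define D where "D = Suc (Max (insert 0 ((\<lambda>(m, i). Poly_Mapping.lookup m i) ` (Poly_Mapping.keys f \<times> UNIV))))"
  have lt: "Poly_Mapping.lookup m i < D" if "m \<in> Poly_Mapping.keys f" for m and i :: 5
    unfolding D_def less_Suc_eq_le using that by (intro Max_ge) force+
  define E where "E m = Poly_Mapping.lookup m 0 + D * (Poly_Mapping.lookup m 1 + D * (Poly_Mapping.lookup m 2 +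
     D * (Poly_Mapping.lookup m 3 + D * Poly_Mapping.lookup m 4)))" for m :: "5 \<Rightarrow>\<^sub>0 nat"
  have digit: "a = a' \<and> b = b'" if "a + D * b = a' + D * b'" "a < D" "a' < D" for a a' b b'
  proof -
    have "a mod D = a' mod D" using arg_cong[OF that(1), of "\<lambda>x. x mod D"] by simp
    then have "a = a'" using that(2,3) by simp
    then show ?thesis using that by simp
  qed
  have inj: "inj_on E (Poly_Mapping.keys f)"
  proof (rule inj_onI)
    fix m n assume mn: "m \<in> Poly_Mapping.keys f" "n \<in> Poly_Mapping.keys f" "E m = E n"
    have "\<forall>i. Poly_Mapping.lookup m i = Poly_Mapping.lookup n i"
      using mn(3) unfolding E_def forall_5 by (meson digit lt mn(1,2))
    then show "m = n" by (intro poly_mapping_eqI) simp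
  qed
  define P where "P = (\<Sum>m\<in>Poly_Mapping.keys f. Polynomial.monom (Poly_Mapping.lookup f m) (E m))"
  obtain m0 where m0: "m0 \<in> Poly_Mapping.keys f" using f by fastforce
  have "Polynomial.coeff P (E m0) = Poly_Mapping.lookup f m0"
  proof -
    have "Polynomial.coeff P (E m0) = (\<Sum>m\<in>Poly_Mapping.keys f. if m = m0 then Poly_Mapping.lookup f m else 0)"
      unfolding P_def coeff_sum using inj m0 by (intro sum.cong) (auto simp: inj_on_def)
    then show ?thesis using m0 by simp
  qed
  then have "P \<noteq> 0" using m0 by (auto simp: in_keys_iff)
  \<comment> \<open>The value 0 is excluded together with the roots, because every
    \<open>t i\<close> has to be nonzero.\<close>
  then have "finite ({s. poly P s = 0} \<union> {0})" by (simp add: poly_roots_finite)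
  from ex_new_if_finite[OF inf this] obtain s where s: "poly P s \<noteq> 0" "s \<noteq> 0" by auto
  define t where "t i = s ^ (if i = 0 then 1 else if i = 1 then D else if i = 2 then D * D
     else if i = 3 then D * D * D else D * D * D * D)" for i :: 5
  have "(\<Prod>i\<in>UNIV. t i ^ Poly_Mapping.lookup m i) = s ^ E m" for m
    unfolding prod_5 by (simp add: t_def E_def algebra_simps flip: power_mult power_add)
  then have "peval t f = poly P s"
    by (simp add: peval_def P_def poly_sum poly_monom)
  then show ?thesis using s by (intro that[of t]) (auto simp: t_def)
qed

section \<open>Local rings\<close>

text \<open>The ring operations of \<open>stalk\<close> are unions over all pairs of
  representatives. Such a union collapses as soon as the result does not depend on the
  representatives.\<close>

lemma UN_pairs_const:
  assumes "p \<in> S" "q \<in> T" "\<And>a s b t. (a, s) \<in> S \<Longrightarrow> (b, t) \<in> T \<Longrightarrow> f a s b t = G"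
  shows "(\<Union>(a, s)\<in>S. \<Union>(b, t)\<in>T. f a s b t) = G"
proof -
  have "(\<Union>(a, s)\<in>S. \<Union>(b, t)\<in>T. f a s b t) = (\<Union>p\<in>S. \<Union>q\<in>T. G)"
    using assms(3) by (intro SUP_cong refl) (auto intro!: SUP_cong)
  then show ?thesis using assms(1,2) by auto
qed

locale homogeneous_point =
  fixes F :: "'r::comm_ring_1 poly5 set" and \<pp> :: "'r poly5 set"
  assumes prime: "homogeneous_prime \<pp>"
begin

lemma graded_pp: "graded \<pp>" and one_notin: "1 \<notin> \<pp>"
  and prime_mult: "f * g \<in> \<pp> \<Longrightarrow> f \<in> \<pp> \<or> g \<in> \<pp>"
  using prime by (auto simp: homogeneous_prime_iff)

lemma ideal_pp: "is_ideal \<pp>"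
  using graded_pp by (rule gradedD)

lemma mult_mem_iff: "f * g \<in> \<pp> \<longleftrightarrow> f \<in> \<pp> \<or> g \<in> \<pp>"
  using prime_mult ideal_mult[OF ideal_pp] ideal_mult_right[OF ideal_pp] by blast

lemma notin_power: "f \<notin> \<pp> \<Longrightarrow> f ^ n \<notin> \<pp>"
  by (induction n) (auto simp: mult_mem_iff one_notin)

lemma notin_prod: "finite A \<Longrightarrow> (\<And>i. i \<in> A \<Longrightarrow> f i \<notin> \<pp>) \<Longrightarrow> prod f A \<notin> \<pp>"
  by (induction A rule: finite_induct) (auto simp: mult_mem_iff one_notin)

text \<open>The kernel of localisation: for a numerator a this says that the germ of a fraction with
  that numerator is zero. Equality of germs is \<open>vanishes\<close> of the cross
  difference.\<close>

definition vanishes :: "'r poly5 \<Rightarrow> bool" where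
  "vanishes a \<longleftrightarrow> (\<exists>u d. homogeneous d u \<and> u \<notin> \<pp> \<and> u * a \<in> ideal_of F)"

lemma vanishes_ideal: "is_ideal {a. vanishes a}"
proof (rule is_idealI)
  have "homogeneous 0 1 \<and> 1 \<notin> \<pp> \<and> 1 * 0 \<in> ideal_of F" using one_notin by (simp add: ideal_0)
  then show "0 \<in> {a. vanishes a}" unfolding vanishes_def by blast
next
  fix a b assume "a \<in> {a. vanishes a}" "b \<in> {a. vanishes a}"
  then obtain u d v e where u: "homogeneous d u" "u \<notin> \<pp>" "u * a \<in> ideal_of F"
    and v: "homogeneous e v" "v \<notin> \<pp>" "v * b \<in> ideal_of F" by (auto simp: vanishes_def)
  have "u * v * (a + b) = v * (u * a) + u * (v * b)" by (simp add: algebra_simps)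
  also have "\<dots> \<in> ideal_of F" using u v by (simp add: ideal_add ideal_mult)
  finally show "a + b \<in> {a. vanishes a}"
    using homogeneous_mult[OF u(1) v(1)] u v by (auto simp: vanishes_def mult_mem_iff intro!: exI[of _ "u * v"])
next
  fix c a assume "a \<in> {a. vanishes a}"
  then obtain u d where u: "homogeneous d u" "u \<notin> \<pp>" "u * a \<in> ideal_of F" by (auto simp: vanishes_def)
  then have "u * (c * a) \<in> ideal_of F"
    using ideal_mult[OF is_ideal_ideal_of u(3), of c] by (simp add: mult_ac)
  then show "c * a \<in> {a. vanishes a}" using u by (auto simp: vanishes_def)
qed

lemma vanishes_0: "vanishes 0"
  and vanishes_add: "vanishes a \<Longrightarrow> vanishes b \<Longrightarrow> vanishes (a + b)"
  and vanishes_diff: "vanishes a \<Longrightarrow> vanishes b \<Longrightarrow> vanishes (a - b)"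
  and vanishes_mult: "vanishes a \<Longrightarrow> vanishes (c * a)"
  using ideal_0[OF vanishes_ideal] ideal_add[OF vanishes_ideal] ideal_diff[OF vanishes_ideal]
    ideal_mult[OF vanishes_ideal] by auto

lemma vanishes_base: "a \<in> ideal_of F \<Longrightarrow> vanishes a"
  unfolding vanishes_def by (rule exI[of _ 1], rule exI[of _ 0]) (simp add: one_notin)

lemma vanishes_uminus: "vanishes a \<Longrightarrow> vanishes (- a)"
  using vanishes_diff[OF vanishes_0] by fastforce

lemma vanishes_cancel:
  assumes "homogeneous d s" "s \<notin> \<pp>" "vanishes (s * a)"
  shows "vanishes a"
proof -
  obtain u e where u: "homogeneous e u" "u \<notin> \<pp>" "u * (s * a) \<in> ideal_of F" using assms(3) by (auto simp: vanishes_def)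
  have "homogeneous (e + d) (u * s) \<and> u * s \<notin> \<pp> \<and> (u * s) * a \<in> ideal_of F"
    using u assms homogeneous_mult[OF u(1) assms(1)] by (simp add: mult_mem_iff mult.assoc)
  then show ?thesis unfolding vanishes_def by blast
qed

lemma vanishes_subset: "F \<subseteq> \<pp> \<Longrightarrow> vanishes a \<Longrightarrow> a \<in> \<pp>"
  using ideal_of_least[OF ideal_pp, of F] prime_mult unfolding vanishes_def by blast

lemma fractions_atI: "homogeneous d a \<Longrightarrow> homogeneous d s \<Longrightarrow> s \<notin> \<pp> \<Longrightarrow> (a, s) \<in> fractions_at \<pp>"
  by (auto simp: fractions_at_def)

lemma fractions_atE:
  assumes "(a, s) \<in> fractions_at \<pp>"
  obtains d where "homogeneous d a" "homogeneous d s" "s \<notin> \<pp>"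
  using assms by (auto simp: fractions_at_def)

lemma fractions_mult:
  "(a, s) \<in> fractions_at \<pp> \<Longrightarrow> (b, t) \<in> fractions_at \<pp> \<Longrightarrow> (a * b, s * t) \<in> fractions_at \<pp>"
  by (auto simp: fractions_at_def mult_mem_iff intro: homogeneous_mult)

lemma fractions_add:
  assumes "(a, s) \<in> fractions_at \<pp>" "(b, t) \<in> fractions_at \<pp>"
  shows "(a * t + b * s, s * t) \<in> fractions_at \<pp>"
proof -
  obtain d e where h: "homogeneous d a" "homogeneous d s" "s \<notin> \<pp>" "homogeneous e b" "homogeneous e t" "t \<notin> \<pp>"
    using assms by (auto simp: fractions_at_def)
  have "homogeneous (d + e) (a * t)" "homogeneous (d + e) (b * s)" "homogeneous (d + e) (s * t)"
    using homogeneous_mult[of d a e t] homogeneous_mult[of e b d s] homogeneous_mult[of d s e t] h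
    by (simp_all add: add.commute)
  then show ?thesis using h by (auto simp: fractions_at_def mult_mem_iff intro: homogeneous_add)
qed

lemma fractions_uminus: "(a, s) \<in> fractions_at \<pp> \<Longrightarrow> (- a, s) \<in> fractions_at \<pp>"
  by (auto simp: fractions_at_def intro: homogeneous_uminus)

lemma fractions_one: "(1, 1) \<in> fractions_at \<pp>" and fractions_zero: "(0, 1) \<in> fractions_at \<pp>"
  using one_notin by (auto intro!: fractions_atI[of 0])

lemma fractions_const: "(pconst c, 1) \<in> fractions_at \<pp>"
  using one_notin by (auto intro!: fractions_atI[of 0])

lemma germ_iff:
  "(b, t) \<in> germ F \<pp> (a, s) \<longleftrightarrow> (b, t) \<in> fractions_at \<pp> \<and> vanishes (a * t - b * s)"
  by (auto simp: germ_def vanishes_def)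

lemma germ_self: "(a, s) \<in> fractions_at \<pp> \<Longrightarrow> (a, s) \<in> germ F \<pp> (a, s)"
  by (simp add: germ_iff vanishes_0)

lemma vanishes_trans:
  assumes "vanishes (a * t - b * s)" "vanishes (b * r - c * t)" "(b, t) \<in> fractions_at \<pp>"
  shows "vanishes (a * r - c * s)"
proof -
  obtain d where t: "homogeneous d t" "t \<notin> \<pp>" using assms(3) by (auto simp: fractions_at_def)
  have "t * (a * r - c * s) = r * (a * t - b * s) + s * (b * r - c * t)" by (simp add: algebra_simps)
  also have "vanishes \<dots>" using assms(1,2) by (intro vanishes_add vanishes_mult)
  finally show ?thesis using vanishes_cancel[OF t] by blast
qed

lemma vanishes_sym: "vanishes (a * t - b * s) \<Longrightarrow> vanishes (b * s - a * t)"
  using vanishes_uminus[of "a * t - b * s"] by simp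

lemma germ_eq_iff:
  assumes "(a, s) \<in> fractions_at \<pp>" "(b, t) \<in> fractions_at \<pp>"
  shows "germ F \<pp> (a, s) = germ F \<pp> (b, t) \<longleftrightarrow> vanishes (a * t - b * s)"
proof
  assume "germ F \<pp> (a, s) = germ F \<pp> (b, t)"
  then have "(b, t) \<in> germ F \<pp> (a, s)" using germ_self[OF assms(2)] by simp
  then show "vanishes (a * t - b * s)" by (simp add: germ_iff)
next
  assume v: "vanishes (a * t - b * s)"
  then have v': "vanishes (b * s - a * t)" by (rule vanishes_sym)
  have "(c, r) \<in> germ F \<pp> (a, s) \<longleftrightarrow> (c, r) \<in> germ F \<pp> (b, t)" for c r
    using vanishes_trans[of b s a t r c] vanishes_trans[of a t b s r c] v v' assms by (auto simp: germ_iff)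
  then show "germ F \<pp> (a, s) = germ F \<pp> (b, t)" by auto
qed

lemma germ_eqI:
  assumes "(a, s) \<in> fractions_at \<pp>" "(b, t) \<in> fractions_at \<pp>" "a * t = b * s"
  shows "germ F \<pp> (a, s) = germ F \<pp> (b, t)"
  using germ_eq_iff[OF assms(1,2)] assms(3) vanishes_0 by simp

lemma carrier_stalk: "carrier (stalk F \<pp>) = germ F \<pp> ` fractions_at \<pp>"
  by (simp add: stalk_def)

lemma germ_in_carrier [simp]: "(a, s) \<in> fractions_at \<pp> \<Longrightarrow> germ F \<pp> (a, s) \<in> carrier (stalk F \<pp>)"
  by (simp add: carrier_stalk)

lemma stalk_cases:
  assumes "U \<in> carrier (stalk F \<pp>)"
  obtains a s where "(a, s) \<in> fractions_at \<pp>" "U = germ F \<pp> (a, s)"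
  using assms by (auto simp: carrier_stalk)

lemma one_stalk: "\<one>\<^bsub>stalk F \<pp>\<^esub> = germ F \<pp> (1, 1)" and zero_stalk: "\<zero>\<^bsub>stalk F \<pp>\<^esub> = germ F \<pp> (0, 1)"
  by (simp_all add: stalk_def)

lemma mult_stalk:
  assumes a: "(a, s) \<in> fractions_at \<pp>" and b: "(b, t) \<in> fractions_at \<pp>"
  shows "germ F \<pp> (a, s) \<otimes>\<^bsub>stalk F \<pp>\<^esub> germ F \<pp> (b, t) = germ F \<pp> (a * b, s * t)"
proof -
  have "germ F \<pp> (a' * b', s' * t') = germ F \<pp> (a * b, s * t)"
    if a': "(a', s') \<in> germ F \<pp> (a, s)" and b': "(b', t') \<in> germ F \<pp> (b, t)" for a' s' b' t'
  proof -
    have "(a' * b') * (s * t) - (a * b) * (s' * t') = - (b' * t * (a * s' - a' * s) + a * s' * (b * t' - b' * t))"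
      by (simp add: algebra_simps)
    then have "vanishes ((a' * b') * (s * t) - (a * b) * (s' * t'))"
      using a' b' by (simp only: germ_iff) (intro vanishes_uminus vanishes_add vanishes_mult; simp)
    then show ?thesis
      using a b a' b' by (subst germ_eq_iff) (auto simp: germ_iff intro: fractions_mult)
  qed
  then have "(\<Union>(a, s)\<in>germ F \<pp> (a, s). \<Union>(b, t)\<in>germ F \<pp> (b, t). germ F \<pp> (a * b, s * t)) = germ F \<pp> (a * b, s * t)"
    by (rule UN_pairs_const[OF germ_self[OF a] germ_self[OF b]])
  then show ?thesis by (simp add: stalk_def)
qed

lemma add_stalk:
  assumes a: "(a, s) \<in> fractions_at \<pp>" and b: "(b, t) \<in> fractions_at \<pp>"
  shows "germ F \<pp> (a, s) \<oplus>\<^bsub>stalk F \<pp>\<^esub> germ F \<pp> (b, t) = germ F \<pp> (a * t + b * s, s * t)"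
proof -
  have "germ F \<pp> (a' * t' + b' * s', s' * t') = germ F \<pp> (a * t + b * s, s * t)"
    if a': "(a', s') \<in> germ F \<pp> (a, s)" and b': "(b', t') \<in> germ F \<pp> (b, t)" for a' s' b' t'
  proof -
    have "(a' * t' + b' * s') * (s * t) - (a * t + b * s) * (s' * t')
       = - (t * t' * (a * s' - a' * s) + s * s' * (b * t' - b' * t))"
      by (simp add: algebra_simps)
    then have "vanishes ((a' * t' + b' * s') * (s * t) - (a * t + b * s) * (s' * t'))"
      using a' b' by (simp only: germ_iff) (intro vanishes_uminus vanishes_add vanishes_mult; simp)
    then show ?thesis
      using a b a' b' by (subst germ_eq_iff) (auto simp: germ_iff intro: fractions_add)
  qed
  then have "(\<Union>(a, s)\<in>germ F \<pp> (a, s). \<Union>(b, t)\<in>germ F \<pp> (b, t). germ F \<pp> (a * t + b * s, s * t)) =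
      germ F \<pp> (a * t + b * s, s * t)"
    by (rule UN_pairs_const[OF germ_self[OF a] germ_self[OF b]])
  then show ?thesis by (simp add: stalk_def)
qed

lemma cring_stalk: "cring (stalk F \<pp>)"
proof (rule cringI)
  note fr = fractions_mult fractions_add fractions_one fractions_zero
  show "abelian_group (stalk F \<pp>)"
  proof (rule abelian_groupI)
    fix U V W assume "U \<in> carrier (stalk F \<pp>)" "V \<in> carrier (stalk F \<pp>)" "W \<in> carrier (stalk F \<pp>)"
    then obtain a s b t c r where a: "(a, s) \<in> fractions_at \<pp>" and b: "(b, t) \<in> fractions_at \<pp>"
      and c: "(c, r) \<in> fractions_at \<pp>" and UVW: "U = germ F \<pp> (a, s)" "V = germ F \<pp> (b, t)" "W = germ F \<pp> (c, r)"
      by (elim stalk_cases) blast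
    show "U \<oplus>\<^bsub>stalk F \<pp>\<^esub> V \<oplus>\<^bsub>stalk F \<pp>\<^esub> W = U \<oplus>\<^bsub>stalk F \<pp>\<^esub> (V \<oplus>\<^bsub>stalk F \<pp>\<^esub> W)"
      unfolding UVW add_stalk[OF a b] add_stalk[OF fr(2)[OF a b] c] add_stalk[OF b c] add_stalk[OF a fr(2)[OF b c]]
      by (rule germ_eqI[OF fr(2)[OF fr(2)[OF a b] c] fr(2)[OF a fr(2)[OF b c]]]) (simp add: algebra_simps)
  next
    fix U V assume "U \<in> carrier (stalk F \<pp>)" "V \<in> carrier (stalk F \<pp>)"
    then obtain a s b t where a: "(a, s) \<in> fractions_at \<pp>" and b: "(b, t) \<in> fractions_at \<pp>"
      and UV: "U = germ F \<pp> (a, s)" "V = germ F \<pp> (b, t)"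
      by (elim stalk_cases) blast
    show "U \<oplus>\<^bsub>stalk F \<pp>\<^esub> V \<in> carrier (stalk F \<pp>)" "U \<oplus>\<^bsub>stalk F \<pp>\<^esub> V = V \<oplus>\<^bsub>stalk F \<pp>\<^esub> U"
      unfolding UV add_stalk[OF a b] add_stalk[OF b a]
      using fr(2)[OF a b] by (simp_all add: mult.commute add.commute)
  next
    fix U assume "U \<in> carrier (stalk F \<pp>)"
    then obtain a s where U: "(a, s) \<in> fractions_at \<pp>" "U = germ F \<pp> (a, s)" by (rule stalk_cases)
    then show "\<zero>\<^bsub>stalk F \<pp>\<^esub> \<oplus>\<^bsub>stalk F \<pp>\<^esub> U = U" by (simp add: zero_stalk add_stalk fr)
    have "germ F \<pp> (- a, s) \<oplus>\<^bsub>stalk F \<pp>\<^esub> U = \<zero>\<^bsub>stalk F \<pp>\<^esub>"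
      using U by (simp add: zero_stalk add_stalk fractions_uminus)
        (rule germ_eqI, use fractions_add[OF fractions_uminus[OF U(1)] U(1)] in \<open>auto intro: fr\<close>)
    then show "\<exists>V\<in>carrier (stalk F \<pp>). V \<oplus>\<^bsub>stalk F \<pp>\<^esub> U = \<zero>\<^bsub>stalk F \<pp>\<^esub>"
      using fractions_uminus[OF U(1)] germ_in_carrier by blast
  qed (simp add: zero_stalk fr)
  show "comm_monoid (stalk F \<pp>)"
  proof (rule comm_monoidI)
    fix U V W assume "U \<in> carrier (stalk F \<pp>)" "V \<in> carrier (stalk F \<pp>)" "W \<in> carrier (stalk F \<pp>)"
    then show "U \<otimes>\<^bsub>stalk F \<pp>\<^esub> V \<otimes>\<^bsub>stalk F \<pp>\<^esub> W = U \<otimes>\<^bsub>stalk F \<pp>\<^esub> (V \<otimes>\<^bsub>stalk F \<pp>\<^esub> W)"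
      by (elim stalk_cases) (simp add: mult_stalk fr mult.assoc)
  next
    fix U V assume "U \<in> carrier (stalk F \<pp>)" "V \<in> carrier (stalk F \<pp>)"
    then show "U \<otimes>\<^bsub>stalk F \<pp>\<^esub> V \<in> carrier (stalk F \<pp>)" "U \<otimes>\<^bsub>stalk F \<pp>\<^esub> V = V \<otimes>\<^bsub>stalk F \<pp>\<^esub> U"
      by (auto elim!: stalk_cases simp: mult_stalk fr mult.commute)
  next
    fix U assume "U \<in> carrier (stalk F \<pp>)"
    then show "\<one>\<^bsub>stalk F \<pp>\<^esub> \<otimes>\<^bsub>stalk F \<pp>\<^esub> U = U"
      by (auto elim!: stalk_cases simp: one_stalk mult_stalk fr)
  qed (simp add: one_stalk fr)
  fix U V W assume "U \<in> carrier (stalk F \<pp>)" "V \<in> carrier (stalk F \<pp>)" "W \<in> carrier (stalk F \<pp>)"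
  then obtain a s b t c r where a: "(a, s) \<in> fractions_at \<pp>" and b: "(b, t) \<in> fractions_at \<pp>"
    and c: "(c, r) \<in> fractions_at \<pp>" and UVW: "U = germ F \<pp> (a, s)" "V = germ F \<pp> (b, t)" "W = germ F \<pp> (c, r)"
    by (elim stalk_cases) blast
  show "(U \<oplus>\<^bsub>stalk F \<pp>\<^esub> V) \<otimes>\<^bsub>stalk F \<pp>\<^esub> W = U \<otimes>\<^bsub>stalk F \<pp>\<^esub> W \<oplus>\<^bsub>stalk F \<pp>\<^esub> V \<otimes>\<^bsub>stalk F \<pp>\<^esub> W"
    unfolding UVW add_stalk[OF a b] mult_stalk[OF fr(2)[OF a b] c] mult_stalk[OF b c] mult_stalk[OF a c]
      add_stalk[OF fr(1)[OF a c] fr(1)[OF b c]]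
    by (rule germ_eqI[OF fr(1)[OF fr(2)[OF a b] c] fr(2)[OF fr(1)[OF a c] fr(1)[OF b c]]]) (simp add: algebra_simps)
qed

sublocale stalk: cring "stalk F \<pp>"
  by (rule cring_stalk)

lemma germ_eq_zero_iff:
  assumes "(a, s) \<in> fractions_at \<pp>"
  shows "germ F \<pp> (a, s) = \<zero>\<^bsub>stalk F \<pp>\<^esub> \<longleftrightarrow> vanishes a"
  using germ_eq_iff[OF assms fractions_zero] by (simp add: zero_stalk)

lemma germ_uminus:
  assumes "(a, s) \<in> fractions_at \<pp>"
  shows "\<ominus>\<^bsub>stalk F \<pp>\<^esub> germ F \<pp> (a, s) = germ F \<pp> (- a, s)"
proof (rule stalk.minus_equality)
  have "(- a * s + a * s, s * s) \<in> fractions_at \<pp>"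
    by (rule fractions_add[OF fractions_uminus[OF assms] assms])
  then show "germ F \<pp> (- a, s) \<oplus>\<^bsub>stalk F \<pp>\<^esub> germ F \<pp> (a, s) = \<zero>\<^bsub>stalk F \<pp>\<^esub>"
    using assms by (simp add: add_stalk fractions_uminus germ_eq_zero_iff vanishes_0)
qed (use assms fractions_uminus in auto)

lemma germ_add_same_denom:
  assumes "homogeneous d a" "homogeneous d b" "homogeneous d s" "s \<notin> \<pp>"
  shows "germ F \<pp> (a, s) \<oplus>\<^bsub>stalk F \<pp>\<^esub> germ F \<pp> (b, s) = germ F \<pp> (a + b, s)"
proof -
  have fr: "(a, s) \<in> fractions_at \<pp>" "(b, s) \<in> fractions_at \<pp>" "(a + b, s) \<in> fractions_at \<pp>"
    using assms by (auto intro: fractions_atI homogeneous_add)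
  then show ?thesis
    by (simp add: add_stalk) (rule germ_eqI, auto intro: fractions_add simp: algebra_simps)
qed

lemma finsum_germ:
  assumes "finite A" "\<And>i. i \<in> A \<Longrightarrow> homogeneous d (a i)" "homogeneous d s" "s \<notin> \<pp>"
  shows "finsum (stalk F \<pp>) (\<lambda>i. germ F \<pp> (a i, s)) A = germ F \<pp> (sum a A, s)"
  using assms(1,2)
proof (induction A rule: finite_induct)
  case empty
  have "(0, s) \<in> fractions_at \<pp>" using assms by (auto intro: fractions_atI)
  then have "germ F \<pp> (0, s) = \<zero>\<^bsub>stalk F \<pp>\<^esub>" using germ_eq_zero_iff vanishes_0 by blast
  then show ?case by simp
next
  case (insert x A)
  then have fr: "\<And>i. i \<in> insert x A \<Longrightarrow> (a i, s) \<in> fractions_at \<pp>" using assms by (auto intro: fractions_atI)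
  then show ?case using insert assms
    by (subst stalk.finsum_insert) (auto simp: germ_add_same_denom[of d] homogeneous_sum)
qed

lemma finprod_germ:
  assumes "finite A" "\<And>i. i \<in> A \<Longrightarrow> (a i, s i) \<in> fractions_at \<pp>"
  shows "finprod (stalk F \<pp>) (\<lambda>i. germ F \<pp> (a i, s i)) A = germ F \<pp> (prod a A, prod s A) \<and>
    (prod a A, prod s A) \<in> fractions_at \<pp>"
  using assms
proof (induction A rule: finite_induct)
  case empty
  then show ?case by (simp add: one_stalk fractions_one)
next
  case (insert x A)
  then have "germ F \<pp> (a x, s x) \<in> carrier (stalk F \<pp>)" "(\<lambda>i. germ F \<pp> (a i, s i)) \<in> A \<rightarrow> carrier (stalk F \<pp>)" by auto
  with insert show ?case by (simp add: mult_stalk fractions_mult)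
qed

lemma germ_power: "(a, s) \<in> fractions_at \<pp> \<Longrightarrow>
  germ F \<pp> (a, s) [^]\<^bsub>stalk F \<pp>\<^esub> (n::nat) = germ F \<pp> (a ^ n, s ^ n) \<and> (a ^ n, s ^ n) \<in> fractions_at \<pp>"
proof (induction n)
  case (Suc n)
  then show ?case using fractions_mult[of "a ^ n" "s ^ n" a s] by (simp add: mult_stalk mult.commute)
qed (simp add: one_stalk fractions_one)

lemma germ_cancel:
  assumes "(a, s) \<in> fractions_at \<pp>" "homogeneous d u" "u \<notin> \<pp>"
  shows "germ F \<pp> (u * a, u * s) = germ F \<pp> (a, s)" "(u * a, u * s) \<in> fractions_at \<pp>"
proof -
  show fr: "(u * a, u * s) \<in> fractions_at \<pp>"
    using assms by (auto simp: fractions_at_def mult_mem_iff intro: homogeneous_mult)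
  show "germ F \<pp> (u * a, u * s) = germ F \<pp> (a, s)"
    by (rule germ_eqI) (use assms fr in \<open>auto simp: mult_ac\<close>)
qed

text \<open>Each row has one degree and one denominator, so the products over all permutations share
  their degree and denominator, and the signed sum can be formed in the numerator.\<close>

lemma det5_germ:
  assumes "\<And>r j. homogeneous (d r) (M r j)" "\<And>r. homogeneous (d r) (s r)" "\<And>r. s r \<notin> \<pp>"
  shows "det5 (stalk F \<pp>) (\<lambda>r j. germ F \<pp> (M r j, s r)) =
      germ F \<pp> (det (\<chi> r j. M r j), \<Prod>r\<in>UNIV. s r)"
proof -
  let ?s = "\<Prod>r\<in>UNIV. s r"
  have s: "homogeneous (\<Sum>r\<in>UNIV. d r) ?s" "?s \<notin> \<pp>"
    using assms notin_prod[of UNIV s] by (auto intro: homogeneous_prod)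
  have h: "homogeneous (\<Sum>r\<in>UNIV. d r) (of_int (sign \<sigma>) * (\<Prod>r\<in>UNIV. M r (\<sigma> r)))" for \<sigma>
    using homogeneous_prod[of UNIV d "\<lambda>r. M r (\<sigma> r)"] assms(1)
    by (auto simp: sign_def intro: homogeneous_uminus)
  have "(if evenperm \<sigma> then \<one>\<^bsub>stalk F \<pp>\<^esub> else \<ominus>\<^bsub>stalk F \<pp>\<^esub> \<one>\<^bsub>stalk F \<pp>\<^esub>) \<otimes>\<^bsub>stalk F \<pp>\<^esub>
      finprod (stalk F \<pp>) (\<lambda>r. germ F \<pp> (M r (\<sigma> r), s r)) UNIV
      = germ F \<pp> (of_int (sign \<sigma>) * (\<Prod>r\<in>UNIV. M r (\<sigma> r)), ?s)" for \<sigma>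
  proof -
    have "(M r (\<sigma> r), s r) \<in> fractions_at \<pp>" for r using assms by (blast intro: fractions_atI)
    then have "finprod (stalk F \<pp>) (\<lambda>r. germ F \<pp> (M r (\<sigma> r), s r)) UNIV = germ F \<pp> ((\<Prod>r\<in>UNIV. M r (\<sigma> r)), ?s)"
      "((\<Prod>r\<in>UNIV. M r (\<sigma> r)), ?s) \<in> fractions_at \<pp>"
      using finprod_germ[of UNIV "\<lambda>r. M r (\<sigma> r)" s] by simp_all
    then show ?thesis
      by (auto simp: sign_def one_stalk fractions_one germ_uminus mult_stalk fractions_uminus)
  qed
  then have "det5 (stalk F \<pp>) (\<lambda>r j. germ F \<pp> (M r j, s r)) =
     finsum (stalk F \<pp>) (\<lambda>\<sigma>. germ F \<pp> (of_int (sign \<sigma>) * (\<Prod>r\<in>UNIV. M r (\<sigma> r)), ?s)) {\<sigma>. \<sigma> permutes UNIV}"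
    by (simp add: det5_def)
  also have "\<dots> = germ F \<pp> (\<Sum>\<sigma> | \<sigma> permutes UNIV. of_int (sign \<sigma>) * (\<Prod>r\<in>UNIV. M r (\<sigma> r)), ?s)"
    by (rule finsum_germ) (use h s in \<open>auto simp: finite_permutations\<close>)
  finally show ?thesis by (simp add: det_def)
qed

text \<open>Translates membership in an ideal of the local ring of projective space into membership
  of polynomials. The multiplier u may be inhomogeneous: b and the \<open>g i\<close> are
  homogeneous, so a component of u outside the prime can replace u.\<close>

lemma genideal_germs_iff:
  assumes fin: "finite A" and g: "\<And>i. i \<in> A \<Longrightarrow> homogeneous (d i) (g i)" "\<And>i. i \<in> A \<Longrightarrow> homogeneous (d i) (s i)"
    "\<And>i. i \<in> A \<Longrightarrow> s i \<notin> \<pp>" and b: "(b, t) \<in> fractions_at \<pp>" and F: "F = {}"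
  shows "germ F \<pp> (b, t) \<in> genideal (stalk F \<pp>) ((\<lambda>i. germ F \<pp> (g i, s i)) ` A) \<longleftrightarrow>
    (\<exists>u. u \<notin> \<pp> \<and> u * b \<in> ideal_of (g ` A))"
proof
  let ?J = "{germ F \<pp> (b, t) | b t. (b, t) \<in> fractions_at \<pp> \<and> (\<exists>u. u \<notin> \<pp> \<and> u * b \<in> ideal_of (g ` A))}"
  have wd: "\<exists>u. u \<notin> \<pp> \<and> u * b \<in> ideal_of (g ` A)"
    if "germ F \<pp> (b, t) = germ F \<pp> (b', t')" "u' \<notin> \<pp>" "u' * b' \<in> ideal_of (g ` A)"
      "(b, t) \<in> fractions_at \<pp>" "(b', t') \<in> fractions_at \<pp>" for b t b' t' u'
  proof -
    have "vanishes (b * t' - b' * t)" using that germ_eq_iff by blast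
    then obtain v where v: "v \<notin> \<pp>" "v * (b * t' - b' * t) \<in> ideal_of F" by (auto simp: vanishes_def)
    then have v0: "v * (b * t' - b' * t) = 0" by (simp add: F)
    have "(u' * v * t') * b = v * t * (u' * b') + u' * (v * (b * t' - b' * t))" by (simp add: algebra_simps)
    then have "(u' * v * t') * b \<in> ideal_of (g ` A)" using v0 that(3) by (simp add: ideal_mult)
    moreover have "u' * v * t' \<notin> \<pp>" using that v by (auto simp: mult_mem_iff fractions_at_def)
    ultimately show ?thesis by blast
  qed
  have JI: "germ F \<pp> (b, t) \<in> ?J" if "(b, t) \<in> fractions_at \<pp>" "u \<notin> \<pp>" "u * b \<in> ideal_of (g ` A)" for b t u
    using that by blast
  have "ideal ?J (stalk F \<pp>)"
  proof (rule idealI)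
    show "ring (stalk F \<pp>)" by (rule stalk.ring_axioms)
    show "subgroup ?J (add_monoid (stalk F \<pp>))"
    proof (rule stalk.add.subgroupI)
      have "1 \<notin> \<pp> \<and> 1 * 0 \<in> ideal_of (g ` A)" using one_notin by (simp add: ideal_0)
      then have "germ F \<pp> (0, 1) \<in> ?J" using fractions_zero by blast
      then show "?J \<noteq> {}" by blast
      show "?J \<subseteq> carrier (stalk F \<pp>)" by auto
      fix U V assume "U \<in> ?J" "V \<in> ?J"
      then obtain a r u b t v where U: "U = germ F \<pp> (a, r)" "(a, r) \<in> fractions_at \<pp>" "u \<notin> \<pp>" "u * a \<in> ideal_of (g ` A)"
        and V: "V = germ F \<pp> (b, t)" "(b, t) \<in> fractions_at \<pp>" "v \<notin> \<pp>" "v * b \<in> ideal_of (g ` A)" by auto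
      have "(u * v) * (a * t + b * r) = v * t * (u * a) + u * r * (v * b)" by (simp add: algebra_simps)
      also have "\<dots> \<in> ideal_of (g ` A)" using U V by (simp add: ideal_add ideal_mult)
      finally show "U \<oplus>\<^bsub>stalk F \<pp>\<^esub> V \<in> ?J"
        unfolding U(1) V(1) add_stalk[OF U(2) V(2)] using U(3) V(3)
        by (intro JI[OF fractions_add[OF U(2) V(2)], of "u * v"]) (auto simp: mult_mem_iff)
    next
      fix U assume "U \<in> ?J"
      then obtain a r u where U: "U = germ F \<pp> (a, r)" "(a, r) \<in> fractions_at \<pp>" "u \<notin> \<pp>" "u * a \<in> ideal_of (g ` A)" by auto
      show "\<ominus>\<^bsub>stalk F \<pp>\<^esub> U \<in> ?J" unfolding U(1) germ_uminus[OF U(2)]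
        by (rule JI[OF fractions_uminus[OF U(2)] U(3)]) (use ideal_uminus[OF is_ideal_ideal_of U(4)] in simp)
    qed
    fix U V assume "U \<in> ?J" "V \<in> carrier (stalk F \<pp>)"
    then obtain a r u b t where U: "U = germ F \<pp> (a, r)" "(a, r) \<in> fractions_at \<pp>" "u \<notin> \<pp>" "u * a \<in> ideal_of (g ` A)"
      and V: "V = germ F \<pp> (b, t)" "(b, t) \<in> fractions_at \<pp>" by (auto elim!: stalk_cases)
    have "u * (b * a) \<in> ideal_of (g ` A)" using ideal_mult[OF is_ideal_ideal_of U(4), of b] by (simp add: mult_ac)
    then show "V \<otimes>\<^bsub>stalk F \<pp>\<^esub> U \<in> ?J" unfolding U(1) V(1) mult_stalk[OF V(2) U(2)]
      by (rule JI[OF fractions_mult[OF V(2) U(2)] U(3)])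
    then show "U \<otimes>\<^bsub>stalk F \<pp>\<^esub> V \<in> ?J"
      using U V by (simp add: stalk.m_comm)
  qed
  moreover have "(\<lambda>i. germ F \<pp> (g i, s i)) ` A \<subseteq> ?J"
  proof clarify
    fix i assume "i \<in> A"
    then have "(g i, s i) \<in> fractions_at \<pp>" "1 * g i \<in> ideal_of (g ` A)"
      using g by (auto intro: fractions_atI ideal_of_base)
    then have "germ F \<pp> (g i, s i) \<in> ?J" using one_notin by (intro JI)
    then show "\<exists>b t. germ F \<pp> (g i, s i) = germ F \<pp> (b, t) \<and> (b, t) \<in> fractions_at \<pp> \<and> (\<exists>u. u \<notin> \<pp> \<and> u * b \<in> ideal_of (g ` A))"
      by blast
  qed
  ultimately have sub: "genideal (stalk F \<pp>) ((\<lambda>i. germ F \<pp> (g i, s i)) ` A) \<subseteq> ?J"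
    by (rule stalk.genideal_minimal)
  assume "germ F \<pp> (b, t) \<in> genideal (stalk F \<pp>) ((\<lambda>i. germ F \<pp> (g i, s i)) ` A)"
  then have "germ F \<pp> (b, t) \<in> ?J" using sub by blast
  then show "\<exists>u. u \<notin> \<pp> \<and> u * b \<in> ideal_of (g ` A)" using wd b by blast
next
  let ?G = "(\<lambda>i. germ F \<pp> (g i, s i)) ` A"
  assume "\<exists>u. u \<notin> \<pp> \<and> u * b \<in> ideal_of (g ` A)"
  then obtain u where u: "u \<notin> \<pp>" "u * b \<in> ideal_of (g ` A)" by blast
  obtain n where n: "homogeneous n b" "homogeneous n t" "t \<notin> \<pp>" using b by (rule fractions_atE)
  have "\<exists>e. hcomp e u \<notin> \<pp>"
  proof (rule ccontr)
    assume "\<nexists>e. hcomp e u \<notin> \<pp>"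
    then have "(\<Sum>d\<in>mdeg ` Poly_Mapping.keys u. hcomp d u) \<in> \<pp>" by (intro ideal_sum[OF ideal_pp]) auto
    then show False using u(1) by (simp flip: sum_hcomp)
  qed
  then obtain e where e: "hcomp e u \<notin> \<pp>" by blast
  let ?v = "hcomp e u"
  have gr: "graded (ideal_of (g ` A))" using g(1) by (intro graded_ideal_of) blast
  have "?v * b = hcomp (n + e) (u * b)"
    using hcomp_mult_homogeneous[OF n(1), of "n + e" u] by (simp add: mult.commute)
  then have "?v * b \<in> ideal_of (g ` A)" using gradedD(2)[OF gr u(2)] by simp
  then obtain c where c: "?v * b = (\<Sum>i\<in>A. c i * g i)" unfolding ideal_of_image[OF fin] by blast
  \<comment> \<open>The component of the degree complementary to \<open>d i\<close>. If
    \<open>d i\<close> exceeds \<open>n + e\<close> there is none, and the truncated difference of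
    degrees would select a wrong one.\<close>
  define c' where "c' i = (if d i \<le> n + e then hcomp (n + e - d i) (c i) else 0)" for i
  have vb: "?v * b = (\<Sum>i\<in>A. c' i * g i)"
  proof -
    have h: "homogeneous (n + e) (?v * b)" using homogeneous_mult[OF homogeneous_hcomp n(1)] by (simp add: add.commute)
    have "?v * b = hcomp (n + e) (\<Sum>i\<in>A. c i * g i)" using h c by (simp add: hcomp_homogeneous)
    also have "\<dots> = (\<Sum>i\<in>A. c' i * g i)"
      unfolding hcomp_sum
    proof (rule sum.cong)
      fix i assume "i \<in> A"
      then show "hcomp (n + e) (c i * g i) = c' i * g i"
        using hcomp_mult_homogeneous[OF g(1), of i "n + e" "c i"] by (simp add: c'_def mult.commute)
    qed simp
    finally show ?thesis .
  qed
  have hv: "homogeneous (n + e) (?v * t)" "?v * t \<notin> \<pp>"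
    using homogeneous_mult[OF homogeneous_hcomp n(2)] n(3) e by (simp_all add: add.commute mult_mem_iff)
  have G: "?G \<subseteq> carrier (stalk F \<pp>)"
    using g by (auto intro!: germ_in_carrier intro: fractions_atI)
  have I: "ideal (genideal (stalk F \<pp>) ?G) (stalk F \<pp>)"
    by (rule stalk.genideal_ideal[OF G])
  have summand: "germ F \<pp> (c' i * g i, ?v * t) \<in> genideal (stalk F \<pp>) ?G" "homogeneous (n + e) (c' i * g i)" if i: "i \<in> A" for i
  proof -
    show h: "homogeneous (n + e) (c' i * g i)"
    proof (cases "d i \<le> n + e")
      case True
      then show ?thesis using homogeneous_mult[OF homogeneous_hcomp g(1)[OF i], of "n + e - d i" "c i"] by (simp add: c'_def)
    qed (simp add: c'_def)
    have cs: "homogeneous (n + e) (c' i * s i)"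
    proof (cases "d i \<le> n + e")
      case True
      then show ?thesis using homogeneous_mult[OF homogeneous_hcomp g(2)[OF i], of "n + e - d i" "c i"] by (simp add: c'_def)
    qed (simp add: c'_def)
    have fr: "(c' i * s i, ?v * t) \<in> fractions_at \<pp>" "(g i, s i) \<in> fractions_at \<pp>" "(c' i * g i, ?v * t) \<in> fractions_at \<pp>"
      using cs hv g i h by (auto intro: fractions_atI)
    have "germ F \<pp> (c' i * g i, ?v * t) = germ F \<pp> (c' i * s i, ?v * t) \<otimes>\<^bsub>stalk F \<pp>\<^esub> germ F \<pp> (g i, s i)"
      unfolding mult_stalk[OF fr(1,2)] by (rule germ_eqI[OF fr(3) fractions_mult[OF fr(1,2)]]) (simp add: mult_ac)
    also have "\<dots> \<in> genideal (stalk F \<pp>) ?G"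
      using fr i stalk.genideal_self[OF G] by (intro ideal.I_l_closed[OF I]) auto
    finally show "germ F \<pp> (c' i * g i, ?v * t) \<in> genideal (stalk F \<pp>) ?G" .
  qed
  have "germ F \<pp> (b, t) = germ F \<pp> (?v * b, ?v * t)" using germ_cancel[OF b homogeneous_hcomp e] by simp
  also have "\<dots> = finsum (stalk F \<pp>) (\<lambda>i. germ F \<pp> (c' i * g i, ?v * t)) A"
    unfolding vb using summand(2) hv by (subst finsum_germ[OF fin]) auto
  also have "\<dots> \<in> genideal (stalk F \<pp>) ?G"
  proof -
    have "finsum (stalk F \<pp>) (\<lambda>i. germ F \<pp> (c' i * g i, ?v * t)) B \<in> genideal (stalk F \<pp>) ?G"
      if "finite B" "B \<subseteq> A" for B
      using that
    proof (induction B rule: finite_induct)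
      case empty then show ?case using additive_subgroup.zero_closed[OF ideal.axioms(1)[OF I]] by simp
    next
      case (insert x B)
      then have "(\<lambda>i. germ F \<pp> (c' i * g i, ?v * t)) \<in> B \<rightarrow> carrier (stalk F \<pp>)"
        "germ F \<pp> (c' x * g x, ?v * t) \<in> carrier (stalk F \<pp>)"
        using summand(1) ideal.Icarr[OF I] by blast+
      then show ?case
        using insert summand(1) additive_subgroup.a_closed[OF ideal.axioms(1)[OF I]]
        by (simp add: stalk.finsum_insert)
    qed
    then show ?thesis using fin by blast
  qed
  finally show "germ F \<pp> (b, t) \<in> genideal (stalk F \<pp>) ?G" .
qed

end

section \<open>The Zariski topology and generic points\<close>

lemma pointsD:
  assumes "x \<in> points F"
  shows "homogeneous_prime x" "F \<subseteq> x" "\<exists>i. pvar i \<notin> x" "ideal_of F \<subseteq> x"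
  using assms ideal_of_least[of x F] by (auto simp: points_def homogeneous_prime_def)

lemma graded_point: "x \<in> points F \<Longrightarrow> graded x"
  using pointsD(1) by (auto simp: homogeneous_prime_iff)

lemma ideal_point: "x \<in> points F \<Longrightarrow> is_ideal x"
  using graded_point by (rule gradedD)

lemma istopology_zariski:
  "istopology (\<lambda>U. \<exists>G. (\<forall>g\<in>G. \<exists>d. homogeneous d g) \<and> U = {\<pp> \<in> points F. \<not> G \<subseteq> \<pp>})"
proof -
  have "\<exists>K. (\<forall>g\<in>K. \<exists>d. homogeneous d g) \<and>
      {\<pp> \<in> points F. \<not> G \<subseteq> \<pp>} \<inter> {\<pp> \<in> points F. \<not> H \<subseteq> \<pp>} = {\<pp> \<in> points F. \<not> K \<subseteq> \<pp>}"
    if G: "\<forall>g\<in>G. \<exists>d. homogeneous d g" and H: "\<forall>g\<in>H. \<exists>d. homogeneous d g" for G H :: "'a poly5 set"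
  proof (intro exI[of _ "{g * h | g h. g \<in> G \<and> h \<in> H}"] conjI ballI)
    fix k assume "k \<in> {g * h | g h. g \<in> G \<and> h \<in> H}"
    then show "\<exists>d. homogeneous d k" using G H homogeneous_mult by blast
  next
    have "(\<not> G \<subseteq> \<pp> \<and> \<not> H \<subseteq> \<pp>) \<longleftrightarrow> \<not> {g * h | g h. g \<in> G \<and> h \<in> H} \<subseteq> \<pp>" if "\<pp> \<in> points F" for \<pp>
    proof -
      interpret homogeneous_point F \<pp> using pointsD(1)[OF that] by unfold_locales
      have "g * h \<in> \<pp> \<longleftrightarrow> g \<in> \<pp> \<or> h \<in> \<pp>" for g h by (rule mult_mem_iff)
      then show ?thesis by blast
    qed
    then show "{\<pp> \<in> points F. \<not> G \<subseteq> \<pp>} \<inter> {\<pp> \<in> points F. \<not> H \<subseteq> \<pp>} =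
      {\<pp> \<in> points F. \<not> {g * h | g h. g \<in> G \<and> h \<in> H} \<subseteq> \<pp>}" by blast
  qed
  moreover have "\<exists>G. (\<forall>g\<in>G. \<exists>d. homogeneous d g) \<and> \<Union>\<K> = {\<pp> \<in> points F. \<not> G \<subseteq> \<pp>}"
    if K: "\<forall>U\<in>\<K>. \<exists>G. (\<forall>g\<in>G. \<exists>d. homogeneous d g) \<and> U = {\<pp> \<in> points F. \<not> G \<subseteq> \<pp>}" for \<K>
  proof -
    from bchoice[OF K] obtain G
      where G: "\<And>U. U \<in> \<K> \<Longrightarrow> (\<forall>g\<in>G U. \<exists>d. homogeneous d g) \<and> U = {\<pp> \<in> points F. \<not> G U \<subseteq> \<pp>}" by blast
    have "\<Union>\<K> = {\<pp> \<in> points F. \<not> (\<Union>U\<in>\<K>. G U) \<subseteq> \<pp>}"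
    proof (intro equalityI subsetI)
      fix \<pp> assume "\<pp> \<in> \<Union>\<K>"
      then obtain U where "U \<in> \<K>" "\<pp> \<in> U" by blast
      then show "\<pp> \<in> {\<pp> \<in> points F. \<not> (\<Union>U\<in>\<K>. G U) \<subseteq> \<pp>}" using G[of U] by blast
    next
      fix \<pp> assume "\<pp> \<in> {\<pp> \<in> points F. \<not> (\<Union>U\<in>\<K>. G U) \<subseteq> \<pp>}"
      then obtain U where "U \<in> \<K>" "\<pp> \<in> points F" "\<not> G U \<subseteq> \<pp>" by blast
      then show "\<pp> \<in> \<Union>\<K>" using G[of U] by blast
    qed
    then show ?thesis using G by (intro exI[of _ "\<Union>U\<in>\<K>. G U"]) blast
  qed
  ultimately show ?thesis unfolding istopology_def by blast
qed

lemma openin_zariski: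
  "openin (zariski F) U \<longleftrightarrow> (\<exists>G. (\<forall>g\<in>G. \<exists>d. homogeneous d g) \<and> U = {\<pp> \<in> points F. \<not> G \<subseteq> \<pp>})"
  unfolding zariski_def by (simp only: topology_inverse'[OF istopology_zariski])

lemma topspace_zariski: "topspace (zariski F) = points F"
proof
  show "topspace (zariski F) \<subseteq> points F"
    using openin_topspace[of "zariski F"] unfolding openin_zariski by blast
  have "points F = {\<pp> \<in> points F. \<not> {1} \<subseteq> \<pp>}" using pointsD(1) by (auto simp: homogeneous_prime_def)
  moreover have "\<forall>g\<in>{1}. \<exists>d. homogeneous d (g::'a poly5)" using homogeneous_1 by blast
  ultimately have "openin (zariski F) (points F)" unfolding openin_zariski by blast
  then show "points F \<subseteq> topspace (zariski F)" by (rule openin_subset)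
qed

lemma closedin_zariski:
  assumes "\<forall>g\<in>G. \<exists>d. homogeneous d g"
  shows "closedin (zariski F) {\<pp> \<in> points F. G \<subseteq> \<pp>}"
proof -
  have "points F - {\<pp> \<in> points F. G \<subseteq> \<pp>} = {\<pp> \<in> points F. \<not> G \<subseteq> \<pp>}" by blast
  then have "openin (zariski F) (points F - {\<pp> \<in> points F. G \<subseteq> \<pp>})"
    unfolding openin_zariski using assms by (intro exI[of _ G]) simp
  then show ?thesis unfolding closedin_def topspace_zariski by auto
qed

lemma closedin_zariskiE:
  assumes "closedin (zariski F) Z"
  obtains G where "\<forall>g\<in>G. \<exists>d. homogeneous d g" "Z = {\<pp> \<in> points F. G \<subseteq> \<pp>}"
proof -
  obtain G where G: "\<forall>g\<in>G. \<exists>d. homogeneous d g" "points F - Z = {\<pp> \<in> points F. \<not> G \<subseteq> \<pp>}" "Z \<subseteq> points F"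
    using assms unfolding closedin_def topspace_zariski openin_zariski by blast
  then have "Z = {\<pp> \<in> points F. G \<subseteq> \<pp>}" by blast
  then show ?thesis using that G by blast
qed

lemma closedin_above:
  assumes "graded \<pp>"
  shows "closedin (zariski F) {q \<in> points F. \<pp> \<subseteq> q}"
proof -
  let ?G = "{f \<in> \<pp>. \<exists>d. homogeneous d f}"
  have "\<pp> \<subseteq> q \<longleftrightarrow> ?G \<subseteq> q" if "q \<in> points F" for q
    using graded_eq_ideal_of_homogeneous[OF assms] ideal_of_least[of q ?G] pointsD(1)[OF that]
    by (auto simp: homogeneous_prime_def)
  then have "{q \<in> points F. \<pp> \<subseteq> q} = {q \<in> points F. ?G \<subseteq> q}" by blast
  then show ?thesis using closedin_zariski[of ?G F] by simp
qed

lemma irreducible_above: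
  assumes "\<pp> \<in> points F"
  shows "irreducible_in (zariski F) {q \<in> points F. \<pp> \<subseteq> q}"
  unfolding irreducible_in_def topspace_zariski
proof (intro conjI allI impI)
  fix A B assume A: "closedin (zariski F) A" and B: "closedin (zariski F) B"
    and sub: "{q \<in> points F. \<pp> \<subseteq> q} \<subseteq> A \<union> B"
  obtain G where G: "A = {\<pp> \<in> points F. G \<subseteq> \<pp>}" using A by (rule closedin_zariskiE)
  obtain H where H: "B = {\<pp> \<in> points F. H \<subseteq> \<pp>}" using B by (rule closedin_zariskiE)
  have "\<pp> \<in> A \<union> B" using sub assms by blast
  then show "{q \<in> points F. \<pp> \<subseteq> q} \<subseteq> A \<or> {q \<in> points F. \<pp> \<subseteq> q} \<subseteq> B" using G H by blast
qed (use assms in auto)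

text \<open>Irreducibility, applied to the closed sets of f and of g, makes the intersection of all
  points prime on homogeneous elements. It is the only point whose closure is the whole space, which
  gives \<open>THE\<close> in \<open>generic_point_def\<close> its value, and it is the smallest
  prime.\<close>

lemma generic_point_characterisation:
  assumes irr: "irreducible_in (zariski F) (points F)"
  shows "generic_point F \<in> points F" "\<And>x. x \<in> points F \<Longrightarrow> generic_point F \<subseteq> x"
proof -
  let ?N = "\<Inter>(points F)"
  have ne: "points F \<noteq> {}" using irr by (simp add: irreducible_in_def)
  have gr: "graded ?N"
    unfolding graded_def
  proof (intro conjI is_idealI ballI allI)
    fix f d assume "f \<in> ?N"
    then show "hcomp d f \<in> ?N" using gradedD(2)[OF graded_point] by blast
  next
    show "0 \<in> ?N" using ideal_0[OF ideal_point] by blast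
  next
    fix a b assume "a \<in> ?N" "b \<in> ?N" then show "a + b \<in> ?N" using ideal_add[OF ideal_point] by blast
  next
    fix c a assume "a \<in> ?N" then show "c * a \<in> ?N" using ideal_mult[OF ideal_point] by blast
  qed
  have pr: "f \<in> ?N \<or> g \<in> ?N" if "homogeneous d f" "homogeneous e g" "f * g \<in> ?N" for f g d e
  proof -
    let ?A = "{\<pp> \<in> points F. {f} \<subseteq> \<pp>}" and ?B = "{\<pp> \<in> points F. {g} \<subseteq> \<pp>}"
    have "closedin (zariski F) ?A" "closedin (zariski F) ?B" using that by (intro closedin_zariski; blast)+
    moreover have "points F \<subseteq> ?A \<union> ?B"
    proof
      fix \<pp> assume p: "\<pp> \<in> points F"
      then have "f * g \<in> \<pp>" using that(3) by blast
      then have "f \<in> \<pp> \<or> g \<in> \<pp>" using pointsD(1)[OF p] by (auto simp: homogeneous_prime_def)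
      then show "\<pp> \<in> ?A \<union> ?B" using p by blast
    qed
    ultimately have "points F \<subseteq> ?A \<or> points F \<subseteq> ?B" using irr unfolding irreducible_in_def by blast
    then show ?thesis by blast
  qed
  have "f \<in> ?N \<or> g \<in> ?N" if "f * g \<in> ?N" for f g
    using graded_prime_if_homogeneous_prime[OF gr pr that] .
  moreover obtain x where x: "x \<in> points F" using ne by blast
  then have "1 \<notin> x" using pointsD(1) homogeneous_prime_def by blast
  then have "1 \<notin> ?N" using x by blast
  ultimately have hp: "homogeneous_prime ?N" using gr unfolding homogeneous_prime_iff by blast
  have Npt: "?N \<in> points F"
    using hp ne pointsD(2,3) unfolding points_def by blast
  have char: "zariski F closure_of {\<pp>} = points F \<longleftrightarrow> \<pp> = ?N" if p: "\<pp> \<in> points F" for \<pp>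
  proof
    assume cl: "zariski F closure_of {\<pp>} = points F"
    have "zariski F closure_of {\<pp>} \<subseteq> {q \<in> points F. \<pp> \<subseteq> q}"
      using p pointsD(1)[OF p] by (intro closure_of_minimal closedin_above) (auto simp: homogeneous_prime_iff)
    then show "\<pp> = ?N" using cl p by blast
  next
    assume eq: "\<pp> = ?N"
    show "zariski F closure_of {\<pp>} = points F"
    proof
      show "zariski F closure_of {\<pp>} \<subseteq> points F" using closure_of_subset_topspace[of "zariski F"] by (simp add: topspace_zariski)
      have "closedin (zariski F) (zariski F closure_of {\<pp>})" by simp
      then obtain G where G: "zariski F closure_of {\<pp>} = {\<pp> \<in> points F. G \<subseteq> \<pp>}" by (rule closedin_zariskiE)
      have "\<pp> \<in> zariski F closure_of {\<pp>}" using p closure_of_subset[of "{\<pp>}" "zariski F"] by (simp add: topspace_zariski)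
      then have "G \<subseteq> \<pp>" unfolding G by simp
      then have "G \<subseteq> q" if "q \<in> points F" for q using Inter_lower[OF that] unfolding eq by (rule order_trans)
      then have "q \<in> {\<pp> \<in> points F. G \<subseteq> \<pp>}" if "q \<in> points F" for q using that by simp
      then show "points F \<subseteq> zariski F closure_of {\<pp>}" unfolding G by (rule subsetI)
    qed
  qed
  have "generic_point F = ?N"
    unfolding generic_point_def using Npt char by (intro the_equality) auto
  then show "generic_point F \<in> points F" "\<And>x. x \<in> points F \<Longrightarrow> generic_point F \<subseteq> x" using Npt by auto
qed

text \<open>An element of the generic point that were not nilpotent in its local ring would be avoided by
  a smaller prime.\<close>

lemma vanishes_at_generic_point:
  assumes F: "\<forall>f\<in>F. \<exists>d. homogeneous d f" and int: "integral_scheme F"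
    and f: "f \<in> generic_point F"
  shows "homogeneous_point.vanishes F (generic_point F) f"
proof -
  let ?\<xi> = "generic_point F"
  have irr: "irreducible_in (zariski F) (points F)" using int by (simp add: integral_scheme_def)
  note gp = generic_point_characterisation[OF irr]
  interpret homogeneous_point F ?\<xi> using pointsD(1)[OF gp(1)] by unfold_locales
  have hom: "vanishes h" if h: "homogeneous d h" "h \<in> ?\<xi>" for d h
  proof -
    \<comment> \<open>A prime that avoids S omits h and consists of elements of the generic point;
      by minimality of that point it would contain h after all.\<close>
    define S where "S = {u * h ^ n | u n. u \<notin> ?\<xi> \<and> (\<exists>e. homogeneous e u)}"
    have "ideal_of F \<inter> S \<noteq> {}"
    proof
      assume disj: "ideal_of F \<inter> S = {}"
      obtain q where q: "homogeneous_prime q" "ideal_of F \<subseteq> q" "q \<inter> S = {}"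
      proof (rule exists_homogeneous_prime)
        show "graded (ideal_of F)" using F by (intro graded_ideal_of) blast
        show "\<exists>d. homogeneous d s" if "s \<in> S" for s
          using that homogeneous_mult homogeneous_power[OF h(1)] unfolding S_def by blast
        have "1 = 1 * h ^ 0" by simp
        then show "1 \<in> S" using one_notin homogeneous_1 unfolding S_def by blast
        fix s t assume "s \<in> S" "t \<in> S"
        then obtain u n e v m e' where s: "s = u * h ^ n" "u \<notin> ?\<xi>" "homogeneous e u"
          and t: "t = v * h ^ m" "v \<notin> ?\<xi>" "homogeneous e' v" unfolding S_def by blast
        have "s * t = (u * v) * h ^ (n + m)" using s t by (simp add: power_add mult_ac)
        moreover have "u * v \<notin> ?\<xi>" "homogeneous (e + e') (u * v)" using s t by (auto simp: mult_mem_iff homogeneous_mult)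
        ultimately show "s * t \<in> S" unfolding S_def by blast
      qed (use disj in auto)
      have sub: "q \<subseteq> ?\<xi>"
      proof -
        have "{f \<in> q. \<exists>d. homogeneous d f} \<subseteq> ?\<xi>"
        proof clarify
          fix g e assume g: "g \<in> q" "homogeneous e g"
          show "g \<in> ?\<xi>"
          proof (rule ccontr)
            assume "g \<notin> ?\<xi>"
            moreover have "g = g * h ^ 0" by simp
            ultimately have "g \<in> S" using g(2) unfolding S_def by blast
            then show False using q(3) g(1) by blast
          qed
        qed
        then have "ideal_of {f \<in> q. \<exists>d. homogeneous d f} \<subseteq> ?\<xi>" by (rule ideal_of_least[OF ideal_pp])
        then show ?thesis using q(1) by (simp add: homogeneous_prime_def)
      qed
      have "q \<in> points F"
        using q sub pointsD(3)[OF gp(1)] ideal_of_superset[of F] unfolding points_def by blast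
      then have "h \<in> q" using gp(2) h(2) by blast
      moreover have "h = 1 * h ^ 1" by simp
      then have "h \<in> S" using one_notin homogeneous_1 unfolding S_def by blast
      ultimately show False using q(3) by blast
    qed
    then obtain u n e where u: "u * h ^ n \<in> ideal_of F" "u \<notin> ?\<xi>" "homogeneous e u" unfolding S_def by blast
    \<comment> \<open>Germs have degree 0, so h is divided by a power of a variable outside the
      point. The relation for \<open>h ^ n\<close> makes this germ nilpotent, hence zero in the
      reduced ring.\<close>
    obtain i where i: "pvar i \<notin> ?\<xi>" using pointsD(3)[OF gp(1)] by blast
    have s: "homogeneous d (pvar i ^ d)" "pvar i ^ d \<notin> ?\<xi>"
      using homogeneous_power[OF homogeneous_pvar, of d i] notin_power[OF i] by auto
    have fr: "(h, pvar i ^ d) \<in> fractions_at ?\<xi>" using fractions_atI[OF h(1) s] .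
    have red: "reduced_ring (stalk F ?\<xi>)" using int gp(1) by (simp add: integral_scheme_def)
    have "germ F ?\<xi> (h, pvar i ^ d) [^]\<^bsub>stalk F ?\<xi>\<^esub> n = \<zero>\<^bsub>stalk F ?\<xi>\<^esub>"
    proof -
      have "vanishes (h ^ n)" using u unfolding vanishes_def by blast
      then show ?thesis using germ_power[OF fr, of n] germ_eq_zero_iff by simp
    qed
    then have "germ F ?\<xi> (h, pvar i ^ d) = \<zero>\<^bsub>stalk F ?\<xi>\<^esub>"
      using red germ_in_carrier[OF fr] unfolding reduced_ring_def by blast
    then show "vanishes h" using germ_eq_zero_iff[OF fr] by simp
  qed
  have "(\<Sum>d\<in>mdeg ` Poly_Mapping.keys f. hcomp d f) \<in> {a. vanishes a}"
    using hom[OF homogeneous_hcomp gradedD(2)[OF graded_pp f]] by (intro ideal_sum[OF vanishes_ideal]) simp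
  then show ?thesis by (simp flip: sum_hcomp)
qed

text \<open>A chain of three points on a proper closed subset of an irreducible space of dimension 2
  would extend to a chain of four irreducible closed subsets.\<close>

lemma no_chain_of_points:
  assumes dim: "has_krull_dim (zariski F) 2" and irr: "irreducible_in (zariski F) (points F)"
    and p: "p \<notin> generic_point F"
    and y: "y0 \<in> points F" "y1 \<in> points F" "y2 \<in> points F" "y0 \<subset> y1" "y1 \<subset> y2" "p \<in> y0"
  shows False
proof -
  note gp = generic_point_characterisation[OF irr]
  \<comment> \<open>Larger primes have smaller closed sets, so the chain is traversed backwards. The
    element p keeps the generic point out of \<open>Z 2\<close> and makes the last inclusion
    strict.\<close>
  define Z where "Z n = (if n = 0 then {q \<in> points F. y2 \<subseteq> q} else if n = 1 then {q \<in> points F. y1 \<subseteq> q}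
     else if n = 2 then {q \<in> points F. y0 \<subseteq> q} else points F)" for n :: nat
  have "closedin (zariski F) (points F)" using closedin_topspace[of "zariski F"] by (simp add: topspace_zariski)
  then have "closedin (zariski F) (Z i) \<and> irreducible_in (zariski F) (Z i)" for i
    using closedin_above[OF graded_point[OF y(1)], of F] closedin_above[OF graded_point[OF y(2)], of F]
      closedin_above[OF graded_point[OF y(3)], of F] irreducible_above[OF y(1)] irreducible_above[OF y(2)]
      irreducible_above[OF y(3)] irr unfolding Z_def by simp
  moreover have "Z i \<subset> Z (Suc i)" if i: "i < 3" for i
  proof -
    have "i = 0 \<or> i = 1 \<or> i = 2" using i by auto
    moreover have "Z 0 \<subset> Z 1" "Z 1 \<subset> Z 2" using y unfolding Z_def by auto
    moreover have "Z 2 \<subset> Z 3"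
    proof -
      have "generic_point F \<notin> Z 2" using p y(6) unfolding Z_def by auto
      then show ?thesis using gp(1) unfolding Z_def by auto
    qed
    ultimately show ?thesis by (auto simp: numeral_2_eq_2 numeral_3_eq_3)
  qed
  ultimately have "irreducible_chain (zariski F) (Suc 2) Z" unfolding irreducible_chain_def by auto
  then show False using dim unfolding has_krull_dim_def by blast
qed

lemma (in coefficient_map) contraction_point:
  assumes "y \<in> points (pmap ` F)"
  shows "{f. pmap f \<in> y} \<in> points F"
proof -
  have y: "graded y" "1 \<notin> y" "\<And>f h. f * h \<in> y \<Longrightarrow> f \<in> y \<or> h \<in> y"
    using pointsD(1)[OF assms] by (auto simp: homogeneous_prime_iff)
  have "graded {f. pmap f \<in> y}"
    unfolding graded_def using gradedD(1)[OF y(1)] gradedD(2)[OF y(1)]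
    by (auto intro!: is_idealI simp: pmap_add pmap_mult ideal_0 ideal_add ideal_mult hcomp_pmap[symmetric])
  then have "homogeneous_prime {f. pmap f \<in> y}" using y(2,3) by (auto simp: homogeneous_prime_iff pmap_mult)
  moreover obtain i where "pvar i \<notin> y" using pointsD(3)[OF assms] by blast
  then have "pvar i \<notin> {f. pmap f \<in> y}" by simp
  then have "\<not> range pvar \<subseteq> {f. pmap f \<in> y}" by blast
  moreover have "F \<subseteq> {f. pmap f \<in> y}" using pointsD(2)[OF assms] by blast
  ultimately show ?thesis unfolding points_def by blast
qed

section \<open>Noether normalisation modulo a uniformiser\<close>

lemma homogeneous_pvar_Suc [simp]: "homogeneous (Suc 0) (pvar i)"
  using homogeneous_pvar by simp

section \<open>Monomials of a given degree, and ideals containing all of them\<close>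

lemma monomial_factor:
  assumes "mdeg m \<noteq> 0"
  obtains i m' where "m = Poly_Mapping.single i 1 + m'"
proof -
  have "\<exists>i. Poly_Mapping.lookup m i \<noteq> 0"
  proof (rule ccontr)
    assume "\<nexists>i. Poly_Mapping.lookup m i \<noteq> 0"
    then show False using assms by simp
  qed
  then obtain i where i: "Poly_Mapping.lookup m i \<noteq> 0" by blast
  then have "m = Poly_Mapping.single i 1 + (m - Poly_Mapping.single i 1)"
    by (intro poly_mapping_eqI) (auto simp: lookup_add lookup_minus lookup_single when_def)
  then show ?thesis using that by blast
qed

lemma monomial_split:
  assumes "mdeg m = p + q"
  obtains m1 m2 where "m = m1 + m2" "mdeg m1 = p" "mdeg m2 = q"
proof -
  have "\<exists>m1 m2. m = m1 + m2 \<and> mdeg m1 = p \<and> mdeg m2 = q"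
    using assms
  proof (induction p arbitrary: m)
    case 0
    then show ?case by (intro exI[of _ 0] exI[of _ m]) simp
  next
    case (Suc p)
    have "mdeg m \<noteq> 0" using Suc.prems by simp
    then obtain i m' where m: "m = Poly_Mapping.single i 1 + m'" by (rule monomial_factor)
    then have "mdeg m = mdeg (Poly_Mapping.single i 1) + mdeg m'" using mdeg_add by metis
    then have "mdeg m' = p + q" using Suc.prems unfolding mdeg_single by linarith
    then obtain m1 m2 where h: "m' = m1 + m2" "mdeg m1 = p" "mdeg m2 = q" using Suc.IH by blast
    have "mdeg (Poly_Mapping.single i 1 + m1) = Suc p" unfolding mdeg_add mdeg_single h(2) by simp
    moreover have "m = (Poly_Mapping.single i 1 + m1) + m2" using m h(1) by (simp add: add.assoc)
    ultimately show ?case using h(3) by blast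
  qed
  then show ?thesis using that by blast
qed

lemma single_mult_1: "Poly_Mapping.single (m1 + m2) (1::'r::comm_ring_1) = Poly_Mapping.single m1 1 * Poly_Mapping.single m2 1"
  by (simp add: mult_single)

lemma single_eq_pconst_mult: "Poly_Mapping.single m c = pconst c * Poly_Mapping.single m 1"
  by (simp add: pconst_mult_single)

lemma finite_mdeg_le: "finite {m. mdeg m \<le> N}"
proof -
  have "Poly_Mapping.lookup ` {m. mdeg m \<le> N} \<subseteq> {f. \<forall>i::5. f i \<in> {..N}}"
  proof (rule image_subsetI)
    fix m :: "5 \<Rightarrow>\<^sub>0 nat" assume "m \<in> {m. mdeg m \<le> N}"
    moreover have "Poly_Mapping.lookup m i \<le> mdeg m" for i by (rule member_le_sum) auto
    ultimately show "Poly_Mapping.lookup m \<in> {f. \<forall>i::5. f i \<in> {..N}}" by (auto intro: order_trans)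
  qed
  moreover have "finite {f. \<forall>i::5. f i \<in> {..N}}"
    using finite_set_of_finite_funs[of "UNIV :: 5 set" "{..N}"] by simp
  ultimately have "finite (Poly_Mapping.lookup ` {m. mdeg m \<le> N})" by (rule finite_subset)
  moreover have "inj_on Poly_Mapping.lookup {m. mdeg m \<le> N}" by (rule inj_onI) (simp only: poly_mapping_eq_iff)
  ultimately show ?thesis by (rule finite_imageD)
qed

text \<open>The quotient by J and H is zero in degree N, and hence in all larger degrees
  (\<open>covers_add\<close>). Geometrically, the forms in H have no common zero on the projective
  scheme of J, so their number bounds the dimension of its cone.\<close>

definition covers :: "'r::comm_ring_1 poly5 set \<Rightarrow> 'r poly5 set \<Rightarrow> nat \<Rightarrow> bool" where
  "covers J H N \<longleftrightarrow> (\<forall>m. mdeg m = N \<longrightarrow> Poly_Mapping.single m 1 \<in> ideal_of (J \<union> H))"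

lemma covers_homogeneous:
  assumes "covers J H N" and "homogeneous N f"
  shows "f \<in> ideal_of (J \<union> H)"
  using assms(2)
proof (induction rule: homogeneous_induct)
  case (single m c)
  then show ?case using assms(1) unfolding single_eq_pconst_mult[of m c] covers_def
    by (simp add: ideal_mult)
qed (simp_all add: ideal_0 ideal_add)

lemma covers_mono:
  assumes "covers J H N" "J \<subseteq> ideal_of (J' \<union> H')" "H \<subseteq> ideal_of (J' \<union> H')"
  shows "covers J' H' N"
proof -
  have "ideal_of (J \<union> H) \<subseteq> ideal_of (J' \<union> H')" using assms(2,3) by (intro ideal_of_least) auto
  then show ?thesis using assms(1) unfolding covers_def by blast
qed

lemma covers_add:
  assumes "covers J H N"
  shows "covers J H (N + M)"
  unfolding covers_def
proof (intro allI impI)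
  fix m :: "5 \<Rightarrow>\<^sub>0 nat" assume "mdeg m = N + M"
  then obtain m1 m2 where "m = m1 + m2" "mdeg m1 = N" by (rule monomial_split)
  then show "Poly_Mapping.single m 1 \<in> ideal_of (J \<union> H)"
    using assms unfolding covers_def by (simp add: single_mult_1 ideal_mult_right)
qed

text \<open>Pigeonhole: a monomial of degree \<open>5 * M\<close> in five variables has an exponent
  of at least M.\<close>

lemma covers_if_variables_nilpotent:
  assumes "is_ideal J" "\<And>i. pvar i ^ M \<in> J"
  shows "covers J {} (5 * M)"
  unfolding covers_def
proof (intro allI impI)
  fix m :: "5 \<Rightarrow>\<^sub>0 nat" assume m: "mdeg m = 5 * M"
  have "\<exists>i. M \<le> Poly_Mapping.lookup m i"
  proof (rule ccontr)
    assume "\<nexists>i. M \<le> Poly_Mapping.lookup m i"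
    then have "mdeg m < (\<Sum>i\<in>(UNIV::5 set). M)" by (intro sum_strict_mono) (auto simp: not_le)
    then show False using m by simp
  qed
  then obtain i where i: "M \<le> Poly_Mapping.lookup m i" by blast
  then have "m = Poly_Mapping.single i M + (m - Poly_Mapping.single i M)"
    by (intro poly_mapping_eqI) (auto simp: lookup_add lookup_minus lookup_single when_def)
  then have "Poly_Mapping.single m 1 = pvar i ^ M * Poly_Mapping.single (m - Poly_Mapping.single i M) (1::'a)"
    by (metis pvar_power single_mult_1)
  then have "Poly_Mapping.single m 1 \<in> J" using assms by (simp add: ideal_mult_right)
  then show "Poly_Mapping.single m 1 \<in> ideal_of (J \<union> {})" using assms(1) by simp
qed

abbreviation vimage_coords :: "(5 \<Rightarrow> 'r::comm_ring_1 poly5) \<Rightarrow> 'r poly5 set \<Rightarrow> 'r poly5 set" where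
  "vimage_coords l J \<equiv> {g. psubst l g \<in> J}"

lemma ideal_of_psubst_image:
  assumes "f \<in> ideal_of G"
  shows "psubst l f \<in> ideal_of (psubst l ` G)"
proof -
  have "ideal_of G \<subseteq> {g. psubst l g \<in> ideal_of (psubst l ` G)}"
    by (intro ideal_of_least ideal_vimage_psubst) (auto intro: ideal_of_base)
  then show ?thesis using assms by blast
qed

lemma covers_vimage:
  assumes l: "coord_change l l'" and c: "covers J H N"
  shows "covers (vimage_coords l J) (psubst l' ` H) N"
  unfolding covers_def
proof (intro allI impI)
  fix m :: "5 \<Rightarrow>\<^sub>0 nat" assume "mdeg m = N"
  then have "homogeneous N (psubst l (Poly_Mapping.single m 1))"
    using coord_change_homogeneous[OF l homogeneous_single] by metis
  then have "psubst l (Poly_Mapping.single m 1) \<in> ideal_of (J \<union> H)" by (rule covers_homogeneous[OF c])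
  then have "psubst l' (psubst l (Poly_Mapping.single m 1)) \<in> ideal_of (psubst l' ` (J \<union> H))"
    by (rule ideal_of_psubst_image)
  also have "psubst l' (psubst l (Poly_Mapping.single m 1)) = Poly_Mapping.single m 1"
    by (rule coord_change_inverse[OF l])
  also have "ideal_of (psubst l' ` (J \<union> H)) \<subseteq> ideal_of (vimage_coords l J \<union> psubst l' ` H)"
    by (intro ideal_of_mono) (auto simp: coord_change_inverse[OF l])
  finally show "Poly_Mapping.single m 1 \<in> ideal_of (vimage_coords l J \<union> psubst l' ` H)" .
qed

lemma vimage_coords_inverse:
  assumes "coord_change l l'"
  shows "vimage_coords l' (vimage_coords l J) = J"
  by (simp add: coord_change_inverse[OF assms])

lemma homogeneous_prime_vimage:
  assumes l: "coord_change l l'" and y: "homogeneous_prime y"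
  shows "homogeneous_prime (vimage_coords l y)"
  using y graded_vimage_psubst[of y l] l
  by (auto simp: homogeneous_prime_iff psubst_mult coord_change_def)

text \<open>A linear form is a combination of variables, so its image under l lies in y. Applied to
  the forms \<open>l' i\<close>, whose images are the variables, this shows that a change of
  coordinates never makes a point irrelevant.\<close>

lemma variables_vimage:
  assumes l: "coord_change l l'" and y: "is_ideal y" and sub: "range pvar \<subseteq> vimage_coords l y"
  shows "range pvar \<subseteq> y"
proof -
  have "homogeneous 1 f \<Longrightarrow> psubst l f \<in> y" for f
  proof (induction rule: homogeneous_induct)
    case (single m c)
    then have "mdeg m \<noteq> 0" by simp
    then obtain i m' where "m = Poly_Mapping.single i 1 + m'" by (rule monomial_factor)
    then have "Poly_Mapping.single m c = pconst c * (pvar i * Poly_Mapping.single m' 1)"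
      by (metis pvar_def single_mult_1 single_eq_pconst_mult)
    moreover have "psubst l (pvar i) \<in> y" using sub by blast
    ultimately show ?case by (simp only: psubst_mult) (intro ideal_mult[OF y] ideal_mult_right[OF y])
  qed (simp_all add: psubst_add ideal_0[OF y] ideal_add[OF y])
  then have "psubst l (l' i) \<in> y" for i using l unfolding coord_change_def by blast
  then show ?thesis using l unfolding coord_change_def by auto
qed

text \<open>Gaussian elimination: a homogeneous linear system with more unknowns than equations has
  a nonzero solution.\<close>

lemma exists_linear_relation:
  fixes c :: "'i \<Rightarrow> 'j \<Rightarrow> 'k::field"
  assumes "finite J" "finite I" "card J < card I"
  obtains \<nu> where "\<exists>i\<in>I. \<nu> i \<noteq> 0" "\<And>j. j \<in> J \<Longrightarrow> (\<Sum>i\<in>I. \<nu> i * c i j) = 0"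
proof -
  have "\<exists>\<nu>. (\<exists>i\<in>I. \<nu> i \<noteq> 0) \<and> (\<forall>j\<in>J. (\<Sum>i\<in>I. \<nu> i * c i j) = 0)"
    using assms
  proof (induction J arbitrary: I c rule: finite_induct)
    case empty
    then obtain i where "i \<in> I" by fastforce
    then show ?case by (intro exI[of _ "\<lambda>_. 1"]) auto
  next
    case (insert j J)
    show ?case
    proof (cases "\<forall>i\<in>I. c i j = 0")
      case True
      obtain \<nu> where "\<exists>i\<in>I. \<nu> i \<noteq> 0" "\<forall>j\<in>J. (\<Sum>i\<in>I. \<nu> i * c i j) = 0"
        using insert.IH[of I c] insert.prems insert.hyps by auto
      then show ?thesis using True by (intro exI[of _ \<nu>]) auto
    next
      case False
      then obtain i0 where i0: "i0 \<in> I" "c i0 j \<noteq> 0" by blast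
      define c' where "c' i j' = c i j' - c i j / c i0 j * c i0 j'" for i j'
      have "card J < card (I - {i0})" using insert i0 by simp
      then obtain \<mu> where \<mu>: "\<exists>i\<in>I - {i0}. \<mu> i \<noteq> 0" "\<forall>j\<in>J. (\<Sum>i\<in>I - {i0}. \<mu> i * c' i j) = 0"
        using insert.IH[of "I - {i0}" c'] insert.prems by auto
      \<comment> \<open>The equation with index j was used to eliminate the unknown
        \<open>i0\<close>, and now determines its value.\<close>
      define \<nu> where "\<nu> i = (if i = i0 then - (\<Sum>i\<in>I - {i0}. \<mu> i * (c i j / c i0 j)) else \<mu> i)" for i
      have split: "(\<Sum>i\<in>I. \<nu> i * c i j') = (\<Sum>i\<in>I - {i0}. \<mu> i * c' i j')" for j'
      proof -
        have "(\<Sum>i\<in>I. \<nu> i * c i j') = \<nu> i0 * c i0 j' + (\<Sum>i\<in>I - {i0}. \<nu> i * c i j')"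
          using insert.prems i0 by (simp add: sum.remove)
        also have "(\<Sum>i\<in>I - {i0}. \<nu> i * c i j') = (\<Sum>i\<in>I - {i0}. \<mu> i * c i j')"
          by (intro sum.cong) (auto simp: \<nu>_def)
        also have "\<nu> i0 * c i0 j' = - (\<Sum>i\<in>I - {i0}. \<mu> i * (c i j / c i0 j * c i0 j'))"
          by (simp add: \<nu>_def sum_distrib_right mult.assoc)
        finally show ?thesis by (simp add: c'_def right_diff_distrib sum_subtractf)
      qed
      have "(\<Sum>i\<in>I - {i0}. \<mu> i * c' i j) = 0" using i0 by (simp add: c'_def)
      then have "\<forall>j'\<in>insert j J. (\<Sum>i\<in>I. \<nu> i * c i j') = 0" using \<mu>(2) split by simp
      moreover have "\<exists>i\<in>I. \<nu> i \<noteq> 0" using \<mu>(1) by (auto simp: \<nu>_def)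
      ultimately show ?thesis by blast
    qed
  qed
  then show ?thesis using that by blast
qed

text \<open>What the argument retains of the discrete valuation: elements prime to
  \<open>\<pi>\<close> are units, and the residue field is infinite, so that a nonzero form over it
  has a nonzero value.\<close>

locale residue =
  fixes \<pi> :: "'r::idom" and red :: "'r \<Rightarrow> 'k::field"
  assumes red: "reduction_map \<pi> red"
    and unit: "\<And>a. \<not> \<pi> dvd a \<Longrightarrow> a dvd 1"
    and inf: "infinite (UNIV :: 'k set)"
begin

sublocale coefficient_map red
  using red by unfold_locales (auto simp: reduction_map_def)

lemma red_eq_0_iff: "red a = 0 \<longleftrightarrow> \<pi> dvd a"
  using red by (simp add: reduction_map_def)

lemma surj_red: "surj red"
  using red by (simp add: reduction_map_def)

lemma not_dvd_1: "\<not> \<pi> dvd 1"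
  using red_eq_0_iff[of 1] by simp

text \<open>Induction on the generators: as \<open>1 - \<pi> * a\<close> is a unit, one relation can
  be solved for its own generator and substituted into the others. V is a submodule over the
  coefficients, which allows the generators to be forms of a single degree.\<close>

lemma nakayama:
  fixes V :: "'r poly5 set"
  assumes V0: "0 \<in> V" and Vadd: "\<And>a b. a \<in> V \<Longrightarrow> b \<in> V \<Longrightarrow> a + b \<in> V" and Vscale: "\<And>c a. a \<in> V \<Longrightarrow> pconst c * a \<in> V"
    and "finite S" "\<And>s. s \<in> S \<Longrightarrow> \<exists>c. s - pconst \<pi> * (\<Sum>t\<in>S. pconst (c t) * t) \<in> V"
  shows "S \<subseteq> V"
  using assms(4,5)
proof (induction S rule: finite_induct)
  case (insert s S)
  let ?\<Sigma> = "\<lambda>c. (\<Sum>t\<in>S. pconst (c t) * t)"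
  have ex: "\<exists>a c. t - pconst \<pi> * (pconst a * s + ?\<Sigma> c) \<in> V" if t: "t \<in> insert s S" for t
  proof -
    obtain c where "t - pconst \<pi> * (\<Sum>t\<in>insert s S. pconst (c t) * t) \<in> V" using insert.prems[OF t] by blast
    then show ?thesis using insert.hyps by (intro exI[of _ "c s"] exI[of _ c]) simp
  qed
  obtain a c where ac: "s - pconst \<pi> * (pconst a * s + ?\<Sigma> c) \<in> V" using ex by blast
  have "\<not> \<pi> dvd 1 - \<pi> * a" using not_dvd_1 by (metis dvd_diff_right_iff dvd_triv_left dvd_diff_left_iff)
  then obtain b where b: "b * (1 - \<pi> * a) = 1" using unit by (metis dvdE mult.commute)
  have s: "s - pconst \<pi> * ?\<Sigma> (\<lambda>t. b * c t) \<in> V"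
  proof -
    have "?\<Sigma> (\<lambda>t. b * c t) = pconst b * ?\<Sigma> c" by (simp add: sum_distrib_left pconst_mult mult.assoc)
    moreover have "pconst b * (s - pconst \<pi> * (pconst a * s + ?\<Sigma> c)) = pconst (b * (1 - \<pi> * a)) * s - pconst \<pi> * (pconst b * ?\<Sigma> c)"
      by (simp add: pconst_mult pconst_diff algebra_simps)
    ultimately show ?thesis using Vscale[OF ac, of b] by (simp add: b)
  qed
  have ring_id: "t - p * (q * p * x + y) = (t - p * (q * s + y)) + p * q * (s - p * x)" for t p q x y :: "'r poly5"
    by (simp add: algebra_simps)
  have "S \<subseteq> V"
  proof (rule insert.IH)
    fix t assume "t \<in> S"
    then obtain a' c' where t: "t - pconst \<pi> * (pconst a' * s + ?\<Sigma> c') \<in> V" using ex by blast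
    have eq: "?\<Sigma> (\<lambda>t. a' * (\<pi> * (b * c t)) + c' t) = pconst (a' * \<pi>) * ?\<Sigma> (\<lambda>t. b * c t) + ?\<Sigma> c'"
      by (simp add: sum_distrib_left pconst_mult pconst_add distrib_right sum.distrib mult.assoc)
    have "t - pconst \<pi> * ?\<Sigma> (\<lambda>t. a' * (\<pi> * (b * c t)) + c' t) =
        (t - pconst \<pi> * (pconst a' * s + ?\<Sigma> c')) + pconst (\<pi> * a') * (s - pconst \<pi> * ?\<Sigma> (\<lambda>t. b * c t))"
      unfolding eq pconst_mult by (rule ring_id)
    then have "t - pconst \<pi> * ?\<Sigma> (\<lambda>t. a' * (\<pi> * (b * c t)) + c' t) \<in> V"
      using Vadd[OF t Vscale[OF s, of "\<pi> * a'"]] by (simp only:)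
    then show "\<exists>c. t - pconst \<pi> * ?\<Sigma> c \<in> V" by (rule exI[of _ "\<lambda>t. a' * (\<pi> * (b * c t)) + c' t"])
  qed
  moreover have "s \<in> V"
  proof -
    have "(\<Sum>t\<in>S'. pconst (b * c t) * t) \<in> V" if "finite S'" "S' \<subseteq> V" for S'
      using that by (induction S' rule: finite_induct) (auto intro: V0 Vadd Vscale)
    then have "?\<Sigma> (\<lambda>t. b * c t) \<in> V" using insert.hyps(1) \<open>S \<subseteq> V\<close> by blast
    then show ?thesis using Vadd[OF s Vscale, of "?\<Sigma> (\<lambda>t. b * c t)" \<pi>] by simp
  qed
  ultimately show ?case by simp
qed simp

text \<open>A graded ideal disjoint from this set and containing \<open>\<pi>\<close> leaves the
  variables in A algebraically independent over the residue field. The set is multiplicative,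
  because polynomials over the residue field form a domain, and so it can be avoided by a
  homogeneous prime.\<close>

definition unit_forms :: "5 set \<Rightarrow> 'r poly5 set" where
  "unit_forms A = {f. (\<exists>d. homogeneous d f) \<and> (\<forall>m\<in>Poly_Mapping.keys f. Poly_Mapping.keys m \<subseteq> A) \<and> pmap f \<noteq> 0}"

lemma unit_formsI:
  assumes "homogeneous d f" "\<And>m. m \<in> Poly_Mapping.keys f \<Longrightarrow> Poly_Mapping.keys m \<subseteq> A" "\<not> \<pi> dvd Poly_Mapping.lookup f m"
  shows "f \<in> unit_forms A"
proof -
  have "Poly_Mapping.lookup (pmap f) m \<noteq> 0" using assms(3) by (simp add: lookup_pmap red_eq_0_iff)
  then have "pmap f \<noteq> 0" by force
  then show ?thesis using assms by (auto simp: unit_forms_def)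
qed

lemma unit_forms_mult:
  assumes "f \<in> unit_forms A" "g \<in> unit_forms A"
  shows "f * g \<in> unit_forms A"
proof -
  have "pmap f * pmap g \<noteq> 0" using assms by (auto simp: unit_forms_def)
  moreover have "Poly_Mapping.keys m \<subseteq> A" if m: "m \<in> Poly_Mapping.keys (f * g)" for m
  proof -
    obtain a b where ab: "m = a + b" "a \<in> Poly_Mapping.keys f" "b \<in> Poly_Mapping.keys g"
      using Poly_Mapping.keys_mult[of f g] m by blast
    then have "Poly_Mapping.keys m \<subseteq> Poly_Mapping.keys a \<union> Poly_Mapping.keys b"
      using Poly_Mapping.keys_add[of a b] by simp
    moreover have "Poly_Mapping.keys a \<subseteq> A" "Poly_Mapping.keys b \<subseteq> A" using ab assms by (auto simp: unit_forms_def)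
    ultimately show ?thesis by blast
  qed
  moreover obtain d e where "homogeneous d f" "homogeneous e g" using assms by (auto simp: unit_forms_def)
  then have "\<exists>d. homogeneous d (f * g)" using homogeneous_mult by blast
  ultimately show ?thesis by (auto simp: unit_forms_def pmap_mult)
qed

lemma one_unit_form: "1 \<in> unit_forms A"
  by (rule unit_formsI[of 0 _ _ 0]) (auto simp: not_dvd_1)

lemma pvar_unit_form: "i \<in> A \<Longrightarrow> pvar i \<in> unit_forms A"
  by (rule unit_formsI[of 1 _ _ "Poly_Mapping.single i 1"]) (auto simp: not_dvd_1 pvar_def homogeneous_pvar_Suc[unfolded pvar_def One_nat_def])

lemma exists_prime_avoiding_forms:
  assumes "graded J" "J \<inter> unit_forms A = {}"
  obtains y where "homogeneous_prime y" "J \<subseteq> y" "y \<inter> unit_forms A = {}"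
proof (rule exists_homogeneous_prime[OF assms(1) _ one_unit_form _ assms(2)])
  show "\<exists>d. homogeneous d s" if "s \<in> unit_forms A" for s using that by (auto simp: unit_forms_def)
qed (use that unit_forms_mult in auto)

text \<open>Noether's substitution: f is nonzero modulo \<open>\<pi>\<close>, hence takes a unit
  value at some t. Adding \<open>t i\<close> times \<open>pvar a\<close> to the other variables in A
  turns f into a unit times a power of \<open>pvar a\<close> modulo these variables, and
  \<open>pvar a\<close> becomes dispensable as a parameter.\<close>

lemma normalisation_step:
  assumes gr: "graded J" and one: "1 \<notin> J" and cov: "covers J (pvar ` A) N"
    and f: "f \<in> J" "f \<in> unit_forms A"
  obtains a l l' M where "a \<in> A" "coord_change l l'" "covers (vimage_coords l J) (pvar ` (A - {a})) M"
proof -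
  note id = gradedD(1)[OF gr]
  obtain d where d: "homogeneous d f" using f(2) by (auto simp: unit_forms_def)
  have keysA: "Poly_Mapping.keys m \<subseteq> A" if "m \<in> Poly_Mapping.keys f" for m using f(2) that by (auto simp: unit_forms_def)
  have f0: "pmap f \<noteq> 0" using f(2) by (simp add: unit_forms_def)
  obtain m0 where m0: "\<not> \<pi> dvd Poly_Mapping.lookup f m0"
  proof (rule ccontr)
    assume "\<not> thesis"
    then have "Poly_Mapping.lookup (pmap f) m = 0" for m using that by (auto simp: lookup_pmap red_eq_0_iff)
    then have "pmap f = 0" by (intro poly_mapping_eqI) simp
    then show False using f0 by simp
  qed
  then have m0k: "m0 \<in> Poly_Mapping.keys f" by (auto simp: in_keys_iff)
  \<comment> \<open>For empty A the form f would be a constant prime to \<open>\<pi>\<close>, that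
    is a unit, and J would contain 1.\<close>
  obtain a where a: "a \<in> A"
  proof (rule ccontr)
    assume "\<not> thesis"
    then have "A = {}" using that by blast
    then have k: "\<And>m. m \<in> Poly_Mapping.keys f \<Longrightarrow> m = 0" using keysA by fastforce
    then have "f = pconst (Poly_Mapping.lookup f 0)"
      unfolding pconst_def by (intro poly_mapping_eqI) (auto simp: lookup_single when_def in_keys_iff)
    moreover obtain b where "b * Poly_Mapping.lookup f 0 = 1" using unit m0 k[OF m0k] by (metis dvdE mult.commute)
    ultimately have "pconst b * f = 1" by (metis pconst_1 pconst_mult)
    then show False using ideal_mult[OF id f(1), of "pconst b"] one by simp
  qed
  obtain s where s: "\<And>i. s i \<noteq> 0" "peval s (pmap f) \<noteq> 0" using exists_peval_nonzero[OF inf f0] by blast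
  have "\<forall>i. \<exists>r. red r = s i / s a" using surj_red by (metis surjD)
  then obtain t0 where t0: "\<And>i. red (t0 i) = s i / s a" by metis
  \<comment> \<open>The point is rescaled so that its coordinate at a is 1, matching the fact that
    \<open>l'\<close> fixes \<open>pvar a\<close>. By homogeneity the value of f stays nonzero
    modulo \<open>\<pi>\<close>.\<close>
  define t where "t = t0(a := 1)"
  have t: "red (t i) = inverse (s a) * s i" for i using s(1)[of a] t0 by (auto simp: t_def divide_inverse mult.commute)
  have "red (peval t f) = inverse (s a) ^ d * peval s (pmap f)"
    unfolding peval_pmap[symmetric] t by (rule peval_scale[OF homogeneous_pmap[OF d]])
  then have "red (peval t f) \<noteq> 0" using s by simp
  then obtain b where b: "b * peval t f = 1" using unit red_eq_0_iff by (metis dvdE mult.commute)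
  define l where "l i = (if i \<in> A - {a} then pvar i - pconst (t i) * pvar a else pvar i)" for i
  define l' where "l' i = (if i \<in> A - {a} then pvar i + pconst (t i) * pvar a else pvar i)" for i
  have l: "coord_change l l'"
    unfolding coord_change_def l_def l'_def
    by (auto intro!: homogeneous_add homogeneous_diff homogeneous_pconst_mult
        simp: psubst_add psubst_diff psubst_mult)
  let ?J = "vimage_coords l J"
  let ?K = "ideal_of (?J \<union> pvar ` (A - {a}))"
  \<comment> \<open>Modulo the other variables of A each \<open>l' i\<close> becomes
    \<open>t i\<close> times \<open>pvar a\<close>, so the image of f becomes
    \<open>peval t f\<close> times \<open>pvar a ^ d\<close>, and the first factor is a
    unit.\<close>
  have xa: "pvar a ^ d \<in> ?K"
  proof -
    have "psubst l' f \<in> ?K"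
      using f(1) by (intro ideal_of_base) (simp add: coord_change_inverse[OF l])
    moreover have "psubst l' f - pconst (peval t f) * pvar a ^ d \<in> ?K"
    proof -
      have "(\<Prod>i\<in>UNIV. l' i ^ Poly_Mapping.lookup m i) - (\<Prod>i\<in>UNIV. (pconst (t i) * pvar a) ^ Poly_Mapping.lookup m i) \<in> ?K"
        if m: "m \<in> Poly_Mapping.keys f" for m
      proof (rule ideal_cong_prod[OF is_ideal_ideal_of])
        fix i :: 5
        consider "i \<in> A - {a}" | "i = a" | "i \<notin> A" by blast
        then show "l' i ^ Poly_Mapping.lookup m i - (pconst (t i) * pvar a) ^ Poly_Mapping.lookup m i \<in> ?K"
        proof cases
          case 1
          then have "l' i - pconst (t i) * pvar a \<in> ?K" unfolding l'_def by (simp add: ideal_of_base)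
          then have "prod (\<lambda>_. l' i) {..<Poly_Mapping.lookup m i} - prod (\<lambda>_. pconst (t i) * pvar a) {..<Poly_Mapping.lookup m i} \<in> ?K"
            by (intro ideal_cong_prod[OF is_ideal_ideal_of])
          then show ?thesis by simp
        next
          case 2
          then show ?thesis by (simp add: l'_def t_def ideal_0)
        next
          case 3
          then have "Poly_Mapping.lookup m i = 0" using keysA[OF m] by (auto simp: in_keys_iff)
          then show ?thesis by (simp add: ideal_0)
        qed
      qed
      then have 1: "pconst (Poly_Mapping.lookup f m) * ((\<Prod>i\<in>UNIV. l' i ^ Poly_Mapping.lookup m i) -
          (\<Prod>i\<in>UNIV. (pconst (t i) * pvar a) ^ Poly_Mapping.lookup m i)) \<in> ?K" if "m \<in> Poly_Mapping.keys f" for m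
        using that by (intro ideal_mult[OF is_ideal_ideal_of])
      have 2: "(\<Prod>i\<in>UNIV. (pconst (t i) * pvar a) ^ Poly_Mapping.lookup m i) =
          pconst (\<Prod>i\<in>UNIV. t i ^ Poly_Mapping.lookup m i) * pvar a ^ d" if "m \<in> Poly_Mapping.keys f" for m
      proof -
        have "mdeg m = d" using d that by (simp add: homogeneous_def)
        then show ?thesis by (simp add: power_mult_distrib prod.distrib pconst_prod pconst_power flip: power_sum)
      qed
      have "pconst (Poly_Mapping.lookup f m) * (\<Prod>i\<in>UNIV. l' i ^ Poly_Mapping.lookup m i) -
          pconst (Poly_Mapping.lookup f m) * (pconst (\<Prod>i\<in>UNIV. t i ^ Poly_Mapping.lookup m i) * pvar a ^ d) \<in> ?K"
        if "m \<in> Poly_Mapping.keys f" for m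
        using 1[OF that] unfolding 2[OF that] right_diff_distrib .
      then have "(\<Sum>m\<in>Poly_Mapping.keys f. pconst (Poly_Mapping.lookup f m) * (\<Prod>i\<in>UNIV. l' i ^ Poly_Mapping.lookup m i)) -
          (\<Sum>m\<in>Poly_Mapping.keys f. pconst (Poly_Mapping.lookup f m) * (pconst (\<Prod>i\<in>UNIV. t i ^ Poly_Mapping.lookup m i) * pvar a ^ d)) \<in> ?K"
        by (rule ideal_cong_sum[OF is_ideal_ideal_of])
      then show ?thesis
        by (simp add: psubst_def mlin_def peval_def pconst_sum pconst_mult sum_distrib_right mult.assoc)
    qed
    ultimately have "pconst (peval t f) * pvar a ^ d \<in> ?K" using ideal_diff_cong[OF is_ideal_ideal_of] by blast
    then have "pconst b * (pconst (peval t f) * pvar a ^ d) \<in> ?K" by (rule ideal_mult[OF is_ideal_ideal_of])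
    then show ?thesis by (simp add: b flip: mult.assoc pconst_mult)
  qed
  have cov': "covers ?J (pvar ` A) N"
  proof (rule covers_mono[OF covers_vimage[OF l cov]])
    show "vimage_coords l J \<subseteq> ideal_of (?J \<union> pvar ` A)" by (auto intro: ideal_of_base)
    have "pvar i \<in> ideal_of (?J \<union> pvar ` A)" if "i \<in> A" for i
      using that by (intro ideal_of_base) simp
    then show "psubst l' ` pvar ` A \<subseteq> ideal_of (?J \<union> pvar ` A)"
      using a by (auto simp: l'_def intro!: ideal_add[OF is_ideal_ideal_of] ideal_mult[OF is_ideal_ideal_of])
  qed
  \<comment> \<open>A monomial of degree \<open>N * q\<close> splits into q monomials of degree N,
    each of which is a multiple of \<open>pvar a\<close> modulo \<open>?K\<close>. For
    \<open>q = d\<close> the resulting power lies in \<open>?K\<close>.\<close>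
  have *: "mdeg m = N * q \<Longrightarrow> \<exists>c. Poly_Mapping.single m 1 - c * pvar a ^ q \<in> ?K" for m q
  proof (induction q arbitrary: m)
    case 0
    then show ?case by (intro exI[of _ "Poly_Mapping.single m 1"]) (simp add: ideal_0)
  next
    case (Suc q)
    then obtain m1 m2 where m: "m = m1 + m2" "mdeg m1 = N" "mdeg m2 = N * q" using monomial_split[of m N "N * q"] by auto
    obtain c2 where c2: "Poly_Mapping.single m2 1 - c2 * pvar a ^ q \<in> ?K" using Suc.IH m(3) by blast
    have "insert (pvar a) (?J \<union> pvar ` (A - {a})) = ?J \<union> pvar ` A" using a by blast
    then have "Poly_Mapping.single m1 1 \<in> ideal_of (insert (pvar a) (?J \<union> pvar ` (A - {a})))"
      using cov' m(2) by (simp add: covers_def)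
    then obtain c1 k where "Poly_Mapping.single m1 1 = c1 * pvar a + k" "k \<in> ?K" unfolding ideal_of_insert by blast
    then have c1: "Poly_Mapping.single m1 1 - c1 * pvar a \<in> ?K" by simp
    have "Poly_Mapping.single m1 1 * Poly_Mapping.single m2 1 - (c1 * pvar a) * (c2 * pvar a ^ q) \<in> ?K"
      by (rule ideal_cong_mult[OF is_ideal_ideal_of c1 c2])
    then have "Poly_Mapping.single m 1 - (c1 * c2) * pvar a ^ Suc q \<in> ?K"
      unfolding m(1) single_mult_1 by (simp add: mult_ac)
    then show ?case by blast
  qed
  have "covers ?J (pvar ` (A - {a})) (N * d)"
    unfolding covers_def
  proof (intro allI impI)
    fix m :: "5 \<Rightarrow>\<^sub>0 nat" assume "mdeg m = N * d"
    then obtain c where "Poly_Mapping.single m 1 - c * pvar a ^ d \<in> ?K" using * by blast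
    moreover have "c * pvar a ^ d \<in> ?K" using xa by (rule ideal_mult[OF is_ideal_ideal_of])
    ultimately show "Poly_Mapping.single m 1 \<in> ?K" using ideal_diff_cong[OF is_ideal_ideal_of] by blast
  qed
  then show ?thesis using that a l by blast
qed

text \<open>Begin with all five variables and eliminate one as long as the ideal contains a unit
  form. At the end covering bounds the dimension from above by the size of A, while avoiding
  \<open>unit_forms A\<close> will bound it from below.\<close>

lemma noether_normalisation:
  assumes gr: "graded J" and one: "1 \<notin> J"
  obtains A l l' N where "coord_change l l'" "covers (vimage_coords l J) (pvar ` A) N"
    "vimage_coords l J \<inter> unit_forms A = {}"
proof -
  have "\<exists>A l l' N. coord_change l l' \<and> covers (vimage_coords l J) (pvar ` A) N \<and> vimage_coords l J \<inter> unit_forms A = {}"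
    if "coord_change l l'" "covers (vimage_coords l J) (pvar ` A) N" for A l l' N
    using that
  proof (induction "card A" arbitrary: A l l' N rule: less_induct)
    case less
    show ?case
    proof (cases "vimage_coords l J \<inter> unit_forms A = {}")
      case True
      then show ?thesis using less.prems by blast
    next
      case False
      then obtain f where f: "f \<in> vimage_coords l J" "f \<in> unit_forms A" by blast
      have gr': "graded (vimage_coords l J)"
        using less.prems(1) by (intro graded_vimage_psubst[OF gr]) (simp add: coord_change_def)
      have one': "1 \<notin> vimage_coords l J" using one by simp
      obtain a k k' M where a: "a \<in> A" and k: "coord_change k k'"
        "covers (vimage_coords k (vimage_coords l J)) (pvar ` (A - {a})) M"
        by (rule normalisation_step[OF gr' one' less.prems(2) f])
      have "vimage_coords k (vimage_coords l J) = vimage_coords (\<lambda>i. psubst l (k i)) J" by (simp add: psubst_psubst)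
      then have c: "covers (vimage_coords (\<lambda>i. psubst l (k i)) J) (pvar ` (A - {a})) M" using k(2) by simp
      have "card (A - {a}) < card A" using a by (intro card_Diff1_less) auto
      from less.hyps[OF this coord_change_compose[OF less.prems(1) k(1)] c] show ?thesis .
    qed
  qed
  moreover have "covers (vimage_coords pvar J) (pvar ` UNIV) 1"
    unfolding covers_def
  proof (intro allI impI)
    fix m :: "5 \<Rightarrow>\<^sub>0 nat" assume m: "mdeg m = 1"
    then have "mdeg m \<noteq> 0" by simp
    then obtain i m' where "m = Poly_Mapping.single i 1 + m'" by (rule monomial_factor)
    then have "Poly_Mapping.single m (1::'r) = pvar i * Poly_Mapping.single m' 1"
      by (metis pvar_def single_mult_1)
    then show "Poly_Mapping.single m (1::'r) \<in> ideal_of (vimage_coords pvar J \<union> range pvar)"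
      by (simp add: ideal_mult_right ideal_of_base)
  qed
  ultimately show ?thesis using that coord_change_id by blast
qed

end

section \<open>Growth of graded quotients: counting forms of degree n\<close>

lemma module_pconst: "Modules.module (\<lambda>(c::'r::comm_ring_1) f. pconst c * f :: 'r poly5)"
  by unfold_locales (simp_all add: algebra_simps pconst_add pconst_mult)

abbreviation rspan :: "'r::comm_ring_1 poly5 set \<Rightarrow> 'r poly5 set" where
  "rspan \<equiv> module.span (\<lambda>c f. pconst c * f)"

context
begin

interpretation M: Modules.module "\<lambda>(c::'r::comm_ring_1) f. pconst c * f :: 'r poly5"
  by (rule module_pconst)

lemmas rspan_0 = M.span_zero and rspan_add = M.span_add and rspan_scale = M.span_scale
  and rspan_base = M.span_base and rspan_finite = M.span_finite and rspan_induct = M.span_induct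
  and rspan_minimal = M.span_minimal and rsubspaceI = M.subspaceI and rsubspace_rspan = M.subspace_span

end

lemma rspan_mono_mult:
  assumes "f \<in> rspan S" "\<And>s. s \<in> S \<Longrightarrow> h * s \<in> rspan T"
  shows "h * f \<in> rspan T"
proof -
  have "module.subspace (\<lambda>c f. pconst c * f) {f. h * f \<in> rspan T}"
  proof (rule rsubspaceI)
    fix c x assume "x \<in> {f. h * f \<in> rspan T}"
    then have "pconst c * (h * x) \<in> rspan T" using rspan_scale by blast
    then show "pconst c * x \<in> {f. h * f \<in> rspan T}" by (simp only: mem_Collect_eq mult.left_commute)
  qed (auto simp: distrib_left rspan_0 rspan_add)
  then show ?thesis using rspan_induct[OF assms(1), of "\<lambda>f. h * f \<in> rspan T"] assms(2) by simp
qed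

text \<open>Modulo y the polynomials are spanned by monomials of degree below N over the polynomials
  in h1 and h2, since a monomial of degree N is a combination of h1 and h2. In degree n the triples
  (m, i, j) are determined by m and i, so their number grows at most linearly with n.\<close>

lemma homogeneous_in_rspan:
  fixes y :: "'r::comm_ring_1 poly5 set"
  assumes gr: "graded y" and h: "homogeneous 1 h1" "homogeneous 1 h2" and cov: "covers y {h1, h2} N" and N: "N \<noteq> 0"
  shows "homogeneous n f \<Longrightarrow>
    \<exists>g \<in> rspan ((\<lambda>(m, i, j). Poly_Mapping.single m 1 * h1 ^ i * h2 ^ j) ` {(m, i, j). mdeg m < N \<and> mdeg m + i + j = n}). f - g \<in> y"
proof (induction n arbitrary: f rule: less_induct)
  case (less n)
  note id = gradedD(1)[OF gr]
  let ?T = "\<lambda>n. {(m::5 \<Rightarrow>\<^sub>0 nat, i::nat, j::nat). mdeg m < N \<and> mdeg m + i + j = n}"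
  let ?w = "\<lambda>(m, i, j). Poly_Mapping.single m (1::'r) * h1 ^ i * h2 ^ j"
  have mult: "h * g \<in> rspan (?w ` ?T n)" if "g \<in> rspan (?w ` ?T (n - 1))" "h = h1 \<or> h = h2" "n \<noteq> 0" for g h
  proof (rule rspan_mono_mult[OF that(1)])
    fix s assume "s \<in> ?w ` ?T (n - 1)"
    then obtain m i j where s: "s = Poly_Mapping.single m 1 * h1 ^ i * h2 ^ j" "mdeg m < N" "mdeg m + i + j = n - 1" by auto
    have "h1 * s = ?w (m, Suc i, j)" "h2 * s = ?w (m, i, Suc j)" using s(1) by (simp_all add: mult_ac)
    moreover have "?w (m, Suc i, j) \<in> ?w ` ?T n" using s that(3) by (intro imageI) auto
    moreover have "?w (m, i, Suc j) \<in> ?w ` ?T n" using s that(3) by (intro imageI) auto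
    ultimately have "h1 * s \<in> ?w ` ?T n" "h2 * s \<in> ?w ` ?T n" by simp_all
    then have "h * s \<in> ?w ` ?T n" using that(2) by (elim disjE) (simp_all only:)
    then show "h * s \<in> rspan (?w ` ?T n)" by (rule rspan_base)
  qed
  from less.prems show ?case
  proof (induction rule: homogeneous_induct)
    case zero
    then show ?case by (intro bexI[of _ 0]) (auto simp: rspan_0 ideal_0[OF id])
  next
    case (add f g)
    then obtain f' g' where "f' \<in> rspan (?w ` ?T n)" "f - f' \<in> y" "g' \<in> rspan (?w ` ?T n)" "g - g' \<in> y" by blast
    then have "f' + g' \<in> rspan (?w ` ?T n)" "f + g - (f' + g') \<in> y"
      using rspan_add ideal_add[OF id, of "f - f'" "g - g'"] by (auto simp: algebra_simps)
    then show ?case by blast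
  next
    case (single m c)
    show ?case
    proof (cases "n < N")
      case True
      then have "(m, 0, 0) \<in> ?T n" using single by simp
      then have "?w (m, 0, 0) \<in> rspan (?w ` ?T n)" by (intro rspan_base imageI)
      then have "pconst c * Poly_Mapping.single m 1 \<in> rspan (?w ` ?T n)" using rspan_scale by fastforce
      then show ?thesis unfolding single_eq_pconst_mult[of m c] using ideal_0[OF id] by force
    next
      case False
      then have "mdeg m = N + (n - N)" using single by simp
      then obtain m1 m2 where m: "m = m1 + m2" "mdeg m1 = N" "mdeg m2 = n - N" by (rule monomial_split)
      have "Poly_Mapping.single m1 1 \<in> ideal_of (insert h1 (insert h2 y))"
        using cov m(2) by (simp add: covers_def Un_commute)
      then obtain c1 c2 k where k: "Poly_Mapping.single m1 1 = c1 * h1 + (c2 * h2 + k)" "k \<in> y"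
        unfolding ideal_of_insert ideal_of_ideal[OF id] by blast
      have "Poly_Mapping.single m1 1 = hcomp N (Poly_Mapping.single m1 (1::'r))"
        using hcomp_homogeneous[OF homogeneous_single[of m1 "1::'r"], of N] m(2) by simp
      also have "\<dots> = h1 * hcomp (N - 1) c1 + (h2 * hcomp (N - 1) c2 + hcomp N k)"
        unfolding k(1) hcomp_add using N
        by (simp add: mult.commute[of _ h1] mult.commute[of _ h2] hcomp_mult_homogeneous[OF h(1)] hcomp_mult_homogeneous[OF h(2)])
      finally have m1: "Poly_Mapping.single m1 (1::'r) = h1 * hcomp (N - 1) c1 + (h2 * hcomp (N - 1) c2 + hcomp N k)" .
      define g1 where "g1 = hcomp (N - 1) c1 * Poly_Mapping.single m2 c"
      define g2 where "g2 = hcomp (N - 1) c2 * Poly_Mapping.single m2 c"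
      have mc: "Poly_Mapping.single m c = h1 * g1 + (h2 * g2 + hcomp N k * Poly_Mapping.single m2 c)"
      proof -
        have "Poly_Mapping.single m c = Poly_Mapping.single m1 1 * Poly_Mapping.single m2 c" by (simp add: m(1) mult_single)
        then show ?thesis unfolding m1 g1_def g2_def by (simp add: algebra_simps)
      qed
      \<comment> \<open>As N is positive, h1 and h2 carry coefficients of degree
        \<open>N - 1\<close>, and after multiplication by the rest of the monomial the degree is
        \<open>n - 1\<close>.\<close>
      have n0: "n \<noteq> 0" and n1: "N - 1 + (n - N) = n - 1" using False N by auto
      have "homogeneous (n - 1) g1" "homogeneous (n - 1) g2"
        unfolding g1_def g2_def n1[symmetric] m(3)[symmetric] by (intro homogeneous_mult homogeneous_hcomp homogeneous_single)+
      then obtain f1 f2 where f: "f1 \<in> rspan (?w ` ?T (n - 1))" "g1 - f1 \<in> y" "f2 \<in> rspan (?w ` ?T (n - 1))" "g2 - f2 \<in> y"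
        using less.IH[of "n - 1"] n0 by (metis (no_types, lifting) diff_less less_one not_gr0)
      have "h1 * f1 + h2 * f2 \<in> rspan (?w ` ?T n)" using mult f n0 by (intro rspan_add) auto
      moreover have eq: "Poly_Mapping.single m c - (h1 * f1 + h2 * f2) =
         h1 * (g1 - f1) + (h2 * (g2 - f2) + hcomp N k * Poly_Mapping.single m2 c)"
        unfolding mc by (simp add: algebra_simps)
      have "Poly_Mapping.single m c - (h1 * f1 + h2 * f2) \<in> y" unfolding eq
        using f(2,4) gradedD(2)[OF gr k(2)] by (intro ideal_add[OF id] ideal_mult[OF id] ideal_mult_right[OF id])
      ultimately show ?thesis by (intro bexI[of _ "h1 * f1 + h2 * f2"])
    qed
  qed
qed

context residue
begin

text \<open>More monomials than generators are linearly dependent over the residue field. Lifting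
  such a relation gives a form in y, because the errors are multiples of \<open>\<pi>\<close>. A
  coefficient that is nonzero modulo \<open>\<pi>\<close> makes it a unit form in the variables of
  A, which y avoids.\<close>

lemma no_dependent_monomials:
  assumes id: "is_ideal y" and pi: "pconst \<pi> \<in> y" and disj: "y \<inter> unit_forms A = {}"
    and fin: "finite I" and inj: "inj_on e I" and deg: "\<And>i. i \<in> I \<Longrightarrow> mdeg (e i) = n"
    and keys: "\<And>i. i \<in> I \<Longrightarrow> Poly_Mapping.keys (e i) \<subseteq> A"
    and T: "finite T" "card T < card I"
    and span: "\<And>i. i \<in> I \<Longrightarrow> \<exists>g \<in> rspan T. Poly_Mapping.single (e i) 1 - g \<in> y"
  shows False
proof -
  have "\<forall>i\<in>I. \<exists>c. Poly_Mapping.single (e i) 1 - (\<Sum>t\<in>T. pconst (c t) * t) \<in> y"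
    using span unfolding rspan_finite[OF T(1)] by blast
  from bchoice[OF this] obtain c
    where c: "\<And>i. i \<in> I \<Longrightarrow> Poly_Mapping.single (e i) 1 - (\<Sum>t\<in>T. pconst (c i t) * t) \<in> y" by blast
  obtain \<nu> where \<nu>: "\<exists>i\<in>I. \<nu> i \<noteq> 0" "\<And>t. t \<in> T \<Longrightarrow> (\<Sum>i\<in>I. \<nu> i * red (c i t)) = 0"
    using exists_linear_relation[OF T(1) fin T(2), of "\<lambda>i t. red (c i t)"] by blast
  have "\<forall>i. \<exists>r. red r = \<nu> i" using surj_red by (metis surjD)
  then obtain r where r: "\<And>i. red (r i) = \<nu> i" by metis
  define f where "f = (\<Sum>i\<in>I. pconst (r i) * Poly_Mapping.single (e i) 1)"
  have "f - (\<Sum>t\<in>T. pconst (\<Sum>i\<in>I. r i * c i t) * t) \<in> y"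
  proof -
    have "(\<Sum>t\<in>T. pconst (\<Sum>i\<in>I. r i * c i t) * t) = (\<Sum>t\<in>T. \<Sum>i\<in>I. pconst (r i) * (pconst (c i t) * t))"
      by (simp add: pconst_sum pconst_mult sum_distrib_right mult.assoc)
    also have "\<dots> = (\<Sum>i\<in>I. pconst (r i) * (\<Sum>t\<in>T. pconst (c i t) * t))"
      by (subst sum.swap) (simp add: sum_distrib_left)
    finally have "f - (\<Sum>t\<in>T. pconst (\<Sum>i\<in>I. r i * c i t) * t) =
        (\<Sum>i\<in>I. pconst (r i) * (Poly_Mapping.single (e i) 1 - (\<Sum>t\<in>T. pconst (c i t) * t)))"
      by (simp only: f_def right_diff_distrib sum_subtractf)
    also have "\<dots> \<in> y" using c by (intro ideal_sum[OF id] ideal_mult[OF id])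
    finally show ?thesis .
  qed
  moreover have "(\<Sum>t\<in>T. pconst (\<Sum>i\<in>I. r i * c i t) * t) \<in> y"
  proof (rule ideal_sum[OF id])
    fix t assume "t \<in> T"
    then have "red (\<Sum>i\<in>I. r i * c i t) = 0" using \<nu>(2) by (simp add: hom_sum hom_mult r)
    then obtain k where "(\<Sum>i\<in>I. r i * c i t) = \<pi> * k" unfolding red_eq_0_iff by (rule dvdE)
    then have "pconst (\<Sum>i\<in>I. r i * c i t) * t = (pconst k * t) * pconst \<pi>" by (simp add: pconst_mult mult_ac)
    then show "pconst (\<Sum>i\<in>I. r i * c i t) * t \<in> y" using ideal_mult[OF id pi] by (simp only:)
  qed
  ultimately have "f \<in> y" using ideal_diff_cong[OF id] by blast
  moreover have "f \<in> unit_forms A"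
  proof -
    obtain i0 where i0: "i0 \<in> I" "\<nu> i0 \<noteq> 0" using \<nu>(1) by blast
    have lk: "Poly_Mapping.lookup f m = (\<Sum>i\<in>I. if e i = m then r i else 0)" for m
      unfolding f_def lookup_sum lookup_pconst_mult by (intro sum.cong) (auto simp: lookup_single when_def)
    have "Poly_Mapping.lookup f (e i0) = (\<Sum>i\<in>I. if i = i0 then r i else 0)"
      unfolding lk using inj i0(1) by (intro sum.cong) (auto simp: inj_on_def)
    then have "\<not> \<pi> dvd Poly_Mapping.lookup f (e i0)" using i0 fin r[of i0] red_eq_0_iff[of "r i0"] by simp
    moreover have "homogeneous n f"
      unfolding f_def
    proof (intro homogeneous_sum homogeneous_pconst_mult)
      fix i assume "i \<in> I"
      then show "homogeneous n (Poly_Mapping.single (e i) (1::'r))" using homogeneous_single[of "e i" "1::'r"] deg by simp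
    qed
    moreover have "Poly_Mapping.keys m \<subseteq> A" if "m \<in> Poly_Mapping.keys f" for m
    proof -
      have ne: "Poly_Mapping.lookup f m \<noteq> 0" using that by (simp add: in_keys_iff)
      have "\<exists>i\<in>I. e i = m"
      proof (rule ccontr)
        assume "\<not> (\<exists>i\<in>I. e i = m)"
        then have "Poly_Mapping.lookup f m = 0" unfolding lk by (intro sum.neutral) auto
        then show False using ne by simp
      qed
      then show ?thesis using keys by blast
    qed
    ultimately show ?thesis by (intro unit_formsI)
  qed
  ultimately show False using disj by blast
qed

text \<open>Three independent variables have quadratically many monomials of given degree, whereas
  two covering forms leave room for linearly many by \<open>homogeneous_in_rspan\<close>.\<close>

lemma not_covers_two_forms:
  assumes gr: "graded y" and pi: "pconst \<pi> \<in> y" and disj: "y \<inter> unit_forms A = {}"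
    and A: "a \<in> A" "b \<in> A" "c \<in> A" "a \<noteq> b" "a \<noteq> c" "b \<noteq> c"
    and h: "homogeneous 1 h1" "homogeneous 1 h2"
  shows "\<not> covers y {h1, h2} N"
proof
  assume "covers y {h1, h2} N"
  then have cov: "covers y {h1, h2} (Suc N)" using covers_add[of y "{h1, h2}" N 1] by simp
  define C where "C = card {m. mdeg m \<le> N}"
  let ?T = "\<lambda>n. {(m::5 \<Rightarrow>\<^sub>0 nat, i::nat, j::nat). mdeg m < Suc N \<and> mdeg m + i + j = n}"
  let ?w = "\<lambda>(m, i, j). Poly_Mapping.single m (1::'r) * h1 ^ i * h2 ^ j"
  have T: "finite (?T n) \<and> card (?T n) \<le> C * Suc n" for n
  proof -
    have inj: "inj_on (\<lambda>(m, i, j). (m, i)) (?T n)" by (auto simp: inj_on_def)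
    have sub: "(\<lambda>(m, i, j). (m, i)) ` ?T n \<subseteq> {m. mdeg m \<le> N} \<times> {..n}" by auto
    have fin: "finite ({m. mdeg m \<le> N} \<times> {..n})" using finite_mdeg_le by blast
    show ?thesis
      using finite_imageD[OF finite_subset[OF sub fin] inj] card_inj_on_le[OF inj sub fin]
      by (simp add: card_cartesian_product C_def)
  qed
  \<comment> \<open>Degree \<open>2 * q\<close> offers \<open>(q + 1)^2 = 4 C^2 + 4 C + 1\<close>
    monomials in a, b, c against at most \<open>C * (2 q + 1) = 4 C^2 + C\<close> generators. The
    first two exponents are bounded by q, so the third, \<open>2 q - i - j\<close>, is not
    truncated.\<close>
  define q where "q = 2 * C"
  define e where "e = (\<lambda>(i, j). Poly_Mapping.single a i + Poly_Mapping.single b j + Poly_Mapping.single c (2 * q - i - j))"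
  show False
  proof (rule no_dependent_monomials[OF gradedD(1)[OF gr] pi disj, where I = "{..q} \<times> {..q}" and e = e and n = "2 * q" and T = "?w ` ?T (2 * q)"])
    show "inj_on e ({..q} \<times> {..q})"
    proof (rule inj_onI, clarify)
      fix i j i' j' assume "e (i, j) = e (i', j')"
      then have "Poly_Mapping.lookup (e (i, j)) a = Poly_Mapping.lookup (e (i', j')) a"
        "Poly_Mapping.lookup (e (i, j)) b = Poly_Mapping.lookup (e (i', j')) b" by simp_all
      then show "i = i' \<and> j = j'" using A by (simp add: e_def lookup_add lookup_single when_def)
    qed
    show "mdeg (e p) = 2 * q" if "p \<in> {..q} \<times> {..q}" for p
      using that unfolding e_def by (auto simp only: split_beta mdeg_add mdeg_single) auto
    show "Poly_Mapping.keys (e p) \<subseteq> A" if "p \<in> {..q} \<times> {..q}" for p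
    proof
      fix k assume "k \<in> Poly_Mapping.keys (e p)"
      then show "k \<in> A" using A by (auto simp: e_def in_keys_iff lookup_add lookup_single when_def split_beta split: if_splits)
    qed
    show "finite (?w ` ?T (2 * q))" using T by blast
    have "card (?w ` ?T (2 * q)) \<le> C * Suc (2 * q)" using T card_image_le order_trans by blast
    also have "\<dots> < card ({..q} \<times> {..q})" by (simp add: q_def card_cartesian_product algebra_simps)
    finally show "card (?w ` ?T (2 * q)) < card ({..q} \<times> {..q})" .
    show "\<exists>g\<in>rspan (?w ` ?T (2 * q)). Poly_Mapping.single (e p) 1 - g \<in> y" if p: "p \<in> {..q} \<times> {..q}" for p
    proof -
      have "mdeg (e p) = 2 * q" using p unfolding e_def by (auto simp only: split_beta mdeg_add mdeg_single) auto
      then have "homogeneous (2 * q) (Poly_Mapping.single (e p) (1::'r))" using homogeneous_single by metis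
      from homogeneous_in_rspan[OF gr h cov _ this] show ?thesis by simp
    qed
  qed simp
qed

text \<open>The same comparison one dimension lower: \<open>C + 1\<close> monomials in a and b of
  degree C against at most C generators. The zero form takes the place of a second covering form;
  its positive powers vanish, which leaves one generator for each monomial of degree at most
  N.\<close>

lemma not_covers_one_form:
  assumes gr: "graded y" and pi: "pconst \<pi> \<in> y" and disj: "y \<inter> unit_forms A = {}"
    and A: "a \<in> A" "b \<in> A" "a \<noteq> b" and h: "homogeneous 1 h1"
  shows "\<not> covers y {h1} N"
proof
  assume "covers y {h1} N"
  then have cov: "covers y {h1, 0} (Suc N)"
    using covers_mono[OF covers_add[of y "{h1}" N 1], of y "{h1, 0}"] ideal_of_superset[of "y \<union> {h1, 0}"] by auto
  let ?T = "\<lambda>n. {(m::5 \<Rightarrow>\<^sub>0 nat, i::nat, j::nat). mdeg m < Suc N \<and> mdeg m + i + j = n}"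
  let ?w = "\<lambda>(m, i, j). Poly_Mapping.single m (1::'r) * h1 ^ i * 0 ^ j"
  define C where "C = card {m. mdeg m \<le> N}"
  define S where "S = (\<lambda>m. Poly_Mapping.single m (1::'r) * h1 ^ (C - mdeg m)) ` {m. mdeg m \<le> N}"
  have S: "finite S" "card S \<le> C" unfolding S_def C_def using finite_mdeg_le card_image_le by blast+
  have "rspan (?w ` ?T C) \<subseteq> rspan S"
  proof (rule rspan_minimal)
    show "?w ` ?T C \<subseteq> rspan S"
    proof clarify
      fix m i j assume "mdeg m < Suc N" "C = mdeg m + i + j"
      then show "Poly_Mapping.single m 1 * h1 ^ i * 0 ^ j \<in> rspan S"
      proof (cases "j = 0")
        case True
        assume "mdeg m < Suc N" "C = mdeg m + i + j"
        then have "Poly_Mapping.single m 1 * h1 ^ i * 0 ^ j \<in> S" using True unfolding S_def by (intro image_eqI[of _ _ m]) auto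
        then show ?thesis by (rule rspan_base)
      qed (simp add: rspan_0 zero_power)
    qed
  qed (rule rsubspace_rspan)
  define e where "e i = Poly_Mapping.single a i + Poly_Mapping.single b (C - i)" for i
  have deg: "mdeg (e p) = C" if "p \<le> C" for p
    using that unfolding e_def mdeg_add mdeg_single by simp
  show False
  proof (rule no_dependent_monomials[OF gradedD(1)[OF gr] pi disj, where I = "{..C}" and e = e and n = C and T = S])
    show "inj_on e {..C}"
    proof (rule inj_onI)
      fix i j assume "e i = e j"
      then have "Poly_Mapping.lookup (e i) a = Poly_Mapping.lookup (e j) a" by simp
      then show "i = j" using A by (simp add: e_def lookup_add lookup_single when_def)
    qed
    show "Poly_Mapping.keys (e p) \<subseteq> A" if "p \<in> {..C}" for p
    proof
      fix k assume "k \<in> Poly_Mapping.keys (e p)"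
      then show "k \<in> A" using A by (auto simp: e_def in_keys_iff lookup_add lookup_single when_def split: if_splits)
    qed
    show "card S < card {..C}" using S by simp
    show "\<exists>g\<in>rspan S. Poly_Mapping.single (e p) 1 - g \<in> y" if p: "p \<in> {..C}" for p
    proof -
      have "homogeneous C (Poly_Mapping.single (e p) (1::'r))" using homogeneous_single[of "e p"] deg[of p] p by simp
      from homogeneous_in_rspan[OF gr h homogeneous_0 cov _ this] show ?thesis
        using \<open>rspan (?w ` ?T C) \<subseteq> rspan S\<close> by blast
    qed
  qed (use S deg in auto)
qed

text \<open>Each new prime is obtained by adjoining a variable that is independent modulo the
  previous one. The growth bounds show that after the first variable at least two independent
  parameters survive, and that after the second the ideal is still not irrelevant.\<close>

lemma exists_chain:
  assumes gr: "graded J" and pi: "pconst \<pi> \<in> J" and disj: "J \<inter> unit_forms A = {}" and A: "card A \<ge> 3"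
  obtains y0 y1 y2 where "homogeneous_prime y0" "homogeneous_prime y1" "homogeneous_prime y2"
    "J \<subseteq> y0" "y0 \<subset> y1" "y1 \<subset> y2" "\<not> range pvar \<subseteq> y2"
proof -
  obtain B where "B \<subseteq> A" "card B = 3" using obtain_subset_with_card_n[OF A] by metis
  then obtain a b c where abc: "a \<in> A" "b \<in> A" "c \<in> A" "a \<noteq> b" "a \<noteq> c" "b \<noteq> c" by (auto simp: card_3_iff)
  obtain y0 where y0: "homogeneous_prime y0" "J \<subseteq> y0" "y0 \<inter> unit_forms A = {}"
    by (rule exists_prime_avoiding_forms[OF gr disj])
  have gy0: "graded y0" and py0: "pconst \<pi> \<in> y0" using y0 pi by (auto simp: homogeneous_prime_iff)
  note nc2 = not_covers_two_forms[OF gy0 py0 y0(3) abc]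
  define J1 where "J1 = ideal_of (insert (pvar a) y0)"
  have gJ1: "graded J1" unfolding J1_def by (rule graded_insert[OF gy0 homogeneous_pvar])
  have idJ1: "is_ideal J1" using gJ1 by (rule gradedD)
  \<comment> \<open>Otherwise y0 would be covered in degree 0 by \<open>pvar a\<close> alone; the
    zero form fills the second place.\<close>
  have one: "1 \<notin> J1"
  proof
    assume "1 \<in> J1"
    then have "f \<in> J1" for f using ideal_mult[OF idJ1, of 1 f] by simp
    then have "covers y0 {pvar a, 0} 0"
      unfolding covers_def J1_def using ideal_of_mono[of "insert (pvar a) y0" "y0 \<union> {pvar a, 0}"] by blast
    then show False using nc2[OF homogeneous_pvar homogeneous_0] by blast
  qed
  obtain A1 k k' N1 where k: "coord_change k k'" and cov1: "covers (vimage_coords k J1) (pvar ` A1) N1"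
    and disj1: "vimage_coords k J1 \<inter> unit_forms A1 = {}"
    by (rule noether_normalisation[OF gJ1 one])
  have gk: "graded (vimage_coords k J1)" using k by (intro graded_vimage_psubst[OF gJ1]) (simp add: coord_change_def)
  \<comment> \<open>A single parameter \<open>b1\<close>, carried back to the form
    \<open>k b1\<close>, would cover y0 together with \<open>pvar a\<close>. These are two forms,
    which the growth bound excludes.\<close>
  have "\<not> card A1 \<le> 1"
  proof
    assume "card A1 \<le> 1"
    then obtain b1 where b1: "A1 \<subseteq> {b1}" by (metis card_le_Suc0_iff_eq finite One_nat_def insertI1 singletonD subsetI subset_eq)
    have "covers J1 {k b1} N1"
    proof -
      have "covers (vimage_coords k' (vimage_coords k J1)) (psubst k ` pvar ` A1) N1"
        by (rule covers_vimage[OF coord_change_sym[OF k] cov1])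
      then have "covers J1 (k ` A1) N1" using vimage_coords_inverse[OF k, of J1] by (simp add: image_image)
      then show ?thesis using b1 ideal_of_superset[of "J1 \<union> {k b1}"] by (elim covers_mono) auto
    qed
    then have "covers y0 {pvar a, k b1} N1"
    proof (rule covers_mono)
      show "J1 \<subseteq> ideal_of (y0 \<union> {pvar a, k b1})" unfolding J1_def by (intro ideal_of_mono) auto
      show "{k b1} \<subseteq> ideal_of (y0 \<union> {pvar a, k b1})" using ideal_of_superset[of "y0 \<union> {pvar a, k b1}"] by auto
    qed
    then show False using nc2[OF homogeneous_pvar, of "k b1"] k by (auto simp: coord_change_def)
  qed
  then obtain a1 b1 where ab1: "a1 \<in> A1" "b1 \<in> A1" "a1 \<noteq> b1"
    using card_le_Suc0_iff_eq[of A1] by auto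
  obtain y1 where y1: "homogeneous_prime y1" "vimage_coords k J1 \<subseteq> y1" "y1 \<inter> unit_forms A1 = {}"
    by (rule exists_prime_avoiding_forms[OF gk disj1])
  have gy1: "graded y1" using y1(1) by (simp add: homogeneous_prime_iff)
  have py1: "pconst \<pi> \<in> y1"
  proof -
    have "pconst \<pi> \<in> J1" unfolding J1_def using py0 by (intro ideal_of_base) simp
    then have "pconst \<pi> \<in> vimage_coords k J1" by simp
    then show ?thesis using y1(2) by blast
  qed
  define J2 where "J2 = ideal_of (insert (pvar a1) y1)"
  have gJ2: "graded J2" unfolding J2_def by (rule graded_insert[OF gy1 homogeneous_pvar])
  \<comment> \<open>If all variables were nilpotent modulo J2, the single form
    \<open>pvar a1\<close> would cover y1. A variable that is not nilpotent can be kept outside the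
    last prime, which is therefore a point of projective space.\<close>
  have "\<exists>i. \<forall>n. pvar i ^ n \<notin> J2"
  proof (rule ccontr)
    assume "\<nexists>i. \<forall>n. pvar i ^ n \<notin> J2"
    then obtain n where n: "\<And>i. pvar i ^ n i \<in> J2" by metis
    have "pvar i ^ (\<Sum>i\<in>UNIV. n i) \<in> J2" for i
    proof -
      have "n i \<le> (\<Sum>i\<in>UNIV. n i)" by (rule member_le_sum) auto
      then obtain r where "(\<Sum>i\<in>UNIV. n i) = n i + r" using le_Suc_ex by blast
      then show ?thesis using n[of i] gradedD(1)[OF gJ2] by (simp add: power_add ideal_mult_right)
    qed
    then have "covers J2 {} (5 * (\<Sum>i\<in>UNIV. n i))" by (rule covers_if_variables_nilpotent[OF gradedD(1)[OF gJ2]])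
    then have "covers y1 {pvar a1} (5 * (\<Sum>i\<in>UNIV. n i))" by (rule covers_mono) (auto simp: J2_def)
    then show False using not_covers_one_form[OF gy1 py1 y1(3) ab1 homogeneous_pvar] by blast
  qed
  then obtain i where i: "\<And>n. pvar i ^ n \<notin> J2" by blast
  obtain y2 where y2: "homogeneous_prime y2" "J2 \<subseteq> y2" "y2 \<inter> range (\<lambda>n. pvar i ^ n) = {}"
  proof (rule exists_homogeneous_prime[OF gJ2, of "range (\<lambda>n. pvar i ^ n)"])
    show "1 \<in> range (\<lambda>n. pvar i ^ n)" by (metis power_0 rangeI)
    show "J2 \<inter> range (\<lambda>n. pvar i ^ n) = {}" using i by blast
    show "\<exists>d. homogeneous d s" if "s \<in> range (\<lambda>n. pvar i ^ n)" for s :: "'r poly5"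
      using that homogeneous_power[OF homogeneous_pvar] by blast
    show "s * t \<in> range (\<lambda>n. pvar i ^ n)" if "s \<in> range (\<lambda>n. pvar i ^ n)" "t \<in> range (\<lambda>n. pvar i ^ n)" for s t :: "'r poly5"
      using that by (auto simp flip: power_add)
  qed blast
  have "pvar i ^ 1 \<in> range (\<lambda>n. pvar i ^ n)" by blast
  then have iy2: "pvar i \<notin> y2" using y2(3) by auto
  have k': "coord_change k' k" using k by (rule coord_change_sym)
  have J1y1: "J1 \<subseteq> vimage_coords k' y1"
    using y1(2) by (auto simp: coord_change_inverse[OF k])
  show ?thesis
  proof (rule that[of y0 "vimage_coords k' y1" "vimage_coords k' y2"])
    show "homogeneous_prime (vimage_coords k' y1)" "homogeneous_prime (vimage_coords k' y2)"
      using homogeneous_prime_vimage[OF k'] y1(1) y2(1) by auto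
    have "pvar a \<in> vimage_coords k' y1" "y0 \<subseteq> vimage_coords k' y1"
      using J1y1 ideal_of_superset[of "insert (pvar a) y0"] unfolding J1_def by auto
    moreover have "pvar a \<notin> y0" using y0(3) pvar_unit_form[OF abc(1)] by blast
    ultimately show "y0 \<subset> vimage_coords k' y1" by blast
    have "y1 \<subseteq> y2" "pvar a1 \<in> y2" using y2(2) ideal_of_superset[of "insert (pvar a1) y1"] unfolding J2_def by auto
    moreover have "pvar a1 \<notin> y1" using y1(3) pvar_unit_form[OF ab1(1)] by blast
    moreover have "psubst k' (psubst k f) = f" for f by (rule coord_change_inverse[OF k])
    then have "psubst k (pvar a1) \<in> vimage_coords k' y2 \<longleftrightarrow> pvar a1 \<in> y2" "psubst k (pvar a1) \<in> vimage_coords k' y1 \<longleftrightarrow> pvar a1 \<in> y1"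
      by (simp_all only: mem_Collect_eq)
    ultimately show "vimage_coords k' y1 \<subset> vimage_coords k' y2" by blast
    show "\<not> range pvar \<subseteq> vimage_coords k' y2"
      using variables_vimage[OF k'] iy2 y2(1) by (auto simp: homogeneous_prime_def)
  qed (use y0 in auto)
qed

text \<open>Normalisation is applied to the special fibre, where three surviving variables would
  yield a forbidden chain. Nakayama's lemma then removes \<open>\<pi>\<close> from the covering
  ideal, so that the same two variables are parameters over the whole base.\<close>

lemma exists_parameters:
  assumes F: "\<forall>f\<in>F. \<exists>d. homogeneous d f"
    and no_chain: "\<And>y0 y1 y2. y0 \<in> points F \<Longrightarrow> y1 \<in> points F \<Longrightarrow> y2 \<in> points F \<Longrightarrow> y0 \<subset> y1 \<Longrightarrow> y1 \<subset> y2 \<Longrightarrow>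
      pconst \<pi> \<in> y0 \<Longrightarrow> False"
  obtains l l' a b N where "coord_change l l'" "a \<noteq> b" "covers (vimage_coords l (ideal_of F)) {pvar a, pvar b} N"
proof -
  define J where "J = ideal_of (insert (pconst \<pi>) (ideal_of F))"
  have gI: "graded (ideal_of F)" using F by (intro graded_ideal_of) blast
  have gJ: "graded J" unfolding J_def by (rule graded_insert[OF gI homogeneous_pconst])
  obtain l l' a b N where l: "coord_change l l'" and ab: "a \<noteq> b" and cov: "covers (vimage_coords l J) {pvar a, pvar b} N"
  proof (cases "1 \<in> J")
    \<comment> \<open>When J is the unit ideal, any two distinct variables cover it already in
      degree 0.\<close>
    case True
    then have "f \<in> J" for f using ideal_mult[OF gradedD(1)[OF gJ], of 1 f] by simp
    then have "covers (vimage_coords pvar J) {pvar 0, pvar 1} 0" unfolding covers_def by (auto intro: ideal_of_base)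
    then show ?thesis using that coord_change_id by (metis zero_neq_one)
  next
    case False
    obtain A l l' N where l: "coord_change l l'" and cov: "covers (vimage_coords l J) (pvar ` A) N"
      and disj: "vimage_coords l J \<inter> unit_forms A = {}"
      by (rule noether_normalisation[OF gJ False])
    have gl: "graded (vimage_coords l J)" using l by (intro graded_vimage_psubst[OF gJ]) (simp add: coord_change_def)
    have pl: "pconst \<pi> \<in> vimage_coords l J" unfolding J_def by (simp add: ideal_of_base)
    have "\<not> 3 \<le> card A"
    proof
      assume "3 \<le> card A"
      from exists_chain[OF gl pl disj this] obtain y0 y1 y2 where
        y: "homogeneous_prime y0" "homogeneous_prime y1" "homogeneous_prime y2" "vimage_coords l J \<subseteq> y0" "y0 \<subset> y1" "y1 \<subset> y2" "\<not> range pvar \<subseteq> y2" .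
      have l': "coord_change l' l" using l by (rule coord_change_sym)
      have J0: "J \<subseteq> vimage_coords l' y0" using y(4) by (auto simp: coord_change_inverse[OF l])
      have strict: "vimage_coords l' z \<subset> vimage_coords l' w" if zw: "z \<subset> w" for z w
      proof -
        obtain f where f: "f \<in> w" "f \<notin> z" using zw by blast
        then have "psubst l f \<in> vimage_coords l' w" "psubst l f \<notin> vimage_coords l' z" by (simp_all add: coord_change_inverse[OF l])
        then show ?thesis using zw by blast
      qed
      have nv: "\<not> range pvar \<subseteq> vimage_coords l' y2"
        using variables_vimage[OF l'] y(3,7) by (auto simp: homogeneous_prime_def)
      have F': "F \<subseteq> vimage_coords l' y0" "pconst \<pi> \<in> vimage_coords l' y0"
        using J0 ideal_of_superset[of F] ideal_of_superset[of "insert (pconst \<pi>) (ideal_of F)"] unfolding J_def by auto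
      have "vimage_coords l' y0 \<in> points F" "vimage_coords l' y1 \<in> points F" "vimage_coords l' y2 \<in> points F"
        using homogeneous_prime_vimage[OF l'] y(1-3) F' nv strict[OF y(5)] strict[OF y(6)] unfolding points_def by blast+
      then show False using no_chain strict[OF y(5)] strict[OF y(6)] F'(2) by blast
    qed
    then have "card A \<le> 2" by simp
    \<comment> \<open>Fewer than two surviving variables are padded to two; adding forms preserves
      covering.\<close>
    then obtain B where B: "A \<subseteq> B" "card B = 2"
      using exists_subset_between[of A 2 UNIV] by auto
    then obtain a b where "B = {a, b}" "a \<noteq> b" by (auto simp: card_2_iff)
    moreover have "covers (vimage_coords l J) (pvar ` B) N"
      using B(1) ideal_of_superset[of "vimage_coords l J \<union> pvar ` B"] by (intro covers_mono[OF cov]) auto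
    ultimately show ?thesis using that[OF l] by simp
  qed
  define V where "V = ideal_of (vimage_coords l (ideal_of F) \<union> {pvar a, pvar b})"
  have gV: "graded V"
    unfolding V_def using l homogeneous_pvar
    by (intro graded_ideal_Union graded_vimage_psubst[OF gI]) (auto simp: coord_change_def intro: exI[of _ "Suc 0"])
  note idV = gradedD(1)[OF gV]
  \<comment> \<open>The monomials of degree N are finitely many and generate all forms of that
    degree, as Nakayama's lemma requires.\<close>
  define S where "S = (\<lambda>m. Poly_Mapping.single m (1::'r)) ` {m. mdeg m = N}"
  have fin: "finite {m. mdeg m = N}" by (rule finite_subset[OF _ finite_mdeg_le[of N]]) auto
  have inj: "inj_on (\<lambda>m. Poly_Mapping.single m (1::'r)) {m. mdeg m = N}"
    by (rule inj_onI) (metis keys_single one_neq_zero singleton_inject)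
  have "S \<subseteq> V"
  proof (rule nakayama)
    show "finite S" unfolding S_def using fin by simp
    fix s assume "s \<in> S"
    then obtain m where m: "s = Poly_Mapping.single m 1" "mdeg m = N" unfolding S_def by blast
    have "ideal_of (vimage_coords l J \<union> {pvar a, pvar b}) \<subseteq> ideal_of (insert (pconst \<pi>) V)"
    proof (rule ideal_of_least)
      have "vimage_coords l J \<subseteq> ideal_of (insert (pconst \<pi>) V)"
      proof clarify
        fix g assume "psubst l g \<in> J"
        then obtain c f where cf: "psubst l g = c * pconst \<pi> + f" "f \<in> ideal_of F" unfolding J_def is_ideal_plus_principal[OF is_ideal_ideal_of] by blast
        have "psubst l (psubst l' f) \<in> ideal_of F" using cf(2) by (simp add: coord_change_inverse[OF l])
        then have "psubst l' f \<in> V" unfolding V_def by (intro ideal_of_base) simp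
        moreover have "g = psubst l' c * pconst \<pi> + psubst l' f"
          using arg_cong[OF cf(1), of "psubst l'"] by (simp add: coord_change_inverse[OF l] psubst_add psubst_mult)
        ultimately show "g \<in> ideal_of (insert (pconst \<pi>) V)" unfolding is_ideal_plus_principal[OF idV] by blast
      qed
      moreover have "{pvar a, pvar b} \<subseteq> ideal_of (insert (pconst \<pi>) V)"
        using ideal_of_superset[of "insert (pconst \<pi>) V"] ideal_of_superset[of "vimage_coords l (ideal_of F) \<union> {pvar a, pvar b}"]
        unfolding V_def by blast
      ultimately show "vimage_coords l J \<union> {pvar a, pvar b} \<subseteq> ideal_of (insert (pconst \<pi>) V)" by blast
    qed simp
    then have "s \<in> ideal_of (insert (pconst \<pi>) V)" using cov m unfolding covers_def by blast
    then obtain c f where cf: "s = c * pconst \<pi> + f" "f \<in> V" unfolding is_ideal_plus_principal[OF idV] by blast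
    \<comment> \<open>Comparing components of degree N turns the arbitrary multiplier of
      \<open>\<pi>\<close> into a combination of the monomials in S.\<close>
    have hs: "homogeneous N s" using homogeneous_single[of m "1::'r"] m by simp
    have "s = hcomp N (pconst \<pi> * c + f)" using hcomp_homogeneous[OF hs, of N] cf(1) by (simp add: mult.commute)
    then have s: "s = pconst \<pi> * hcomp N c + hcomp N f" by (simp add: hcomp_add hcomp_pconst_mult)
    define r where "r t = Poly_Mapping.lookup c (the_inv_into {m. mdeg m = N} (\<lambda>m. Poly_Mapping.single m (1::'r)) t)" for t
    have "(\<Sum>t\<in>S. pconst (r t) * t) = (\<Sum>m\<in>{m. mdeg m = N}. pconst (r (Poly_Mapping.single m 1)) * Poly_Mapping.single m 1)"
      unfolding S_def by (rule sum.reindex_cong[OF inj]) auto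
    also have "\<dots> = (\<Sum>m\<in>{m. mdeg m = N}. Poly_Mapping.single m (Poly_Mapping.lookup c m))"
      by (intro sum.cong) (auto simp: r_def the_inv_into_f_f[OF inj] pconst_mult_single)
    also have "\<dots> = hcomp N c"
      by (rule poly_mapping_eqI) (simp add: lookup_sum lookup_single when_def lookup_hcomp fin)
    finally have "s - pconst \<pi> * (\<Sum>t\<in>S. pconst (r t) * t) = hcomp N f" by (subst s) simp
    then have "s - pconst \<pi> * (\<Sum>t\<in>S. pconst (r t) * t) \<in> V" using gradedD(2)[OF gV cf(2)] by simp
    then show "\<exists>c. s - pconst \<pi> * (\<Sum>t\<in>S. pconst (c t) * t) \<in> V" by (rule exI[of _ r])
  qed (use ideal_0[OF idV] ideal_add[OF idV] ideal_mult[OF idV] in auto)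
  then have "covers (vimage_coords l (ideal_of F)) {pvar a, pvar b} N"
    unfolding covers_def S_def V_def by blast
  then show ?thesis using that l ab by blast
qed

end

section \<open>Regular sequences with prescribed top forms\<close>

text \<open>Below, the weight of a polynomial is its degree in the variables in B.\<close>

definition wle :: "5 set \<Rightarrow> nat \<Rightarrow> 'r::comm_ring_1 poly5 \<Rightarrow> bool" where
  "wle B n f \<longleftrightarrow> (\<forall>m\<in>Poly_Mapping.keys f. (\<Sum>i\<in>B. Poly_Mapping.lookup m i) \<le> n)"

definition wlt :: "5 set \<Rightarrow> nat \<Rightarrow> 'r::comm_ring_1 poly5 \<Rightarrow> bool" where
  "wlt B n f \<longleftrightarrow> (\<forall>m\<in>Poly_Mapping.keys f. (\<Sum>i\<in>B. Poly_Mapping.lookup m i) < n)"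

lemma wlt_imp_wle: "wlt B n f \<Longrightarrow> wle B n f"
  by (auto simp: wle_def wlt_def)

lemma wle_imp_wlt: "wle B n f \<Longrightarrow> n < p \<Longrightarrow> wlt B p f"
  by (auto simp: wle_def wlt_def)

lemma wlt_0 [simp]: "wlt B n 0" and wle_0 [simp]: "wle B n 0"
  by (simp_all add: wlt_def wle_def)

lemma wlt_add: "wlt B n f \<Longrightarrow> wlt B n g \<Longrightarrow> wlt B n (f + g)"
  using Poly_Mapping.keys_add[of f g] by (auto simp: wlt_def)

lemma wle_add: "wle B n f \<Longrightarrow> wle B n g \<Longrightarrow> wle B n (f + g)"
  using Poly_Mapping.keys_add[of f g] by (auto simp: wle_def)

lemma wlt_uminus: "wlt B n f \<Longrightarrow> wlt B n (- f)"
  by (simp add: wlt_def)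

lemma wlt_sum: "(\<And>i. i \<in> S \<Longrightarrow> wlt B n (f i)) \<Longrightarrow> wlt B n (sum f S)"
  by (induction S rule: infinite_finite_induct) (auto intro: wlt_add)

lemma wle_mult: "wle B p f \<Longrightarrow> wle B q g \<Longrightarrow> wle B (p + q) (f * g)"
  using Poly_Mapping.keys_mult[of f g] by (fastforce simp: wle_def lookup_add sum.distrib intro: add_mono)

lemma wlt_mult:
  assumes "wle B p f" "wlt B q g"
  shows "wlt B (p + q) (f * g)"
  unfolding wlt_def
proof
  fix m assume "m \<in> Poly_Mapping.keys (f * g)"
  then obtain a b where ab: "m = a + b" "a \<in> Poly_Mapping.keys f" "b \<in> Poly_Mapping.keys g"
    using Poly_Mapping.keys_mult[of f g] by blast
  then have "(\<Sum>i\<in>B. Poly_Mapping.lookup a i) \<le> p" "(\<Sum>i\<in>B. Poly_Mapping.lookup b i) < q"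
    using assms by (auto simp: wle_def wlt_def)
  then show "(\<Sum>i\<in>B. Poly_Mapping.lookup m i) < p + q" by (simp add: ab(1) lookup_add sum.distrib)
qed

lemma wle_homogeneous:
  assumes "homogeneous n f"
  shows "wle B n f"
  unfolding wle_def
proof
  fix m assume "m \<in> Poly_Mapping.keys f"
  then have "mdeg m = n" using assms by (simp add: homogeneous_def)
  moreover have "(\<Sum>i\<in>B. Poly_Mapping.lookup m i) \<le> mdeg m" by (rule sum_mono2) auto
  ultimately show "(\<Sum>i\<in>B. Poly_Mapping.lookup m i) \<le> n" by simp
qed

lemma wle_pvar_outside: "a \<notin> B \<Longrightarrow> wle B 0 (pvar a)"
  by (auto simp: wle_def pvar_def lookup_single when_def)

lemma wle_power: "wle B p f \<Longrightarrow> wle B (n * p) (f ^ n)"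
proof (induction n)
  case 0
  then show ?case by (simp add: wle_def)
qed (simp add: wle_mult)

text \<open>Equality of the parts of weight n without extracting them. The relation is
  multiplicative, so the top form of a product follows from those of its factors.\<close>

definition wcong :: "5 set \<Rightarrow> nat \<Rightarrow> 'r::comm_ring_1 poly5 \<Rightarrow> 'r poly5 \<Rightarrow> bool" where
  "wcong B n f g \<longleftrightarrow> wle B n f \<and> wle B n g \<and> wlt B n (f - g)"

lemma wcong_refl: "wle B n f \<Longrightarrow> wcong B n f f"
  by (simp add: wcong_def)

lemma wcong_mult:
  assumes "wcong B p f f'" "wcong B q g g'"
  shows "wcong B (p + q) (f * g) (f' * g')"
proof -
  have "f * g - f' * g' = f * (g - g') + g' * (f - f')" by (simp add: algebra_simps)
  moreover have "wlt B (p + q) (f * (g - g'))" "wlt B (q + p) (g' * (f - f'))"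
    using assms by (auto simp: wcong_def intro: wlt_mult)
  ultimately show ?thesis using assms by (auto simp: wcong_def add.commute intro: wle_mult wlt_add)
qed

lemma wcong_power: "wcong B p f g \<Longrightarrow> wcong B (n * p) (f ^ n) (g ^ n)"
proof (induction n)
  case 0
  then show ?case by (simp add: wcong_def wle_def)
qed (simp add: wcong_mult)

lemma wcong_prod:
  "finite S \<Longrightarrow> (\<And>i. i \<in> S \<Longrightarrow> wcong B (p i) (f i) (g i)) \<Longrightarrow> wcong B (sum p S) (prod f S) (prod g S)"
proof (induction S rule: finite_induct)
  case empty
  then show ?case by (simp add: wcong_def wle_def)
qed (simp add: wcong_mult)

locale top_forms =
  fixes B :: "5 set" and M :: nat and H :: "5 \<Rightarrow> 'r::comm_ring_1 poly5"
  assumes M: "M > 0" and H: "\<And>i. i \<in> B \<Longrightarrow> wcong B M (H i) (pvar i ^ M)"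
begin

text \<open>Exponents of the variables in B are divided with remainder by M, and \<open>H i\<close>
  replaces each full factor \<open>pvar i ^ M\<close>. In this way the polynomial ring is free over
  the \<open>H i\<close> on the same basis as over the powers \<open>pvar i ^ M\<close>.\<close>

definition lift :: "(5 \<Rightarrow>\<^sub>0 nat) \<Rightarrow> 'r poly5" where
  "lift m = (\<Prod>i\<in>UNIV. if i \<in> B then pvar i ^ (Poly_Mapping.lookup m i mod M) * H i ^ (Poly_Mapping.lookup m i div M)
     else pvar i ^ Poly_Mapping.lookup m i)"

abbreviation wt :: "(5 \<Rightarrow>\<^sub>0 nat) \<Rightarrow> nat" where
  "wt m \<equiv> (\<Sum>i\<in>B. Poly_Mapping.lookup m i)"

lemma lift_wcong: "wlt B (wt m) (lift m - Poly_Mapping.single m 1)"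
proof -
  let ?w = "\<lambda>i. if i \<in> B then Poly_Mapping.lookup m i else 0"
  have "wcong B (sum ?w UNIV) (lift m) (\<Prod>i\<in>UNIV. pvar i ^ Poly_Mapping.lookup m i)"
    unfolding lift_def
  proof (rule wcong_prod)
    fix i :: 5
    show "wcong B (?w i) (if i \<in> B then pvar i ^ (Poly_Mapping.lookup m i mod M) * H i ^ (Poly_Mapping.lookup m i div M)
        else pvar i ^ Poly_Mapping.lookup m i) (pvar i ^ Poly_Mapping.lookup m i)"
    proof (cases "i \<in> B")
      case True
      let ?k = "Poly_Mapping.lookup m i"
      have "wcong B (?k mod M * 1) (pvar i ^ (?k mod M)) (pvar i ^ (?k mod M) :: 'r poly5)"
        by (intro wcong_refl wle_power wle_homogeneous homogeneous_pvar)
      then have "wcong B (?k mod M * 1 + ?k div M * M) (pvar i ^ (?k mod M) * H i ^ (?k div M))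
          (pvar i ^ (?k mod M) * (pvar i ^ M) ^ (?k div M))"
        by (rule wcong_mult[OF _ wcong_power[OF H[OF True]]])
      moreover have "?k mod M * 1 + ?k div M * M = ?k" by simp
      moreover have "pvar i ^ (?k mod M) * (pvar i ^ M) ^ (?k div M) = (pvar i ^ ?k :: 'r poly5)"
        by (simp flip: power_mult power_add)
      ultimately show ?thesis using True by simp
    next
      case False
      then have "wle B (Poly_Mapping.lookup m i * 0) (pvar i ^ Poly_Mapping.lookup m i :: 'r poly5)"
        by (intro wle_power wle_pvar_outside)
      then show ?thesis using False by (simp add: wcong_refl)
    qed
  qed simp
  moreover have "sum ?w UNIV = wt m" by (simp add: sum.If_cases)
  moreover have "(\<Prod>i\<in>UNIV. pvar i ^ Poly_Mapping.lookup m i) = Poly_Mapping.single m (1::'r)"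
    by (simp add: single_eq_prod_pvar)
  ultimately show ?thesis by (simp add: wcong_def)
qed

text \<open>\<open>mlin lift\<close> is the identity up to terms of smaller weight, hence
  unitriangular for the filtration by weight. Looking at the largest weight gives injectivity, and
  induction on the weight gives surjectivity.\<close>

lemma mlin_lift_diff:
  assumes "wle B n f"
  shows "wlt B n (mlin lift f - f)"
proof -
  have "mlin lift f - f = (\<Sum>m\<in>Poly_Mapping.keys f. pconst (Poly_Mapping.lookup f m) * (lift m - Poly_Mapping.single m 1))"
  proof -
    have "f = mlin (\<lambda>m. Poly_Mapping.single m 1) f" by (simp add: mlin_monomials)
    then have "mlin lift f - f = mlin lift f - mlin (\<lambda>m. Poly_Mapping.single m 1) f" by simp
    then show ?thesis by (simp add: mlin_def sum_subtractf right_diff_distrib)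
  qed
  also have "wlt B n \<dots>"
  proof (rule wlt_sum)
    fix m assume "m \<in> Poly_Mapping.keys f"
    then have "wt m \<le> n" using assms by (simp add: wle_def)
    moreover have "wlt B (0 + wt m) (pconst (Poly_Mapping.lookup f m) * (lift m - Poly_Mapping.single m 1))"
      by (intro wlt_mult wle_homogeneous homogeneous_pconst lift_wcong)
    ultimately show "wlt B n (pconst (Poly_Mapping.lookup f m) * (lift m - Poly_Mapping.single m 1))"
      by (auto simp: wlt_def)
  qed
  finally show ?thesis .
qed

lemma mlin_lift_inj:
  assumes "mlin lift f = 0"
  shows "f = 0"
proof (rule ccontr)
  assume "f \<noteq> 0"
  then have ne: "Poly_Mapping.keys f \<noteq> {}" by simp
  let ?n = "Max (wt ` Poly_Mapping.keys f)"
  obtain m where m: "m \<in> Poly_Mapping.keys f" "wt m = ?n"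
    using Max_in[of "wt ` Poly_Mapping.keys f"] ne by fastforce
  have "wle B ?n f" unfolding wle_def by simp
  then have "wlt B ?n (- f)" using mlin_lift_diff assms by fastforce
  then show False using m by (auto simp: wlt_def)
qed

lemma mlin_lift_surj: "\<exists>g. mlin lift g = f"
proof -
  have "wlt B n f \<Longrightarrow> \<exists>g. mlin lift g = f" for n f
  proof (induction n arbitrary: f)
    case 0
    then have "f = 0" by (auto simp: wlt_def)
    then show ?case by (intro exI[of _ 0]) simp
  next
    case (Suc n)
    then have "wle B n f" by (auto simp: wlt_def wle_def)
    then have "wlt B n (- (mlin lift f - f))" by (intro wlt_uminus mlin_lift_diff)
    then obtain g where "mlin lift g = f - mlin lift f" using Suc.IH by fastforce
    then have "mlin lift (g + f) = f" by (simp add: mlin_add)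
    then show ?case by blast
  qed
  moreover have "wlt B (Suc (Max (insert 0 (wt ` Poly_Mapping.keys f)))) f"
    by (auto simp: wlt_def less_Suc_eq_le)
  ultimately show ?thesis by blast
qed

text \<open>Adding M to an exponent keeps its remainder and increases its quotient by one.\<close>

lemma mlin_lift_power:
  assumes b: "b \<in> B"
  shows "mlin lift (pvar b ^ M * f) = H b * mlin lift f"
proof (induction f rule: poly5_induct)
  case (single m c)
  have "lift (Poly_Mapping.single b M + m) = H b * lift m"
  proof -
    let ?F = "\<lambda>m i. if i \<in> B then pvar i ^ (Poly_Mapping.lookup m i mod M) * H i ^ (Poly_Mapping.lookup m i div M)
     else pvar i ^ Poly_Mapping.lookup m i"
    have "lift (Poly_Mapping.single b M + m) = ?F (Poly_Mapping.single b M + m) b * (\<Prod>i\<in>UNIV - {b}. ?F (Poly_Mapping.single b M + m) i)"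
      unfolding lift_def by (rule prod.remove) auto
    also have "(\<Prod>i\<in>UNIV - {b}. ?F (Poly_Mapping.single b M + m) i) = (\<Prod>i\<in>UNIV - {b}. ?F m i)"
      by (intro prod.cong) (auto simp: lookup_add lookup_single when_def)
    also have "?F (Poly_Mapping.single b M + m) b = H b * ?F m b"
      using M b by (simp add: lookup_add mult_ac)
    also have "H b * ?F m b * (\<Prod>i\<in>UNIV - {b}. ?F m i) = H b * (?F m b * (\<Prod>i\<in>UNIV - {b}. ?F m i))"
      by (simp only: mult.assoc)
    also have "?F m b * (\<Prod>i\<in>UNIV - {b}. ?F m i) = lift m"
      unfolding lift_def by (rule prod.remove[symmetric]) auto
    finally show ?thesis .
  qed
  then show ?case by (simp add: pvar_power mult_single mult.left_commute)
qed (simp_all add: distrib_left mlin_add)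

lemma powers_ideal_iff:
  "(f :: 'r poly5) \<in> ideal_of ((\<lambda>i. pvar i ^ M) ` S) \<longleftrightarrow> (\<forall>m\<in>Poly_Mapping.keys f. \<exists>i\<in>S. M \<le> Poly_Mapping.lookup m i)"
proof
  let ?I = "{f :: 'r poly5. \<forall>m\<in>Poly_Mapping.keys f. \<exists>i\<in>S. M \<le> Poly_Mapping.lookup m i}"
  have "is_ideal ?I"
  proof (rule is_idealI)
    fix a b assume "a \<in> ?I" "b \<in> ?I"
    then show "a + b \<in> ?I" using Poly_Mapping.keys_add[of a b] by blast
  next
    fix c a assume a: "a \<in> ?I"
    show "c * a \<in> ?I"
    proof (intro CollectI ballI)
      fix m assume "m \<in> Poly_Mapping.keys (c * a)"
      then obtain m1 m2 where m: "m = m1 + m2" "m2 \<in> Poly_Mapping.keys a" using Poly_Mapping.keys_mult[of c a] by blast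
      then obtain i where "i \<in> S" "M \<le> Poly_Mapping.lookup m2 i" using a by blast
      then show "\<exists>i\<in>S. M \<le> Poly_Mapping.lookup m i" using m by (intro bexI[of _ i]) (auto simp: lookup_add)
    qed
  qed simp
  moreover have "(\<lambda>i. pvar i ^ M) ` S \<subseteq> ?I" by (force simp: pvar_power lookup_single)
  ultimately have sub: "ideal_of ((\<lambda>i. pvar i ^ M) ` S) \<subseteq> ?I" by (rule ideal_of_least)
  assume "f \<in> ideal_of ((\<lambda>i. pvar i ^ M) ` S)"
  then have "f \<in> ?I" using sub by (rule rev_subsetD)
  then show "\<forall>m\<in>Poly_Mapping.keys f. \<exists>i\<in>S. M \<le> Poly_Mapping.lookup m i" by simp
next
  assume f: "\<forall>m\<in>Poly_Mapping.keys f. \<exists>i\<in>S. M \<le> Poly_Mapping.lookup m i"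
  have "(\<Sum>m\<in>Poly_Mapping.keys f. Poly_Mapping.single m (Poly_Mapping.lookup f m)) \<in> ideal_of ((\<lambda>i. pvar i ^ M) ` S)"
  proof (rule ideal_sum[OF is_ideal_ideal_of])
    fix m assume "m \<in> Poly_Mapping.keys f"
    then obtain i where i: "i \<in> S" "M \<le> Poly_Mapping.lookup m i" using f by blast
    have "m = Poly_Mapping.single i M + (m - Poly_Mapping.single i M)"
      using i(2) by (intro poly_mapping_eqI) (auto simp: lookup_add lookup_minus lookup_single when_def)
    then have "Poly_Mapping.single m (Poly_Mapping.lookup f m) =
        Poly_Mapping.single (m - Poly_Mapping.single i M) (Poly_Mapping.lookup f m) * pvar i ^ M"
      by (simp add: pvar_power mult_single add.commute)
    moreover have "pvar i ^ M \<in> ideal_of ((\<lambda>i. pvar i ^ M :: 'r poly5) ` S)" using i(1) by (intro ideal_of_base) simp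
    ultimately show "Poly_Mapping.single m (Poly_Mapping.lookup f m) \<in> ideal_of ((\<lambda>i. pvar i ^ M) ` S)"
      using ideal_mult[OF is_ideal_ideal_of] by simp
  qed
  then show "f \<in> ideal_of ((\<lambda>i. pvar i ^ M) ` S)" by (simp flip: poly5_eq_sum_singles)
qed

lemma mlin_lift_ideal:
  assumes S: "S \<subseteq> B"
  shows "mlin lift f \<in> ideal_of (H ` S) \<longleftrightarrow> f \<in> ideal_of ((\<lambda>i. pvar i ^ M) ` S)"
proof
  assume "mlin lift f \<in> ideal_of (H ` S)"
  then obtain c where "mlin lift f = (\<Sum>i\<in>S. c i * H i)" unfolding ideal_of_image[OF finite] by blast
  moreover have "\<forall>i. \<exists>g. mlin lift g = c i" using mlin_lift_surj by blast
  then obtain c' where c': "\<And>i. mlin lift (c' i) = c i" by metis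
  ultimately have "mlin lift f = (\<Sum>i\<in>S. H i * mlin lift (c' i))" by (simp add: mult.commute)
  also have "\<dots> = (\<Sum>i\<in>S. mlin lift (pvar i ^ M * c' i))" using S by (intro sum.cong) (auto simp: mlin_lift_power)
  finally have "mlin lift (f - (\<Sum>i\<in>S. pvar i ^ M * c' i)) = 0" by (simp add: mlin_diff mlin_sum)
  then have "f = (\<Sum>i\<in>S. pvar i ^ M * c' i)" using mlin_lift_inj by fastforce
  also have "\<dots> \<in> ideal_of ((\<lambda>i. pvar i ^ M) ` S)"
  proof (rule ideal_sum[OF is_ideal_ideal_of])
    fix i assume "i \<in> S"
    then have "pvar i ^ M \<in> ideal_of ((\<lambda>i. pvar i ^ M :: 'r poly5) ` S)" by (intro ideal_of_base) simp
    then show "pvar i ^ M * c' i \<in> ideal_of ((\<lambda>i. pvar i ^ M) ` S)" by (rule ideal_mult_right[OF is_ideal_ideal_of])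
  qed
  finally show "f \<in> ideal_of ((\<lambda>i. pvar i ^ M) ` S)" .
next
  assume "f \<in> ideal_of ((\<lambda>i. pvar i ^ M) ` S)"
  then obtain c where "f = (\<Sum>i\<in>S. pvar i ^ M * c i)" unfolding ideal_of_image[OF finite] by (auto simp: mult.commute)
  then have "mlin lift f = (\<Sum>i\<in>S. H i * mlin lift (c i))" using S by (auto simp: mlin_sum mlin_lift_power intro!: sum.cong)
  also have "\<dots> \<in> ideal_of (H ` S)"
  proof (rule ideal_sum[OF is_ideal_ideal_of])
    fix i assume "i \<in> S"
    then have "H i \<in> ideal_of (H ` S)" by (intro ideal_of_base) simp
    then show "H i * mlin lift (c i) \<in> ideal_of (H ` S)" by (rule ideal_mult_right[OF is_ideal_ideal_of])
  qed
  finally show "mlin lift f \<in> ideal_of (H ` S)" .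
qed

text \<open>The bijection \<open>mlin lift\<close> turns multiplication by \<open>H\<^sub>i\<close> into multiplication by \<open>x\<^sub>i ^ M\<close>.\<close>

lemma regular:
  assumes S: "S \<subseteq> B" and b: "b \<in> B - S" and a: "a * H b \<in> ideal_of (H ` S)"
  shows "a \<in> ideal_of (H ` S)"
proof -
  obtain a' where a': "mlin lift a' = a" using mlin_lift_surj by blast
  have "mlin lift (pvar b ^ M * a') = a * H b" using b mlin_lift_power[of b a'] by (simp add: a' mult.commute[of a])
  then have *: "pvar b ^ M * a' \<in> ideal_of ((\<lambda>i. pvar i ^ M) ` S)" using a mlin_lift_ideal[OF S] by metis
  have "\<exists>i\<in>S. M \<le> Poly_Mapping.lookup m i" if m: "m \<in> Poly_Mapping.keys a'" for m
  proof -
    have "Poly_Mapping.lookup (pvar b ^ M * f) (Poly_Mapping.single b M + m) = Poly_Mapping.lookup f m" for f :: "'r poly5"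
      by (induction f rule: poly5_induct)
        (simp_all add: distrib_left lookup_add pvar_power mult_single lookup_single when_def)
    then have "Poly_Mapping.single b M + m \<in> Poly_Mapping.keys (pvar b ^ M * a')" using m by (simp add: in_keys_iff)
    then obtain i where "i \<in> S" "M \<le> Poly_Mapping.lookup (Poly_Mapping.single b M + m) i"
      using * unfolding powers_ideal_iff by blast
    moreover have "i \<noteq> b" using \<open>i \<in> S\<close> b by blast
    ultimately show ?thesis by (intro bexI[of _ i]) (auto simp: lookup_add lookup_single when_def)
  qed
  then have "a' \<in> ideal_of ((\<lambda>i. pvar i ^ M) ` S)" unfolding powers_ideal_iff by blast
  then show ?thesis using mlin_lift_ideal[OF S] a' by blast
qed

end

section \<open>Local complete intersections\<close>

lemma cramer_3:
  fixes p1 p2 p3 :: "'a::comm_ring_1"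
  assumes "e1 = n11 * p1 + n12 * p2 + n13 * p3" "e2 = n21 * p1 + n22 * p2 + n23 * p3" "e3 = n31 * p1 + n32 * p2 + n33 * p3"
  defines "D \<equiv> n11 * (n22 * n33 - n23 * n32) - n12 * (n21 * n33 - n23 * n31) + n13 * (n21 * n32 - n22 * n31)"
  shows "D * p1 = (n22 * n33 - n23 * n32) * e1 - (n12 * n33 - n13 * n32) * e2 + (n12 * n23 - n13 * n22) * e3"
    "D * p2 = - (n21 * n33 - n23 * n31) * e1 + (n11 * n33 - n13 * n31) * e2 - (n11 * n23 - n13 * n21) * e3"
    "D * p3 = (n21 * n32 - n22 * n31) * e1 - (n11 * n32 - n12 * n31) * e2 + (n11 * n22 - n12 * n21) * e3"
  unfolding assms by (simp_all add: algebra_simps)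

lemma ideal_of_3:
  "ideal_of {a, b, c :: 'a::comm_ring_1} = {x * a + y * b + z * c | x y z. True}"
  by (simp add: ideal_of_insert) (auto simp: add.assoc, metis add.assoc)

text \<open>The Pfaffians have no control over their top forms, so elements of I with known top
  forms are added. Squares are taken because one factor of \<open>\<gamma> i * \<gamma> i\<close> is
  rewritten in the Pfaffians near x, and the other stays as a coefficient lying in x. The passage
  from the Pfaffians to the new elements is thus a scalar matrix modulo x and remains invertible
  there.\<close>

lemma regular_sequence_at_point:
  fixes F :: "'r::comm_ring_1 poly5 set"
  assumes F: "\<forall>f\<in>F. \<exists>d. homogeneous d f" and x: "x \<in> points F"
    and l: "coord_change l l'" and ab: "a \<noteq> b" and cov0: "covers (vimage_coords l (ideal_of F)) {pvar a, pvar b} N0"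
    and p: "homogeneous 2 p1" "homogeneous 2 p2" "homogeneous 2 p3" "p1 \<in> ideal_of F" "p2 \<in> ideal_of F" "p3 \<in> ideal_of F"
    and s: "s \<notin> x" "\<And>f. f \<in> ideal_of F \<Longrightarrow> s * f \<in> ideal_of {p1, p2, p3}"
  shows "\<exists>fs. regular_sequence (stalk {} x) fs \<and> germ {} x ` ideal_fractions_at F x = genideal (stalk {} x) (set fs)"
proof -
  interpret homogeneous_point "{}" x using pointsD(1)[OF x] by unfold_locales
  let ?I = "ideal_of F"
  have gI: "graded ?I" using F by (intro graded_ideal_of) blast
  have Ix: "?I \<subseteq> x" by (rule pointsD(4)[OF x])
  \<comment> \<open>\<open>N > 1\<close> makes the weight 2 of a Pfaffian smaller than the weight
    \<open>2 * N\<close> of the square, and it makes the coefficients of degree \<open>N - 1\<close>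
    available.\<close>
  define N where "N = Suc (Suc N0)"
  have cov: "covers (vimage_coords l ?I) {pvar a, pvar b} N" using covers_add[OF cov0, of 2] by (simp add: N_def)
  have gv: "graded (vimage_coords l ?I)" using l by (intro graded_vimage_psubst[OF gI]) (simp add: coord_change_def)
  obtain b1 b2 b3 where B: "- {a, b} = {b1, b2, b3}" "b1 \<noteq> b2" "b1 \<noteq> b3" "b2 \<noteq> b3"
  proof -
    have "card (- {a, b}) = 3" using ab by (simp add: Compl_eq_Diff_UNIV card_Diff_subset)
    then show ?thesis using that by (auto simp: card_3_iff)
  qed
  have "\<exists>g. homogeneous N g \<and> g \<in> vimage_coords l ?I \<and> wcong (- {a, b}) N g (pvar i ^ N)" for i
  proof -
    have h: "homogeneous N (pvar i ^ N :: 'r poly5)" using homogeneous_power[OF homogeneous_pvar, of N i] by simp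
    then have "pvar i ^ N \<in> ideal_of (vimage_coords l ?I \<union> {pvar a, pvar b})" by (rule covers_homogeneous[OF cov])
    then have "pvar i ^ N \<in> ideal_of (insert (pvar a) (insert (pvar b) (vimage_coords l ?I)))" by (simp add: Un_commute)
    then obtain c1 c2 g where g: "pvar i ^ N = c1 * pvar a + (c2 * pvar b + g)" "g \<in> vimage_coords l ?I"
      unfolding ideal_of_insert ideal_of_ideal[OF gradedD(1)[OF gv]] by blast
    have "pvar i ^ N = hcomp N (pvar a * c1 + (pvar b * c2 + g))" using hcomp_homogeneous[OF h, of N] g(1) by (simp add: mult.commute)
    then have eq: "pvar i ^ N = pvar a * hcomp (N - 1) c1 + (pvar b * hcomp (N - 1) c2 + hcomp N g)"
      by (simp add: hcomp_add hcomp_mult_homogeneous[OF homogeneous_pvar] N_def)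
    have "hcomp N g - pvar i ^ N = - (pvar a * hcomp (N - 1) c1 + pvar b * hcomp (N - 1) c2)" unfolding eq by simp
    moreover have "wle (- {a, b}) (0 + (N - 1)) (pvar a * hcomp (N - 1) c1)" "wle (- {a, b}) (0 + (N - 1)) (pvar b * hcomp (N - 1) c2)"
      by (intro wle_mult wle_pvar_outside wle_homogeneous homogeneous_hcomp; simp)+
    then have "wle (- {a, b}) (N - 1) (pvar a * hcomp (N - 1) c1 + pvar b * hcomp (N - 1) c2)" by (simp add: wle_add)
    then have "wlt (- {a, b}) N (- (pvar a * hcomp (N - 1) c1 + pvar b * hcomp (N - 1) c2))"
      by (intro wlt_uminus wle_imp_wlt) (auto simp: N_def)
    ultimately have "wcong (- {a, b}) N (hcomp N g) (pvar i ^ N)"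
      using wle_homogeneous[OF homogeneous_hcomp] wle_homogeneous[OF h] by (simp add: wcong_def)
    moreover have "hcomp N g \<in> vimage_coords l ?I" by (rule gradedD(2)[OF gv g(2)])
    ultimately show ?thesis using homogeneous_hcomp by blast
  qed
  then obtain g where g: "\<And>i. homogeneous N (g i)" "\<And>i. psubst l (g i) \<in> ?I" "\<And>i. wcong (- {a, b}) N (g i) (pvar i ^ N)" by simp metis
  \<comment> \<open>Otherwise x would contain all forms of degree N and, being prime, all
    variables.\<close>
  have "l a \<notin> x \<or> l b \<notin> x"
  proof (rule ccontr)
    assume "\<not> (l a \<notin> x \<or> l b \<notin> x)"
    then have "vimage_coords l ?I \<union> {pvar a, pvar b} \<subseteq> vimage_coords l x" using Ix by auto
    then have *: "ideal_of (vimage_coords l ?I \<union> {pvar a, pvar b}) \<subseteq> vimage_coords l x"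
      by (intro ideal_of_least ideal_vimage_psubst ideal_pp)
    have "pvar i \<in> x" for i
    proof -
      have "homogeneous N (psubst l' (pvar i ^ N))"
        using coord_change_homogeneous[OF coord_change_sym[OF l] homogeneous_power[OF homogeneous_pvar, of N i]] by simp
      then have "psubst l' (pvar i ^ N) \<in> vimage_coords l x" using covers_homogeneous[OF cov] * by blast
      then have "pvar i ^ N \<in> x" by (simp add: coord_change_inverse[OF l])
      then show ?thesis using notin_power by blast
    qed
    then show False using pointsD(3)[OF x] by blast
  qed
  then obtain z where z: "z = a \<or> z = b" "l z \<notin> x" by blast
  define p where "p i = (if i = b1 then p1 else if i = b2 then p2 else p3)" for i
  have p': "homogeneous 2 (p i)" "p i \<in> ?I" for i using p by (simp_all add: p_def)
  \<comment> \<open>Weight is the degree in the variables other than a and b, so the power of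
    \<open>pvar z\<close> has weight 0 and \<open>pvar i ^ (2 * N)\<close> is the top form. The
    exponent \<open>2 * N - 2\<close> makes both summands forms of degree
    \<open>2 * N\<close>.\<close>
  define H where "H i = pvar z ^ (2 * N - 2) * psubst l' (p i) + g i ^ 2" for i
  define G where "G i = psubst l (H i)" for i
  define \<gamma> where "\<gamma> i = psubst l (g i)" for i
  define y where "y = l z ^ (2 * N - 2)"
  have hp: "homogeneous 2 (psubst l' (p i))" for i by (rule coord_change_homogeneous[OF coord_change_sym[OF l] p'(1)])
  interpret tf: top_forms "- {a, b}" "2 * N" H
  proof
    show "0 < 2 * N" by (simp add: N_def)
    fix i
    have "wle (- {a, b}) ((2 * N - 2) * 0 + 2) (pvar z ^ (2 * N - 2) * psubst l' (p i))"
      using z(1) by (intro wle_mult wle_power wle_pvar_outside wle_homogeneous hp) auto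
    then have "wle (- {a, b}) 2 (pvar z ^ (2 * N - 2) * psubst l' (p i))" by (simp only: mult_0_right add_0)
    then have w: "wlt (- {a, b}) (2 * N) (pvar z ^ (2 * N - 2) * psubst l' (p i))"
      by (rule wle_imp_wlt) (simp add: N_def)
    have c: "wcong (- {a, b}) (2 * N) (g i ^ 2) ((pvar i ^ N) ^ 2)" by (rule wcong_power[OF g(3)])
    then have "wle (- {a, b}) (2 * N) (H i)"
      unfolding H_def using w by (intro wle_add wlt_imp_wle[OF w]) (auto simp: wcong_def)
    moreover have "wlt (- {a, b}) (2 * N) (H i - (pvar i ^ N) ^ 2)"
    proof -
      have eq: "H i - (pvar i ^ N) ^ 2 = pvar z ^ (2 * N - 2) * psubst l' (p i) + (g i ^ 2 - (pvar i ^ N) ^ 2)" by (simp add: H_def)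
      show ?thesis unfolding eq using w c by (intro wlt_add) (auto simp: wcong_def)
    qed
    ultimately show "wcong (- {a, b}) (2 * N) (H i) (pvar i ^ (2 * N))"
      using c by (simp add: wcong_def mult.commute flip: power_mult)
  qed
  have hG: "homogeneous (2 * N) (G i)" for i
  proof -
    have "homogeneous ((2 * N - 2) * 1 + 2) (pvar z ^ (2 * N - 2) * psubst l' (p i))"
      by (intro homogeneous_mult homogeneous_power homogeneous_pvar hp)
    then have "homogeneous (2 * N) (H i)"
      unfolding H_def using homogeneous_power[OF g(1), of 2 i] by (intro homogeneous_add) (simp_all add: N_def)
    then show ?thesis unfolding G_def by (rule coord_change_homogeneous[OF l])
  qed
  have G: "G i = y * p i + \<gamma> i * \<gamma> i" for i
    by (simp add: G_def H_def y_def \<gamma>_def psubst_add psubst_mult psubst_power coord_change_inverse[OF l] power2_eq_square)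
  have GI: "G i \<in> ?I" for i
    unfolding G \<gamma>_def using p'(2) g(2) by (intro ideal_add[OF is_ideal_ideal_of] ideal_mult[OF is_ideal_ideal_of])
  have regG: "c \<in> ideal_of (G ` S)" if S: "S \<subseteq> {b1, b2, b3}" "k \<in> {b1, b2, b3} - S" and c: "c * G k \<in> ideal_of (G ` S)" for c S k
  proof -
    have inv: "psubst l' (G i) = H i" for i unfolding G_def by (rule coord_change_inverse[OF l])
    have "psubst l' (c * G k) \<in> ideal_of (psubst l' ` G ` S)" using c by (rule ideal_of_psubst_image)
    then have cH: "psubst l' c * H k \<in> ideal_of (H ` S)" by (simp add: psubst_mult inv image_image)
    have "S \<subseteq> - {a, b}" "k \<in> - {a, b} - S" unfolding B(1) using S by auto
    from tf.regular[OF this cH] have "psubst l' c \<in> ideal_of (H ` S)" .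
    then have "psubst l (psubst l' c) \<in> ideal_of (psubst l ` H ` S)" by (rule ideal_of_psubst_image)
    then show ?thesis by (simp add: coord_change_inverse[OF l] image_image G_def)
  qed
  have "\<exists>r. \<forall>i. s * \<gamma> i = r i 1 * p1 + r i 2 * p2 + r i (3::nat) * p3"
  proof -
    have "\<forall>i. \<exists>r. s * \<gamma> i = r 1 * p1 + r 2 * p2 + r (3::nat) * p3"
    proof
      fix i
      obtain u v w where "s * \<gamma> i = u * p1 + v * p2 + w * p3"
        using s(2)[OF g(2)[of i]] unfolding \<gamma>_def ideal_of_3 by blast
      then show "\<exists>r. s * \<gamma> i = r 1 * p1 + r 2 * p2 + r (3::nat) * p3"
        by (intro exI[of _ "\<lambda>n. if n = 1 then u else if n = 2 then v else w"]) simp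
    qed
    then show ?thesis by metis
  qed
  then obtain r where r: "\<And>i. s * \<gamma> i = r i 1 * p1 + r i 2 * p2 + r i (3::nat) * p3" by blast
  have pb: "p b1 = p1" "p b2 = p2" "p b3 = p3" using B by (simp_all add: p_def)
  define n where "n i j = \<gamma> i * r i j" for i j
  have e: "s * G b1 = (s * y + n b1 1) * p1 + n b1 2 * p2 + n b1 3 * p3"
    "s * G b2 = n b2 1 * p1 + (s * y + n b2 2) * p2 + n b2 3 * p3"
    "s * G b3 = n b3 1 * p1 + n b3 2 * p2 + (s * y + n b3 3) * p3"
  proof -
    have "s * G i = s * y * p i + \<gamma> i * (s * \<gamma> i)" for i by (simp add: G algebra_simps)
    then show "s * G b1 = (s * y + n b1 1) * p1 + n b1 2 * p2 + n b1 3 * p3"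
      "s * G b2 = n b2 1 * p1 + (s * y + n b2 2) * p2 + n b2 3 * p3"
      "s * G b3 = n b3 1 * p1 + n b3 2 * p2 + (s * y + n b3 3) * p3"
      unfolding r by (simp_all add: pb n_def algebra_simps)
  qed
  \<comment> \<open>The determinant of the matrix that expresses the multiples \<open>s * G\<close>
    by the three Pfaffians. Its entries \<open>n i j\<close> contain a factor
    \<open>\<gamma> i\<close> from I, so modulo x it equals the cube of
    \<open>s * y\<close>.\<close>
  define D where "D = (s * y + n b1 1) * ((s * y + n b2 2) * (s * y + n b3 3) - n b2 3 * n b3 2) -
     n b1 2 * (n b2 1 * (s * y + n b3 3) - n b2 3 * n b3 1) + n b1 3 * (n b2 1 * n b3 2 - (s * y + n b2 2) * n b3 1)"
  have nx: "n i j \<in> x" for i j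
    unfolding n_def \<gamma>_def using g(2) Ix by (intro ideal_mult_right[OF ideal_pp]) auto
  have Dx: "D \<notin> x"
  proof
    assume "D \<in> x"
    have "D - (s * y) * ((s * y) * (s * y)) \<in> x"
    proof -
      have "D - (s * y) * ((s * y) * (s * y)) =
        n b1 1 * ((s * y + n b2 2) * (s * y + n b3 3) - n b2 3 * n b3 2) +
        (s * y) * (n b2 2 * (s * y + n b3 3) + s * y * n b3 3 - n b2 3 * n b3 2) -
        n b1 2 * (n b2 1 * (s * y + n b3 3) - n b2 3 * n b3 1) + n b1 3 * (n b2 1 * n b3 2 - (s * y + n b2 2) * n b3 1)"
        unfolding D_def by (simp add: algebra_simps)
      also have "\<dots> \<in> x" using nx
        by (intro ideal_add[OF ideal_pp] ideal_diff[OF ideal_pp] ideal_mult[OF ideal_pp] ideal_mult_right[OF ideal_pp])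
          (auto intro!: ideal_add[OF ideal_pp] ideal_diff[OF ideal_pp] ideal_mult[OF ideal_pp] ideal_mult_right[OF ideal_pp])
      finally show ?thesis .
    qed
    then have "(s * y) * ((s * y) * (s * y)) \<in> x" using \<open>D \<in> x\<close> ideal_diff_cong[OF ideal_pp] by blast
    then show False using s(1) notin_power[OF z(2)] unfolding y_def by (simp add: mult_mem_iff)
  qed
  let ?G = "ideal_of (G ` {b1, b2, b3})"
  have sG: "s * G b1 \<in> ?G" "s * G b2 \<in> ?G" "s * G b3 \<in> ?G"
    by (intro ideal_mult[OF is_ideal_ideal_of] ideal_of_base; simp)+
  have Dp: "D * p1 \<in> ?G" "D * p2 \<in> ?G" "D * p3 \<in> ?G"
    unfolding D_def cramer_3[OF e]
    by (intro ideal_add[OF is_ideal_ideal_of] ideal_diff[OF is_ideal_ideal_of] ideal_mult[OF is_ideal_ideal_of] sG)+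
  have local_gen: "\<exists>u. u \<notin> x \<and> u * f \<in> ?G" if f: "f \<in> ?I" for f
  proof -
    obtain u v w where "s * f = u * p1 + v * p2 + w * p3" using s(2)[OF f] unfolding ideal_of_3 by blast
    then have "D * s * f = u * (D * p1) + v * (D * p2) + w * (D * p3)" by (simp add: mult.assoc) (simp add: algebra_simps)
    also have "\<dots> \<in> ?G"
      by (intro ideal_add[OF is_ideal_ideal_of] ideal_mult[OF is_ideal_ideal_of Dp(1)]
          ideal_mult[OF is_ideal_ideal_of Dp(2)] ideal_mult[OF is_ideal_ideal_of Dp(3)])
    finally show ?thesis using Dx s(1) by (intro exI[of _ "D * s"]) (auto simp: mult_mem_iff)
  qed
  have GsubI: "?G \<subseteq> ?I" using GI by (intro ideal_of_least) auto
  define t where "t = l z ^ (2 * N)"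
  have t: "homogeneous (2 * N) t" "t \<notin> x"
    using l homogeneous_power[of 1 "l z" "2 * N"] notin_power[OF z(2)] by (auto simp: t_def coord_change_def)
  have frG: "(G i, t) \<in> fractions_at x" for i using fractions_atI[OF hG t] .
  define fs where "fs = [germ {} x (G b1, t), germ {} x (G b2, t), germ {} x (G b3, t)]"
  have gen: "germ {} x (c, d) \<in> genideal (stalk {} x) ((\<lambda>i. germ {} x (G i, t)) ` S) \<longleftrightarrow> (\<exists>u. u \<notin> x \<and> u * c \<in> ideal_of (G ` S))"
    if "(c, d) \<in> fractions_at x" for S c d
    by (rule genideal_germs_iff[OF finite hG t(1) t(2) that refl])
  have setfs: "set fs = (\<lambda>i. germ {} x (G i, t)) ` {b1, b2, b3}" by (simp add: fs_def)
  have carr: "set fs \<subseteq> carrier (stalk {} x)" unfolding setfs using frG by auto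
  have "regular_sequence (stalk {} x) fs"
    unfolding regular_sequence_def
  proof (intro conjI allI impI ballI)
    show "set fs \<subseteq> carrier (stalk {} x)" by (rule carr)
    show "genideal (stalk {} x) (set fs) \<noteq> carrier (stalk {} x)"
    proof
      assume "genideal (stalk {} x) (set fs) = carrier (stalk {} x)"
      then have "germ {} x (1, 1) \<in> genideal (stalk {} x) (set fs)" using germ_in_carrier[OF fractions_one] by simp
      then obtain u where "u \<notin> x" "u * 1 \<in> ?G" unfolding setfs gen[OF fractions_one] by blast
      then show False using GsubI Ix by auto
    qed
    fix k c assume k: "k < length fs" and c: "c \<in> carrier (stalk {} x)"
      and ck: "c \<otimes>\<^bsub>stalk {} x\<^esub> fs ! k \<in> genideal (stalk {} x) (set (take k fs))"
    obtain e d where cd: "(e, d) \<in> fractions_at x" "c = germ {} x (e, d)" using c by (rule stalk_cases)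
    define i where "i = [b1, b2, b3] ! k"
    define S where "S = set (take k [b1, b2, b3])"
    have k3: "k = 0 \<or> k = 1 \<or> k = 2" using k by (auto simp: fs_def)
    have fk: "fs ! k = germ {} x (G i, t)" using k3 by (elim disjE) (simp_all add: fs_def i_def)
    have tk: "set (take k fs) = (\<lambda>i. germ {} x (G i, t)) ` S"
      using k3 by (elim disjE) (simp_all add: fs_def S_def numeral_2_eq_2)
    have Si: "S \<subseteq> {b1, b2, b3}" "i \<in> {b1, b2, b3} - S"
      using k3 B(2,3,4) by (elim disjE; simp add: i_def S_def numeral_2_eq_2)+
    have "germ {} x (e * G i, d * t) \<in> genideal (stalk {} x) ((\<lambda>i. germ {} x (G i, t)) ` S)"
      using ck unfolding fk tk cd(2) mult_stalk[OF cd(1) frG] .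
    then obtain u where u: "u \<notin> x" "u * (e * G i) \<in> ideal_of (G ` S)" unfolding gen[OF fractions_mult[OF cd(1) frG]] by blast
    then have "u * e * G i \<in> ideal_of (G ` S)" by (simp add: mult.assoc)
    then have "u * e \<in> ideal_of (G ` S)" by (rule regG[OF Si])
    then show "c \<in> genideal (stalk {} x) (set (take k fs))"
      unfolding tk cd(2) gen[OF cd(1)] using u(1) by blast
  qed
  moreover have "germ {} x ` ideal_fractions_at F x = genideal (stalk {} x) (set fs)"
  proof (intro equalityI subsetI)
    fix U assume "U \<in> germ {} x ` ideal_fractions_at F x"
    then obtain c d where cd: "U = germ {} x (c, d)" "(c, d) \<in> fractions_at x" "c \<in> ?I" by (auto simp: ideal_fractions_at_def)
    then show "U \<in> genideal (stalk {} x) (set fs)" unfolding setfs cd(1) gen[OF cd(2)] using local_gen by blast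
  next
    fix U assume U: "U \<in> genideal (stalk {} x) (set fs)"
    then have "U \<in> carrier (stalk {} x)" using ideal.Icarr[OF stalk.genideal_ideal[OF carr]] by blast
    then obtain c d where cd: "(c, d) \<in> fractions_at x" "U = germ {} x (c, d)" by (rule stalk_cases)
    then obtain u where u: "u \<notin> x" "u * c \<in> ?G" using U unfolding setfs cd(2) gen[OF cd(1)] by blast
    obtain m where m: "homogeneous m c" using cd(1) by (rule fractions_atE)
    \<comment> \<open>Fractions are extended by homogeneous elements, so u is replaced by one of its
      components; I is graded, hence the product with c stays in I.\<close>
    have "\<exists>e. hcomp e u \<notin> x"
    proof (rule ccontr)
      assume "\<nexists>e. hcomp e u \<notin> x"
      then have "(\<Sum>d\<in>mdeg ` Poly_Mapping.keys u. hcomp d u) \<in> x" by (intro ideal_sum[OF ideal_pp]) auto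
      then show False using u(1) by (simp flip: sum_hcomp)
    qed
    then obtain e where e: "hcomp e u \<notin> x" by blast
    have "hcomp (m + e) (c * u) \<in> ?I" using u(2) GsubI by (intro gradedD(2)[OF gI]) (auto simp: mult.commute)
    then have "hcomp e u * c \<in> ?I" by (simp add: hcomp_mult_homogeneous[OF m] mult.commute)
    then have "(hcomp e u * c, hcomp e u * d) \<in> ideal_fractions_at F x"
      using germ_cancel(2)[OF cd(1) homogeneous_hcomp e] by (simp add: ideal_fractions_at_def)
    then show "U \<in> germ {} x ` ideal_fractions_at F x"
      unfolding cd(2) germ_cancel(1)[OF cd(1) homogeneous_hcomp e, symmetric] by (rule imageI)
  qed
  ultimately show ?thesis by blast
qed

section \<open>Kaehler differentials\<close>

locale constants_in_cring = cring A for A :: "('a, 'm) ring_scheme" (structure) +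
  fixes B :: "'a set"
  assumes B: "B \<subseteq> carrier A"
begin

lemma formal_sumsD: "m \<in> formal_sums A \<Longrightarrow> m x \<in> carrier A"
  by (simp add: formal_sums_def)

lemma formal_zero: "(\<lambda>_. \<zero>) \<in> formal_sums A"
  by (simp add: formal_sums_def)

lemma formal_add:
  assumes "m \<in> formal_sums A" "n \<in> formal_sums A"
  shows "(\<lambda>x. m x \<oplus> n x) \<in> formal_sums A"
proof -
  have "{b. m b \<oplus> n b \<noteq> \<zero>} \<subseteq> {b. m b \<noteq> \<zero>} \<union> {b. n b \<noteq> \<zero>}" by auto
  then show ?thesis using assms by (auto simp: formal_sums_def intro: finite_subset)
qed

lemma formal_smult:
  assumes "a \<in> carrier A" "m \<in> formal_sums A"
  shows "(\<lambda>x. a \<otimes> m x) \<in> formal_sums A"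
proof -
  have "{b. a \<otimes> m b \<noteq> \<zero>} \<subseteq> {b. m b \<noteq> \<zero>}" using assms by auto
  then show ?thesis using assms by (auto simp: formal_sums_def intro: finite_subset)
qed

lemma formal_uminus:
  assumes "m \<in> formal_sums A"
  shows "(\<lambda>x. \<ominus> m x) \<in> formal_sums A"
proof -
  have "(\<lambda>x. (\<ominus> \<one>) \<otimes> m x) \<in> formal_sums A" using assms by (intro formal_smult) auto
  moreover have "(\<lambda>x. (\<ominus> \<one>) \<otimes> m x) = (\<lambda>x. \<ominus> m x)" using assms by (auto simp: l_minus formal_sumsD)
  ultimately show ?thesis by simp
qed

lemma formal_minus:
  assumes "m \<in> formal_sums A" "n \<in> formal_sums A"
  shows "(\<lambda>x. m x \<ominus> n x) \<in> formal_sums A"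
  using formal_add[OF assms(1) formal_uminus[OF assms(2)]] by (simp add: a_minus_def)

lemma formal_dsym:
  assumes "b \<in> carrier A"
  shows "dsym A b \<in> formal_sums A"
proof -
  have "{x. (if x = b then \<one> else \<zero>) \<noteq> \<zero>} \<subseteq> {b}" by auto
  then have "finite {x. (if x = b then \<one> else \<zero>) \<noteq> \<zero>}" by (rule finite_subset) simp
  then show ?thesis using assms by (auto simp: formal_sums_def dsym_def)
qed

lemma rel_formal: "m \<in> kaehler_rel A B \<Longrightarrow> m \<in> formal_sums A"
  by (induction rule: kaehler_rel.induct)
    (use B in \<open>auto intro!: formal_zero formal_add formal_smult formal_minus formal_dsym\<close>)

lemma rel_uminus:
  assumes "m \<in> kaehler_rel A B"
  shows "(\<lambda>x. \<ominus> m x) \<in> kaehler_rel A B"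
proof -
  have "(\<lambda>x. (\<ominus> \<one>) \<otimes> m x) \<in> kaehler_rel A B" using assms by (intro kaehler_rel.smult) auto
  moreover have "(\<lambda>x. (\<ominus> \<one>) \<otimes> m x) = (\<lambda>x. \<ominus> m x)" using rel_formal[OF assms] by (auto simp: l_minus formal_sumsD)
  ultimately show ?thesis by simp
qed

lemma class_eq_iff:
  assumes m: "m \<in> formal_sums A" and n: "n \<in> formal_sums A"
  shows "kaehler_class A B m = kaehler_class A B n \<longleftrightarrow> (\<lambda>x. m x \<ominus> n x) \<in> kaehler_rel A B"
proof
  have "(\<lambda>x. m x \<ominus> m x) = (\<lambda>_. \<zero>)" using m by (auto simp: formal_sumsD)
  then have "m \<in> kaehler_class A B m" using m by (simp add: kaehler_class_def kaehler_rel.zero)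
  moreover assume "kaehler_class A B m = kaehler_class A B n"
  ultimately show "(\<lambda>x. m x \<ominus> n x) \<in> kaehler_rel A B" by (auto simp: kaehler_class_def)
next
  assume r: "(\<lambda>x. m x \<ominus> n x) \<in> kaehler_rel A B"
  have "(\<lambda>x. k x \<ominus> m x) \<in> kaehler_rel A B \<longleftrightarrow> (\<lambda>x. k x \<ominus> n x) \<in> kaehler_rel A B" if k: "k \<in> formal_sums A" for k
  proof -
    have c: "k x \<in> carrier A" "m x \<in> carrier A" "n x \<in> carrier A" for x using k m n by (auto simp: formal_sumsD)
    have "(\<lambda>x. (k x \<ominus> m x) \<oplus> (m x \<ominus> n x)) = (\<lambda>x. k x \<ominus> n x)"
      by (rule ext) (use c in \<open>simp add: a_minus_def a_assoc r_neg1\<close>)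
    moreover have "(\<lambda>x. (k x \<ominus> n x) \<oplus> (\<ominus> (m x \<ominus> n x))) = (\<lambda>x. k x \<ominus> m x)"
      by (rule ext) (use c in algebra)
    ultimately show ?thesis using kaehler_rel.add[OF _ r] kaehler_rel.add[OF _ rel_uminus[OF r]] by metis
  qed
  then show "kaehler_class A B m = kaehler_class A B n" by (auto simp: kaehler_class_def)
qed

lemma class_self: "m \<in> formal_sums A \<Longrightarrow> m \<in> kaehler_class A B m"
proof -
  assume m: "m \<in> formal_sums A"
  then have "(\<lambda>x. m x \<ominus> m x) = (\<lambda>_. \<zero>)" by (auto simp: formal_sumsD)
  then show ?thesis using m by (simp add: kaehler_class_def kaehler_rel.zero)
qed

abbreviation \<Omega> :: "('a, ('a \<Rightarrow> 'a) set) module" where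
  "\<Omega> \<equiv> kaehler A B"

lemma class_in_carrier: "m \<in> formal_sums A \<Longrightarrow> kaehler_class A B m \<in> carrier \<Omega>"
  by (simp add: kaehler_def)

lemma \<Omega>_cases:
  assumes "w \<in> carrier \<Omega>"
  obtains m where "m \<in> formal_sums A" "w = kaehler_class A B m"
  using assms by (auto simp: kaehler_def)

lemma class_add:
  assumes m: "m \<in> formal_sums A" and n: "n \<in> formal_sums A"
  shows "kaehler_class A B m \<oplus>\<^bsub>\<Omega>\<^esub> kaehler_class A B n = kaehler_class A B (\<lambda>x. m x \<oplus> n x)"
proof -
  have "kaehler_class A B (\<lambda>x. m' x \<oplus> n' x) = kaehler_class A B (\<lambda>x. m x \<oplus> n x)"
    if "m' \<in> kaehler_class A B m" "n' \<in> kaehler_class A B n" for m' n'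
  proof -
    have r: "m' \<in> formal_sums A" "n' \<in> formal_sums A" "(\<lambda>x. m' x \<ominus> m x) \<in> kaehler_rel A B" "(\<lambda>x. n' x \<ominus> n x) \<in> kaehler_rel A B"
      using that by (auto simp: kaehler_class_def)
    have c: "m x \<in> carrier A" "n x \<in> carrier A" "m' x \<in> carrier A" "n' x \<in> carrier A" for x
      using r m n by (auto simp: formal_sumsD)
    have "(\<lambda>x. (m' x \<ominus> m x) \<oplus> (n' x \<ominus> n x)) = (\<lambda>x. (m' x \<oplus> n' x) \<ominus> (m x \<oplus> n x))"
      by (rule ext) (use c in \<open>simp add: a_minus_def minus_add a_ac\<close>)
    then have "(\<lambda>x. (m' x \<oplus> n' x) \<ominus> (m x \<oplus> n x)) \<in> kaehler_rel A B" using kaehler_rel.add[OF r(3,4)] by simp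
    then show ?thesis using class_eq_iff[OF formal_add[OF r(1,2)] formal_add[OF m n]] by simp
  qed
  then have "(\<Union>m'\<in>kaehler_class A B m. \<Union>n'\<in>kaehler_class A B n. kaehler_class A B (\<lambda>x. m' x \<oplus> n' x)) =
      (\<Union>m'\<in>kaehler_class A B m. \<Union>n'\<in>kaehler_class A B n. kaehler_class A B (\<lambda>x. m x \<oplus> n x))"
    by (intro SUP_cong refl) auto
  also have "\<dots> = kaehler_class A B (\<lambda>x. m x \<oplus> n x)" using class_self[OF m] class_self[OF n] by auto
  finally show ?thesis by (simp add: kaehler_def)
qed

lemma class_smult:
  assumes a: "a \<in> carrier A" and m: "m \<in> formal_sums A"
  shows "a \<odot>\<^bsub>\<Omega>\<^esub> kaehler_class A B m = kaehler_class A B (\<lambda>x. a \<otimes> m x)"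
proof -
  have "kaehler_class A B (\<lambda>x. a \<otimes> m' x) = kaehler_class A B (\<lambda>x. a \<otimes> m x)" if "m' \<in> kaehler_class A B m" for m'
  proof -
    have r: "m' \<in> formal_sums A" "(\<lambda>x. m' x \<ominus> m x) \<in> kaehler_rel A B" using that by (auto simp: kaehler_class_def)
    have c: "m x \<in> carrier A" "m' x \<in> carrier A" for x using r m by (auto simp: formal_sumsD)
    have "(\<lambda>x. a \<otimes> (m' x \<ominus> m x)) = (\<lambda>x. a \<otimes> m' x \<ominus> a \<otimes> m x)"
      by (rule ext) (use c a in \<open>simp add: a_minus_def r_distr r_minus\<close>)
    then have "(\<lambda>x. a \<otimes> m' x \<ominus> a \<otimes> m x) \<in> kaehler_rel A B" using kaehler_rel.smult[OF a r(2)] by simp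
    then show ?thesis using class_eq_iff[OF formal_smult[OF a r(1)] formal_smult[OF a m]] by simp
  qed
  then have "(\<Union>m'\<in>kaehler_class A B m. kaehler_class A B (\<lambda>x. a \<otimes> m' x)) = (\<Union>m'\<in>kaehler_class A B m. kaehler_class A B (\<lambda>x. a \<otimes> m x))"
    by (intro SUP_cong refl)
  also have "\<dots> = kaehler_class A B (\<lambda>x. a \<otimes> m x)" using class_self[OF m] by auto
  finally show ?thesis by (simp add: kaehler_def)
qed

lemma zero_\<Omega>: "\<zero>\<^bsub>\<Omega>\<^esub> = kaehler_class A B (\<lambda>_. \<zero>)"
  by (simp add: kaehler_def)

lemma module_\<Omega>: "Module.module A \<Omega>"
proof (rule Module.moduleI)
  show "cring A" by (rule is_cring)
  show "abelian_group \<Omega>"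
  proof (rule abelian_groupI)
    fix u v w assume "u \<in> carrier \<Omega>" "v \<in> carrier \<Omega>" "w \<in> carrier \<Omega>"
    then show "u \<oplus>\<^bsub>\<Omega>\<^esub> v \<oplus>\<^bsub>\<Omega>\<^esub> w = u \<oplus>\<^bsub>\<Omega>\<^esub> (v \<oplus>\<^bsub>\<Omega>\<^esub> w)"
      by (elim \<Omega>_cases) (simp add: class_add formal_add a_assoc formal_sumsD)
  next
    fix u v assume "u \<in> carrier \<Omega>" "v \<in> carrier \<Omega>"
    then show "u \<oplus>\<^bsub>\<Omega>\<^esub> v \<in> carrier \<Omega>" "u \<oplus>\<^bsub>\<Omega>\<^esub> v = v \<oplus>\<^bsub>\<Omega>\<^esub> u"
      by (auto elim!: \<Omega>_cases simp: class_add formal_add class_in_carrier a_comm formal_sumsD)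
  next
    fix u assume "u \<in> carrier \<Omega>"
    then obtain m where m: "m \<in> formal_sums A" "u = kaehler_class A B m" by (rule \<Omega>_cases)
    then show "\<zero>\<^bsub>\<Omega>\<^esub> \<oplus>\<^bsub>\<Omega>\<^esub> u = u" by (simp add: zero_\<Omega> class_add formal_zero formal_sumsD)
    have "kaehler_class A B (\<lambda>x. \<ominus> m x) \<oplus>\<^bsub>\<Omega>\<^esub> u = \<zero>\<^bsub>\<Omega>\<^esub>"
      using m by (simp add: zero_\<Omega> class_add formal_uminus l_neg formal_sumsD)
    then show "\<exists>v\<in>carrier \<Omega>. v \<oplus>\<^bsub>\<Omega>\<^esub> u = \<zero>\<^bsub>\<Omega>\<^esub>" using class_in_carrier[OF formal_uminus[OF m(1)]] by blast
  qed (simp add: zero_\<Omega> class_in_carrier formal_zero)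
next
  fix a b u assume a: "a \<in> carrier A" and b: "b \<in> carrier A" and u: "u \<in> carrier \<Omega>"
  obtain m where m: "m \<in> formal_sums A" "u = kaehler_class A B m" using u by (rule \<Omega>_cases)
  show "(a \<oplus> b) \<odot>\<^bsub>\<Omega>\<^esub> u = a \<odot>\<^bsub>\<Omega>\<^esub> u \<oplus>\<^bsub>\<Omega>\<^esub> b \<odot>\<^bsub>\<Omega>\<^esub> u"
    using a b m by (simp add: class_smult class_add formal_smult l_distr formal_sumsD)
  show "(a \<otimes> b) \<odot>\<^bsub>\<Omega>\<^esub> u = a \<odot>\<^bsub>\<Omega>\<^esub> (b \<odot>\<^bsub>\<Omega>\<^esub> u)"
    using a b m by (simp add: class_smult formal_smult m_assoc formal_sumsD)
next
  fix a u v assume a: "a \<in> carrier A" and u: "u \<in> carrier \<Omega>" and v: "v \<in> carrier \<Omega>"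
  obtain m where m: "m \<in> formal_sums A" "u = kaehler_class A B m" using u by (rule \<Omega>_cases)
  obtain n where n: "n \<in> formal_sums A" "v = kaehler_class A B n" using v by (rule \<Omega>_cases)
  show "a \<odot>\<^bsub>\<Omega>\<^esub> (u \<oplus>\<^bsub>\<Omega>\<^esub> v) = a \<odot>\<^bsub>\<Omega>\<^esub> u \<oplus>\<^bsub>\<Omega>\<^esub> a \<odot>\<^bsub>\<Omega>\<^esub> v"
    using a m n by (simp add: class_smult class_add formal_smult formal_add r_distr formal_sumsD)
next
  fix a u assume a: "a \<in> carrier A" and u: "u \<in> carrier \<Omega>"
  obtain m where m: "m \<in> formal_sums A" "u = kaehler_class A B m" using u by (rule \<Omega>_cases)
  show "a \<odot>\<^bsub>\<Omega>\<^esub> u \<in> carrier \<Omega>" using a m by (simp add: class_smult class_in_carrier formal_smult)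
next
  fix u assume "u \<in> carrier \<Omega>"
  then obtain m where m: "m \<in> formal_sums A" "u = kaehler_class A B m" by (rule \<Omega>_cases)
  show "\<one> \<odot>\<^bsub>\<Omega>\<^esub> u = u" using m by (simp add: class_smult formal_sumsD)
qed

abbreviation d :: "'a \<Rightarrow> ('a \<Rightarrow> 'a) set" where
  "d \<equiv> kaehler_d A B"

lemma d_closed: "a \<in> carrier A \<Longrightarrow> d a \<in> carrier \<Omega>"
  by (simp add: kaehler_d_def class_in_carrier formal_dsym)

lemma d_add:
  assumes "a \<in> carrier A" "b \<in> carrier A"
  shows "d (a \<oplus> b) = d a \<oplus>\<^bsub>\<Omega>\<^esub> d b"
  unfolding kaehler_d_def class_add[OF formal_dsym[OF assms(1)] formal_dsym[OF assms(2)]]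
  using assms by (subst class_eq_iff) (auto intro!: formal_dsym formal_add kaehler_rel.sum_rule)

lemma d_mult:
  assumes "a \<in> carrier A" "b \<in> carrier A"
  shows "d (a \<otimes> b) = a \<odot>\<^bsub>\<Omega>\<^esub> d b \<oplus>\<^bsub>\<Omega>\<^esub> b \<odot>\<^bsub>\<Omega>\<^esub> d a"
  unfolding kaehler_d_def class_smult[OF assms(1) formal_dsym[OF assms(2)]] class_smult[OF assms(2) formal_dsym[OF assms(1)]]
    class_add[OF formal_smult[OF assms(1) formal_dsym[OF assms(2)]] formal_smult[OF assms(2) formal_dsym[OF assms(1)]]]
  using assms by (subst class_eq_iff) (auto intro!: formal_dsym formal_add formal_smult kaehler_rel.product_rule)

lemma d_const:
  assumes "c \<in> B"
  shows "d c = \<zero>\<^bsub>\<Omega>\<^esub>"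
proof -
  have c: "c \<in> carrier A" using assms B by blast
  have "(\<lambda>x. dsym A c x \<ominus> \<zero>) = dsym A c" using formal_sumsD[OF formal_dsym[OF c]] by (auto simp: a_minus_def)
  then show ?thesis
    unfolding kaehler_d_def zero_\<Omega> class_eq_iff[OF formal_dsym[OF c] formal_zero] using kaehler_rel.const_rule[OF assms] by simp
qed

text \<open>The universal property of differentials: a derivation D along \<open>\<rho>\<close>
  factors through \<open>\<Omega>\<close>. The element c is the value of the induced functional at
  w, so it is the same for every relation between a differential and w.\<close>

lemma derivation_functional:
  assumes K: "cring K" and \<rho>: "\<rho> \<in> ring_hom A K"
    and D: "\<And>a. a \<in> carrier A \<Longrightarrow> D a \<in> carrier K"
    and D_add: "\<And>a b. a \<in> carrier A \<Longrightarrow> b \<in> carrier A \<Longrightarrow> D (a \<oplus> b) = D a \<oplus>\<^bsub>K\<^esub> D b"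
    and D_mult: "\<And>a b. a \<in> carrier A \<Longrightarrow> b \<in> carrier A \<Longrightarrow> D (a \<otimes> b) = \<rho> a \<otimes>\<^bsub>K\<^esub> D b \<oplus>\<^bsub>K\<^esub> \<rho> b \<otimes>\<^bsub>K\<^esub> D a"
    and D_const: "\<And>c. c \<in> B \<Longrightarrow> D c = \<zero>\<^bsub>K\<^esub>"
    and w: "w \<in> carrier \<Omega>"
  obtains c where "c \<in> carrier K" "\<And>a \<alpha>. a \<in> carrier A \<Longrightarrow> \<alpha> \<in> carrier A \<Longrightarrow> d a = \<alpha> \<odot>\<^bsub>\<Omega>\<^esub> w \<Longrightarrow> D a = \<rho> \<alpha> \<otimes>\<^bsub>K\<^esub> c"
proof -
  interpret K: cring K by (rule K)
  interpret h: ring_hom_cring A K \<rho> by (intro ring_hom_cring.intro ring_hom_cring_axioms.intro is_cring K \<rho>)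
  \<comment> \<open>The linear extension of D to formal sums. It kills each kind of relation in
    \<open>kaehler_rel\<close>, and therefore depends on classes alone.\<close>
  define T where "T m = finsum K (\<lambda>b. \<rho> (m b) \<otimes>\<^bsub>K\<^esub> D b) {b. m b \<noteq> \<zero>}" for m
  have supp: "b \<in> carrier A" if "m \<in> formal_sums A" "m b \<noteq> \<zero>" for m b using that by (auto simp: formal_sums_def)
  have T_superset: "T m = finsum K (\<lambda>b. \<rho> (m b) \<otimes>\<^bsub>K\<^esub> D b) S"
    if m: "m \<in> formal_sums A" and S: "finite S" "{b. m b \<noteq> \<zero>} \<subseteq> S" "S \<subseteq> carrier A" for m S
    unfolding T_def
    by (rule K.add.finprod_mono_neutral_cong_left)
      (use m S D in \<open>auto simp: formal_sumsD Pi_def dest: supp\<close>)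
  have fin: "finite {b. m b \<noteq> \<zero>}" if "m \<in> formal_sums A" for m using that by (simp add: formal_sums_def)
  have T_closed: "T m \<in> carrier K" if "m \<in> formal_sums A" for m
    unfolding T_def using that D by (intro K.finsum_closed) (auto simp: formal_sumsD supp)
  have T_add: "T (\<lambda>x. m x \<oplus> n x) = T m \<oplus>\<^bsub>K\<^esub> T n" if m: "m \<in> formal_sums A" and n: "n \<in> formal_sums A" for m n
  proof -
    let ?S = "{b. m b \<noteq> \<zero>} \<union> {b. n b \<noteq> \<zero>}"
    have S: "finite ?S" "?S \<subseteq> carrier A" using fin m n supp by auto
    have "T (\<lambda>x. m x \<oplus> n x) = finsum K (\<lambda>b. \<rho> (m b \<oplus> n b) \<otimes>\<^bsub>K\<^esub> D b) ?S"
      by (rule T_superset[OF formal_add[OF m n] S(1) _ S(2)]) auto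
    also have "\<dots> = finsum K (\<lambda>b. \<rho> (m b) \<otimes>\<^bsub>K\<^esub> D b \<oplus>\<^bsub>K\<^esub> \<rho> (n b) \<otimes>\<^bsub>K\<^esub> D b) ?S"
      by (rule K.finsum_cong') (use m n S D in \<open>auto simp: formal_sumsD K.l_distr subset_iff\<close>)
    also have "\<dots> = finsum K (\<lambda>b. \<rho> (m b) \<otimes>\<^bsub>K\<^esub> D b) ?S \<oplus>\<^bsub>K\<^esub> finsum K (\<lambda>b. \<rho> (n b) \<otimes>\<^bsub>K\<^esub> D b) ?S"
      by (rule K.finsum_addf) (use m n S D in \<open>auto simp: formal_sumsD subset_iff\<close>)
    also have "\<dots> = T m \<oplus>\<^bsub>K\<^esub> T n" using T_superset[OF m S(1) _ S(2)] T_superset[OF n S(1) _ S(2)] by auto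
    finally show ?thesis .
  qed
  have T_smult: "T (\<lambda>x. a \<otimes> m x) = \<rho> a \<otimes>\<^bsub>K\<^esub> T m" if a: "a \<in> carrier A" and m: "m \<in> formal_sums A" for a m
  proof -
    let ?S = "{b. m b \<noteq> \<zero>}"
    have S: "finite ?S" "?S \<subseteq> carrier A" using fin m supp by auto
    have "T (\<lambda>x. a \<otimes> m x) = finsum K (\<lambda>b. \<rho> (a \<otimes> m b) \<otimes>\<^bsub>K\<^esub> D b) ?S"
      by (rule T_superset[OF formal_smult[OF a m] S(1) _ S(2)]) (use a in auto)
    also have "\<dots> = finsum K (\<lambda>b. \<rho> a \<otimes>\<^bsub>K\<^esub> (\<rho> (m b) \<otimes>\<^bsub>K\<^esub> D b)) ?S"
      by (rule K.finsum_cong') (use a m S D in \<open>auto simp: formal_sumsD K.m_assoc subset_iff\<close>)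
    also have "\<dots> = \<rho> a \<otimes>\<^bsub>K\<^esub> T m"
      unfolding T_def by (rule K.finsum_rdistr[symmetric]) (use a m S D in \<open>auto simp: formal_sumsD subset_iff\<close>)
    finally show ?thesis .
  qed
  have T_dsym: "T (dsym A b) = D b" if b: "b \<in> carrier A" for b
  proof -
    have "T (dsym A b) = finsum K (\<lambda>x. \<rho> (dsym A b x) \<otimes>\<^bsub>K\<^esub> D x) {b}"
      by (rule T_superset[OF formal_dsym[OF b]]) (use b in \<open>auto simp: dsym_def\<close>)
    also have "\<dots> = D b" using b D by (simp add: K.finsum_insert dsym_def)
    finally show ?thesis .
  qed
  have T_minus: "T (\<lambda>x. m x \<ominus> n x) = T m \<ominus>\<^bsub>K\<^esub> T n" if m: "m \<in> formal_sums A" and n: "n \<in> formal_sums A" for m n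
  proof -
    have e: "(\<lambda>x. m x \<ominus> n x) = (\<lambda>x. m x \<oplus> (\<ominus> \<one>) \<otimes> n x)"
      by (rule ext) (use n in \<open>simp add: a_minus_def l_minus formal_sumsD\<close>)
    have "T (\<lambda>x. m x \<ominus> n x) = T m \<oplus>\<^bsub>K\<^esub> \<rho> (\<ominus> \<one>) \<otimes>\<^bsub>K\<^esub> T n"
      unfolding e using m n by (simp add: T_add T_smult formal_smult)
    then show ?thesis using T_closed[OF n] by (simp add: a_minus_def K.l_minus)
  qed
  have rel: "T m = \<zero>\<^bsub>K\<^esub>" if "m \<in> kaehler_rel A B" for m
    using that
  proof (induction rule: kaehler_rel.induct)
    case zero
    then show ?case by (simp add: T_def)
  next
    case (add m n)
    then show ?case using T_add[OF rel_formal rel_formal] by simp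
  next
    case (smult a m)
    then show ?case using T_smult[OF _ rel_formal] by simp
  next
    case (sum_rule a b)
    have "T (\<lambda>x. dsym A (a \<oplus> b) x \<ominus> (dsym A a x \<oplus> dsym A b x)) = D (a \<oplus> b) \<ominus>\<^bsub>K\<^esub> (D a \<oplus>\<^bsub>K\<^esub> D b)"
      using sum_rule by (simp add: T_minus T_add formal_dsym formal_add T_dsym)
    then show ?case using sum_rule D D_add by (simp add: a_minus_def K.r_neg)
  next
    case (product_rule a b)
    have "T (\<lambda>x. dsym A (a \<otimes> b) x \<ominus> (a \<otimes> dsym A b x \<oplus> b \<otimes> dsym A a x)) =
        D (a \<otimes> b) \<ominus>\<^bsub>K\<^esub> (\<rho> a \<otimes>\<^bsub>K\<^esub> D b \<oplus>\<^bsub>K\<^esub> \<rho> b \<otimes>\<^bsub>K\<^esub> D a)"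
      using product_rule by (simp add: T_minus T_add T_smult formal_dsym formal_add formal_smult T_dsym)
    then show ?case using product_rule D D_mult by (simp add: a_minus_def K.r_neg)
  next
    case (const_rule c)
    then show ?case using T_dsym B D_const by auto
  qed
  obtain m where m: "m \<in> formal_sums A" "w = kaehler_class A B m" using w by (rule \<Omega>_cases)
  show ?thesis
  proof (rule that[of "T m"])
    show "T m \<in> carrier K" by (rule T_closed[OF m(1)])
    fix a \<alpha> assume a: "a \<in> carrier A" "\<alpha> \<in> carrier A" "d a = \<alpha> \<odot>\<^bsub>\<Omega>\<^esub> w"
    then have "kaehler_class A B (dsym A a) = kaehler_class A B (\<lambda>x. \<alpha> \<otimes> m x)"
      unfolding m(2) class_smult[OF a(2) m(1)] by (simp add: kaehler_d_def)
    then have "(\<lambda>x. dsym A a x \<ominus> \<alpha> \<otimes> m x) \<in> kaehler_rel A B"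
      using class_eq_iff[OF formal_dsym[OF a(1)] formal_smult[OF a(2) m(1)]] by simp
    then have "T (\<lambda>x. dsym A a x \<ominus> \<alpha> \<otimes> m x) = \<zero>\<^bsub>K\<^esub>" by (rule rel)
    then have "D a \<ominus>\<^bsub>K\<^esub> \<rho> \<alpha> \<otimes>\<^bsub>K\<^esub> T m = \<zero>\<^bsub>K\<^esub>"
      using a m by (simp add: T_minus T_smult T_dsym formal_dsym formal_smult)
    then show "D a = \<rho> \<alpha> \<otimes>\<^bsub>K\<^esub> T m" using a D T_closed[OF m(1)] by simp
  qed
qed

end

section \<open>Differentials on the chart of a nonzero coordinate\<close>

lemma pdiff_homogeneous_0:
  assumes "homogeneous 0 f"
  shows "pdiff j f = 0"
proof -
  have "f = pconst (Poly_Mapping.lookup f 0)"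
  proof (rule poly_mapping_eqI)
    fix m :: "5 \<Rightarrow>\<^sub>0 nat"
    show "Poly_Mapping.lookup f m = Poly_Mapping.lookup (pconst (Poly_Mapping.lookup f 0)) m"
    proof (cases "m = 0")
      case False
      then have "mdeg m \<noteq> 0" by (metis (mono_tags, lifting) finite poly_mapping_eqI lookup_zero sum_eq_0_iff UNIV_I)
      then show ?thesis using assms False by (simp add: homogeneous_iff pconst_def lookup_single when_def)
    qed (simp add: pconst_def)
  qed
  then show ?thesis by (metis pdiff_pconst)
qed

text \<open>The extra variable restores the degree lost by differentiation. In degree 0 the
  derivative vanishes, so the truncated degree \<open>n - 1\<close> causes no exception.\<close>

lemma homogeneous_pvar_pdiff:
  assumes "homogeneous n f"
  shows "homogeneous n (pvar i * pdiff j f)"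
proof (cases n)
  case 0
  then show ?thesis using pdiff_homogeneous_0[of f j] assms by simp
next
  case (Suc k)
  then show ?thesis using homogeneous_mult[OF homogeneous_pvar homogeneous_pdiff[OF assms], of i j] by simp
qed

context homogeneous_point
begin

lemma scalar_subset: "range (scalar_germ F \<pp>) \<subseteq> carrier (stalk F \<pp>)"
  using fractions_const by (auto simp: scalar_germ_def)

sublocale kd: constants_in_cring "stalk F \<pp>" "range (scalar_germ F \<pp>)"
  by unfold_locales (rule scalar_subset)

sublocale km: Module.module "stalk F \<pp>" "kaehler (stalk F \<pp>) (range (scalar_germ F \<pp>))"
  by (rule kd.module_\<Omega>)

lemma omega_stalk_eq: "omega_stalk F \<pp> = kd.\<Omega>"
  by (simp add: omega_stalk_def)

lemma zero_eq_germ: "homogeneous n s \<Longrightarrow> s \<notin> \<pp> \<Longrightarrow> germ F \<pp> (0, s) = \<zero>\<^bsub>stalk F \<pp>\<^esub>"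
  using germ_eq_zero_iff[OF fractions_atI[OF homogeneous_0]] vanishes_0 by blast

lemma d_zero: "kd.d \<zero>\<^bsub>stalk F \<pp>\<^esub> = \<zero>\<^bsub>kd.\<Omega>\<^esub>"
proof -
  have "\<zero>\<^bsub>stalk F \<pp>\<^esub> = scalar_germ F \<pp> 0" by (simp add: zero_stalk scalar_germ_def)
  then show ?thesis using kd.d_const by simp
qed

lemma pvar_power_facts:
  assumes "pvar i \<notin> \<pp>"
  shows "homogeneous n (pvar i ^ n :: 'r poly5)" "pvar i ^ n \<notin> \<pp>"
  using homogeneous_power[OF homogeneous_pvar, of n i] notin_power[OF assms] by auto

definition ratio :: "5 \<Rightarrow> 5 \<Rightarrow> ('r poly5 \<times> 'r poly5) set" where
  "ratio i j = germ F \<pp> (pvar j, pvar i)"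

lemma ratio_closed: "pvar i \<notin> \<pp> \<Longrightarrow> ratio i j \<in> carrier (stalk F \<pp>)"
  unfolding ratio_def by (intro germ_in_carrier fractions_atI[OF homogeneous_pvar homogeneous_pvar])

text \<open>The quotient of a by \<open>pvar i ^ n\<close> is a polynomial in the ratios
  \<open>ratio i j\<close>, and its derivative with respect to such a ratio is the germ in the
  summand. The Leibniz rule, peeling one variable off a monomial at a time, reduces this to
  constants.\<close>

lemma chain_rule:
  assumes i: "pvar i \<notin> \<pp>" and a: "homogeneous n a"
  shows "kd.d (germ F \<pp> (a, pvar i ^ n)) =
    finsum kd.\<Omega> (\<lambda>j. germ F \<pp> (pvar i * pdiff j a, pvar i ^ n) \<odot>\<^bsub>kd.\<Omega>\<^esub> kd.d (ratio i j)) (- {i})"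
proof -
  note pw = pvar_power_facts[OF i]
  note du = kd.d_closed[OF ratio_closed[OF i]]
  have gc: "germ F \<pp> (b, pvar i ^ k) \<in> carrier (stalk F \<pp>)" if "homogeneous k b" for b k
    by (intro germ_in_carrier fractions_atI[OF that pw])
  define R where "R k b = finsum kd.\<Omega> (\<lambda>j. germ F \<pp> (pvar i * pdiff j b, pvar i ^ k) \<odot>\<^bsub>kd.\<Omega>\<^esub> kd.d (ratio i j)) (- {i})" for k b
  have tc: "germ F \<pp> (pvar i * pdiff j b, pvar i ^ k) \<odot>\<^bsub>kd.\<Omega>\<^esub> kd.d (ratio i j) \<in> carrier kd.\<Omega>" if "homogeneous k b" for j b k
    using gc[OF homogeneous_pvar_pdiff[OF that]] du by (rule km.smult_closed)
  have Rc: "R k b \<in> carrier kd.\<Omega>" if "homogeneous k b" for k b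
    unfolding R_def using tc[OF that] by (intro km.finsum_closed) auto
  have dui: "kd.d (ratio i i) = \<zero>\<^bsub>kd.\<Omega>\<^esub>"
  proof -
    have "ratio i i = scalar_germ F \<pp> 1"
      unfolding ratio_def scalar_germ_def
      using germ_eqI[OF fractions_atI[OF homogeneous_pvar homogeneous_pvar i, of i] fractions_one] by simp
    then show ?thesis using kd.d_const by simp
  qed
  have mono: "kd.d (germ F \<pp> (Poly_Mapping.single m c, pvar i ^ k)) = R k (Poly_Mapping.single m c)" if "mdeg m = k" for m c k
    using that
  proof (induction k arbitrary: m)
    case 0
    have "m = 0" using 0 by (intro poly_mapping_eqI) simp
    then have "germ F \<pp> (Poly_Mapping.single m c, pvar i ^ 0) = scalar_germ F \<pp> c"
      by (simp add: scalar_germ_def pconst_def)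
    then have "kd.d (germ F \<pp> (Poly_Mapping.single m c, pvar i ^ 0)) = \<zero>\<^bsub>kd.\<Omega>\<^esub>" using kd.d_const by simp
    moreover have "R 0 (Poly_Mapping.single m c) = \<zero>\<^bsub>kd.\<Omega>\<^esub>"
    proof -
      have "germ F \<pp> (pvar i * pdiff j (Poly_Mapping.single m c), pvar i ^ 0) = \<zero>\<^bsub>stalk F \<pp>\<^esub>" for j
        using pdiff_pconst[of j c] zero_eq_germ[OF pw, of 0] \<open>m = 0\<close> by (simp add: pconst_def)
      then show ?thesis unfolding R_def using du by (simp add: km.smult_l_null)
    qed
    ultimately show ?case by simp
  next
    case (Suc k)
    then have "mdeg m \<noteq> 0" by simp
    then obtain e m' where m: "m = Poly_Mapping.single e 1 + m'" by (rule monomial_factor)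
    have m': "mdeg m' = k" using Suc.prems unfolding m mdeg_add mdeg_single by simp
    define \<mu> where "\<mu> = Poly_Mapping.single m' c"
    have mu: "Poly_Mapping.single m c = pvar e * \<mu>" by (simp add: m \<mu>_def pvar_def mult_single)
    have h\<mu>: "homogeneous k \<mu>" using homogeneous_single[of m' c] m' by (simp add: \<mu>_def)
    let ?u = "ratio i e" and ?\<mu> = "germ F \<pp> (\<mu>, pvar i ^ k)"
    have fr: "(pvar e, pvar i) \<in> fractions_at \<pp>" "(\<mu>, pvar i ^ k) \<in> fractions_at \<pp>"
      using fractions_atI[OF homogeneous_pvar homogeneous_pvar i] fractions_atI[OF h\<mu> pw] by auto
    have uc: "?u \<in> carrier (stalk F \<pp>)" "?\<mu> \<in> carrier (stalk F \<pp>)" using ratio_closed[OF i] gc[OF h\<mu>] by auto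
    have "germ F \<pp> (pvar e * \<mu>, pvar i ^ Suc k) = ?u \<otimes>\<^bsub>stalk F \<pp>\<^esub> ?\<mu>"
      unfolding ratio_def mult_stalk[OF fr] by simp
    then have lhs: "kd.d (germ F \<pp> (pvar e * \<mu>, pvar i ^ Suc k)) = ?u \<odot>\<^bsub>kd.\<Omega>\<^esub> R k \<mu> \<oplus>\<^bsub>kd.\<Omega>\<^esub> ?\<mu> \<odot>\<^bsub>kd.\<Omega>\<^esub> kd.d ?u"
      using kd.d_mult[OF uc] Suc.IH[OF m'] by (simp add: \<mu>_def)
    have summand: "germ F \<pp> (pvar i * pdiff j (pvar e * \<mu>), pvar i ^ Suc k) \<odot>\<^bsub>kd.\<Omega>\<^esub> kd.d (ratio i j) =
       ?u \<odot>\<^bsub>kd.\<Omega>\<^esub> (germ F \<pp> (pvar i * pdiff j \<mu>, pvar i ^ k) \<odot>\<^bsub>kd.\<Omega>\<^esub> kd.d (ratio i j)) \<oplus>\<^bsub>kd.\<Omega>\<^esub>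
       (if j = e then ?\<mu> \<odot>\<^bsub>kd.\<Omega>\<^esub> kd.d (ratio i j) else \<zero>\<^bsub>kd.\<Omega>\<^esub>)" for j
    proof -
      have h1: "homogeneous (Suc k) (pvar e * (pvar i * pdiff j \<mu>))"
        using homogeneous_mult[OF homogeneous_pvar homogeneous_pvar_pdiff[OF h\<mu>], of e i j] by simp
      have h2: "homogeneous (Suc k) (pvar i * (\<mu> * pdiff j (pvar e)))"
        using homogeneous_mult[OF homogeneous_pvar h\<mu>, of i] by (simp add: pdiff_pvar)
      have "pvar i * pdiff j (pvar e * \<mu>) = pvar e * (pvar i * pdiff j \<mu>) + pvar i * (\<mu> * pdiff j (pvar e))"
        by (simp add: pdiff_mult algebra_simps)
      then have "germ F \<pp> (pvar i * pdiff j (pvar e * \<mu>), pvar i ^ Suc k) =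
          germ F \<pp> (pvar e * (pvar i * pdiff j \<mu>), pvar i ^ Suc k) \<oplus>\<^bsub>stalk F \<pp>\<^esub> germ F \<pp> (pvar i * (\<mu> * pdiff j (pvar e)), pvar i ^ Suc k)"
        using germ_add_same_denom[OF h1 h2 pw] by simp
      also have "germ F \<pp> (pvar e * (pvar i * pdiff j \<mu>), pvar i ^ Suc k) = ?u \<otimes>\<^bsub>stalk F \<pp>\<^esub> germ F \<pp> (pvar i * pdiff j \<mu>, pvar i ^ k)"
        unfolding ratio_def mult_stalk[OF fr(1) fractions_atI[OF homogeneous_pvar_pdiff[OF h\<mu>] pw]] by simp
      also have "germ F \<pp> (pvar i * (\<mu> * pdiff j (pvar e)), pvar i ^ Suc k) = (if j = e then ?\<mu> else \<zero>\<^bsub>stalk F \<pp>\<^esub>)"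
        using germ_cancel(1)[OF fr(2) homogeneous_pvar i] zero_eq_germ[OF pw, of "Suc k"] by (simp add: pdiff_pvar)
      finally show ?thesis
        using uc gc[OF homogeneous_pvar_pdiff[OF h\<mu>, of i j]] du[of j]
        by (simp add: km.smult_l_distr km.smult_assoc1 km.smult_l_null)
    qed
    have "R (Suc k) (pvar e * \<mu>) = finsum kd.\<Omega> (\<lambda>j. ?u \<odot>\<^bsub>kd.\<Omega>\<^esub> (germ F \<pp> (pvar i * pdiff j \<mu>, pvar i ^ k) \<odot>\<^bsub>kd.\<Omega>\<^esub> kd.d (ratio i j))) (- {i})
      \<oplus>\<^bsub>kd.\<Omega>\<^esub> finsum kd.\<Omega> (\<lambda>j. if j = e then ?\<mu> \<odot>\<^bsub>kd.\<Omega>\<^esub> kd.d (ratio i j) else \<zero>\<^bsub>kd.\<Omega>\<^esub>) (- {i})"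
      unfolding R_def summand using tc[OF h\<mu>] uc du
      by (subst km.finsum_addf) (auto simp: km.smult_closed)
    also have "finsum kd.\<Omega> (\<lambda>j. ?u \<odot>\<^bsub>kd.\<Omega>\<^esub> (germ F \<pp> (pvar i * pdiff j \<mu>, pvar i ^ k) \<odot>\<^bsub>kd.\<Omega>\<^esub> kd.d (ratio i j))) (- {i}) = ?u \<odot>\<^bsub>kd.\<Omega>\<^esub> R k \<mu>"
      unfolding R_def using tc[OF h\<mu>] uc by (subst km.finsum_smult_ldistr) auto
    also have "finsum kd.\<Omega> (\<lambda>j. if j = e then ?\<mu> \<odot>\<^bsub>kd.\<Omega>\<^esub> kd.d (ratio i j) else \<zero>\<^bsub>kd.\<Omega>\<^esub>) (- {i}) = ?\<mu> \<odot>\<^bsub>kd.\<Omega>\<^esub> kd.d ?u"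
    \<comment> \<open>The index i is absent from the sum. This agrees with the product rule, since
      \<open>ratio i i\<close> is a constant and has zero differential.\<close>
    proof (cases "e = i")
      case True
      have "finsum kd.\<Omega> (\<lambda>j. if j = e then ?\<mu> \<odot>\<^bsub>kd.\<Omega>\<^esub> kd.d (ratio i j) else \<zero>\<^bsub>kd.\<Omega>\<^esub>) (- {i}) = finsum kd.\<Omega> (\<lambda>j. \<zero>\<^bsub>kd.\<Omega>\<^esub>) (- {i})"
        by (rule km.finsum_cong') (use True in auto)
      then show ?thesis using True dui uc by (simp add: km.smult_r_null)
    next
      case False
      then show ?thesis
        using km.add.finprod_singleton[of e "- {i}" "\<lambda>j. ?\<mu> \<odot>\<^bsub>kd.\<Omega>\<^esub> kd.d (ratio i j)"] du uc
        by (simp add: km.smult_closed eq_commute[of e])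
    qed
    finally show ?case unfolding mu lhs by simp
  qed
  have "kd.d (germ F \<pp> (a, pvar i ^ n)) = R n a"
    using a
  proof (induction rule: homogeneous_induct)
    case zero
    have "R n 0 = \<zero>\<^bsub>kd.\<Omega>\<^esub>" unfolding R_def using du zero_eq_germ[OF pw, of n] by (simp add: km.smult_l_null)
    then show ?case using zero_eq_germ[OF pw, of n] d_zero by simp
  next
    case (add f g)
    have "R n (f + g) = finsum kd.\<Omega> (\<lambda>j. germ F \<pp> (pvar i * pdiff j f, pvar i ^ n) \<odot>\<^bsub>kd.\<Omega>\<^esub> kd.d (ratio i j) \<oplus>\<^bsub>kd.\<Omega>\<^esub>
        germ F \<pp> (pvar i * pdiff j g, pvar i ^ n) \<odot>\<^bsub>kd.\<Omega>\<^esub> kd.d (ratio i j)) (- {i})"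
      unfolding R_def
    proof (rule km.finsum_cong')
      fix j
      have "germ F \<pp> (pvar i * pdiff j (f + g), pvar i ^ n) = germ F \<pp> (pvar i * pdiff j f, pvar i ^ n) \<oplus>\<^bsub>stalk F \<pp>\<^esub> germ F \<pp> (pvar i * pdiff j g, pvar i ^ n)"
        using germ_add_same_denom[OF homogeneous_pvar_pdiff[OF add(1)] homogeneous_pvar_pdiff[OF add(2)] pw] by (simp add: pdiff_add distrib_left)
      then show "germ F \<pp> (pvar i * pdiff j (f + g), pvar i ^ n) \<odot>\<^bsub>kd.\<Omega>\<^esub> kd.d (ratio i j) =
        germ F \<pp> (pvar i * pdiff j f, pvar i ^ n) \<odot>\<^bsub>kd.\<Omega>\<^esub> kd.d (ratio i j) \<oplus>\<^bsub>kd.\<Omega>\<^esub>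
        germ F \<pp> (pvar i * pdiff j g, pvar i ^ n) \<odot>\<^bsub>kd.\<Omega>\<^esub> kd.d (ratio i j)"
        using gc[OF homogeneous_pvar_pdiff[OF add(1)]] gc[OF homogeneous_pvar_pdiff[OF add(2)]] du by (simp add: km.smult_l_distr)
    qed (use tc[OF add(1)] tc[OF add(2)] in auto)
    also have "\<dots> = R n f \<oplus>\<^bsub>kd.\<Omega>\<^esub> R n g" unfolding R_def using tc[OF add(1)] tc[OF add(2)] by (intro km.finsum_addf) auto
    finally show ?case
      using add kd.d_add[OF gc[OF add(1)] gc[OF add(2)]] germ_add_same_denom[OF add(1,2) pw] by simp
  next
    case (single m c)
    then show ?case by (rule mono)
  qed
  then show ?thesis by (simp add: R_def)
qed

end

section \<open>Derivations into residue fields\<close>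

lemma (in homogeneous_point) vanishes_self: "F = \<pp> \<Longrightarrow> vanishes a \<longleftrightarrow> a \<in> \<pp>"
  using vanishes_subset vanishes_base ideal_of_base by blast

text \<open>A vector of forms annihilated modulo the prime by the gradients of F is a tangent vector
  at the point; it induces a derivation from the local ring to the residue field. The common degree
  e allows a homogeneous formula.\<close>

locale point_derivation = homogeneous_point F \<pp> for F :: "'r::comm_ring_1 poly5 set" and \<pp> +
  fixes v :: "5 \<Rightarrow> 'r poly5" and e :: nat and i :: 5
  assumes F_sub: "F \<subseteq> \<pp>" and i: "pvar i \<notin> \<pp>" and v: "\<And>j. homogeneous e (v j)"
    and tangent: "\<And>f. f \<in> F \<Longrightarrow> (\<Sum>j\<in>UNIV. v j * pdiff j f) \<in> \<pp>"
begin

sublocale res: homogeneous_point \<pp> \<pp>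
  using prime by unfold_locales

definition \<delta> :: "'r poly5 \<Rightarrow> 'r poly5" where
  "\<delta> f = (\<Sum>j\<in>UNIV. v j * pdiff j f)"

lemma \<delta>_add: "\<delta> (f + g) = \<delta> f + \<delta> g" and \<delta>_diff: "\<delta> (f - g) = \<delta> f - \<delta> g"
  by (simp_all add: \<delta>_def pdiff_add pdiff_diff distrib_left right_diff_distrib sum.distrib sum_subtractf)

lemma \<delta>_0 [simp]: "\<delta> 0 = 0"
  by (simp add: \<delta>_def)

lemma \<delta>_mult: "\<delta> (f * g) = f * \<delta> g + g * \<delta> f"
  by (simp add: \<delta>_def pdiff_mult distrib_left sum.distrib sum_distrib_left mult_ac)

lemma \<delta>_ideal: "f \<in> ideal_of F \<Longrightarrow> \<delta> f \<in> \<pp>"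
proof -
  have "is_ideal {f \<in> \<pp>. \<delta> f \<in> \<pp>}"
    using ideal_pp by (intro is_idealI) (auto simp: \<delta>_add \<delta>_mult ideal_0 ideal_add ideal_mult ideal_mult_right)
  moreover have "F \<subseteq> {f \<in> \<pp>. \<delta> f \<in> \<pp>}" using F_sub tangent by (auto simp: \<delta>_def)
  ultimately show "f \<in> ideal_of F \<Longrightarrow> \<delta> f \<in> \<pp>" using ideal_of_least by blast
qed

text \<open>The quotient rule, with the powers of \<open>pvar i\<close> balancing the degree e of
  the vector. A representative is selected by \<open>SOME\<close>; \<open>D_germ\<close> shows that
  the selection has no influence.\<close>

definition D :: "('r poly5 \<times> 'r poly5) set \<Rightarrow> ('r poly5 \<times> 'r poly5) set" where
  "D U = (let (a, s) = SOME p. p \<in> fractions_at \<pp> \<and> U = germ F \<pp> p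
     in germ \<pp> \<pp> (pvar i * (s * \<delta> a - a * \<delta> s), s * s * pvar i ^ e))"

lemma D_fraction:
  assumes "(a, s) \<in> fractions_at \<pp>"
  shows "(pvar i * (s * \<delta> a - a * \<delta> s), s * s * pvar i ^ e) \<in> fractions_at \<pp>"
proof -
  obtain n where n: "homogeneous n a" "homogeneous n s" "s \<notin> \<pp>" using assms by (rule fractions_atE)
  have h: "homogeneous (n + (e + n)) (b * (v j * (pvar i * pdiff j c)))" if "homogeneous n b" "homogeneous n c" for b c j
    by (intro homogeneous_mult homogeneous_pvar_pdiff that v)
  have "pvar i * (s * \<delta> a - a * \<delta> s) = (\<Sum>j\<in>UNIV. s * (v j * (pvar i * pdiff j a))) - (\<Sum>j\<in>UNIV. a * (v j * (pvar i * pdiff j s)))"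
    by (simp add: \<delta>_def right_diff_distrib sum_distrib_left mult_ac)
  moreover have "homogeneous (n + (e + n)) \<dots>" using h n by (intro homogeneous_diff homogeneous_sum)
  moreover have "homogeneous (n + n + e) (s * s * pvar i ^ e)" by (intro homogeneous_mult n pvar_power_facts[OF i])
  then have "homogeneous (n + (e + n)) (s * s * pvar i ^ e)" by (simp add: ac_simps)
  moreover have "s * s * pvar i ^ e \<notin> \<pp>" using n(3) notin_power[OF i] by (simp add: mult_mem_iff)
  ultimately show ?thesis by (intro fractions_atI) auto
qed

lemma D_germ:
  assumes as: "(a, s) \<in> fractions_at \<pp>"
  shows "D (germ F \<pp> (a, s)) = germ \<pp> \<pp> (pvar i * (s * \<delta> a - a * \<delta> s), s * s * pvar i ^ e)"
proof -
  let ?P = "\<lambda>p. p \<in> fractions_at \<pp> \<and> germ F \<pp> (a, s) = germ F \<pp> p"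
  obtain b t where bt: "(SOME p. ?P p) = (b, t)" by (rule prod.exhaust)
  have "?P (a, s)" using as by simp
  then have "?P (SOME p. ?P p)" by (rule someI)
  then have b: "(b, t) \<in> fractions_at \<pp>" and eq: "germ F \<pp> (a, s) = germ F \<pp> (b, t)" using bt by auto
  have "vanishes (a * t - b * s)" using eq germ_eq_iff[OF as b] by simp
  then obtain u where u: "u \<notin> \<pp>" "u * (a * t - b * s) \<in> ideal_of F" by (auto simp: vanishes_def)
  have "u * (a * t - b * s) \<in> \<pp>" using u(2) ideal_of_least[OF ideal_pp F_sub] by blast
  then have z: "a * t - b * s \<in> \<pp>" using u(1) by (simp add: mult_mem_iff)
  \<comment> \<open>The relation holds after multiplication by u. As the cross difference itself
    lies in the prime, the term with \<open>\<delta> u\<close> drops out, and primality cancels u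
    from the other.\<close>
  have "u * \<delta> (a * t - b * s) + (a * t - b * s) * \<delta> u \<in> \<pp>" using \<delta>_ideal[OF u(2)] by (simp add: \<delta>_mult)
  moreover have "(a * t - b * s) * \<delta> u \<in> \<pp>" using z by (rule ideal_mult_right[OF ideal_pp])
  ultimately have "u * \<delta> (a * t - b * s) \<in> \<pp>" using ideal_diff[OF ideal_pp] by fastforce
  then have dz: "\<delta> (a * t - b * s) \<in> \<pp>" using u(1) by (simp add: mult_mem_iff)
  have "pvar i * (s * \<delta> a - a * \<delta> s) * (t * t * pvar i ^ e) - pvar i * (t * \<delta> b - b * \<delta> t) * (s * s * pvar i ^ e) =
    (pvar i * pvar i ^ e * s * t) * \<delta> (a * t - b * s) - (pvar i * pvar i ^ e * (t * \<delta> s + s * \<delta> t)) * (a * t - b * s)"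
    by (simp add: \<delta>_diff \<delta>_mult algebra_simps)
  also have "\<dots> \<in> \<pp>"
    by (rule ideal_diff[OF ideal_pp ideal_mult[OF ideal_pp dz] ideal_mult[OF ideal_pp z]])
  finally have "germ \<pp> \<pp> (pvar i * (s * \<delta> a - a * \<delta> s), s * s * pvar i ^ e) = germ \<pp> \<pp> (pvar i * (t * \<delta> b - b * \<delta> t), t * t * pvar i ^ e)"
    using res.germ_eq_iff[OF D_fraction[OF as] D_fraction[OF b]] res.vanishes_self by simp
  then show ?thesis unfolding D_def bt by simp
qed

text \<open>Reduction to the residue field: \<open>stalk \<pp> \<pp>\<close> is the local ring of
  the scheme cut out by the prime itself, taken at its generic point.\<close>

definition \<rho> :: "('r poly5 \<times> 'r poly5) set \<Rightarrow> ('r poly5 \<times> 'r poly5) set" where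
  "\<rho> U = germ \<pp> \<pp> (SOME p. p \<in> fractions_at \<pp> \<and> U = germ F \<pp> p)"

lemma \<rho>_germ:
  assumes as: "(a, s) \<in> fractions_at \<pp>"
  shows "\<rho> (germ F \<pp> (a, s)) = germ \<pp> \<pp> (a, s)"
proof -
  let ?P = "\<lambda>p. p \<in> fractions_at \<pp> \<and> germ F \<pp> (a, s) = germ F \<pp> p"
  obtain b t where bt: "(SOME p. ?P p) = (b, t)" by (rule prod.exhaust)
  have "?P (a, s)" using as by simp
  then have "?P (SOME p. ?P p)" by (rule someI)
  then have b: "(b, t) \<in> fractions_at \<pp>" and eq: "germ F \<pp> (a, s) = germ F \<pp> (b, t)" using bt by auto
  have "vanishes (a * t - b * s)" using eq germ_eq_iff[OF as b] by simp
  then have "a * t - b * s \<in> \<pp>" by (rule vanishes_subset[OF F_sub])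
  then have "germ \<pp> \<pp> (a, s) = germ \<pp> \<pp> (b, t)" using res.germ_eq_iff[OF as b] res.vanishes_self by simp
  then show ?thesis unfolding \<rho>_def bt by simp
qed

lemma \<rho>_hom: "\<rho> \<in> ring_hom (stalk F \<pp>) (stalk \<pp> \<pp>)"
proof (rule ring_hom_memI)
  fix U V assume "U \<in> carrier (stalk F \<pp>)" "V \<in> carrier (stalk F \<pp>)"
  then obtain a s b t where a: "(a, s) \<in> fractions_at \<pp>" "U = germ F \<pp> (a, s)" and b: "(b, t) \<in> fractions_at \<pp>" "V = germ F \<pp> (b, t)"
    by (elim stalk_cases) blast
  show "\<rho> (U \<otimes>\<^bsub>stalk F \<pp>\<^esub> V) = \<rho> U \<otimes>\<^bsub>stalk \<pp> \<pp>\<^esub> \<rho> V"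
    using a b by (simp add: mult_stalk res.mult_stalk \<rho>_germ fractions_mult)
  show "\<rho> (U \<oplus>\<^bsub>stalk F \<pp>\<^esub> V) = \<rho> U \<oplus>\<^bsub>stalk \<pp> \<pp>\<^esub> \<rho> V"
    using a b by (simp add: add_stalk res.add_stalk \<rho>_germ fractions_add)
next
  fix U assume "U \<in> carrier (stalk F \<pp>)"
  then show "\<rho> U \<in> carrier (stalk \<pp> \<pp>)" by (elim stalk_cases) (simp add: \<rho>_germ)
next
  show "\<rho> \<one>\<^bsub>stalk F \<pp>\<^esub> = \<one>\<^bsub>stalk \<pp> \<pp>\<^esub>" by (simp add: one_stalk res.one_stalk \<rho>_germ fractions_one)
qed

lemma D_closed: "U \<in> carrier (stalk F \<pp>) \<Longrightarrow> D U \<in> carrier (stalk \<pp> \<pp>)"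
  by (elim stalk_cases) (simp add: D_germ D_fraction)

lemma D_add:
  assumes "U \<in> carrier (stalk F \<pp>)" "V \<in> carrier (stalk F \<pp>)"
  shows "D (U \<oplus>\<^bsub>stalk F \<pp>\<^esub> V) = D U \<oplus>\<^bsub>stalk \<pp> \<pp>\<^esub> D V"
proof -
  obtain a s b t where a: "(a, s) \<in> fractions_at \<pp>" "U = germ F \<pp> (a, s)" and b: "(b, t) \<in> fractions_at \<pp>" "V = germ F \<pp> (b, t)"
    using assms by (elim stalk_cases) blast
  show ?thesis
    unfolding a(2) b(2) add_stalk[OF a(1) b(1)] D_germ[OF fractions_add[OF a(1) b(1)]] D_germ[OF a(1)] D_germ[OF b(1)]
      res.add_stalk[OF D_fraction[OF a(1)] D_fraction[OF b(1)]]
    by (rule res.germ_eqI[OF D_fraction[OF fractions_add[OF a(1) b(1)]] fractions_add[OF D_fraction[OF a(1)] D_fraction[OF b(1)]]])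
      (simp add: \<delta>_add \<delta>_mult algebra_simps)
qed

lemma D_mult:
  assumes "U \<in> carrier (stalk F \<pp>)" "V \<in> carrier (stalk F \<pp>)"
  shows "D (U \<otimes>\<^bsub>stalk F \<pp>\<^esub> V) = \<rho> U \<otimes>\<^bsub>stalk \<pp> \<pp>\<^esub> D V \<oplus>\<^bsub>stalk \<pp> \<pp>\<^esub> \<rho> V \<otimes>\<^bsub>stalk \<pp> \<pp>\<^esub> D U"
proof -
  obtain a s b t where a: "(a, s) \<in> fractions_at \<pp>" "U = germ F \<pp> (a, s)" and b: "(b, t) \<in> fractions_at \<pp>" "V = germ F \<pp> (b, t)"
    using assms by (elim stalk_cases) blast
  note f1 = fractions_mult[OF a(1) D_fraction[OF b(1)]] and f2 = fractions_mult[OF b(1) D_fraction[OF a(1)]]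
  show ?thesis
    unfolding a(2) b(2) mult_stalk[OF a(1) b(1)] D_germ[OF fractions_mult[OF a(1) b(1)]] D_germ[OF a(1)] D_germ[OF b(1)]
      \<rho>_germ[OF a(1)] \<rho>_germ[OF b(1)] res.mult_stalk[OF a(1) D_fraction[OF b(1)]] res.mult_stalk[OF b(1) D_fraction[OF a(1)]]
      res.add_stalk[OF f1 f2]
    by (rule res.germ_eqI[OF D_fraction[OF fractions_mult[OF a(1) b(1)]] fractions_add[OF f1 f2]])
      (simp add: \<delta>_mult algebra_simps)
qed

lemma D_const:
  assumes "U \<in> range (scalar_germ F \<pp>)"
  shows "D U = \<zero>\<^bsub>stalk \<pp> \<pp>\<^esub>"
proof -
  obtain c where "U = germ F \<pp> (pconst c, 1)" using assms by (auto simp: scalar_germ_def)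
  moreover have "\<delta> (pconst c) = 0" "\<delta> 1 = 0" by (simp_all add: \<delta>_def)
  ultimately show ?thesis
    using res.germ_eq_zero_iff[OF D_fraction[OF fractions_const[of c]]] res.vanishes_0 by (simp add: D_germ fractions_const)
qed

lemma D_ratio_eq_zero_iff:
  assumes "v i = 0"
  shows "D (ratio i j) = \<zero>\<^bsub>stalk \<pp> \<pp>\<^esub> \<longleftrightarrow> v j \<in> \<pp>"
proof -
  have "\<delta> (pvar j) = v j" for j
    by (simp add: \<delta>_def pdiff_pvar if_distrib[of "\<lambda>x. _ * x"] cong: if_cong)
  then have "D (ratio i j) = germ \<pp> \<pp> (pvar i * (pvar i * v j), pvar i * pvar i * pvar i ^ e)"
    "(pvar i * (pvar i * v j), pvar i * pvar i * pvar i ^ e) \<in> fractions_at \<pp>"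
    using D_germ[OF fractions_atI[OF homogeneous_pvar homogeneous_pvar i], of j]
      D_fraction[OF fractions_atI[OF homogeneous_pvar homogeneous_pvar i], of j] assms by (simp_all add: ratio_def)
  then show ?thesis using i by (simp add: res.germ_eq_zero_iff res.vanishes_self mult_mem_iff)
qed

lemma functional:
  assumes w: "w \<in> carrier kd.\<Omega>"
  obtains c where "c \<in> carrier (stalk \<pp> \<pp>)"
    "\<And>a \<alpha>. a \<in> carrier (stalk F \<pp>) \<Longrightarrow> \<alpha> \<in> carrier (stalk F \<pp>) \<Longrightarrow> kd.d a = \<alpha> \<odot>\<^bsub>kd.\<Omega>\<^esub> w \<Longrightarrow> D a = \<rho> \<alpha> \<otimes>\<^bsub>stalk \<pp> \<pp>\<^esub> c"
  using kd.derivation_functional[OF res.cring_stalk \<rho>_hom D_closed D_add D_mult D_const w] by blast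

end

text \<open>If w generates the differentials, each derivation into the residue field is determined
  by its value at w. The first vector has nonzero value there, while \<open>v k = 0\<close>; so the
  coefficient of the k-th ratio vanishes in the residue field. Then the second vector must vanish at
  k too.\<close>

lemma no_two_tangent_vectors:
  assumes "homogeneous_prime \<pp>" and F: "F \<subseteq> \<pp>" and i: "pvar i \<notin> \<pp>"
    and w: "w \<in> carrier (omega_stalk F \<pp>)"
      "\<And>u. u \<in> carrier (omega_stalk F \<pp>) \<Longrightarrow> \<exists>\<alpha>\<in>carrier (stalk F \<pp>). u = \<alpha> \<odot>\<^bsub>omega_stalk F \<pp>\<^esub> w"
    and v: "\<And>j. homogeneous e (v j)" "\<And>f. f \<in> F \<Longrightarrow> (\<Sum>j\<in>UNIV. v j * pdiff j f) \<in> \<pp>"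
    and v': "\<And>j. homogeneous e' (v' j)" "\<And>f. f \<in> F \<Longrightarrow> (\<Sum>j\<in>UNIV. v' j * pdiff j f) \<in> \<pp>"
    and vi: "v i = 0" "v' i = 0" and jk: "v j \<notin> \<pp>" "v k = 0" "v' k \<notin> \<pp>"
  shows False
proof -
  interpret P: point_derivation F \<pp> v e i using assms by unfold_locales auto
  interpret P': point_derivation F \<pp> v' e' i using assms by unfold_locales auto
  let ?K = "stalk \<pp> \<pp>"
  have w': "w \<in> carrier P.kd.\<Omega>" using w(1) by (simp add: P.omega_stalk_eq)
  have "\<exists>\<alpha>\<in>carrier (stalk F \<pp>). P.kd.d (P.ratio i n) = \<alpha> \<odot>\<^bsub>P.kd.\<Omega>\<^esub> w" for n
    using w(2)[unfolded P.omega_stalk_eq] P.kd.d_closed[OF P.ratio_closed[OF i]] by blast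
  then obtain \<alpha> where \<alpha>: "\<And>n. \<alpha> n \<in> carrier (stalk F \<pp>)" "\<And>n. P.kd.d (P.ratio i n) = \<alpha> n \<odot>\<^bsub>P.kd.\<Omega>\<^esub> w" by metis
  obtain c where c: "c \<in> carrier ?K"
    "\<And>a \<alpha>. a \<in> carrier (stalk F \<pp>) \<Longrightarrow> \<alpha> \<in> carrier (stalk F \<pp>) \<Longrightarrow> P.kd.d a = \<alpha> \<odot>\<^bsub>P.kd.\<Omega>\<^esub> w \<Longrightarrow> P.D a = P.\<rho> \<alpha> \<otimes>\<^bsub>?K\<^esub> c"
    using P.functional[OF w'] by blast
  obtain c' where c': "c' \<in> carrier ?K"
    "\<And>a \<alpha>. a \<in> carrier (stalk F \<pp>) \<Longrightarrow> \<alpha> \<in> carrier (stalk F \<pp>) \<Longrightarrow> P.kd.d a = \<alpha> \<odot>\<^bsub>P.kd.\<Omega>\<^esub> w \<Longrightarrow> P'.D a = P'.\<rho> \<alpha> \<otimes>\<^bsub>?K\<^esub> c'"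
    using P'.functional[OF w'] by blast
  have D: "P.D (P.ratio i n) = P.\<rho> (\<alpha> n) \<otimes>\<^bsub>?K\<^esub> c" "P'.D (P.ratio i n) = P'.\<rho> (\<alpha> n) \<otimes>\<^bsub>?K\<^esub> c'" for n
    using c(2)[OF P.ratio_closed[OF i] \<alpha>] c'(2)[OF P.ratio_closed[OF i] \<alpha>] by auto
  have zero: "U = \<zero>\<^bsub>?K\<^esub> \<or> V = \<zero>\<^bsub>?K\<^esub>" if UV: "U \<in> carrier ?K" "V \<in> carrier ?K" "U \<otimes>\<^bsub>?K\<^esub> V = \<zero>\<^bsub>?K\<^esub>" for U V
  proof -
    obtain a s b t where a: "(a, s) \<in> fractions_at \<pp>" "U = germ \<pp> \<pp> (a, s)" and b: "(b, t) \<in> fractions_at \<pp>" "V = germ \<pp> \<pp> (b, t)"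
      using UV by (elim P.res.stalk_cases) blast
    have "a * b \<in> \<pp>" using UV(3) a b P.res.germ_eq_zero_iff[OF P.fractions_mult[OF a(1) b(1)]]
      by (simp add: P.res.mult_stalk P.res.vanishes_self)
    then show ?thesis using a b by (auto simp: P.mult_mem_iff P.res.germ_eq_zero_iff P.res.vanishes_self)
  qed
  have \<rho>c: "P.\<rho> (\<alpha> n) \<in> carrier ?K" for n using \<alpha>(1) P.\<rho>_hom by (auto dest: ring_hom_closed)
  have "P.\<rho> (\<alpha> j) \<otimes>\<^bsub>?K\<^esub> c \<noteq> \<zero>\<^bsub>?K\<^esub>" using P.D_ratio_eq_zero_iff[OF vi(1), of j] jk(1) D(1) by simp
  then have "c \<noteq> \<zero>\<^bsub>?K\<^esub>" using \<rho>c P.res.stalk.r_null by auto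
  moreover have "v k \<in> \<pp>" using jk(2) ideal_0[OF P.ideal_pp] by simp
  then have "P.\<rho> (\<alpha> k) \<otimes>\<^bsub>?K\<^esub> c = \<zero>\<^bsub>?K\<^esub>" using P.D_ratio_eq_zero_iff[OF vi(1), of k] D(1) by simp
  ultimately have "P.\<rho> (\<alpha> k) = \<zero>\<^bsub>?K\<^esub>" using zero[OF \<rho>c c(1)] by blast
  moreover have "P.\<rho> = P'.\<rho>" by (simp add: P.\<rho>_def P'.\<rho>_def fun_eq_iff)
  ultimately have "P'.D (P.ratio i k) = \<zero>\<^bsub>?K\<^esub>" using D(2)[of k] c'(1) by (simp add: P.res.stalk.l_null)
  then show False using P'.D_ratio_eq_zero_iff[OF vi(2), of k] jk(3) by simp
qed

section \<open>Submaximal Pfaffians\<close>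

lemma X5D:
  assumes "\<Phi> \<in> X5"
  shows "homogeneous 1 (\<Phi> i j)" "\<Phi> i i = 0" "\<Phi> j i = - \<Phi> i j"
  using assms unfolding X5_def by blast+

lemma x5_entries:
  assumes "\<Phi> \<in> X5"
  shows "\<Phi> 0 0 = 0" "\<Phi> 1 1 = 0" "\<Phi> 2 2 = 0" "\<Phi> 3 3 = 0" "\<Phi> 4 4 = 0"
    "\<Phi> 1 0 = - \<Phi> 0 1" "\<Phi> 2 0 = - \<Phi> 0 2" "\<Phi> 3 0 = - \<Phi> 0 3" "\<Phi> 4 0 = - \<Phi> 0 4"
    "\<Phi> 2 1 = - \<Phi> 1 2" "\<Phi> 3 1 = - \<Phi> 1 3" "\<Phi> 4 1 = - \<Phi> 1 4"
    "\<Phi> 3 2 = - \<Phi> 2 3" "\<Phi> 4 2 = - \<Phi> 2 4" "\<Phi> 4 3 = - \<Phi> 3 4"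
  using X5D[OF assms] by metis+

lemma Pf_mult_matrix:
  assumes \<Phi>: "\<Phi> \<in> X5"
  shows "(\<Sum>i\<in>UNIV. Pf \<Phi> i * \<Phi> i j) = 0"
proof -
  have "\<forall>j. (\<Sum>i\<in>UNIV. Pf \<Phi> i * \<Phi> i j) = 0"
    unfolding forall_5 sum_5 by (simp add: Pf_def pf4_def x5_entries[OF \<Phi>] algebra_simps)
  then show ?thesis by blast
qed

lemma homogeneous_pf4:
  assumes \<Phi>: "\<Phi> \<in> X5"
  shows "homogeneous 2 (pf4 \<Phi> a b c d)"
proof -
  have "homogeneous (1 + 1) (\<Phi> i j * \<Phi> k l)" for i j k l by (intro homogeneous_mult X5D(1)[OF \<Phi>])
  then have "homogeneous 2 (\<Phi> i j * \<Phi> k l)" for i j k l by (simp only: one_add_one)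
  then show ?thesis unfolding pf4_def by (intro homogeneous_add homogeneous_diff)
qed

lemma homogeneous_Pf:
  assumes \<Phi>: "\<Phi> \<in> X5"
  shows "homogeneous 2 (Pf \<Phi> i)"
  using homogeneous_pf4[OF \<Phi>] homogeneous_uminus[OF homogeneous_pf4[OF \<Phi>]] by (simp add: Pf_def)

lemma homogeneous_pfaffian_scheme:
  "\<Phi> \<in> X5 \<Longrightarrow> \<forall>f\<in>pfaffian_scheme \<Phi>. \<exists>d. homogeneous d f"
  using homogeneous_Pf by (auto simp: pfaffian_scheme_def)

text \<open>Up to the sign of the permutation \<open>(a, b, c, d, e)\<close>, the submaximal Pfaffians involving the
  entry \<open>(a, b)\<close>.\<close>

definition pivot :: "'r::comm_ring_1 matrix5 \<Rightarrow> 5 \<Rightarrow> 5 \<Rightarrow> 5 \<Rightarrow> 5 \<Rightarrow> 5 \<Rightarrow> 'r poly5 \<Rightarrow> bool" where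
  "pivot \<Phi> a b c d e \<epsilon> \<longleftrightarrow> distinct [a, b, c, d, e] \<and> (\<epsilon> = 1 \<or> \<epsilon> = - 1) \<and>
     Pf \<Phi> e = - \<epsilon> * pf4 \<Phi> a b c d \<and> Pf \<Phi> d = \<epsilon> * pf4 \<Phi> a b c e \<and> Pf \<Phi> c = - \<epsilon> * pf4 \<Phi> a b d e"

lemma exists_pivot:
  assumes \<Phi>: "\<Phi> \<in> X5" and ab: "a \<noteq> b"
  obtains c d e \<epsilon> where "pivot \<Phi> a b c d e \<epsilon>"
proof -
  have "\<forall>a b. a \<noteq> b \<longrightarrow> (\<exists>c d e \<epsilon>. pivot \<Phi> a b c d e \<epsilon>)"
    unfolding forall_5
  proof (intro conjI impI)
    show "\<exists>c d e \<epsilon>. pivot \<Phi> 0 1 c d e \<epsilon>"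
      by (rule exI[of _ 2], rule exI[of _ 3], rule exI[of _ 4], rule exI[of _ "1"])
        (simp add: pivot_def Pf_def pf4_def x5_entries[OF \<Phi>] algebra_simps)
    show "\<exists>c d e \<epsilon>. pivot \<Phi> 0 2 c d e \<epsilon>"
      by (rule exI[of _ 1], rule exI[of _ 3], rule exI[of _ 4], rule exI[of _ "- 1"])
        (simp add: pivot_def Pf_def pf4_def x5_entries[OF \<Phi>] algebra_simps)
    show "\<exists>c d e \<epsilon>. pivot \<Phi> 0 3 c d e \<epsilon>"
      by (rule exI[of _ 1], rule exI[of _ 2], rule exI[of _ 4], rule exI[of _ "1"])
        (simp add: pivot_def Pf_def pf4_def x5_entries[OF \<Phi>] algebra_simps)
    show "\<exists>c d e \<epsilon>. pivot \<Phi> 0 4 c d e \<epsilon>"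
      by (rule exI[of _ 1], rule exI[of _ 2], rule exI[of _ 3], rule exI[of _ "- 1"])
        (simp add: pivot_def Pf_def pf4_def x5_entries[OF \<Phi>] algebra_simps)
    show "\<exists>c d e \<epsilon>. pivot \<Phi> 1 0 c d e \<epsilon>"
      by (rule exI[of _ 2], rule exI[of _ 3], rule exI[of _ 4], rule exI[of _ "- 1"])
        (simp add: pivot_def Pf_def pf4_def x5_entries[OF \<Phi>] algebra_simps)
    show "\<exists>c d e \<epsilon>. pivot \<Phi> 1 2 c d e \<epsilon>"
      by (rule exI[of _ 0], rule exI[of _ 3], rule exI[of _ 4], rule exI[of _ "1"])
        (simp add: pivot_def Pf_def pf4_def x5_entries[OF \<Phi>] algebra_simps)
    show "\<exists>c d e \<epsilon>. pivot \<Phi> 1 3 c d e \<epsilon>"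
      by (rule exI[of _ 0], rule exI[of _ 2], rule exI[of _ 4], rule exI[of _ "- 1"])
        (simp add: pivot_def Pf_def pf4_def x5_entries[OF \<Phi>] algebra_simps)
    show "\<exists>c d e \<epsilon>. pivot \<Phi> 1 4 c d e \<epsilon>"
      by (rule exI[of _ 0], rule exI[of _ 2], rule exI[of _ 3], rule exI[of _ "1"])
        (simp add: pivot_def Pf_def pf4_def x5_entries[OF \<Phi>] algebra_simps)
    show "\<exists>c d e \<epsilon>. pivot \<Phi> 2 0 c d e \<epsilon>"
      by (rule exI[of _ 1], rule exI[of _ 3], rule exI[of _ 4], rule exI[of _ "1"])
        (simp add: pivot_def Pf_def pf4_def x5_entries[OF \<Phi>] algebra_simps)
    show "\<exists>c d e \<epsilon>. pivot \<Phi> 2 1 c d e \<epsilon>"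
      by (rule exI[of _ 0], rule exI[of _ 3], rule exI[of _ 4], rule exI[of _ "- 1"])
        (simp add: pivot_def Pf_def pf4_def x5_entries[OF \<Phi>] algebra_simps)
    show "\<exists>c d e \<epsilon>. pivot \<Phi> 2 3 c d e \<epsilon>"
      by (rule exI[of _ 0], rule exI[of _ 1], rule exI[of _ 4], rule exI[of _ "1"])
        (simp add: pivot_def Pf_def pf4_def x5_entries[OF \<Phi>] algebra_simps)
    show "\<exists>c d e \<epsilon>. pivot \<Phi> 2 4 c d e \<epsilon>"
      by (rule exI[of _ 0], rule exI[of _ 1], rule exI[of _ 3], rule exI[of _ "- 1"])
        (simp add: pivot_def Pf_def pf4_def x5_entries[OF \<Phi>] algebra_simps)
    show "\<exists>c d e \<epsilon>. pivot \<Phi> 3 0 c d e \<epsilon>"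
      by (rule exI[of _ 1], rule exI[of _ 2], rule exI[of _ 4], rule exI[of _ "- 1"])
        (simp add: pivot_def Pf_def pf4_def x5_entries[OF \<Phi>] algebra_simps)
    show "\<exists>c d e \<epsilon>. pivot \<Phi> 3 1 c d e \<epsilon>"
      by (rule exI[of _ 0], rule exI[of _ 2], rule exI[of _ 4], rule exI[of _ "1"])
        (simp add: pivot_def Pf_def pf4_def x5_entries[OF \<Phi>] algebra_simps)
    show "\<exists>c d e \<epsilon>. pivot \<Phi> 3 2 c d e \<epsilon>"
      by (rule exI[of _ 0], rule exI[of _ 1], rule exI[of _ 4], rule exI[of _ "- 1"])
        (simp add: pivot_def Pf_def pf4_def x5_entries[OF \<Phi>] algebra_simps)
    show "\<exists>c d e \<epsilon>. pivot \<Phi> 3 4 c d e \<epsilon>"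
      by (rule exI[of _ 0], rule exI[of _ 1], rule exI[of _ 2], rule exI[of _ "1"])
        (simp add: pivot_def Pf_def pf4_def x5_entries[OF \<Phi>] algebra_simps)
    show "\<exists>c d e \<epsilon>. pivot \<Phi> 4 0 c d e \<epsilon>"
      by (rule exI[of _ 1], rule exI[of _ 2], rule exI[of _ 3], rule exI[of _ "1"])
        (simp add: pivot_def Pf_def pf4_def x5_entries[OF \<Phi>] algebra_simps)
    show "\<exists>c d e \<epsilon>. pivot \<Phi> 4 1 c d e \<epsilon>"
      by (rule exI[of _ 0], rule exI[of _ 2], rule exI[of _ 3], rule exI[of _ "- 1"])
        (simp add: pivot_def Pf_def pf4_def x5_entries[OF \<Phi>] algebra_simps)
    show "\<exists>c d e \<epsilon>. pivot \<Phi> 4 2 c d e \<epsilon>"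
      by (rule exI[of _ 0], rule exI[of _ 1], rule exI[of _ 3], rule exI[of _ "1"])
        (simp add: pivot_def Pf_def pf4_def x5_entries[OF \<Phi>] algebra_simps)
    show "\<exists>c d e \<epsilon>. pivot \<Phi> 4 3 c d e \<epsilon>"
      by (rule exI[of _ 0], rule exI[of _ 1], rule exI[of _ 2], rule exI[of _ "- 1"])
        (simp add: pivot_def Pf_def pf4_def x5_entries[OF \<Phi>] algebra_simps)
  qed simp_all
  then show ?thesis using that ab by blast
qed

lemma UNIV_5_distinct:
  assumes "distinct [a, b, c, d, e :: 5]"
  shows "UNIV = {a, b, c, d, e}"
proof -
  have "card {a, b, c, d, e} = CARD(5)" using assms by simp
  then have "{a, b, c, d, e} = UNIV" by (intro card_subset_eq) auto
  then show ?thesis by (rule sym)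
qed

lemma sum_5_distinct:
  assumes "distinct [a, b, c, d, e :: 5]"
  shows "(\<Sum>i\<in>UNIV. f i) = f a + f b + f c + f d + (f e :: 'a::comm_monoid_add)"
  unfolding UNIV_5_distinct[OF assms] using assms by (simp add: add.assoc)

text \<open>The columns b and a of \<open>P \<Phi> = 0\<close> express \<open>\<Phi> a b\<close>
  times \<open>Pf \<Phi> a\<close> and \<open>Pf \<Phi> b\<close> through the other three
  Pfaffians.\<close>

lemma pivot_mult_ideal:
  assumes \<Phi>: "\<Phi> \<in> X5" and pv: "pivot \<Phi> a b c d e \<epsilon>" and f: "f \<in> ideal_of (pfaffian_scheme \<Phi>)"
  shows "\<Phi> a b * f \<in> ideal_of {Pf \<Phi> c, Pf \<Phi> d, Pf \<Phi> e}"
proof -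
  let ?I = "ideal_of {Pf \<Phi> c, Pf \<Phi> d, Pf \<Phi> e}"
  have dist: "distinct [a, b, c, d, e]" using pv by (simp add: pivot_def)
  have base: "Pf \<Phi> c \<in> ?I" "Pf \<Phi> d \<in> ?I" "Pf \<Phi> e \<in> ?I" by (auto intro: ideal_of_base)
  have "Pf \<Phi> a * \<Phi> a b + Pf \<Phi> b * \<Phi> b b + Pf \<Phi> c * \<Phi> c b + Pf \<Phi> d * \<Phi> d b + Pf \<Phi> e * \<Phi> e b = 0"
    using Pf_mult_matrix[OF \<Phi>, of b] unfolding sum_5_distinct[OF dist] .
  then have "\<Phi> a b * Pf \<Phi> a + (Pf \<Phi> c * \<Phi> c b + Pf \<Phi> d * \<Phi> d b + Pf \<Phi> e * \<Phi> e b) = 0"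
    by (simp add: X5D(2)[OF \<Phi>] mult.commute[of "\<Phi> a b"] add.assoc)
  then have "\<Phi> a b * Pf \<Phi> a = - (Pf \<Phi> c * \<Phi> c b + Pf \<Phi> d * \<Phi> d b + Pf \<Phi> e * \<Phi> e b)"
    by (rule eq_neg_iff_add_eq_0[THEN iffD2])
  moreover have "\<dots> \<in> ?I"
    by (intro ideal_uminus[OF is_ideal_ideal_of] ideal_add[OF is_ideal_ideal_of] ideal_mult_right[OF is_ideal_ideal_of] base)
  ultimately have pa: "\<Phi> a b * Pf \<Phi> a \<in> ?I" by simp
  have "Pf \<Phi> a * \<Phi> a a + Pf \<Phi> b * \<Phi> b a + Pf \<Phi> c * \<Phi> c a + Pf \<Phi> d * \<Phi> d a + Pf \<Phi> e * \<Phi> e a = 0"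
    using Pf_mult_matrix[OF \<Phi>, of a] unfolding sum_5_distinct[OF dist] .
  then have "\<Phi> a b * Pf \<Phi> b = Pf \<Phi> c * \<Phi> c a + Pf \<Phi> d * \<Phi> d a + Pf \<Phi> e * \<Phi> e a"
    by (simp add: X5D(2)[OF \<Phi>] X5D(3)[OF \<Phi>, of b a] algebra_simps)
  moreover have "\<dots> \<in> ?I"
    by (intro ideal_add[OF is_ideal_ideal_of] ideal_mult_right[OF is_ideal_ideal_of] base)
  ultimately have pb: "\<Phi> a b * Pf \<Phi> b \<in> ?I" by simp
  have "\<Phi> a b * Pf \<Phi> i \<in> ?I" for i
  proof -
    have "i = a \<or> i = b \<or> i = c \<or> i = d \<or> i = e" using UNIV_5_distinct[OF dist] by blast
    then show ?thesis using pa pb base ideal_mult[OF is_ideal_ideal_of] by auto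
  qed
  moreover have "is_ideal {f. \<Phi> a b * f \<in> ?I}"
    by (intro is_idealI) (auto simp: distrib_left mult.left_commute[of "\<Phi> a b"] intro: ideal_0 ideal_add ideal_mult)
  ultimately have "ideal_of (pfaffian_scheme \<Phi>) \<subseteq> {f. \<Phi> a b * f \<in> ?I}"
    by (intro ideal_of_least) (auto simp: pfaffian_scheme_def)
  then show ?thesis using f by blast
qed

text \<open>Differentiate \<open>P \<Phi> = 0\<close>; the part in which P is not differentiated
  lies in the ideal. So along the scheme the derivatives of P are in the kernel of
  \<open>\<Phi>\<close>.\<close>

lemma first_order_syzygy:
  assumes \<Phi>: "\<Phi> \<in> X5"
  shows "(\<Sum>i\<in>UNIV. pdiff k (Pf \<Phi> i) * \<Phi> i j) \<in> ideal_of (pfaffian_scheme \<Phi>)"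
proof -
  have "pdiff k (\<Sum>i\<in>UNIV. Pf \<Phi> i * \<Phi> i j) = 0" by (simp add: Pf_mult_matrix[OF \<Phi>])
  then have "(\<Sum>i\<in>UNIV. Pf \<Phi> i * pdiff k (\<Phi> i j)) + (\<Sum>i\<in>UNIV. pdiff k (Pf \<Phi> i) * \<Phi> i j) = 0"
    by (simp add: pdiff_sum pdiff_mult sum.distrib mult.commute)
  then have "(\<Sum>i\<in>UNIV. pdiff k (Pf \<Phi> i) * \<Phi> i j) = - (\<Sum>i\<in>UNIV. Pf \<Phi> i * pdiff k (\<Phi> i j))"
    by (simp add: eq_neg_iff_add_eq_0 add.commute)
  moreover have "(\<Sum>i\<in>UNIV. Pf \<Phi> i * pdiff k (\<Phi> i j)) \<in> ideal_of (pfaffian_scheme \<Phi>)"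
    by (intro ideal_sum[OF is_ideal_ideal_of] ideal_mult_right[OF is_ideal_ideal_of] ideal_of_base) (simp add: pfaffian_scheme_def)
  ultimately show ?thesis using ideal_uminus[OF is_ideal_ideal_of] by simp
qed

text \<open>If \<open>u\<close> and \<open>w\<close> lie in the kernel of an alternating matrix \<open>f\<close> of rank 2, then
  \<open>f\<^sub>0\<^sub>1 u m w\<^sup>T\<close> is the sum of the \<open>2 \<times> 2\<close> minors of \<open>(u, w)\<close> against the derivative of the
  Pfaffians of \<open>f\<close> in the direction of the alternating matrix \<open>m\<close>.\<close>

lemma rank_two_identity:
  fixes f01 f02 f03 f04 f12 f13 f14 f23 f24 f34 m01 m02 m03 m04 m12 m13 m14 m23 m24 m34
    u0 u1 u2 u3 u4 w0 w1 w2 w3 w4 :: "'a::comm_ring_1"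
  assumes I: "is_ideal I"
    and r1: "f01 * u0 - (u2 * f12 + u3 * f13 + u4 * f14) \<in> I" (is "?r1 \<in> I")
    and r0: "- (f01 * u1) - (u2 * f02 + u3 * f03 + u4 * f04) \<in> I" (is "?r0 \<in> I")
    and s1: "f01 * w0 - (w2 * f12 + w3 * f13 + w4 * f14) \<in> I" (is "?s1 \<in> I")
    and s0: "- (f01 * w1) - (w2 * f02 + w3 * f03 + w4 * f04) \<in> I" (is "?s0 \<in> I")
    and p: "f01 * f23 - f02 * f13 + f03 * f12 \<in> I" (is "?p23 \<in> I") "f01 * f24 - f02 * f14 + f04 * f12 \<in> I" (is "?p24 \<in> I")
      "f01 * f34 - f03 * f14 + f04 * f13 \<in> I" (is "?p34 \<in> I")
  shows "f01 * (f01 * (m01 * (u0 * w1 - u1 * w0) + m02 * (u0 * w2 - u2 * w0) + m03 * (u0 * w3 - u3 * w0) + m04 * (u0 * w4 - u4 * w0)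
      + m12 * (u1 * w2 - u2 * w1) + m13 * (u1 * w3 - u3 * w1) + m14 * (u1 * w4 - u4 * w1)
      + m23 * (u2 * w3 - u3 * w2) + m24 * (u2 * w4 - u4 * w2) + m34 * (u3 * w4 - u4 * w3))
    - ((u2 * w3 - u3 * w2) * (m01 * f23 + f01 * m23 - m02 * f13 - f02 * m13 + m03 * f12 + f03 * m12)
     + (u2 * w4 - u4 * w2) * (m01 * f24 + f01 * m24 - m02 * f14 - f02 * m14 + m04 * f12 + f04 * m12)
     + (u3 * w4 - u4 * w3) * (m01 * f34 + f01 * m34 - m03 * f14 - f03 * m14 + m04 * f13 + f04 * m13))) \<in> I" (is "?L \<in> I")
proof -
  let ?Aw = "w2 * f12 + w3 * f13 + w4 * f14" and ?Bw = "w2 * f02 + w3 * f03 + w4 * f04"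
  let ?Au = "u2 * f12 + u3 * f13 + u4 * f14" and ?Bu = "u2 * f02 + u3 * f03 + u4 * f04"
  have "?L = (m01 * (- ?s0 - ?Bw) + f01 * (m02 * w2 + m03 * w3 + m04 * w4)) * ?r1
      + (m01 * (?s1 + ?Aw) - f01 * (m12 * w2 + m13 * w3 + m14 * w4)) * ?r0
      + (m01 * ?Bu - f01 * (m02 * u2 + m03 * u3 + m04 * u4)) * ?s1
      + (f01 * (m12 * u2 + m13 * u3 + m14 * u4) - m01 * ?Au) * ?s0
      - m01 * ((u2 * w3 - u3 * w2) * ?p23 + (u2 * w4 - u4 * w2) * ?p24 + (u3 * w4 - u4 * w3) * ?p34)"
    by (simp add: algebra_simps)
  also have "\<dots> \<in> I"
    by (intro ideal_add[OF I] ideal_diff[OF I] ideal_mult[OF I r1] ideal_mult[OF I r0] ideal_mult[OF I s1] ideal_mult[OF I s0]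
        ideal_mult[OF I ideal_add[OF I ideal_add[OF I ideal_mult[OF I p(1)] ideal_mult[OF I p(2)]] ideal_mult[OF I p(3)]]])
  finally show ?thesis .
qed

definition minor3 :: "('i \<Rightarrow> 'a::comm_ring_1) \<Rightarrow> ('i \<Rightarrow> 'a) \<Rightarrow> ('i \<Rightarrow> 'a) \<Rightarrow> 'i \<Rightarrow> 'i \<Rightarrow> 'i \<Rightarrow> 'a" where
  "minor3 A B C k l m = A k * (B l * C m - B m * C l) - A l * (B k * C m - B m * C k) + A m * (B k * C l - B l * C k)"

text \<open>Modulo x the matrix has rank at most 2, and the derivatives of P in the directions k and
  m lie in its kernel. Thus \<open>rank_two_identity\<close> applies with the derivative of the
  matrix in direction l, which supplies the third row of the minor. The surplus factor
  \<open>\<Phi> a b\<close> is cancelled by primality.\<close>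

lemma Q_form_eq_minor:
  assumes \<Phi>: "\<Phi> \<in> X5" and pv: "pivot \<Phi> a b c d e \<epsilon>"
    and hp: "homogeneous_prime x" and F: "pfaffian_scheme \<Phi> \<subseteq> x" and ab: "\<Phi> a b \<notin> x"
  shows "\<Phi> a b * Q_form \<Phi> k l m -
    \<epsilon> * minor3 (\<lambda>j. pdiff j (Pf \<Phi> c)) (\<lambda>j. pdiff j (Pf \<Phi> d)) (\<lambda>j. pdiff j (Pf \<Phi> e)) k l m \<in> x"
proof -
  interpret homogeneous_point "pfaffian_scheme \<Phi>" x using hp by unfold_locales
  have Ix: "ideal_of (pfaffian_scheme \<Phi>) \<subseteq> x" using F by (rule ideal_of_least[OF ideal_pp])
  have dist: "distinct [a, b, c, d, e]" and \<epsilon>: "\<epsilon> = 1 \<or> \<epsilon> = - 1"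
    and pfs: "Pf \<Phi> e = - \<epsilon> * pf4 \<Phi> a b c d" "Pf \<Phi> d = \<epsilon> * pf4 \<Phi> a b c e" "Pf \<Phi> c = - \<epsilon> * pf4 \<Phi> a b d e"
    using pv by (auto simp: pivot_def)
  have anti: "\<Phi> b a = - \<Phi> a b" "\<Phi> c a = - \<Phi> a c" "\<Phi> d a = - \<Phi> a d" "\<Phi> e a = - \<Phi> a e" "\<Phi> c b = - \<Phi> b c" "\<Phi> d b = - \<Phi> b d" "\<Phi> e b = - \<Phi> b e"
    "\<Phi> d c = - \<Phi> c d" "\<Phi> e c = - \<Phi> c e" "\<Phi> e d = - \<Phi> d e"
    using X5D(3)[OF \<Phi>] by blast+
  define u where "u i = pdiff k (Pf \<Phi> i)" for i
  define w where "w i = pdiff m (Pf \<Phi> i)" for i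
  define v where "v i = pdiff l (Pf \<Phi> i)" for i
  define M where "M i j = pdiff l (\<Phi> i j)" for i j
  have syz: "t i a * \<Phi> a j + t i b * \<Phi> b j + t i c * \<Phi> c j + t i d * \<Phi> d j + t i e * \<Phi> e j \<in> x"
    if "t = (\<lambda>i h. pdiff i (Pf \<Phi> h))" for t i j
    using first_order_syzygy[OF \<Phi>, of i j] Ix unfolding sum_5_distinct[OF dist] that by blast
  have pf_in: "pf4 \<Phi> a b c d \<in> x" "pf4 \<Phi> a b c e \<in> x" "pf4 \<Phi> a b d e \<in> x"
  proof -
    have "Pf \<Phi> i \<in> x" for i using F by (auto simp: pfaffian_scheme_def)
    then have "- \<epsilon> * pf4 \<Phi> a b c d \<in> x" "\<epsilon> * pf4 \<Phi> a b c e \<in> x" "- \<epsilon> * pf4 \<Phi> a b d e \<in> x" using pfs by metis+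
    then show "pf4 \<Phi> a b c d \<in> x" "pf4 \<Phi> a b c e \<in> x" "pf4 \<Phi> a b d e \<in> x"
      using \<epsilon> by (auto simp: ideal_uminus_iff[OF ideal_pp])
  qed
  have r: "\<Phi> a b * u a - (u c * \<Phi> b c + u d * \<Phi> b d + u e * \<Phi> b e) \<in> x"
    "- (\<Phi> a b * u b) - (u c * \<Phi> a c + u d * \<Phi> a d + u e * \<Phi> a e) \<in> x"
    "\<Phi> a b * w a - (w c * \<Phi> b c + w d * \<Phi> b d + w e * \<Phi> b e) \<in> x"
    "- (\<Phi> a b * w b) - (w c * \<Phi> a c + w d * \<Phi> a d + w e * \<Phi> a e) \<in> x"
    using syz[OF refl, of k b] syz[OF refl, of k a] syz[OF refl, of m b] syz[OF refl, of m a]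
    unfolding anti X5D(2)[OF \<Phi>] u_def w_def by (simp_all add: algebra_simps)
  have Q: "Q_form \<Phi> k l m = M a b * (u a * w b - u b * w a) + M a c * (u a * w c - u c * w a) + M a d * (u a * w d - u d * w a) + M a e * (u a * w e - u e * w a)
      + M b c * (u b * w c - u c * w b) + M b d * (u b * w d - u d * w b) + M b e * (u b * w e - u e * w b)
      + M c d * (u c * w d - u d * w c) + M c e * (u c * w e - u e * w c) + M d e * (u d * w e - u e * w d)"
  proof -
    have Manti: "M b a = - M a b" "M c a = - M a c" "M d a = - M a d" "M e a = - M a e" "M c b = - M b c" "M d b = - M b d" "M e b = - M b e"
      "M d c = - M c d" "M e c = - M c e" "M e d = - M d e" "M a a = 0" "M b b = 0" "M c c = 0" "M d d = 0" "M e e = 0"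
      unfolding M_def by (simp_all add: anti pdiff_uminus X5D(2)[OF \<Phi>])
    have "Q_form \<Phi> k l m = (\<Sum>i\<in>UNIV. \<Sum>j\<in>UNIV. u i * M i j * w j)" by (simp add: Q_form_def u_def w_def M_def)
    then show ?thesis unfolding sum_5_distinct[OF dist] Manti by (simp add: algebra_simps)
  qed
  have V: "pdiff l (pf4 \<Phi> i j n h) = M i j * \<Phi> n h + \<Phi> i j * M n h - M i n * \<Phi> j h - \<Phi> i n * M j h + M i h * \<Phi> j n + \<Phi> i h * M j n" for i j n h
    unfolding pf4_def M_def by (simp add: pdiff_add pdiff_diff pdiff_mult algebra_simps)
  have vs: "v e = - \<epsilon> * pdiff l (pf4 \<Phi> a b c d)" "v d = \<epsilon> * pdiff l (pf4 \<Phi> a b c e)" "v c = - \<epsilon> * pdiff l (pf4 \<Phi> a b d e)"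
    unfolding v_def pfs using \<epsilon> by (auto simp: pdiff_uminus)
  have \<epsilon>2: "\<epsilon> * \<epsilon> = 1" using \<epsilon> by auto
  have minor: "\<epsilon> * minor3 (\<lambda>j. pdiff j (Pf \<Phi> c)) (\<lambda>j. pdiff j (Pf \<Phi> d)) (\<lambda>j. pdiff j (Pf \<Phi> e)) k l m =
      (u c * w d - u d * w c) * pdiff l (pf4 \<Phi> a b c d) + (u c * w e - u e * w c) * pdiff l (pf4 \<Phi> a b c e) + (u d * w e - u e * w d) * pdiff l (pf4 \<Phi> a b d e)"
  proof -
    have "minor3 (\<lambda>j. pdiff j (Pf \<Phi> c)) (\<lambda>j. pdiff j (Pf \<Phi> d)) (\<lambda>j. pdiff j (Pf \<Phi> e)) k l m =
        - (u c * w d - u d * w c) * v e + (u c * w e - u e * w c) * v d - (u d * w e - u e * w d) * v c"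
      by (simp add: minor3_def u_def v_def w_def algebra_simps)
    also have "\<dots> = \<epsilon> * ((u c * w d - u d * w c) * pdiff l (pf4 \<Phi> a b c d) + (u c * w e - u e * w c) * pdiff l (pf4 \<Phi> a b c e) + (u d * w e - u e * w d) * pdiff l (pf4 \<Phi> a b d e))"
      unfolding vs by (simp add: algebra_simps)
    finally show ?thesis using \<epsilon>2 by (simp flip: mult.assoc)
  qed
  have "\<Phi> a b * (\<Phi> a b * Q_form \<Phi> k l m - \<epsilon> * minor3 (\<lambda>j. pdiff j (Pf \<Phi> c)) (\<lambda>j. pdiff j (Pf \<Phi> d)) (\<lambda>j. pdiff j (Pf \<Phi> e)) k l m) \<in> x"
    unfolding minor Q V
    by (rule rank_two_identity[OF ideal_pp r]) (use pf_in in \<open>simp_all add: pf4_def\<close>)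
  then show ?thesis using ab by (simp add: mult_mem_iff)
qed

subsection \<open>Determinants with a distinguished row\<close>

text \<open>The numerators of the matrix in \<open>wedge_coefficient_def\<close>. With
  \<open>unit_row j\<close> as last row the determinant extracts the coefficient of the j-th
  component of the last argument.\<close>

definition frame :: "5 \<Rightarrow> (5 \<Rightarrow> 'a) \<Rightarrow> (5 \<Rightarrow> 'a) \<Rightarrow> (5 \<Rightarrow> 'a) \<Rightarrow> (5 \<Rightarrow> 'a) \<Rightarrow> 'a::comm_ring_1 ^ 5 ^ 5" where
  "frame i A B C h = (\<chi> r j. if r = 0 then (if j = i then 1 else 0) else if r = 1 then A j else if r = 2 then B j
     else if r = 3 then C j else h j)"

definition unit_row :: "5 \<Rightarrow> 5 \<Rightarrow> 'a::comm_ring_1" where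
  "unit_row j = (\<lambda>i. if i = j then 1 else 0)"

lemma det_frame_linear:
  "det (frame i A B C h) = (\<Sum>j\<in>UNIV. h j * det (frame i A B C (unit_row j)))"
proof -
  let ?c = "\<lambda>r. \<chi> j. if r = 0 then (if j = i then 1 else 0) else if r = 1 then A j else if r = 2 then B j else C j"
  have fr: "frame i A B C g = (\<chi> r. if r = 4 then (\<chi> j. g j) else ?c r)" for g
    unfolding frame_def vec_eq_iff by (auto simp: forall_5)
  have e: "(\<chi> j. h j) = (\<Sum>k\<in>UNIV. h k *s (\<chi> j. unit_row k j))"
    by (auto simp: vec_eq_iff unit_row_def if_distrib[of "\<lambda>x. _ * x"] cong: if_cong)
  have "det (frame i A B C h) = det (\<chi> r. if r = 4 then (\<Sum>k\<in>UNIV. h k *s (\<chi> j. unit_row k j)) else ?c r)"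
    unfolding fr e ..
  also have "\<dots> = (\<Sum>k\<in>UNIV. det (\<chi> r. if r = 4 then h k *s (\<chi> j. unit_row k j) else ?c r))"
    by (rule det_linear_row_sum) simp
  also have "\<dots> = (\<Sum>k\<in>UNIV. h k * det (\<chi> r. if r = 4 then (\<chi> j. unit_row k j) else ?c r))"
    by (simp only: det_row_mul)
  finally show ?thesis unfolding fr .
qed

lemma det_frame_same: "det (frame i A B C (unit_row i)) = 0"
  by (rule det_identical_rows[of 0 4]) (simp_all add: row_def frame_def unit_row_def vec_eq_iff)

text \<open>The first and last rows are unit vectors, so only permutations fixing 0 and 4 contribute
  to the determinant.\<close>

lemma det_frame_minor_id: "det (frame 0 A B C (unit_row 4)) = minor3 A B C 1 2 3"
proof -
  let ?t = "\<lambda>p. of_int (sign p) * (\<Prod>r\<in>UNIV. frame 0 A B C (unit_row 4) $ r $ p r)"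
  have "det (frame 0 A B C (unit_row 4)) = (\<Sum>p | p permutes {1, 2, 3}. ?t p)"
    unfolding det_def
  proof (rule sum.mono_neutral_right)
    show "finite {p. p permutes (UNIV :: 5 set)}" by (simp add: finite_permutations)
    show "{p. p permutes {1, 2, 3}} \<subseteq> {p. p permutes (UNIV :: 5 set)}" by (auto intro: permutes_subset)
    show "\<forall>p\<in>{p. p permutes UNIV} - {p. p permutes {1, 2, 3}}. ?t p = 0"
    proof
      fix p assume p: "p \<in> {p. p permutes (UNIV :: 5 set)} - {p. p permutes {1, 2, 3}}"
      have "\<not> (p 0 = 0 \<and> p 4 = 4)"
      proof
        assume 0: "p 0 = 0 \<and> p 4 = 4"
        have "p permutes {1, 2, 3}"
        proof (rule permutes_superset[of p UNIV])
          show "p permutes UNIV" using p by blast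
          fix x :: 5 assume "x \<in> UNIV - {1, 2, 3}"
          then have "x = 0 \<or> x = 4" using exhaust_5[of x] by auto
          then show "p x = x" using 0 by auto
        qed
        then show False using p by blast
      qed
      then have "frame 0 A B C (unit_row 4) $ 0 $ p 0 = 0 \<or> frame 0 A B C (unit_row 4) $ 4 $ p 4 = 0"
        by (auto simp: frame_def unit_row_def)
      then have "(\<Prod>r\<in>UNIV. frame 0 A B C (unit_row 4) $ r $ p r) = 0" unfolding prod_5 by auto
      then show "?t p = 0" by simp
    qed
  qed
  also have "\<dots> = minor3 A B C 1 2 3"
  proof -
    have f1: "finite {2::5, 3}" "1 \<notin> {2::5, 3}" and f2: "finite {3::5}" "2 \<notin> {3::5}" by auto
    show ?thesis
      unfolding prod_5 sum_over_permutations_insert[OF f1] sum_over_permutations_insert[OF f2] permutes_sing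
      by (simp add: sign_swap_id permutation_swap_id sign_compose sign_id frame_def unit_row_def minor3_def
          Transposition.transpose_def algebra_simps)
  qed
  finally show ?thesis .
qed

lemma det_frame_minor:
  assumes "\<rho> permutes (UNIV :: 5 set)"
  shows "det (frame (\<rho> 0) A B C (unit_row (\<rho> 4))) = of_int (sign \<rho>) * minor3 A B C (\<rho> 1) (\<rho> 2) (\<rho> 3)"
proof -
  have inj: "\<rho> i = \<rho> j \<longleftrightarrow> i = j" for i j using permutes_inj[OF assms] by (auto dest: injD)
  have "(\<chi> r j. frame (\<rho> 0) A B C (unit_row (\<rho> 4)) $ r $ \<rho> j) = frame 0 (A \<circ> \<rho>) (B \<circ> \<rho>) (C \<circ> \<rho>) (unit_row 4)"
    by (simp add: frame_def unit_row_def vec_eq_iff inj)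
  then have "minor3 (A \<circ> \<rho>) (B \<circ> \<rho>) (C \<circ> \<rho>) 1 2 3 = of_int (sign \<rho>) * det (frame (\<rho> 0) A B C (unit_row (\<rho> 4)))"
    using det_permute_columns[OF assms, of "frame (\<rho> 0) A B C (unit_row (\<rho> 4))"] det_frame_minor_id[of "A \<circ> \<rho>" "B \<circ> \<rho>" "C \<circ> \<rho>"] by simp
  then have m: "minor3 A B C (\<rho> 1) (\<rho> 2) (\<rho> 3) = of_int (sign \<rho>) * det (frame (\<rho> 0) A B C (unit_row (\<rho> 4)))"
    by (simp add: minor3_def)
  have "of_int (sign \<rho>) * (of_int (sign \<rho>) * det (frame (\<rho> 0) A B C (unit_row (\<rho> 4)))) = det (frame (\<rho> 0) A B C (unit_row (\<rho> 4)))"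
    by (simp only: mult.assoc[symmetric] of_int_mult[symmetric] sign_idempotent of_int_1 mult_1)
  then show ?thesis unfolding m by (rule sym)
qed

lemma det_frame_even:
  assumes "\<sigma> permutes (UNIV :: 5 set)" "evenperm \<sigma>"
  shows "det (frame (\<sigma> 0) A B C (unit_row (\<sigma> 1))) = - minor3 A B C (\<sigma> 2) (\<sigma> 3) (\<sigma> 4)"
proof -
  \<comment> \<open>The cycle 1 to 2 to 3 to 4 to 1 puts \<open>\<sigma> 1\<close> in the last place
    and leaves \<open>\<sigma> 2\<close>, \<open>\<sigma> 3\<close>, \<open>\<sigma> 4\<close> in
    order. It is odd, which accounts for the minus sign.\<close>
  define c :: "5 \<Rightarrow> 5" where "c = Transposition.transpose 1 2 \<circ> (Transposition.transpose 2 3 \<circ> Transposition.transpose 3 4)"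
  have cv: "c 0 = 0" "c 1 = 2" "c 2 = 3" "c 3 = 4" "c 4 = 1" by (simp_all add: c_def Transposition.transpose_def)
  have c: "c permutes UNIV" unfolding c_def by (intro permutes_compose permutes_swap_id) auto
  have sc: "sign c = - 1" unfolding c_def by (simp add: sign_compose permutation_swap_id permutation_compose sign_swap_id)
  have p: "(\<sigma> \<circ> c) permutes UNIV" by (rule permutes_compose[OF c assms(1)])
  have "permutation \<sigma>" "permutation c" using assms(1) c by (simp_all add: permutation_permutes) blast+
  moreover have "sign \<sigma> = 1" using assms(2) by (simp add: sign_def)
  ultimately have "sign (\<sigma> \<circ> c) = - 1" using sc by (simp add: sign_compose)
  then show ?thesis using det_frame_minor[OF p, of A B C] by (simp add: cv)
qed

lemma exists_permutation_5:
  assumes dist: "distinct [i0, i1, i2, i3, i4 :: 5]"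
  obtains \<rho> where "\<rho> permutes UNIV" "\<rho> 0 = i0" "\<rho> 1 = i1" "\<rho> 2 = i2" "\<rho> 3 = i3" "\<rho> 4 = i4"
proof -
  define \<rho> where "\<rho> r = (if r = 0 then i0 else if r = 1 then i1 else if r = 2 then i2 else if r = 3 then i3 else i4)" for r :: 5
  have \<rho>v: "\<rho> 0 = i0" "\<rho> 1 = i1" "\<rho> 2 = i2" "\<rho> 3 = i3" "\<rho> 4 = i4" by (simp_all add: \<rho>_def)
  have "inj \<rho>" using dist unfolding inj_def forall_5 \<rho>v by auto
  moreover have "surj \<rho>" using \<open>inj \<rho>\<close> by (rule finite_UNIV_inj_surj[OF finite])
  ultimately have "bij \<rho>" by (simp add: bij_def)
  then have "\<rho> permutes UNIV" by (rule bij_imp_permutes) simp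
  then show ?thesis using that \<rho>v by blast
qed

text \<open>The point is the common sign s: the relations from Cramer's rule and Euler's formula
  compare these three minors with each other.\<close>

lemma det_frame_minors:
  assumes dist: "distinct [i, j, j', k, l :: 5]"
  obtains s :: "'a::comm_ring_1" where "s = 1 \<or> s = - 1"
    "\<And>A B C. det (frame i A B C (unit_row j)) = s * minor3 A B C j' k l"
    "\<And>A B C. det (frame i A B C (unit_row j')) = - s * minor3 A B C j k l"
    "\<And>A B C. det (frame j A B C (unit_row j')) = s * minor3 A B C i k l"
proof -
  have "distinct [i, j', k, l, j]" using dist by auto
  then obtain \<rho> where \<rho>: "\<rho> permutes UNIV" and \<rho>v: "\<rho> 0 = i" "\<rho> 1 = j'" "\<rho> 2 = k" "\<rho> 3 = l" "\<rho> 4 = j"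
    by (rule exists_permutation_5)
  have perm: "permutation \<rho>" using \<rho> by (auto simp: permutation_permutes)
  let ?t = "Transposition.transpose 1 4 :: 5 \<Rightarrow> 5"
  have t: "?t permutes UNIV" by (intro permutes_swap_id; simp)
  have p1: "(\<rho> \<circ> ?t) permutes UNIV" by (rule permutes_compose[OF t \<rho>])
  have s1: "sign (\<rho> \<circ> ?t) = - sign \<rho>" using perm by (simp add: sign_compose permutation_swap_id sign_swap_id)
  have tv: "?t 0 = 0" "?t 1 = 4" "?t 2 = 2" "?t 3 = 3" "?t 4 = 1"
    by (simp_all add: Transposition.transpose_def)
  show ?thesis
  proof (rule that[of "of_int (sign \<rho>)"])
    show "of_int (sign \<rho>) = (1::'a) \<or> of_int (sign \<rho>) = (- 1::'a)" by (simp add: sign_def)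
    show "det (frame i A B C (unit_row j)) = of_int (sign \<rho>) * minor3 A B C j' k l" for A B C :: "5 \<Rightarrow> 'a"
      using det_frame_minor[OF \<rho>, of A B C] by (simp add: \<rho>v)
    show "det (frame i A B C (unit_row j')) = - of_int (sign \<rho>) * minor3 A B C j k l" for A B C :: "5 \<Rightarrow> 'a"
      using det_frame_minor[OF p1, of A B C] by (simp add: \<rho>v tv s1)
    show "det (frame j A B C (unit_row j')) = of_int (sign \<rho>) * minor3 A B C i k l" for A B C :: "5 \<Rightarrow> 'a"
    proof -
      \<comment> \<open>The square of c is the cycle 0 to 4 to 1 to 0. It is even and rotates the
        roles of i, j and \<open>j'\<close>.\<close>
      define c :: "5 \<Rightarrow> 5" where "c = Transposition.transpose 0 4 \<circ> Transposition.transpose 0 1"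
      have c: "c permutes UNIV" unfolding c_def by (intro permutes_compose permutes_swap_id) auto
      have cv: "c 0 = 1" "c 1 = 4" "c 2 = 2" "c 3 = 3" "c 4 = 0" by (simp_all add: c_def Transposition.transpose_def)
      have c2: "(c \<circ> c) permutes UNIV" by (rule permutes_compose[OF c c])
      have sc: "sign c = 1" unfolding c_def by (simp add: sign_compose permutation_swap_id sign_swap_id)
      have pc: "permutation c" using c by (auto simp: permutation_permutes)
      have "sign (\<rho> \<circ> (c \<circ> c)) = sign \<rho>" using perm pc sc by (simp add: sign_compose permutation_compose)
      moreover have "(\<rho> \<circ> (c \<circ> c)) permutes UNIV" by (rule permutes_compose[OF c2 \<rho>])
      ultimately show ?thesis using det_frame_minor[of "\<rho> \<circ> (c \<circ> c)" A B C] by (simp add: \<rho>v cv)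
    qed
  qed
qed

lemma det_frame_swap:
  fixes A B C :: "5 \<Rightarrow> 'a::comm_ring_1"
  assumes "i \<noteq> j"
  shows "det (frame j A B C (unit_row i)) = - det (frame i A B C (unit_row j))"
proof -
  have "card (- {i, j}) = 3" using assms by (simp add: Compl_eq_Diff_UNIV card_Diff_subset)
  then obtain k l m where klm: "- {i, j} = {k, l, m}" "k \<noteq> l" "k \<noteq> m" "l \<noteq> m" by (auto simp: card_3_iff)
  have "k \<notin> {i, j}" "l \<notin> {i, j}" "m \<notin> {i, j}" using klm(1) by blast+
  then have dist: "distinct [i, k, l, m, j]" using klm assms by auto
  obtain \<rho> where \<rho>: "\<rho> permutes UNIV" "\<rho> 0 = i" "\<rho> 1 = k" "\<rho> 2 = l" "\<rho> 3 = m" "\<rho> 4 = j" by (rule exists_permutation_5[OF dist])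
  let ?t = "Transposition.transpose 0 4 :: 5 \<Rightarrow> 5"
  have t: "?t permutes UNIV" by (intro permutes_swap_id; simp)
  have p: "(\<rho> \<circ> ?t) permutes UNIV" by (rule permutes_compose[OF t \<rho>(1)])
  have "permutation \<rho>" using \<rho>(1) by (auto simp: permutation_permutes)
  then have s: "sign (\<rho> \<circ> ?t) = - sign \<rho>" by (simp add: sign_compose permutation_swap_id sign_swap_id)
  have tv: "?t 0 = 4" "?t 1 = 1" "?t 2 = 2" "?t 3 = 3" "?t 4 = 0" by (simp_all add: Transposition.transpose_def)
  show ?thesis using det_frame_minor[OF \<rho>(1), of A B C] det_frame_minor[OF p, of A B C] by (simp add: tv \<rho> s)
qed

section \<open>Smoothness and the Jacobian matrix\<close>

text \<open>Two vectors in the kernel of the rows in W modulo y, independent by their triangular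
  shape at the places j and k, so that no division is involved. They vanish at i, as tangent vectors
  on the chart of i do.\<close>

definition kernel_pair :: "'r::comm_ring_1 poly5 set \<Rightarrow> 5 \<Rightarrow> (5 \<Rightarrow> 'r poly5) set \<Rightarrow> bool" where
  "kernel_pair y i W \<longleftrightarrow> (\<exists>v v' e e' j k. (\<forall>n. homogeneous e (v n)) \<and> (\<forall>n. homogeneous e' (v' n)) \<and> v i = 0 \<and> v' i = 0 \<and>
     v j \<notin> y \<and> v k = 0 \<and> v' k \<notin> y \<and> (\<forall>A\<in>W. (\<Sum>n\<in>UNIV. v n * A n) \<in> y \<and> (\<Sum>n\<in>UNIV. v' n * A n) \<in> y))"

lemma kernel_pairI:
  assumes "\<And>n. homogeneous e (v n)" "\<And>n. homogeneous e' (v' n)" "v i = 0" "v' i = 0" "v j \<notin> y" "v k = 0" "v' k \<notin> y"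
    "\<And>A. A \<in> W \<Longrightarrow> (\<Sum>n\<in>UNIV. v n * A n) \<in> y" "\<And>A. A \<in> W \<Longrightarrow> (\<Sum>n\<in>UNIV. v' n * A n) \<in> y"
  shows "kernel_pair y i W"
  unfolding kernel_pair_def using assms by blast

lemma sum_two: "j \<noteq> k \<Longrightarrow> (\<Sum>n\<in>UNIV. (if n = j then a else if n = k then b else 0) * A n) = a * A j + b * (A k :: 'a::comm_ring_1)"
  for j k :: 5
proof -
  assume jk: "j \<noteq> k"
  have "(\<Sum>n\<in>UNIV. (if n = j then a else if n = k then b else 0) * A n) = (\<Sum>n\<in>{j, k}. (if n = j then a else if n = k then b else 0) * A n)"
    by (rule sum.mono_neutral_right) auto
  then show ?thesis using jk by simp
qed

lemma sum_three:
  fixes j k l :: 5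
  assumes "j \<noteq> k" "j \<noteq> l" "k \<noteq> l"
  shows "(\<Sum>n\<in>UNIV. (if n = j then a else if n = k then b else if n = l then c else 0) * A n) = a * A j + b * A k + c * (A l :: 'a::comm_ring_1)"
proof -
  have "(\<Sum>n\<in>UNIV. (if n = j then a else if n = k then b else if n = l then c else 0) * A n) =
      (\<Sum>n\<in>{j, k, l}. (if n = j then a else if n = k then b else if n = l then c else 0) * A n)"
    by (rule sum.mono_neutral_right) auto
  then show ?thesis using assms by (auto simp: add.assoc)
qed

lemma homogeneous_minor2:
  assumes "\<And>n. homogeneous 1 (A n)" "\<And>n. homogeneous 1 (B n)"
  shows "homogeneous 2 (A k * B l - A l * B k)"
proof -
  have "homogeneous (1 + 1) (A k * B l)" "homogeneous (1 + 1) (A l * B k)" using assms by (intro homogeneous_mult; simp)+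
  then show ?thesis unfolding one_add_one by (rule homogeneous_diff)
qed

text \<open>For each further column j the vector of \<open>2 * 2\<close> minors of A and B in the
  columns j, k, l, a cross product, kills A and B identically. Its product with C is a
  \<open>3 * 3\<close> minor, hence in y.\<close>

lemma kernel_pair_rank_2:
  assumes id: "is_ideal y" and hA: "\<And>n. homogeneous 1 (A n)" and hB: "\<And>n. homogeneous 1 (B n)"
    and ikl: "distinct [i, k, l]" and nz: "A k * B l - A l * B k \<notin> y"
    and minors: "\<And>k l m. distinct [i, k, l, m] \<Longrightarrow> minor3 A B C k l m \<in> y"
  shows "kernel_pair y i {A, B, C}"
proof -
  have "card (- {i, k, l}) = 2" using ikl by (simp add: Compl_eq_Diff_UNIV card_Diff_subset)
  then obtain j h where jh: "- {i, k, l} = {j, h}" "j \<noteq> h" by (auto simp: card_2_iff)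
  have n: "j \<notin> {i, k, l}" "h \<notin> {i, k, l}" using jh(1) by blast+
  define v where "v j n = (if n = j then A k * B l - A l * B k else if n = k then A l * B j - A j * B l else if n = l then A j * B k - A k * B j else 0)" for j n
  have hom: "homogeneous 2 (v j n)" for j n
    using homogeneous_minor2[of A B, OF hA hB] by (simp add: v_def)
  have ker: "(\<Sum>n\<in>UNIV. v j n * D n) \<in> y" if "D \<in> {A, B, C}" "distinct [i, j, k, l]" for D j
  proof -
    have d: "j \<noteq> k" "j \<noteq> l" "k \<noteq> l" using that(2) by auto
    have eq: "(\<Sum>n\<in>UNIV. v j n * D n) = (A k * B l - A l * B k) * D j + (A l * B j - A j * B l) * D k + (A j * B k - A k * B j) * D l"
      unfolding v_def by (rule sum_three[OF d])
    have "(\<Sum>n\<in>UNIV. v j n * A n) = 0" "(\<Sum>n\<in>UNIV. v j n * B n) = 0" "(\<Sum>n\<in>UNIV. v j n * C n) = minor3 A B C j k l"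
      unfolding v_def sum_three[OF d] minor3_def by (simp_all add: algebra_simps)
    then show ?thesis using that minors[of j k l] ideal_0[OF id] by auto
  qed
  show ?thesis
  proof (rule kernel_pairI[where v = "v j" and v' = "v h" and j = j and k = h])
    show "v j i = 0" "v h i = 0" using n ikl by (auto simp: v_def)
    show "v j h = 0" using n jh by (auto simp: v_def)
    show "v j j \<notin> y" "v h h \<notin> y" using nz by (simp_all add: v_def)
  qed (use hom ker n ikl in auto)
qed

text \<open>All rows are proportional to A modulo y, so the relation between the columns j and k of
  A annihilates every row; there are two choices of j.\<close>

lemma kernel_pair_rank_1:
  assumes id: "is_ideal y" and hA: "\<And>n. homogeneous 1 (A n)" and ik: "i \<noteq> k" and nz: "A k \<notin> y"
    and minors: "\<And>D k l. D \<in> W \<Longrightarrow> distinct [i, k, l] \<Longrightarrow> A k * D l - A l * D k \<in> y"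
  shows "kernel_pair y i W"
proof -
  have "card (- {i, k}) = 3" using ik by (simp add: Compl_eq_Diff_UNIV card_Diff_subset)
  then obtain j h g where jh: "- {i, k} = {j, h, g}" "j \<noteq> h" by (auto simp: card_3_iff)
  have n: "j \<notin> {i, k}" "h \<notin> {i, k}" using jh(1) by blast+
  define v where "v j n = (if n = j then A k else if n = k then - A j else 0)" for j n
  have hom: "homogeneous 1 (v j n)" for j n using hA homogeneous_uminus[OF hA] by (simp add: v_def)
  have ker: "(\<Sum>n\<in>UNIV. v j n * D n) \<in> y" if "D \<in> W" "distinct [i, j, k]" for D j
  proof -
    have d: "j \<noteq> k" "distinct [i, k, j]" using that(2) by auto
    have "(\<Sum>n\<in>UNIV. v j n * D n) = A k * D j + (- A j) * D k" unfolding v_def by (rule sum_two[OF d(1)])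
    also have "\<dots> = A k * D j - A j * D k" by simp
    also have "\<dots> \<in> y" using minors[OF that(1) d(2)] .
    finally show ?thesis .
  qed
  show ?thesis
  proof (rule kernel_pairI[where v = "v j" and v' = "v h" and j = j and k = h])
    show "v j i = 0" "v h i = 0" using n ik by (auto simp: v_def)
    show "v j h = 0" using n jh by (auto simp: v_def)
    show "v j j \<notin> y" "v h h \<notin> y" using nz by (simp_all add: v_def)
  qed (use hom ker n ik in auto)
qed

lemma kernel_pair_rank_0:
  assumes id: "is_ideal y" and one: "1 \<notin> y" and zero: "\<And>D k. D \<in> W \<Longrightarrow> k \<noteq> i \<Longrightarrow> D k \<in> y"
  shows "kernel_pair y i W"
proof -
  have "card (- {i}) = 4" by (simp add: Compl_eq_Diff_UNIV card_Diff_subset)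
  then obtain S where S: "S \<subseteq> - {i}" "card S = 2" using obtain_subset_with_card_n[of 2 "- {i}"] by auto
  then obtain j h where jh: "S = {j, h}" "j \<noteq> h" by (auto simp: card_2_iff)
  have n: "j \<noteq> i" "h \<noteq> i" using jh S by auto
  define v where "v j n = (if n = j then 1 else 0 :: 'a poly5)" for j n :: 5
  have ker: "(\<Sum>n\<in>UNIV. v j n * D n) \<in> y" if "D \<in> W" "j \<noteq> i" for D j
    using zero[OF that] by (simp add: v_def if_distrib[of "\<lambda>x. x * _"] cong: if_cong)
  show ?thesis
    by (rule kernel_pairI[where v = "v j" and v' = "v h" and j = j and k = h and e = 0 and e' = 0])
      (use n jh ker one in \<open>auto simp: v_def\<close>)
qed

text \<open>Outside column i there remain four columns, on which the three rows have rank at most 2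
  modulo y, so the kernel has at least two dimensions. The cases are the possible ranks.\<close>

lemma kernel_pair_if_minors_vanish:
  assumes id: "is_ideal y" and one: "1 \<notin> y"
    and h: "\<And>n. homogeneous 1 (A n)" "\<And>n. homogeneous 1 (B n)" "\<And>n. homogeneous 1 (C n)"
    and minors: "\<And>k l m. distinct [i, k, l, m] \<Longrightarrow> minor3 A B C k l m \<in> y"
  shows "kernel_pair y i {A, B, C}"
proof -
  have rows: "minor3 A C B k l m \<in> y" "minor3 B C A k l m \<in> y" if "distinct [i, k, l, m]" for k l m
  proof -
    have "minor3 A C B k l m = - minor3 A B C k l m" "minor3 B C A k l m = minor3 A B C k l m"
      by (simp_all add: minor3_def algebra_simps)
    then show "minor3 A C B k l m \<in> y" "minor3 B C A k l m \<in> y" using minors[OF that] ideal_uminus[OF id] by auto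
  qed
  have sets: "{A, C, B} = {A, B, C}" "{B, C, A} = {A, B, C}" by auto
  consider (two) k l where "distinct [i, k, l]" "A k * B l - A l * B k \<notin> y \<or> A k * C l - A l * C k \<notin> y \<or> B k * C l - B l * C k \<notin> y"
    | (rank1) D k where "\<And>k l. distinct [i, k, l] \<Longrightarrow> A k * B l - A l * B k \<in> y \<and> A k * C l - A l * C k \<in> y \<and> B k * C l - B l * C k \<in> y"
      "D \<in> {A, B, C}" "i \<noteq> k" "D k \<notin> y"
    | (zero) "\<And>D k. D \<in> {A, B, C} \<Longrightarrow> k \<noteq> i \<Longrightarrow> D k \<in> y"
    by metis
  then show ?thesis
  proof cases
    case two
    then show ?thesis
      using kernel_pair_rank_2[of y A B i k l C, OF id h(1,2) two(1) _ minors] kernel_pair_rank_2[of y A C i k l B, OF id h(1,3) two(1) _ rows(1)]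
        kernel_pair_rank_2[of y B C i k l A, OF id h(2,3) two(1) _ rows(2)] unfolding sets by blast
  next
    case rank1
    have neg: "D' k * D l - D' l * D k \<in> y" if "D k * D' l - D l * D' k \<in> y" for D D' :: "5 \<Rightarrow> 'a poly5" and k l
      using ideal_uminus[OF id that] by (simp add: algebra_simps)
    have "D k * D' l - D l * D' k \<in> y" if "D' \<in> {A, B, C}" "distinct [i, k, l]" for D' k l
      using that(1) rank1(1)[OF that(2)] rank1(2) neg ideal_0[OF id] by (auto simp: mult.commute)
    moreover have "homogeneous 1 (D n)" for n using rank1(2) h by auto
    ultimately show ?thesis using kernel_pair_rank_1[of y D i k "{A, B, C}", OF id _ rank1(3,4)] by blast
  next
    case zero
    then show ?thesis by (rule kernel_pair_rank_0[OF id one])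
  qed
qed

lemma exists_nonvanishing_Q_form:
  assumes \<Phi>: "\<Phi> \<in> X5" and y: "y \<in> points (pfaffian_scheme \<Phi>)" and ab: "\<Phi> a b \<notin> y"
    and w: "w \<in> carrier (omega_stalk (pfaffian_scheme \<Phi>) y)"
      "\<And>u. u \<in> carrier (omega_stalk (pfaffian_scheme \<Phi>) y) \<Longrightarrow>
        \<exists>\<alpha>\<in>carrier (stalk (pfaffian_scheme \<Phi>) y). u = \<alpha> \<odot>\<^bsub>omega_stalk (pfaffian_scheme \<Phi>) y\<^esub> w"
  obtains \<sigma> where "\<sigma> permutes UNIV" "evenperm \<sigma>" "pvar (\<sigma> 0) \<notin> y" "Q_form \<Phi> (\<sigma> 2) (\<sigma> 3) (\<sigma> 4) \<notin> y"
proof -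
  let ?F = "pfaffian_scheme \<Phi>"
  have hp: "homogeneous_prime y" and Fy: "?F \<subseteq> y" using pointsD[OF y] by auto
  interpret homogeneous_point ?F y using hp by unfold_locales
  obtain i where i: "pvar i \<notin> y" using pointsD(3)[OF y] by blast
  have "a \<noteq> b" using ab X5D(2)[OF \<Phi>] ideal_0[OF ideal_pp] by auto
  then obtain c d e \<epsilon> where pv: "pivot \<Phi> a b c d e \<epsilon>" using exists_pivot[OF \<Phi>] by blast
  have dist: "distinct [a, b, c, d, e]" and \<epsilon>: "\<epsilon> = 1 \<or> \<epsilon> = - 1" using pv by (auto simp: pivot_def)
  define A where "A h j = pdiff j (Pf \<Phi> h)" for h j
  have hA: "homogeneous 1 (A h n)" for h n unfolding A_def using homogeneous_pdiff[OF homogeneous_Pf[OF \<Phi>]] by simp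
  have "\<exists>k l m. distinct [i, k, l, m] \<and> minor3 (A c) (A d) (A e) k l m \<notin> y"
  proof (rule ccontr)
    assume "\<not> (\<exists>k l m. distinct [i, k, l, m] \<and> minor3 (A c) (A d) (A e) k l m \<notin> y)"
    then have "kernel_pair y i {A c, A d, A e}"
      using kernel_pair_if_minors_vanish[of y "A c" "A d" "A e" i, OF ideal_pp one_notin hA hA hA] by blast
    then obtain v v' s t j k where v: "\<And>n. homogeneous s (v n)" "\<And>n. homogeneous t (v' n)" "v i = 0" "v' i = 0" "v j \<notin> y" "v k = 0" "v' k \<notin> y"
      and ker': "\<forall>D\<in>{A c, A d, A e}. (\<Sum>n\<in>UNIV. v n * D n) \<in> y \<and> (\<Sum>n\<in>UNIV. v' n * D n) \<in> y"
      unfolding kernel_pair_def by blast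
    have ker: "(\<Sum>n\<in>UNIV. v n * A h n) \<in> y \<and> (\<Sum>n\<in>UNIV. v' n * A h n) \<in> y" if "h \<in> {c, d, e}" for h
      using ker' that by auto
    \<comment> \<open>It suffices to annihilate the gradients of the three pivot Pfaffians:
      \<open>first_order_syzygy\<close> in the columns a and b, together with
      \<open>\<Phi> a b\<close> being outside y, forces the other two.\<close>
    have tangent: "(\<Sum>n\<in>UNIV. z n * pdiff n f) \<in> y" if z: "\<And>h. h \<in> {c, d, e} \<Longrightarrow> (\<Sum>n\<in>UNIV. z n * A h n) \<in> y" and f: "f \<in> ?F" for z f
    proof -
      define T where "T h = (\<Sum>n\<in>UNIV. z n * A h n)" for h
      have syz: "(\<Sum>h\<in>UNIV. T h * \<Phi> h g) \<in> y" for g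
      proof -
        have "(\<Sum>h\<in>UNIV. T h * \<Phi> h g) = (\<Sum>n\<in>UNIV. z n * (\<Sum>h\<in>UNIV. A h n * \<Phi> h g))"
          unfolding T_def sum_distrib_right sum_distrib_left by (subst sum.swap) (simp add: mult.assoc)
        also have "\<dots> \<in> y"
          unfolding A_def by (intro ideal_sum[OF ideal_pp] ideal_mult[OF ideal_pp] subsetD[OF pointsD(4)[OF y] first_order_syzygy[OF \<Phi>]])
        finally show ?thesis .
      qed
      have Tc: "T c \<in> y" "T d \<in> y" "T e \<in> y" using z by (auto simp: T_def)
      have rest: "T c * \<Phi> c g + T d * \<Phi> d g + T e * \<Phi> e g \<in> y" for g
        by (intro ideal_add[OF ideal_pp] ideal_mult_right[OF ideal_pp] Tc)
      have "T a * \<Phi> a b \<in> y"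
      proof -
        have "T a * \<Phi> a b + (T c * \<Phi> c b + T d * \<Phi> d b + T e * \<Phi> e b) \<in> y"
          using syz[of b] unfolding sum_5_distinct[OF dist] by (simp add: X5D(2)[OF \<Phi>] add.assoc)
        then show ?thesis using ideal_diff[OF ideal_pp _ rest[of b]] by fastforce
      qed
      moreover have "T b * \<Phi> b a \<in> y"
      proof -
        have "T b * \<Phi> b a + (T c * \<Phi> c a + T d * \<Phi> d a + T e * \<Phi> e a) \<in> y"
          using syz[of a] unfolding sum_5_distinct[OF dist] by (simp add: X5D(2)[OF \<Phi>] add.assoc)
        then show ?thesis using ideal_diff[OF ideal_pp _ rest[of a]] by fastforce
      qed
      moreover have "\<Phi> b a \<notin> y" using ab X5D(3)[OF \<Phi>, of b a] ideal_uminus_iff[OF ideal_pp] by simp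
      ultimately have "T a \<in> y" "T b \<in> y" using ab by (auto simp: mult_mem_iff)
      then have "T h \<in> y" for h using Tc UNIV_5_distinct[OF dist] by (metis UNIV_I insertE singletonD)
      then show ?thesis using f unfolding T_def A_def pfaffian_scheme_def by auto
    qed
    show False
      by (rule no_two_tangent_vectors[OF hp Fy i w v(1) tangent v(2) tangent v(3-7)]) (use ker in auto)
  qed
  then obtain k l m where klm: "distinct [i, k, l, m]" "minor3 (A c) (A d) (A e) k l m \<notin> y" by blast
  have Q: "Q_form \<Phi> k l m \<notin> y" if "minor3 (A c) (A d) (A e) k l m \<notin> y" for k l m
  proof
    assume "Q_form \<Phi> k l m \<in> y"
    then have "\<Phi> a b * Q_form \<Phi> k l m \<in> y" by (rule ideal_mult[OF ideal_pp])
    moreover have "\<Phi> a b * Q_form \<Phi> k l m - \<epsilon> * minor3 (A c) (A d) (A e) k l m \<in> y"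
      using Q_form_eq_minor[OF \<Phi> pv hp Fy ab] unfolding A_def .
    ultimately have "\<epsilon> * minor3 (A c) (A d) (A e) k l m \<in> y" using ideal_diff_cong[OF ideal_pp] by blast
    then show False using that \<epsilon> by (auto simp: ideal_uminus_iff[OF ideal_pp])
  qed
  have "card (- {i, k, l, m}) = 1" using klm(1) by (simp add: Compl_eq_Diff_UNIV card_Diff_subset)
  then obtain j where "- {i, k, l, m} = {j}" by (auto simp: card_1_singleton_iff)
  then have "j \<notin> {i, k, l, m}" by blast
  then have d1: "distinct [i, j, k, l, m]" using klm(1) by auto
  obtain \<sigma> where \<sigma>: "\<sigma> permutes UNIV" "\<sigma> 0 = i" "\<sigma> 1 = j" "\<sigma> 2 = k" "\<sigma> 3 = l" "\<sigma> 4 = m" by (rule exists_permutation_5[OF d1])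
  show ?thesis
  proof (cases "evenperm \<sigma>")
    case True
    then show ?thesis using that[OF \<sigma>(1)] i Q[OF klm(2)] by (simp add: \<sigma>)
  next
    case False
    \<comment> \<open>Exchanging k and l makes the permutation even and changes the minor only by
      its sign.\<close>
    let ?t = "Transposition.transpose 2 3 :: 5 \<Rightarrow> 5"
    have t: "?t permutes UNIV" by (intro permutes_swap_id; simp)
    have tv: "?t 0 = 0" "?t 2 = 3" "?t 3 = 2" "?t 4 = 4" by (simp_all add: Transposition.transpose_def)
    have "permutation \<sigma>" using \<sigma>(1) by (auto simp: permutation_permutes)
    then have "evenperm (\<sigma> \<circ> ?t)" using False by (simp add: evenperm_comp permutation_swap_id evenperm_swap)
    moreover have "minor3 (A c) (A d) (A e) l k m \<notin> y"
    proof -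
      have "minor3 (A c) (A d) (A e) l k m = - minor3 (A c) (A d) (A e) k l m" by (simp add: minor3_def algebra_simps)
      then show ?thesis using klm(2) by (simp add: ideal_uminus_iff[OF ideal_pp])
    qed
    ultimately show ?thesis using that[OF permutes_compose[OF t \<sigma>(1)]] i Q by (simp add: \<sigma> tv)
  qed
qed

section \<open>The invariant differential\<close>

lemma homogeneous_mult_eq: "homogeneous d f \<Longrightarrow> homogeneous e g \<Longrightarrow> d + e = n \<Longrightarrow> homogeneous n (f * g)"
  using homogeneous_mult by blast

lemma homogeneous_sign: "\<epsilon> = 1 \<or> \<epsilon> = - 1 \<Longrightarrow> homogeneous 0 (\<epsilon> :: 'r::comm_ring_1 poly5)"
  using homogeneous_uminus[of 0 1] by auto

lemma homogeneous_minor3: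
  assumes "\<And>n. homogeneous d (A n)" "\<And>n. homogeneous e (B n)" "\<And>n. homogeneous h (C n)"
  shows "homogeneous (d + (e + h)) (minor3 A B C k l m)"
  unfolding minor3_def
  by (intro homogeneous_add homogeneous_diff homogeneous_mult assms)

lemma complement_of_three:
  fixes i j k :: 5
  assumes "distinct [i, j, k]"
  obtains l m where "distinct [i, j, k, l, m]"
proof -
  have "card (- {i, j, k}) = 2" using assms by (simp add: Compl_eq_Diff_UNIV card_Diff_subset)
  then obtain l m where lm: "- {i, j, k} = {l, m}" "l \<noteq> m" by (auto simp: card_2_iff)
  have "l \<notin> {i, j, k}" "m \<notin> {i, j, k}" using lm(1) by blast+
  then show ?thesis using that[of l m] assms lm(2) by auto
qed

text \<open>By \<open>vanishes_\<xi>\<close> the local ring at \<open>\<xi>\<close> has no nonzero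
  element coming from the prime. Equality of germs can therefore be tested by congruences modulo
  \<open>\<xi>\<close>.\<close>

locale pfaffian_generic_point = homogeneous_point "pfaffian_scheme \<Phi>" \<xi>
  for \<Phi> :: "'r::comm_ring_1 matrix5" and \<xi> +
  assumes X5: "\<Phi> \<in> X5"
    and generic: "generic_point (pfaffian_scheme \<Phi>) = \<xi>"
    and sub_\<xi>: "pfaffian_scheme \<Phi> \<subseteq> \<xi>"
    and vanishes_\<xi>: "f \<in> \<xi> \<Longrightarrow> vanishes f"
    and smooth: "\<exists>\<sigma>. \<sigma> permutes UNIV \<and> evenperm \<sigma> \<and> pvar (\<sigma> 0) \<notin> \<xi> \<and> Q_form \<Phi> (\<sigma> 2) (\<sigma> 3) (\<sigma> 4) \<notin> \<xi>"
begin

abbreviation F :: "'r poly5 set" where "F \<equiv> pfaffian_scheme \<Phi>"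

abbreviation du :: "5 \<Rightarrow> 5 \<Rightarrow> (('r poly5 \<times> 'r poly5) set \<Rightarrow> ('r poly5 \<times> 'r poly5) set) set" where
  "du i j \<equiv> kd.d (ratio i j)"

lemma ideal_sub_\<xi>: "ideal_of F \<subseteq> \<xi>"
  using sub_\<xi> by (rule ideal_of_least[OF ideal_pp])

lemma Pf_in_\<xi>: "Pf \<Phi> i \<in> \<xi>"
  using sub_\<xi> by (auto simp: pfaffian_scheme_def)

lemma du_closed: "pvar i \<notin> \<xi> \<Longrightarrow> du i j \<in> carrier kd.\<Omega>"
  by (intro kd.d_closed ratio_closed)

lemma du_same: "pvar i \<notin> \<xi> \<Longrightarrow> du i i = \<zero>\<^bsub>kd.\<Omega>\<^esub>"
proof -
  assume i: "pvar i \<notin> \<xi>"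
  have "ratio i i = scalar_germ F \<xi> 1"
    unfolding ratio_def scalar_germ_def
    using germ_eqI[OF fractions_atI[OF homogeneous_pvar homogeneous_pvar i, of i] fractions_one] by simp
  then show ?thesis using kd.d_const by simp
qed

lemma germ_eq_generic:
  assumes "(a, s) \<in> fractions_at \<xi>" "(b, t) \<in> fractions_at \<xi>" "a * t - b * s \<in> \<xi>"
  shows "germ F \<xi> (a, s) = germ F \<xi> (b, t)"
  using germ_eq_iff[OF assms(1,2)] vanishes_\<xi>[OF assms(3)] by blast

lemma germ_eq_zero:
  assumes "(a, s) \<in> fractions_at \<xi>" "a \<in> \<xi>"
  shows "germ F \<xi> (a, s) = \<zero>\<^bsub>stalk F \<xi>\<^esub>"
  using germ_eq_zero_iff[OF assms(1)] vanishes_\<xi>[OF assms(2)] by blast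

lemma smult_germ:
  assumes "(a, s) \<in> fractions_at \<xi>" "(b, t) \<in> fractions_at \<xi>" "w \<in> carrier kd.\<Omega>"
  shows "germ F \<xi> (a, s) \<odot>\<^bsub>kd.\<Omega>\<^esub> (germ F \<xi> (b, t) \<odot>\<^bsub>kd.\<Omega>\<^esub> w) = germ F \<xi> (a * b, s * t) \<odot>\<^bsub>kd.\<Omega>\<^esub> w"
  using km.smult_assoc1[OF germ_in_carrier[OF assms(1)] germ_in_carrier[OF assms(2)] assms(3)]
  unfolding mult_stalk[OF assms(1,2)] by (rule sym)

lemma smult_germ_eq:
  assumes "(a, s) \<in> fractions_at \<xi>" "(b, t) \<in> fractions_at \<xi>" "(c, r) \<in> fractions_at \<xi>" "w \<in> carrier kd.\<Omega>"
    "a * b * r - c * (s * t) \<in> \<xi>"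
  shows "germ F \<xi> (a, s) \<odot>\<^bsub>kd.\<Omega>\<^esub> (germ F \<xi> (b, t) \<odot>\<^bsub>kd.\<Omega>\<^esub> w) = germ F \<xi> (c, r) \<odot>\<^bsub>kd.\<Omega>\<^esub> w"
  unfolding smult_germ[OF assms(1,2,4)] using germ_eq_generic[OF fractions_mult[OF assms(1,2)] assms(3,5)] by simp

lemma smult_germ_cancel:
  assumes "homogeneous n a" "homogeneous n b" "a \<notin> \<xi>" "b \<notin> \<xi>" "u \<in> carrier kd.\<Omega>" "v \<in> carrier kd.\<Omega>"
    "germ F \<xi> (a, b) \<odot>\<^bsub>kd.\<Omega>\<^esub> u = v"
  shows "u = germ F \<xi> (b, a) \<odot>\<^bsub>kd.\<Omega>\<^esub> v"
proof -
  have fr: "(a, b) \<in> fractions_at \<xi>" "(b, a) \<in> fractions_at \<xi>" using assms by (auto intro: fractions_atI)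
  have "germ F \<xi> (b, a) \<odot>\<^bsub>kd.\<Omega>\<^esub> (germ F \<xi> (a, b) \<odot>\<^bsub>kd.\<Omega>\<^esub> u) = germ F \<xi> (1, 1) \<odot>\<^bsub>kd.\<Omega>\<^esub> u"
    by (rule smult_germ_eq[OF fr(2,1) fractions_one assms(5)]) (simp add: mult.commute ideal_0[OF ideal_pp])
  also have "\<dots> = u" using km.smult_one[OF assms(5)] by (simp add: one_stalk)
  finally show ?thesis using assms(7) by simp
qed

lemma function_field_eq: "function_field F = stalk F \<xi>"
  and rational_differentials_eq: "rational_differentials F = kd.\<Omega>"
  and rational_d_eq: "rational_d F = kd.d"
  and coordinate_ratio_eq: "coordinate_ratio F = ratio"
  by (auto simp: function_field_def rational_differentials_def omega_stalk_def rational_d_def coordinate_ratio_def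
      generic ratio_def fun_eq_iff)

end

locale pfaffian_pivot = pfaffian_generic_point +
  fixes a b c d e :: 5 and \<epsilon> :: "'a poly5"
  assumes pv: "pivot \<Phi> a b c d e \<epsilon>" and ab: "\<Phi> a b \<notin> \<xi>"
begin

abbreviation grad :: "5 \<Rightarrow> 5 \<Rightarrow> 'a poly5" where
  "grad h \<equiv> \<lambda>j. pdiff j (Pf \<Phi> h)"

abbreviation M :: "5 \<Rightarrow> 5 \<Rightarrow> 5 \<Rightarrow> 'a poly5" where
  "M \<equiv> minor3 (grad c) (grad d) (grad e)"

text \<open>The invariant differential will be \<open>x\<^sub>i\<^sup>2 \<Phi>\<^sub>a\<^sub>b d(x\<^sub>j/x\<^sub>i) / \<kappa>\<^sub>i\<^sub>j\<close>.\<close>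

definition \<kappa> :: "5 \<Rightarrow> 5 \<Rightarrow> 'a poly5" where
  "\<kappa> i j = - \<epsilon> * det (frame i (grad c) (grad d) (grad e) (unit_row j))"

lemma sign_cases: "\<epsilon> = 1 \<or> \<epsilon> = - 1"
  using pv by (simp add: pivot_def)

lemma sign_square: "\<epsilon> * \<epsilon> = 1"
  using sign_cases by auto

lemma homogeneous_entry: "homogeneous 1 (\<Phi> a b)"
  by (rule X5D(1)[OF X5])

lemma homogeneous_grad: "homogeneous 1 (grad h n)"
  using homogeneous_pdiff[OF homogeneous_Pf[OF X5]] by simp

lemma homogeneous_M: "homogeneous 3 (M k l m)"
  using homogeneous_minor3[of 1 "grad c" 1 "grad d" 1 "grad e", OF homogeneous_grad homogeneous_grad homogeneous_grad]
  by (simp add: numeral_3_eq_3)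

lemma \<kappa>_same: "\<kappa> i i = 0"
  by (simp add: \<kappa>_def det_frame_same)

lemma \<kappa>_swap: "\<kappa> j i = - \<kappa> i j"
proof (cases "i = j")
  case False
  then show ?thesis using det_frame_swap[OF False, of "grad c" "grad d" "grad e"] by (simp add: \<kappa>_def)
qed (simp add: \<kappa>_same)

lemma \<kappa>_minors:
  assumes "distinct [i, j, j', k, l]"
  obtains s where "s = 1 \<or> s = - 1" "\<kappa> i j = s * M j' k l" "\<kappa> i j' = - s * M j k l" "\<kappa> j j' = s * M i k l"
proof -
  obtain s :: "'a poly5" where s: "s = 1 \<or> s = - 1"
    "\<And>A B C. det (frame i A B C (unit_row j)) = s * minor3 A B C j' k l"
    "\<And>A B C. det (frame i A B C (unit_row j')) = - s * minor3 A B C j k l"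
    "\<And>A B C. det (frame j A B C (unit_row j')) = s * minor3 A B C i k l"
    by (rule det_frame_minors[OF assms]) blast
  show ?thesis
    by (rule that[of "- \<epsilon> * s"]) (use s(1) sign_cases in \<open>auto simp: \<kappa>_def s(2-4)\<close>)
qed

lemma homogeneous_\<kappa>: "homogeneous 3 (\<kappa> i j)"
proof (cases "i = j")
  case False
  have "card (- {i, j}) = 3" using False by (simp add: Compl_eq_Diff_UNIV card_Diff_subset)
  then obtain j' k l where "- {i, j} = {j', k, l}" by (auto simp: card_3_iff)
  then have "j' \<notin> {i, j}" by blast
  then have "distinct [i, j, j']" using False by auto
  then obtain k l where "distinct [i, j, j', k, l]" by (rule complement_of_three)
  then obtain s where "s = 1 \<or> s = - 1" "\<kappa> i j = s * M j' k l" by (rule \<kappa>_minors)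
  then show ?thesis using homogeneous_mult_eq[OF homogeneous_sign homogeneous_M] by simp
qed (simp add: \<kappa>_same)

text \<open>The coefficients in the expansion of a minor along its first column. They do not depend
  on that column, so a relation between the columns of the gradients passes to the minors.\<close>

definition cofactor :: "5 \<Rightarrow> 5 \<Rightarrow> 5 \<Rightarrow> 'a poly5" where
  "cofactor k l h = (if h = c then grad d k * grad e l - grad d l * grad e k
     else if h = d then grad c l * grad e k - grad c k * grad e l else grad c k * grad d l - grad c l * grad d k)"

lemma pivot_distinct: "c \<noteq> d" "c \<noteq> e" "d \<noteq> e"
  using pv by (auto simp: pivot_def)

lemma minor_expansion:
  "M n k l = cofactor k l c * grad c n + cofactor k l d * grad d n + cofactor k l e * grad e n"
  using pivot_distinct by (simp add: cofactor_def minor3_def algebra_simps)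

lemma homogeneous_cofactor: "homogeneous 2 (cofactor k l h)"
  unfolding cofactor_def using homogeneous_minor2[of "grad d" "grad e", OF homogeneous_grad homogeneous_grad]
    homogeneous_minor2[of "grad c" "grad e", OF homogeneous_grad homogeneous_grad]
    homogeneous_minor2[of "grad c" "grad d", OF homogeneous_grad homogeneous_grad] by simp

text \<open>Euler's formula says that \<open>(\<Sum>n. pvar n * grad h n)\<close> is twice a
  Pfaffian and so lies in \<open>\<xi>\<close>; the cofactor expansion carries this over to the
  minors.\<close>

lemma euler_relation_minors: "(\<Sum>n\<in>UNIV. pvar n * M n k l) \<in> \<xi>"
proof -
  have eu: "(\<Sum>n\<in>UNIV. pvar n * grad h n) \<in> \<xi>" for h
    unfolding euler_formula[OF homogeneous_Pf[OF X5]] by (rule ideal_mult[OF ideal_pp Pf_in_\<xi>])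
  have "(\<Sum>n\<in>UNIV. pvar n * M n k l) = cofactor k l c * (\<Sum>n\<in>UNIV. pvar n * grad c n)
      + cofactor k l d * (\<Sum>n\<in>UNIV. pvar n * grad d n) + cofactor k l e * (\<Sum>n\<in>UNIV. pvar n * grad e n)"
    unfolding minor_expansion sum_distrib_left sum.distrib[symmetric] by (rule sum.cong) (simp_all add: algebra_simps)
  also have "\<dots> \<in> \<xi>" by (intro ideal_add[OF ideal_pp] ideal_mult[OF ideal_pp] eu)
  finally show ?thesis .
qed

lemma M_degenerate: "M k k l = 0" "M l k l = 0"
  by (simp_all add: minor3_def algebra_simps)

text \<open>This is the quotient rule between the charts of i and j, written for the expected
  coefficients \<open>\<kappa>\<close>. In the Euler relation of the minors the terms with a
  repeated column vanish, and three remain.\<close>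

lemma euler_relation: "pvar i * \<kappa> j j' - (pvar j * \<kappa> i j' - pvar j' * \<kappa> i j) \<in> \<xi>"
proof (cases "distinct [i, j, j']")
  case True
  then obtain k l where dist: "distinct [i, j, j', k, l]" by (rule complement_of_three)
  then obtain s where s: "\<kappa> i j = s * M j' k l" "\<kappa> i j' = - s * M j k l" "\<kappa> j j' = s * M i k l"
    by (rule \<kappa>_minors) blast
  have "pvar i * \<kappa> j j' - (pvar j * \<kappa> i j' - pvar j' * \<kappa> i j) = s * (\<Sum>n\<in>UNIV. pvar n * M n k l)"
    unfolding s sum_5_distinct[OF dist] M_degenerate by (simp add: algebra_simps)
  then show ?thesis using ideal_mult[OF ideal_pp euler_relation_minors] by simp
next
  case False
  have "pvar i * \<kappa> j j' - (pvar j * \<kappa> i j' - pvar j' * \<kappa> i j) = 0"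
    using False \<kappa>_swap[of i j] \<kappa>_swap[of i j'] by (auto simp: \<kappa>_same)
  then show ?thesis using ideal_0[OF ideal_pp] by simp
qed

text \<open>The combination f of the Pfaffians with cofactors as coefficients has zero germ, and
  modulo \<open>\<xi>\<close> its gradient is the minor in which one column varies. The chain rule
  applied to f then leaves a relation between the differentials of just two ratios, since minors
  with repeated columns vanish.\<close>

lemma cramer_relation:
  assumes i: "pvar i \<notin> \<xi>"
  shows "germ F \<xi> (\<kappa> i j, pvar i ^ 3) \<odot>\<^bsub>kd.\<Omega>\<^esub> du i j' = germ F \<xi> (\<kappa> i j', pvar i ^ 3) \<odot>\<^bsub>kd.\<Omega>\<^esub> du i j"
proof -
  note pw = pvar_power_facts[OF i]
  have z: "germ F \<xi> (0, pvar i ^ 3) \<odot>\<^bsub>kd.\<Omega>\<^esub> du i j = \<zero>\<^bsub>kd.\<Omega>\<^esub>" for j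
    using zero_eq_germ[OF pw, of 3] km.smult_l_null[OF du_closed[OF i]] by simp
  have kc: "germ F \<xi> (\<kappa> i j, pvar i ^ 3) \<in> carrier (stalk F \<xi>)" for j
    by (intro germ_in_carrier fractions_atI[OF homogeneous_\<kappa> pw])
  consider "j = j'" | "j = i" | "j' = i" | "distinct [i, j, j']" by fastforce
  then show ?thesis
  proof cases
    case 4
    then obtain k l where dist: "distinct [i, j, j', k, l]" by (rule complement_of_three)
    then obtain s where s: "s = 1 \<or> s = - 1" "\<kappa> i j = s * M j' k l" "\<kappa> i j' = - s * M j k l" by (rule \<kappa>_minors)
    define f where "f = cofactor k l c * Pf \<Phi> c + cofactor k l d * Pf \<Phi> d + cofactor k l e * Pf \<Phi> e"
    have hf: "homogeneous 4 f" unfolding f_def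
      by (intro homogeneous_add homogeneous_mult_eq[OF homogeneous_cofactor homogeneous_Pf[OF X5]]) simp_all
    have f\<xi>: "f \<in> \<xi>" unfolding f_def by (intro ideal_add[OF ideal_pp] ideal_mult[OF ideal_pp Pf_in_\<xi>])
    have df: "pdiff n f - M n k l \<in> \<xi>" for n
    proof -
      have "pdiff n f - M n k l = Pf \<Phi> c * pdiff n (cofactor k l c) + Pf \<Phi> d * pdiff n (cofactor k l d) + Pf \<Phi> e * pdiff n (cofactor k l e)"
        unfolding f_def minor_expansion by (simp add: pdiff_add pdiff_mult algebra_simps)
      also have "\<dots> \<in> \<xi>" by (intro ideal_add[OF ideal_pp] ideal_mult_right[OF ideal_pp Pf_in_\<xi>])
      finally show ?thesis .
    qed
    have Mfr: "(M n k l, pvar i ^ 3) \<in> fractions_at \<xi>" for n by (rule fractions_atI[OF homogeneous_M pw])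
    have coef: "germ F \<xi> (pvar i * pdiff n f, pvar i ^ 4) = germ F \<xi> (M n k l, pvar i ^ 3)" for n
    proof (rule germ_eq_generic[OF fractions_atI[OF homogeneous_pvar_pdiff[OF hf] pw] Mfr])
      have "pvar i * pdiff n f * pvar i ^ 3 - M n k l * pvar i ^ 4 = pvar i ^ 4 * (pdiff n f - M n k l)"
        by (simp add: algebra_simps numeral_eq_Suc)
      then show "pvar i * pdiff n f * pvar i ^ 3 - M n k l * pvar i ^ 4 \<in> \<xi>"
        using ideal_mult[OF ideal_pp df] by simp
    qed
    let ?t = "\<lambda>n. germ F \<xi> (M n k l, pvar i ^ 3) \<odot>\<^bsub>kd.\<Omega>\<^esub> du i n"
    have tc: "?t n \<in> carrier kd.\<Omega>" for n using germ_in_carrier[OF Mfr] du_closed[OF i] by (rule km.smult_closed)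
    have "germ F \<xi> (f, pvar i ^ 4) = \<zero>\<^bsub>stalk F \<xi>\<^esub>" by (rule germ_eq_zero[OF fractions_atI[OF hf pw] f\<xi>])
    then have "finsum kd.\<Omega> ?t (- {i}) = \<zero>\<^bsub>kd.\<Omega>\<^esub>"
      using chain_rule[OF i hf] d_zero unfolding coef by simp
    moreover have "- {i} = {j, j', k, l}" using UNIV_5_distinct[OF dist] dist by auto
    ultimately have "finsum kd.\<Omega> ?t {j, j', k, l} = \<zero>\<^bsub>kd.\<Omega>\<^esub>" by simp
    moreover have "finsum kd.\<Omega> ?t {j, j', k, l} = ?t j \<oplus>\<^bsub>kd.\<Omega>\<^esub> (?t j' \<oplus>\<^bsub>kd.\<Omega>\<^esub> (?t k \<oplus>\<^bsub>kd.\<Omega>\<^esub> ?t l))"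
      using dist tc by (simp add: km.finsum_insert)
    moreover have "?t k = \<zero>\<^bsub>kd.\<Omega>\<^esub>" "?t l = \<zero>\<^bsub>kd.\<Omega>\<^esub>" unfolding M_degenerate by (rule z)+
    ultimately have sum0: "?t j \<oplus>\<^bsub>kd.\<Omega>\<^esub> ?t j' = \<zero>\<^bsub>kd.\<Omega>\<^esub>" using tc by simp
    have neg: "germ F \<xi> (- M n k l, pvar i ^ 3) \<odot>\<^bsub>kd.\<Omega>\<^esub> du i n = \<ominus>\<^bsub>kd.\<Omega>\<^esub> ?t n" for n
      using germ_uminus[OF Mfr] km.smult_l_minus[OF germ_in_carrier[OF Mfr] du_closed[OF i]] by simp
    have "?t j' = \<ominus>\<^bsub>kd.\<Omega>\<^esub> ?t j" using sum0 tc by (metis km.a_comm km.minus_equality)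
    then show ?thesis using s(1) tc[of j] neg[of j] neg[of j'] by (auto simp: s(2,3))
  qed (simp_all add: \<kappa>_same z du_same[OF i] km.smult_r_null[OF kc])
qed

text \<open>The minus sign in \<open>\<kappa>_def\<close> cancels the one produced by
  \<open>det_frame_even\<close>.\<close>

lemma Q_form_\<kappa>:
  assumes "\<sigma> permutes UNIV" "evenperm \<sigma>"
  shows "\<Phi> a b * Q_form \<Phi> (\<sigma> 2) (\<sigma> 3) (\<sigma> 4) - \<kappa> (\<sigma> 0) (\<sigma> 1) \<in> \<xi>"
  using Q_form_eq_minor[OF X5 pv prime sub_\<xi> ab, of "\<sigma> 2" "\<sigma> 3" "\<sigma> 4"]
  unfolding \<kappa>_def det_frame_even[OF assms] by simp

end

section \<open>Sums over a common denominator and determinants of forms\<close>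

context pfaffian_generic_point
begin

lemma finsum_smult_germ:
  assumes "finite A" "\<And>j. j \<in> A \<Longrightarrow> homogeneous n (f j)" "homogeneous n s" "s \<notin> \<xi>" "w \<in> carrier kd.\<Omega>"
  shows "finsum kd.\<Omega> (\<lambda>j. germ F \<xi> (f j, s) \<odot>\<^bsub>kd.\<Omega>\<^esub> w) A = germ F \<xi> (sum f A, s) \<odot>\<^bsub>kd.\<Omega>\<^esub> w"
  using assms(1,2)
proof (induction A rule: finite_induct)
  case empty
  then show ?case using zero_eq_germ[OF assms(3,4)] km.smult_l_null[OF assms(5)] by simp
next
  case (insert j A)
  have gc: "germ F \<xi> (g, s) \<in> carrier (stalk F \<xi>)" if "homogeneous n g" for g
    using that assms by (intro germ_in_carrier fractions_atI)
  have hs: "homogeneous n (sum f A)" using insert.prems by (intro homogeneous_sum) auto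
  have hj: "homogeneous n (f j)" using insert.prems by auto
  have "finsum kd.\<Omega> (\<lambda>j. germ F \<xi> (f j, s) \<odot>\<^bsub>kd.\<Omega>\<^esub> w) (insert j A) =
      germ F \<xi> (f j, s) \<odot>\<^bsub>kd.\<Omega>\<^esub> w \<oplus>\<^bsub>kd.\<Omega>\<^esub> finsum kd.\<Omega> (\<lambda>j. germ F \<xi> (f j, s) \<odot>\<^bsub>kd.\<Omega>\<^esub> w) A"
    using insert.hyps insert.prems by (intro km.finsum_insert) (auto intro!: km.smult_closed gc assms(5))
  also have "finsum kd.\<Omega> (\<lambda>j. germ F \<xi> (f j, s) \<odot>\<^bsub>kd.\<Omega>\<^esub> w) A = germ F \<xi> (sum f A, s) \<odot>\<^bsub>kd.\<Omega>\<^esub> w"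
    using insert.IH insert.prems by auto
  also have "germ F \<xi> (f j, s) \<odot>\<^bsub>kd.\<Omega>\<^esub> w \<oplus>\<^bsub>kd.\<Omega>\<^esub> germ F \<xi> (sum f A, s) \<odot>\<^bsub>kd.\<Omega>\<^esub> w =
      (germ F \<xi> (f j, s) \<oplus>\<^bsub>stalk F \<xi>\<^esub> germ F \<xi> (sum f A, s)) \<odot>\<^bsub>kd.\<Omega>\<^esub> w"
    by (rule km.smult_l_distr[OF gc[OF hj] gc[OF hs] assms(5), symmetric])
  also have "\<dots> = germ F \<xi> (sum f (insert j A), s) \<odot>\<^bsub>kd.\<Omega>\<^esub> w"
    using germ_add_same_denom[OF hj hs assms(3,4)] insert.hyps by simp
  finally show ?case .
qed

end

context homogeneous_point
begin

lemma common_denominator: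
  fixes h :: "5 \<Rightarrow> ('r poly5 \<times> 'r poly5) set"
  assumes "\<forall>j. h j \<in> carrier (stalk F \<pp>)"
  obtains n b t where "\<And>j. homogeneous n (b j)" "homogeneous n t" "t \<notin> \<pp>" "\<And>j. h j = germ F \<pp> (b j, t)"
proof -
  have "\<exists>p. p \<in> fractions_at \<pp> \<and> h j = germ F \<pp> p" for j
    using assms[rule_format, of j] by (elim stalk_cases) blast
  then obtain p where p: "\<And>j. p j \<in> fractions_at \<pp>" "\<And>j. h j = germ F \<pp> (p j)" by metis
  define f s where "f j = fst (p j)" and "s j = snd (p j)" for j
  have fs: "(f j, s j) \<in> fractions_at \<pp>" "h j = germ F \<pp> (f j, s j)" for j using p by (simp_all add: f_def s_def)
  then have "\<exists>d. homogeneous d (f j) \<and> homogeneous d (s j) \<and> s j \<notin> \<pp>" for j by (auto simp: fractions_at_def)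
  then obtain d where d: "\<And>j. homogeneous (d j) (f j)" "\<And>j. homogeneous (d j) (s j)" "\<And>j. s j \<notin> \<pp>" by metis
  define r where "r j = (\<Prod>k\<in>UNIV - {j}. s k)" for j
  have r: "homogeneous (\<Sum>k\<in>UNIV - {j}. d k) (r j)" "r j \<notin> \<pp>" for j
    unfolding r_def by (rule homogeneous_prod[OF d(2)] notin_prod[OF finite d(3)])+
  have rs: "r j * s j = prod s UNIV" for j unfolding r_def by (simp add: prod.remove[of UNIV j] mult.commute)
  have sd: "(\<Sum>k\<in>UNIV - {j}. d k) + d j = sum d UNIV" for j by (simp add: sum.remove[of UNIV j] add.commute)
  show ?thesis
  proof (rule that[of "sum d UNIV" "\<lambda>j. r j * f j" "prod s UNIV"])
    show "homogeneous (sum d UNIV) (r j * f j)" for j by (rule homogeneous_mult_eq[OF r(1) d(1) sd])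
    show "homogeneous (sum d UNIV) (prod s UNIV)" using d(2) by (intro homogeneous_prod)
    show "prod s UNIV \<notin> \<pp>" using d(3) by (intro notin_prod) auto
    show "h j = germ F \<pp> (r j * f j, prod s UNIV)" for j
      using germ_cancel(1)[OF fs(1)[of j] r[of j]] fs(2)[of j] unfolding rs by simp
  qed
qed

end

lemma homogeneous_det:
  fixes B :: "'r::comm_ring_1 poly5 ^ 'n ^ 'n"
  assumes "\<And>r j. homogeneous (d r) (B $ r $ j)"
  shows "homogeneous (sum d UNIV) (det B)"
  unfolding det_def
proof (rule homogeneous_sum)
  fix p :: "'n \<Rightarrow> 'n"
  have "of_int (sign p) = (1 :: 'r poly5) \<or> of_int (sign p) = (- 1 :: 'r poly5)" by (simp add: sign_def)
  moreover have "homogeneous (sum d UNIV) (\<Prod>r\<in>UNIV. B $ r $ p r)" using assms by (intro homogeneous_prod)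
  ultimately show "homogeneous (sum d UNIV) (of_int (sign p) * (\<Prod>r\<in>UNIV. B $ r $ p r))"
    using homogeneous_uminus by auto
qed

lemma det_frame_as_minor:
  assumes "i \<noteq> j"
  obtains s :: "'a::comm_ring_1" and k l m where "\<And>A B C. det (frame i A B C (unit_row j)) = s * minor3 A B C k l m"
proof -
  have "card (- {i, j}) = 3" using assms by (simp add: Compl_eq_Diff_UNIV card_Diff_subset)
  then obtain j' k l where "- {i, j} = {j', k, l}" by (auto simp: card_3_iff)
  then have "j' \<notin> {i, j}" by blast
  then have "distinct [i, j, j']" using assms by auto
  then obtain k l where "distinct [i, j, j', k, l]" by (rule complement_of_three)
  then obtain s :: 'a where "\<And>A B C. det (frame i A B C (unit_row j)) = s * minor3 A B C j' k l"
    by (rule det_frame_minors) blast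
  then show ?thesis by (rule that)
qed

lemma det_frame_scale:
  fixes A B C h :: "5 \<Rightarrow> 'a::comm_ring_1"
  shows "det (frame i (\<lambda>j. x * A j) (\<lambda>j. x * B j) (\<lambda>j. x * C j) h) = x ^ 3 * det (frame i A B C h)"
proof -
  have "det (frame i (\<lambda>j. x * A j) (\<lambda>j. x * B j) (\<lambda>j. x * C j) (unit_row j)) = x ^ 3 * det (frame i A B C (unit_row j))" for j
  proof (cases "i = j")
    case False
    obtain s :: 'a and k l m where "\<And>A B C. det (frame i A B C (unit_row j)) = s * minor3 A B C k l m"
      by (rule det_frame_as_minor[OF False]) blast
    note dm = this
    show ?thesis unfolding dm by (simp add: minor3_def power3_eq_cube algebra_simps)
  qed (simp add: det_frame_same)
  then show ?thesis
    unfolding det_frame_linear[of i _ _ _ h] sum_distrib_left by (simp add: mult.left_commute)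
qed

section \<open>Existence and uniqueness of the invariant differential\<close>

context pfaffian_pivot
begin

text \<open>\<open>smooth\<close> gives a nonzero coefficient on one chart. If all coefficients on
  the chart of i vanished, \<open>euler_relation\<close> would make this one vanish as well.\<close>

lemma exists_nonzero_\<kappa>:
  assumes i: "pvar i \<notin> \<xi>"
  obtains j where "\<kappa> i j \<notin> \<xi>"
proof -
  obtain \<sigma> where \<sigma>: "\<sigma> permutes UNIV" "evenperm \<sigma>" "Q_form \<Phi> (\<sigma> 2) (\<sigma> 3) (\<sigma> 4) \<notin> \<xi>" using smooth by blast
  have nz: "\<kappa> (\<sigma> 0) (\<sigma> 1) \<notin> \<xi>"
    using ideal_diff_cong[OF ideal_pp Q_form_\<kappa>[OF \<sigma>(1,2)]] \<sigma>(3) ab by (simp add: mult_mem_iff)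
  have "\<exists>j. \<kappa> i j \<notin> \<xi>"
  proof (rule ccontr)
    assume "\<nexists>j. \<kappa> i j \<notin> \<xi>"
    then have "pvar (\<sigma> 0) * \<kappa> i (\<sigma> 1) - pvar (\<sigma> 1) * \<kappa> i (\<sigma> 0) \<in> \<xi>"
      by (intro ideal_diff[OF ideal_pp] ideal_mult[OF ideal_pp]) auto
    then have "pvar i * \<kappa> (\<sigma> 0) (\<sigma> 1) \<in> \<xi>"
      using ideal_diff_cong[OF ideal_pp euler_relation[of i "\<sigma> 0" "\<sigma> 1"]] by blast
    then show False using i nz by (simp add: mult_mem_iff)
  qed
  then show ?thesis using that by blast
qed

lemma \<kappa>_fraction: "pvar i \<notin> \<xi> \<Longrightarrow> (\<kappa> i j, pvar i ^ 2 * \<Phi> a b) \<in> fractions_at \<xi>"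
  by (rule fractions_atI[OF homogeneous_\<kappa> homogeneous_mult_eq[OF pvar_power_facts(1) homogeneous_entry]])
    (simp_all add: mult_mem_iff ab notin_power)

lemma du_proportional:
  assumes i: "pvar i \<notin> \<xi>" and j0: "\<kappa> i j0 \<notin> \<xi>"
  shows "du i j = germ F \<xi> (\<kappa> i j, \<kappa> i j0) \<odot>\<^bsub>kd.\<Omega>\<^esub> du i j0"
proof -
  note pw = pvar_power_facts[OF i]
  have fr: "(\<kappa> i j, pvar i ^ 3) \<in> fractions_at \<xi>" "(pvar i ^ 3, \<kappa> i j0) \<in> fractions_at \<xi>" "(\<kappa> i j, \<kappa> i j0) \<in> fractions_at \<xi>"
    by (rule fractions_atI[OF homogeneous_\<kappa> pw] fractions_atI[OF pw(1) homogeneous_\<kappa> j0] fractions_atI[OF homogeneous_\<kappa> homogeneous_\<kappa> j0])+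
  have "du i j = germ F \<xi> (pvar i ^ 3, \<kappa> i j0) \<odot>\<^bsub>kd.\<Omega>\<^esub> (germ F \<xi> (\<kappa> i j, pvar i ^ 3) \<odot>\<^bsub>kd.\<Omega>\<^esub> du i j0)"
    by (rule smult_germ_cancel[OF homogeneous_\<kappa> pw(1) j0 pw(2) du_closed[OF i] _ cramer_relation[OF i]])
      (rule km.smult_closed[OF germ_in_carrier[OF fr(1)] du_closed[OF i]])
  also have "\<dots> = germ F \<xi> (\<kappa> i j, \<kappa> i j0) \<odot>\<^bsub>kd.\<Omega>\<^esub> du i j0"
    by (rule smult_germ_eq[OF fr(2,1,3) du_closed[OF i]]) (simp add: mult_ac ideal_0[OF ideal_pp])
  finally show ?thesis .
qed

text \<open>On one chart w is obtained by solving the expected formula at an index where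
  \<open>\<kappa>\<close> is nonzero, and \<open>cramer_relation\<close> yields the other indices.
  Another chart is reached by the Leibniz rule for the factorisation of \<open>ratio i0 j\<close>
  through i, with \<open>euler_relation\<close> matching the coefficients.\<close>

lemma exists_generator:
  obtains w where "w \<in> carrier kd.\<Omega>"
    "\<And>i j. pvar i \<notin> \<xi> \<Longrightarrow> du i j = germ F \<xi> (\<kappa> i j, pvar i ^ 2 * \<Phi> a b) \<odot>\<^bsub>kd.\<Omega>\<^esub> w"
proof -
  obtain i0 where i0: "pvar i0 \<notin> \<xi>" using smooth by blast
  obtain j0 where j0: "\<kappa> i0 j0 \<notin> \<xi>" by (rule exists_nonzero_\<kappa>[OF i0])
  let ?D = "\<lambda>i. pvar i ^ 2 * \<Phi> a b"
  have D: "homogeneous 3 (?D i)" "pvar i \<notin> \<xi> \<Longrightarrow> ?D i \<notin> \<xi>" for i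
    using homogeneous_mult_eq[OF homogeneous_power[OF homogeneous_pvar, of 2] homogeneous_entry]
    by (simp_all add: mult_mem_iff ab notin_power)
  have fr0: "(?D i0, \<kappa> i0 j0) \<in> fractions_at \<xi>" by (rule fractions_atI[OF D(1) homogeneous_\<kappa> j0])
  define w where "w = germ F \<xi> (?D i0, \<kappa> i0 j0) \<odot>\<^bsub>kd.\<Omega>\<^esub> du i0 j0"
  have w: "w \<in> carrier kd.\<Omega>" unfolding w_def by (rule km.smult_closed[OF germ_in_carrier[OF fr0] du_closed[OF i0]])
  have du0: "du i0 j = germ F \<xi> (\<kappa> i0 j, ?D i0) \<odot>\<^bsub>kd.\<Omega>\<^esub> w" for j
  proof -
    have "germ F \<xi> (\<kappa> i0 j, ?D i0) \<odot>\<^bsub>kd.\<Omega>\<^esub> w = germ F \<xi> (\<kappa> i0 j, \<kappa> i0 j0) \<odot>\<^bsub>kd.\<Omega>\<^esub> du i0 j0"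
      unfolding w_def
      by (rule smult_germ_eq[OF \<kappa>_fraction[OF i0] fr0 fractions_atI[OF homogeneous_\<kappa> homogeneous_\<kappa> j0] du_closed[OF i0]])
        (simp add: mult_ac ideal_0[OF ideal_pp])
    then show ?thesis using du_proportional[OF i0 j0, of j] by simp
  qed
  have "du i j = germ F \<xi> (\<kappa> i j, ?D i) \<odot>\<^bsub>kd.\<Omega>\<^esub> w" if i: "pvar i \<notin> \<xi>" for i j
  proof -
    have rf: "(pvar n, pvar m) \<in> fractions_at \<xi>" if "pvar m \<notin> \<xi>" for m n
      by (rule fractions_atI[OF homogeneous_pvar homogeneous_pvar that])
    have "ratio i0 j = ratio i j \<otimes>\<^bsub>stalk F \<xi>\<^esub> ratio i0 i"
      unfolding ratio_def mult_stalk[OF rf[OF i] rf[OF i0]]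
      by (rule germ_eqI[OF rf[OF i0] fractions_mult[OF rf[OF i] rf[OF i0]]]) (simp add: mult_ac)
    then have "du i0 j = ratio i j \<odot>\<^bsub>kd.\<Omega>\<^esub> du i0 i \<oplus>\<^bsub>kd.\<Omega>\<^esub> ratio i0 i \<odot>\<^bsub>kd.\<Omega>\<^esub> du i j"
      using kd.d_mult[OF ratio_closed[OF i] ratio_closed[OF i0]] by simp
    moreover have c1: "ratio i0 i \<odot>\<^bsub>kd.\<Omega>\<^esub> du i j \<in> carrier kd.\<Omega>" "ratio i j \<odot>\<^bsub>kd.\<Omega>\<^esub> du i0 i \<in> carrier kd.\<Omega>"
      by (rule km.smult_closed[OF ratio_closed[OF i0] du_closed[OF i]] km.smult_closed[OF ratio_closed[OF i] du_closed[OF i0]])+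
    ultimately have e1: "ratio i0 i \<odot>\<^bsub>kd.\<Omega>\<^esub> du i j = du i0 j \<oplus>\<^bsub>kd.\<Omega>\<^esub> \<ominus>\<^bsub>kd.\<Omega>\<^esub> (ratio i j \<odot>\<^bsub>kd.\<Omega>\<^esub> du i0 i)"
      by (simp add: km.a_comm[OF c1(2,1)] km.a_assoc km.r_neg)
    have h3: "homogeneous 4 (pvar n * \<kappa> i0 m)" for n m by (rule homogeneous_mult_eq[OF homogeneous_pvar homogeneous_\<kappa>]) simp
    have hs: "homogeneous 4 (pvar i * ?D i0)" by (rule homogeneous_mult_eq[OF homogeneous_pvar D(1)]) simp
    have sn: "pvar i * ?D i0 \<notin> \<xi>" using D(2)[OF i0] i by (simp add: mult_mem_iff)
    have "du i0 j = germ F \<xi> (pvar i * \<kappa> i0 j, pvar i * ?D i0) \<odot>\<^bsub>kd.\<Omega>\<^esub> w"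
      unfolding du0[of j] germ_cancel(1)[OF \<kappa>_fraction[OF i0] homogeneous_pvar i] ..
    moreover have "ratio i j \<odot>\<^bsub>kd.\<Omega>\<^esub> du i0 i = germ F \<xi> (pvar j * \<kappa> i0 i, pvar i * ?D i0) \<odot>\<^bsub>kd.\<Omega>\<^esub> w"
      unfolding du0[of i] unfolding ratio_def by (rule smult_germ[OF rf[OF i] \<kappa>_fraction[OF i0] w])
    then have "\<ominus>\<^bsub>kd.\<Omega>\<^esub> (ratio i j \<odot>\<^bsub>kd.\<Omega>\<^esub> du i0 i) = germ F \<xi> (- (pvar j * \<kappa> i0 i), pvar i * ?D i0) \<odot>\<^bsub>kd.\<Omega>\<^esub> w"
      using km.smult_l_minus[OF germ_in_carrier[OF fractions_atI[OF h3 hs sn]] w] germ_uminus[OF fractions_atI[OF h3 hs sn]] by simp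
    ultimately have "ratio i0 i \<odot>\<^bsub>kd.\<Omega>\<^esub> du i j =
        (germ F \<xi> (pvar i * \<kappa> i0 j, pvar i * ?D i0) \<oplus>\<^bsub>stalk F \<xi>\<^esub> germ F \<xi> (- (pvar j * \<kappa> i0 i), pvar i * ?D i0)) \<odot>\<^bsub>kd.\<Omega>\<^esub> w"
      unfolding e1 using km.smult_l_distr[OF germ_in_carrier[OF fractions_atI[OF h3 hs sn]] germ_in_carrier[OF fractions_atI[OF homogeneous_uminus[OF h3] hs sn]] w] by simp
    also have "\<dots> = germ F \<xi> (pvar i * \<kappa> i0 j - pvar j * \<kappa> i0 i, pvar i * ?D i0) \<odot>\<^bsub>kd.\<Omega>\<^esub> w"
      using germ_add_same_denom[OF h3 homogeneous_uminus[OF h3] hs sn, of i j j i] by simp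
    finally have "germ F \<xi> (pvar i, pvar i0) \<odot>\<^bsub>kd.\<Omega>\<^esub> du i j = germ F \<xi> (pvar i * \<kappa> i0 j - pvar j * \<kappa> i0 i, pvar i * ?D i0) \<odot>\<^bsub>kd.\<Omega>\<^esub> w"
      (is "_ = ?R") unfolding ratio_def .
    moreover have fR: "(pvar i * \<kappa> i0 j - pvar j * \<kappa> i0 i, pvar i * ?D i0) \<in> fractions_at \<xi>"
      by (rule fractions_atI[OF homogeneous_diff[OF h3 h3] hs sn])
    then have "?R \<in> carrier kd.\<Omega>" by (intro km.smult_closed germ_in_carrier w)
    ultimately have "du i j = germ F \<xi> (pvar i0, pvar i) \<odot>\<^bsub>kd.\<Omega>\<^esub> ?R"
      using smult_germ_cancel[OF homogeneous_pvar homogeneous_pvar i i0 du_closed[OF i]] by blast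
    also have "\<dots> = germ F \<xi> (\<kappa> i j, ?D i) \<odot>\<^bsub>kd.\<Omega>\<^esub> w"
    proof (rule smult_germ_eq[OF rf[OF i] fR \<kappa>_fraction[OF i] w])
      have "pvar i0 * (pvar i * \<kappa> i0 j - pvar j * \<kappa> i0 i) * ?D i - \<kappa> i j * (pvar i * (pvar i * ?D i0)) =
          - (pvar i ^ 2 * pvar i0 * \<Phi> a b) * (pvar i0 * \<kappa> i j - (pvar i * \<kappa> i0 j - pvar j * \<kappa> i0 i))"
        by (simp add: algebra_simps power2_eq_square)
      then show "pvar i0 * (pvar i * \<kappa> i0 j - pvar j * \<kappa> i0 i) * ?D i - \<kappa> i j * (pvar i * (pvar i * ?D i0)) \<in> \<xi>"
        using ideal_mult[OF ideal_pp euler_relation[of i0 i j], of "- (pvar i ^ 2 * pvar i0 * \<Phi> a b)"] by simp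
    qed
    finally show ?thesis .
  qed
  then show ?thesis using that[OF w] by blast
qed

lemma homogeneous_Q_form: "homogeneous 2 (Q_form \<Phi> k l m)"
proof -
  have "homogeneous 0 (pdiff l (\<Phi> i j))" for i j using homogeneous_pdiff[OF X5D(1)[OF X5]] by simp
  then have "homogeneous 2 (grad i k * pdiff l (\<Phi> i j) * grad j m)" for i j
    by (intro homogeneous_mult_eq[OF homogeneous_mult_eq[OF homogeneous_grad _ refl] homogeneous_grad]) simp_all
  then show ?thesis unfolding Q_form_def by (intro homogeneous_sum)
qed

text \<open>Uniqueness: \<open>smooth\<close> supplies an even permutation for which the formula is
  meaningful, and it determines the value. Existence: \<open>Q_form_\<kappa>\<close> shows that w
  satisfies the formula for every such permutation.\<close>

lemma invariant_differential_unique: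
  assumes w: "w \<in> carrier kd.\<Omega>"
    and du: "\<And>i j. pvar i \<notin> \<xi> \<Longrightarrow> du i j = germ F \<xi> (\<kappa> i j, pvar i ^ 2 * \<Phi> a b) \<odot>\<^bsub>kd.\<Omega>\<^esub> w"
  shows "invariant_differential \<Phi> = w"
proof -
  have formula: "w = germ F \<xi> (pvar (\<sigma> 0) ^ 2, Q_form \<Phi> (\<sigma> 2) (\<sigma> 3) (\<sigma> 4)) \<odot>\<^bsub>kd.\<Omega>\<^esub> du (\<sigma> 0) (\<sigma> 1)"
    if \<sigma>: "\<sigma> permutes UNIV" "evenperm \<sigma>" and i: "pvar (\<sigma> 0) \<notin> \<xi>" and Q: "Q_form \<Phi> (\<sigma> 2) (\<sigma> 3) (\<sigma> 4) \<notin> \<xi>" for \<sigma>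
  proof -
    let ?Q = "Q_form \<Phi> (\<sigma> 2) (\<sigma> 3) (\<sigma> 4)" and ?x = "pvar (\<sigma> 0)"
    have "germ F \<xi> (?x ^ 2, ?Q) \<odot>\<^bsub>kd.\<Omega>\<^esub> du (\<sigma> 0) (\<sigma> 1) = germ F \<xi> (1, 1) \<odot>\<^bsub>kd.\<Omega>\<^esub> w"
      unfolding du[OF i]
    proof (rule smult_germ_eq[OF fractions_atI[OF pvar_power_facts(1)[OF i] homogeneous_Q_form Q] \<kappa>_fraction[OF i] fractions_one w])
      have "?x ^ 2 * \<kappa> (\<sigma> 0) (\<sigma> 1) * 1 - 1 * (?Q * (?x ^ 2 * \<Phi> a b)) = - (?x ^ 2) * (\<Phi> a b * ?Q - \<kappa> (\<sigma> 0) (\<sigma> 1))"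
        by (simp add: algebra_simps)
      then show "?x ^ 2 * \<kappa> (\<sigma> 0) (\<sigma> 1) * 1 - 1 * (?Q * (?x ^ 2 * \<Phi> a b)) \<in> \<xi>"
        using ideal_mult[OF ideal_pp Q_form_\<kappa>[OF \<sigma>], of "- (?x ^ 2)"] by simp
    qed
    then show ?thesis using km.smult_one[OF w] by (simp add: one_stalk)
  qed
  obtain \<sigma> where \<sigma>: "\<sigma> permutes UNIV" "evenperm \<sigma>" "pvar (\<sigma> 0) \<notin> \<xi>" "Q_form \<Phi> (\<sigma> 2) (\<sigma> 3) (\<sigma> 4) \<notin> \<xi>"
    using smooth by blast
  show ?thesis
    unfolding invariant_differential_def Let_def generic rational_differentials_eq rational_d_eq coordinate_ratio_eq
  proof (rule the_equality, intro conjI allI impI, goal_cases)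
    case 1
    show ?case by (rule w)
  next
    case (2 \<sigma>)
    then show ?case using formula[of \<sigma>] by blast
  next
    case (3 w')
    then show ?case using \<sigma> formula[OF \<sigma>] by metis
  qed
qed

lemma invariant_differential_closed: "invariant_differential \<Phi> \<in> carrier kd.\<Omega>"
  and du_invariant_differential:
    "pvar i \<notin> \<xi> \<Longrightarrow> du i j = germ F \<xi> (\<kappa> i j, pvar i ^ 2 * \<Phi> a b) \<odot>\<^bsub>kd.\<Omega>\<^esub> invariant_differential \<Phi>"
proof -
  obtain w where w: "w \<in> carrier kd.\<Omega>"
    "\<And>i j. pvar i \<notin> \<xi> \<Longrightarrow> du i j = germ F \<xi> (\<kappa> i j, pvar i ^ 2 * \<Phi> a b) \<odot>\<^bsub>kd.\<Omega>\<^esub> w"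
    using exists_generator by blast
  show "invariant_differential \<Phi> \<in> carrier kd.\<Omega>"
    "pvar i \<notin> \<xi> \<Longrightarrow> du i j = germ F \<xi> (\<kappa> i j, pvar i ^ 2 * \<Phi> a b) \<odot>\<^bsub>kd.\<Omega>\<^esub> invariant_differential \<Phi>"
    using w invariant_differential_unique[OF w] by auto
qed

end

section \<open>The canonical sheaf\<close>

lemma minor3_mult:
  fixes R1 R2 R3 A B C :: "'i \<Rightarrow> 'a::comm_ring_1"
  assumes "\<And>j. R1 j = g11 * A j + g12 * B j + g13 * C j" "\<And>j. R2 j = g21 * A j + g22 * B j + g23 * C j"
    "\<And>j. R3 j = g31 * A j + g32 * B j + g33 * C j"
  shows "minor3 R1 R2 R3 k l m =
    (g11 * (g22 * g33 - g23 * g32) - g12 * (g21 * g33 - g23 * g31) + g13 * (g21 * g32 - g22 * g31)) * minor3 A B C k l m"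
  unfolding minor3_def assms by (simp add: algebra_simps)

lemma minor3_cong:
  assumes id: "is_ideal I" and "\<And>j. A j - A' j \<in> I" "\<And>j. B j - B' j \<in> I" "\<And>j. C j - C' j \<in> I"
  shows "minor3 A B C k l m - minor3 A' B' C' k l m \<in> I"
proof -
  have "(A k * (B l * C m) - A' k * (B' l * C' m)) \<in> I" for k l m
    by (intro ideal_cong_mult[OF id] assms)
  note * = this
  have "minor3 A B C k l m - minor3 A' B' C' k l m =
    (A k * (B l * C m) - A' k * (B' l * C' m)) - (A k * (B m * C l) - A' k * (B' m * C' l))
    - (A l * (B k * C m) - A' l * (B' k * C' m)) + (A l * (B m * C k) - A' l * (B' m * C' k))
    + (A m * (B k * C l) - A' m * (B' k * C' l)) - (A m * (B l * C k) - A' m * (B' l * C' k))"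
    by (simp add: minor3_def algebra_simps)
  also have "\<dots> \<in> I" by (intro ideal_diff[OF id] ideal_add[OF id] *)
  finally show ?thesis .
qed

context pfaffian_generic_point
begin

text \<open>In the quotient rule the term containing f itself vanishes on the subscheme, so the
  denominator is not differentiated.\<close>

lemma chart_diff_ideal:
  assumes "f \<in> ideal_of F" "homogeneous n f" "homogeneous n s" "s \<notin> \<xi>"
  shows "chart_diff F i j (f, s) = germ F \<xi> (pvar i * pdiff j f, s)"
proof -
  have f: "f \<in> \<xi>" using assms(1) ideal_sub_\<xi> by blast
  have eq: "pvar i * (s * pdiff j f - f * pdiff j s) = s * (pvar i * pdiff j f) - f * (pvar i * pdiff j s)"
    by (simp add: algebra_simps)
  have fr: "(pvar i * (s * pdiff j f - f * pdiff j s), s * s) \<in> fractions_at \<xi>"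
    unfolding eq using assms
    by (intro fractions_atI[of "n + n"] homogeneous_diff homogeneous_mult homogeneous_pvar_pdiff) (auto simp: mult_mem_iff)
  have "pvar i * (s * pdiff j f - f * pdiff j s) * s - pvar i * pdiff j f * (s * s) = - (pvar i * pdiff j s * s) * f"
    by (simp add: algebra_simps)
  then have "pvar i * (s * pdiff j f - f * pdiff j s) * s - pvar i * pdiff j f * (s * s) \<in> \<xi>"
    using ideal_mult[OF ideal_pp f, of "- (pvar i * pdiff j s * s)"] by simp
  then show ?thesis
    unfolding chart_diff_def generic prod.case
    by (intro germ_eq_generic[OF fr fractions_atI[OF homogeneous_pvar_pdiff[OF assms(2)] assms(3,4)]])
qed

lemma wedge_coefficient_eq:
  assumes f: "f1 \<in> ideal_of F" "f2 \<in> ideal_of F" "f3 \<in> ideal_of F"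
    and h: "homogeneous n1 f1" "homogeneous n2 f2" "homogeneous n3 f3"
    and s: "homogeneous n1 s1" "homogeneous n2 s2" "homogeneous n3 s3" "s1 \<notin> \<xi>" "s2 \<notin> \<xi>" "s3 \<notin> \<xi>"
    and b: "\<And>j. homogeneous n (b j)" "homogeneous n t" "t \<notin> \<xi>" and g: "\<And>j. g j = germ F \<xi> (b j, t)"
  shows "wedge_coefficient F i (f1, s1) (f2, s2) (f3, s3) g =
      germ F \<xi> (det (frame i (\<lambda>j. pvar i * pdiff j f1) (\<lambda>j. pvar i * pdiff j f2) (\<lambda>j. pvar i * pdiff j f3) b), s1 * s2 * s3 * t)"
    and "(det (frame i (\<lambda>j. pvar i * pdiff j f1) (\<lambda>j. pvar i * pdiff j f2) (\<lambda>j. pvar i * pdiff j f3) b), s1 * s2 * s3 * t)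
      \<in> fractions_at \<xi>"
proof -
  define B where "B = frame i (\<lambda>j. pvar i * pdiff j f1) (\<lambda>j. pvar i * pdiff j f2) (\<lambda>j. pvar i * pdiff j f3) b"
  define D :: "5 \<Rightarrow> nat" where "D r = (if r = 0 then 0 else if r = 1 then n1 else if r = 2 then n2 else if r = 3 then n3 else n)" for r
  define S where "S r = (if r = 0 then 1 else if r = 1 then s1 else if r = 2 then s2 else if r = 3 then s3 else t)" for r :: 5
  have hB: "homogeneous (D r) (B $ r $ j)" for r j
    unfolding B_def frame_def D_def using homogeneous_pvar_pdiff[OF h(1)] homogeneous_pvar_pdiff[OF h(2)] homogeneous_pvar_pdiff[OF h(3)] b(1)
    by simp
  have hS: "homogeneous (D r) (S r)" "S r \<notin> \<xi>" for r
    unfolding S_def D_def using s b one_notin by simp_all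
  have S: "(\<Prod>r\<in>UNIV. S r) = s1 * s2 * s3 * t" unfolding prod_5 by (simp add: S_def)
  have "wedge_coefficient F i (f1, s1) (f2, s2) (f3, s3) g = det5 (stalk F \<xi>) (\<lambda>r j. germ F \<xi> (B $ r $ j, S r))"
    unfolding wedge_coefficient_def function_field_eq
    by (intro arg_cong[where f = "det5 (stalk F \<xi>)"] ext)
      (simp add: B_def frame_def S_def chart_diff_ideal[OF f(1) h(1) s(1,4)] chart_diff_ideal[OF f(2) h(2) s(2,5)]
        chart_diff_ideal[OF f(3) h(3) s(3,6)] g one_stalk zero_stalk)
  also have "\<dots> = germ F \<xi> (det B, s1 * s2 * s3 * t)"
    using det5_germ[of D "\<lambda>r j. B $ r $ j" S, OF hB hS] unfolding S by simp
  finally show "wedge_coefficient F i (f1, s1) (f2, s2) (f3, s3) g =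
      germ F \<xi> (det (frame i (\<lambda>j. pvar i * pdiff j f1) (\<lambda>j. pvar i * pdiff j f2) (\<lambda>j. pvar i * pdiff j f3) b), s1 * s2 * s3 * t)"
    unfolding B_def .
  have "homogeneous (sum D UNIV) (prod S UNIV)" using hS(1) by (intro homogeneous_prod)
  moreover have "prod S UNIV \<notin> \<xi>" using hS(2) by (intro notin_prod) auto
  ultimately have "(det B, s1 * s2 * s3 * t) \<in> fractions_at \<xi>"
    using homogeneous_det[of D B, OF hB] unfolding S by (intro fractions_atI)
  then show "(det (frame i (\<lambda>j. pvar i * pdiff j f1) (\<lambda>j. pvar i * pdiff j f2) (\<lambda>j. pvar i * pdiff j f3) b), s1 * s2 * s3 * t)
      \<in> fractions_at \<xi>" unfolding B_def .
qed

end

section \<open>Comparison of the canonical stalk with the stalk generated by the invariant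
  differential\<close>

context pfaffian_pivot
begin

lemma det_frame_\<kappa>:
  "det (frame i (grad c) (grad d) (grad e) g) = - \<epsilon> * (\<Sum>j\<in>UNIV. g j * \<kappa> i j)"
proof -
  have "g j * det (frame i (grad c) (grad d) (grad e) (unit_row j)) = - \<epsilon> * (g j * \<kappa> i j)" for j
  proof -
    have "- \<epsilon> * (g j * \<kappa> i j) = (\<epsilon> * \<epsilon>) * (g j * det (frame i (grad c) (grad d) (grad e) (unit_row j)))"
      unfolding \<kappa>_def by (simp add: mult_ac)
    then show ?thesis by (simp add: sign_square)
  qed
  then show ?thesis unfolding det_frame_linear[of i _ _ _ g] sum_distrib_left by simp
qed

text \<open>Test w on the three pivot Pfaffians. The resulting wedge coefficient is the coefficient
  of w over the invariant differential times a fraction that is a unit at x, so regularity of one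
  gives regularity of the other.\<close>

lemma canonical_stalk_subset:
  assumes x: "x \<in> points F" and \<xi>x: "\<xi> \<subseteq> x" and abx: "\<Phi> a b \<notin> x" and w: "w \<in> canonical_stalk F x"
  shows "w \<in> generated_stalk F (invariant_differential \<Phi>) x"
proof -
  interpret X: homogeneous_point F x using pointsD(1)[OF x] by unfold_locales
  let ?\<omega> = "invariant_differential \<Phi>"
  obtain i where ix: "pvar i \<notin> x" using pointsD(3)[OF x] by blast
  then have i: "pvar i \<notin> \<xi>" using \<xi>x by blast
  note pw = pvar_power_facts[OF i]
  obtain g where g: "\<forall>j. g j \<in> carrier (stalk F \<xi>)"
      "w = finsum kd.\<Omega> (\<lambda>j. g j \<odot>\<^bsub>kd.\<Omega>\<^esub> du i j) (- {i})"
      and wedge: "\<forall>f1\<in>ideal_fractions_at F x. \<forall>f2\<in>ideal_fractions_at F x. \<forall>f3\<in>ideal_fractions_at F x.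
             wedge_coefficient F i f1 f2 f3 g \<in> local_functions F x"
    using w ix unfolding canonical_stalk_def function_field_eq rational_differentials_eq rational_d_eq coordinate_ratio_eq by blast
  obtain n B t where B: "\<And>j. homogeneous n (B j)" "homogeneous n t" "t \<notin> \<xi>" "\<And>j. g j = germ F \<xi> (B j, t)"
    using common_denominator[OF g(1)] by blast
  \<comment> \<open>By the formula for the differentials of the ratios, w is the fraction of T by
    \<open>t * ?D\<close> times the invariant differential; up to sign and powers of
    \<open>pvar i\<close>, T is also the numerator of the wedge coefficient.\<close>
  define T where "T = (\<Sum>j\<in>UNIV. B j * \<kappa> i j)"
  have hT: "homogeneous (n + 3) T" unfolding T_def by (intro homogeneous_sum homogeneous_mult B(1) homogeneous_\<kappa>)
  let ?D = "pvar i ^ 2 * \<Phi> a b"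
  have D: "homogeneous 3 ?D" "?D \<notin> \<xi>"
    using homogeneous_mult_eq[OF pw(1)[of 2] homogeneous_entry] pw(2) ab by (simp_all add: mult_mem_iff)
  have tD: "homogeneous (n + 3) (t * ?D)" "t * ?D \<notin> \<xi>" using homogeneous_mult[OF B(2) D(1)] B(3) D(2) by (simp_all add: mult_mem_iff)
  note \<omega> = invariant_differential_closed
  have "w = finsum kd.\<Omega> (\<lambda>j. germ F \<xi> (B j * \<kappa> i j, t * ?D) \<odot>\<^bsub>kd.\<Omega>\<^esub> ?\<omega>) (- {i})"
    unfolding g(2)
  proof (rule km.finsum_cong')
    show "g j \<odot>\<^bsub>kd.\<Omega>\<^esub> du i j = germ F \<xi> (B j * \<kappa> i j, t * ?D) \<odot>\<^bsub>kd.\<Omega>\<^esub> ?\<omega>" for j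
      unfolding B(4) du_invariant_differential[OF i]
      by (rule smult_germ[OF fractions_atI[OF B(1-3)] \<kappa>_fraction[OF i] \<omega>])
    show "(\<lambda>j. germ F \<xi> (B j * \<kappa> i j, t * ?D) \<odot>\<^bsub>kd.\<Omega>\<^esub> ?\<omega>) \<in> - {i} \<rightarrow> carrier kd.\<Omega>"
      by (intro funcsetI km.smult_closed \<omega> germ_in_carrier fractions_atI[OF homogeneous_mult[OF B(1) homogeneous_\<kappa>] tD])
  qed simp
  also have "\<dots> = germ F \<xi> (\<Sum>j\<in>- {i}. B j * \<kappa> i j, t * ?D) \<odot>\<^bsub>kd.\<Omega>\<^esub> ?\<omega>"
    by (rule finsum_smult_germ[OF _ _ tD \<omega>]) (auto intro: homogeneous_mult B(1) homogeneous_\<kappa>)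
  also have "(\<Sum>j\<in>- {i}. B j * \<kappa> i j) = T"
    unfolding T_def by (rule sum.mono_neutral_left) (auto simp: \<kappa>_same)
  finally have wT: "w = germ F \<xi> (T, t * ?D) \<odot>\<^bsub>kd.\<Omega>\<^esub> ?\<omega>" .
  have Pf: "Pf \<Phi> h \<in> ideal_of F" for h by (rule ideal_of_base) (simp add: pfaffian_scheme_def)
  have mem: "(Pf \<Phi> h, pvar i ^ 2) \<in> ideal_fractions_at F x" for h
    using X.fractions_atI[OF homogeneous_Pf[OF X5] X.pvar_power_facts[OF ix]] Pf by (simp add: ideal_fractions_at_def)
  note W = wedge_coefficient_eq[OF Pf[of c] Pf[of d] Pf[of e] homogeneous_Pf[OF X5] homogeneous_Pf[OF X5] homogeneous_Pf[OF X5]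
      pw(1) pw(1) pw(1) pw(2) pw(2) pw(2) B, of i]
  have "germ F \<xi> (det (frame i (\<lambda>j. pvar i * grad c j) (\<lambda>j. pvar i * grad d j) (\<lambda>j. pvar i * grad e j) B),
      pvar i ^ 2 * pvar i ^ 2 * pvar i ^ 2 * t) \<in> local_functions F x"
    using wedge mem unfolding W(1)[symmetric] by blast
  then obtain p r where pr: "(p, r) \<in> fractions_at x"
    "germ F \<xi> (det (frame i (\<lambda>j. pvar i * grad c j) (\<lambda>j. pvar i * grad d j) (\<lambda>j. pvar i * grad e j) B),
      pvar i ^ 2 * pvar i ^ 2 * pvar i ^ 2 * t) = germ F \<xi> (p, r)"
    unfolding local_functions_def generic by auto
  have sub: "(p, r) \<in> fractions_at \<xi>" if "(p, r) \<in> fractions_at x" for p r using that \<xi>x by (auto simp: fractions_at_def)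
  have "vanishes (det (frame i (\<lambda>j. pvar i * grad c j) (\<lambda>j. pvar i * grad d j) (\<lambda>j. pvar i * grad e j) B) * r
      - p * (pvar i ^ 2 * pvar i ^ 2 * pvar i ^ 2 * t))"
    using germ_eq_iff[OF W(2) sub[OF pr(1)]] pr(2) by (simp only: simp_thms)
  then have "det (frame i (\<lambda>j. pvar i * grad c j) (\<lambda>j. pvar i * grad d j) (\<lambda>j. pvar i * grad e j) B) * r
      - p * (pvar i ^ 2 * pvar i ^ 2 * pvar i ^ 2 * t) \<in> \<xi>" by (rule vanishes_subset[OF sub_\<xi>])
  moreover have "det (frame i (\<lambda>j. pvar i * grad c j) (\<lambda>j. pvar i * grad d j) (\<lambda>j. pvar i * grad e j) B) * r
      - p * (pvar i ^ 2 * pvar i ^ 2 * pvar i ^ 2 * t) = pvar i ^ 3 * (- \<epsilon> * T * r - p * pvar i ^ 3 * t)"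
    unfolding det_frame_scale det_frame_\<kappa> T_def[symmetric] by (simp add: algebra_simps numeral_eq_Suc)
  ultimately have key: "- \<epsilon> * T * r - p * pvar i ^ 3 * t \<in> \<xi>" using pw(2)[of 3] by (simp add: mult_mem_iff)
  obtain m where m: "homogeneous m p" "homogeneous m r" "r \<notin> x" using pr(1) by (rule X.fractions_atE)
  have "homogeneous 1 (- \<epsilon> * pvar i)"
    using homogeneous_mult_eq[OF homogeneous_uminus[OF homogeneous_sign[OF sign_cases]] homogeneous_pvar] by simp
  then have "(- \<epsilon> * pvar i, \<Phi> a b) \<in> fractions_at x" by (rule X.fractions_atI[OF _ homogeneous_entry abx])
  then have fr: "(p * (- \<epsilon> * pvar i), r * \<Phi> a b) \<in> fractions_at x" by (rule X.fractions_mult[OF pr(1)])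
  \<comment> \<open>The denominator \<open>r * \<Phi> a b\<close> lies outside x, so the coefficient
    of w is a local function at x.\<close>
  have "germ F \<xi> (T, t * ?D) = germ F \<xi> (p * (- \<epsilon> * pvar i), r * \<Phi> a b)"
  proof (rule germ_eq_generic[OF fractions_atI[OF hT tD] sub[OF fr]])
    have "T * (r * \<Phi> a b) - p * (- \<epsilon> * pvar i) * (t * ?D) = (- \<epsilon> * \<Phi> a b) * (- \<epsilon> * T * r - p * pvar i ^ 3 * t)"
    proof -
      have "(- \<epsilon> * \<Phi> a b) * (- \<epsilon> * T * r - p * pvar i ^ 3 * t) = (\<epsilon> * \<epsilon>) * (T * r * \<Phi> a b) + \<epsilon> * \<Phi> a b * p * pvar i ^ 3 * t"
        by (simp add: algebra_simps)
      then show ?thesis by (simp add: sign_square algebra_simps numeral_eq_Suc)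
    qed
    then show "T * (r * \<Phi> a b) - p * (- \<epsilon> * pvar i) * (t * ?D) \<in> \<xi>" using ideal_mult[OF ideal_pp key, of "- \<epsilon> * \<Phi> a b"] by simp
  qed
  then have "w = germ F \<xi> (p * (- \<epsilon> * pvar i), r * \<Phi> a b) \<odot>\<^bsub>kd.\<Omega>\<^esub> ?\<omega>" using wT by simp
  then show ?thesis
    unfolding generated_stalk_def local_functions_def generic rational_differentials_eq using fr by blast
qed

text \<open>After multiplication by \<open>\<Phi> a b\<close> each element of the ideal is a
  combination of the pivot Pfaffians, and modulo \<open>\<xi>\<close> so is its gradient, with the
  same coefficients. The minor of three such gradients is the determinant G of the coefficients
  times a minor of the pivot gradients.\<close>

lemma det_frame_ideal:
  assumes f: "f1 \<in> ideal_of F" "f2 \<in> ideal_of F" "f3 \<in> ideal_of F"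
    and h: "homogeneous n1 f1" "homogeneous n2 f2" "homogeneous n3 f3" and ij: "i \<noteq> j"
  obtains H where "homogeneous (n1 + (n2 + n3)) H"
    "\<Phi> a b ^ 3 * det (frame i (\<lambda>j. pvar i * pdiff j f1) (\<lambda>j. pvar i * pdiff j f2) (\<lambda>j. pvar i * pdiff j f3) (unit_row j)) - \<kappa> i j * H \<in> \<xi>"
proof -
  let ?N = "n1 + (n2 + n3)"
  obtain s k l m where det: "\<And>A B C. det (frame i A B C (unit_row j)) = (s :: 'a poly5) * minor3 A B C k l m"
    by (rule det_frame_as_minor[OF ij]) blast
  have "\<exists>u v w. \<forall>n. \<Phi> a b * pdiff n f - (u * grad c n + v * grad d n + w * grad e n) \<in> \<xi>" if f: "f \<in> ideal_of F" for f
  proof -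
    obtain u v w where uvw: "\<Phi> a b * f = u * Pf \<Phi> c + v * Pf \<Phi> d + w * Pf \<Phi> e"
      using pivot_mult_ideal[OF X5 pv f] unfolding ideal_of_3 by blast
    have f\<xi>: "f \<in> \<xi>" using f ideal_sub_\<xi> by blast
    have "\<Phi> a b * pdiff n f - (u * grad c n + v * grad d n + w * grad e n) \<in> \<xi>" for n
    proof -
      have "\<Phi> a b * pdiff n f + f * pdiff n (\<Phi> a b) = u * grad c n + v * grad d n + w * grad e n
          + (Pf \<Phi> c * pdiff n u + Pf \<Phi> d * pdiff n v + Pf \<Phi> e * pdiff n w)"
        using arg_cong[OF uvw, of "pdiff n"] by (simp add: pdiff_add pdiff_mult algebra_simps)
      then have "\<Phi> a b * pdiff n f - (u * grad c n + v * grad d n + w * grad e n) =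
          (Pf \<Phi> c * pdiff n u + Pf \<Phi> d * pdiff n v + Pf \<Phi> e * pdiff n w) - f * pdiff n (\<Phi> a b)"
        by (simp add: algebra_simps)
      also have "\<dots> \<in> \<xi>"
        by (intro ideal_diff[OF ideal_pp] ideal_add[OF ideal_pp] ideal_mult_right[OF ideal_pp Pf_in_\<xi>] ideal_mult_right[OF ideal_pp f\<xi>])
      finally show ?thesis .
    qed
    then show ?thesis by blast
  qed
  note grads = this
  obtain u1 v1 w1 where g1: "\<And>n. \<Phi> a b * pdiff n f1 - (u1 * grad c n + v1 * grad d n + w1 * grad e n) \<in> \<xi>" using grads[OF f(1)] by blast
  obtain u2 v2 w2 where g2: "\<And>n. \<Phi> a b * pdiff n f2 - (u2 * grad c n + v2 * grad d n + w2 * grad e n) \<in> \<xi>" using grads[OF f(2)] by blast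
  obtain u3 v3 w3 where g3: "\<And>n. \<Phi> a b * pdiff n f3 - (u3 * grad c n + v3 * grad d n + w3 * grad e n) \<in> \<xi>" using grads[OF f(3)] by blast
  define G where "G = u1 * (v2 * w3 - w2 * v3) - v1 * (u2 * w3 - w2 * u3) + w1 * (u2 * v3 - v2 * u3)"
  let ?E = "det (frame i (\<lambda>j. pvar i * pdiff j f1) (\<lambda>j. pvar i * pdiff j f2) (\<lambda>j. pvar i * pdiff j f3) (unit_row j))"
  have E: "?E = pvar i ^ 3 * (s * minor3 (\<lambda>j. pdiff j f1) (\<lambda>j. pdiff j f2) (\<lambda>j. pdiff j f3) k l m)"
    unfolding det_frame_scale det ..
  have "minor3 (\<lambda>n. \<Phi> a b * pdiff n f1) (\<lambda>n. \<Phi> a b * pdiff n f2) (\<lambda>n. \<Phi> a b * pdiff n f3) k l m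
      - minor3 (\<lambda>n. u1 * grad c n + v1 * grad d n + w1 * grad e n) (\<lambda>n. u2 * grad c n + v2 * grad d n + w2 * grad e n)
          (\<lambda>n. u3 * grad c n + v3 * grad d n + w3 * grad e n) k l m \<in> \<xi>"
    by (rule minor3_cong[OF ideal_pp g1 g2 g3])
  moreover have "minor3 (\<lambda>n. u1 * grad c n + v1 * grad d n + w1 * grad e n) (\<lambda>n. u2 * grad c n + v2 * grad d n + w2 * grad e n)
          (\<lambda>n. u3 * grad c n + v3 * grad d n + w3 * grad e n) k l m = G * M k l m"
    unfolding G_def by (rule minor3_mult) (rule refl)+
  moreover have "minor3 (\<lambda>n. \<Phi> a b * pdiff n f1) (\<lambda>n. \<Phi> a b * pdiff n f2) (\<lambda>n. \<Phi> a b * pdiff n f3) k l m =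
      \<Phi> a b ^ 3 * minor3 (\<lambda>j. pdiff j f1) (\<lambda>j. pdiff j f2) (\<lambda>j. pdiff j f3) k l m"
    by (simp add: minor3_def power3_eq_cube algebra_simps)
  ultimately have "(pvar i ^ 3 * s) * (\<Phi> a b ^ 3 * minor3 (\<lambda>j. pdiff j f1) (\<lambda>j. pdiff j f2) (\<lambda>j. pdiff j f3) k l m - G * M k l m) \<in> \<xi>"
    by (intro ideal_mult[OF ideal_pp]) simp
  moreover have \<kappa>: "\<kappa> i j = - \<epsilon> * (s * M k l m)" unfolding \<kappa>_def det ..
  have "\<kappa> i j * (- \<epsilon> * (pvar i ^ 3 * G)) = (\<epsilon> * \<epsilon>) * (pvar i ^ 3 * s * (G * M k l m))" unfolding \<kappa> by (simp add: mult_ac)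
  then have "(pvar i ^ 3 * s) * (\<Phi> a b ^ 3 * minor3 (\<lambda>j. pdiff j f1) (\<lambda>j. pdiff j f2) (\<lambda>j. pdiff j f3) k l m - G * M k l m) =
      \<Phi> a b ^ 3 * ?E - \<kappa> i j * (- \<epsilon> * (pvar i ^ 3 * G))"
    unfolding E sign_square by (simp add: right_diff_distrib mult_ac)
  ultimately have main: "\<Phi> a b ^ 3 * ?E - \<kappa> i j * (- \<epsilon> * (pvar i ^ 3 * G)) \<in> \<xi>" by simp
  have hE: "homogeneous ?N ?E"
  proof -
    define D :: "5 \<Rightarrow> nat" where "D r = (if r = 0 then 0 else if r = 1 then n1 else if r = 2 then n2 else if r = 3 then n3 else 0)" for r
    have "homogeneous (sum D UNIV) ?E"
      by (rule homogeneous_det) (use homogeneous_pvar_pdiff[OF h(1)] homogeneous_pvar_pdiff[OF h(2)] homogeneous_pvar_pdiff[OF h(3)]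
        in \<open>simp add: frame_def D_def unit_row_def\<close>)
    then show ?thesis by (simp add: sum_5 D_def add.assoc)
  qed
  \<comment> \<open>The coefficients u, v, w, and with them G, may be inhomogeneous. As
    \<open>\<xi>\<close> is graded, the component of degree \<open>3 + ?N\<close> of the congruence
    is again one, and it contains G through a component of degree \<open>?N\<close>.\<close>
  have "homogeneous (3 + ?N) (\<Phi> a b ^ 3 * ?E)"
    by (rule homogeneous_mult[OF _ hE]) (use homogeneous_power[OF homogeneous_entry, of 3] in simp)
  then have "hcomp (3 + ?N) (\<Phi> a b ^ 3 * ?E) = \<Phi> a b ^ 3 * ?E" by (simp add: hcomp_homogeneous)
  moreover have "hcomp (3 + ?N) (\<kappa> i j * (- \<epsilon> * (pvar i ^ 3 * G))) = \<kappa> i j * hcomp ?N (- \<epsilon> * (pvar i ^ 3 * G))"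
    unfolding hcomp_mult_homogeneous[OF homogeneous_\<kappa>] by simp
  ultimately have "\<Phi> a b ^ 3 * ?E - \<kappa> i j * hcomp ?N (- \<epsilon> * (pvar i ^ 3 * G)) \<in> \<xi>"
    using gradedD(2)[OF graded_pp main, of "3 + ?N"] unfolding hcomp_diff by (simp only:)
  then show ?thesis by (rule that[OF homogeneous_hcomp])
qed

text \<open>On each chart w is lifted to a multiple of a single differential, at an index
  \<open>j0\<close> where \<open>\<kappa>\<close> is nonzero. By \<open>det_frame_ideal\<close>
  every wedge then contains the factor \<open>\<kappa> i j0\<close>, which cancels against the
  denominator of the lift; the denominators left over are units at x.\<close>

lemma canonical_stalk_superset:
  assumes x: "x \<in> points F" and \<xi>x: "\<xi> \<subseteq> x" and abx: "\<Phi> a b \<notin> x"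
    and w: "w \<in> generated_stalk F (invariant_differential \<Phi>) x"
  shows "w \<in> canonical_stalk F x"
proof -
  interpret X: homogeneous_point F x using pointsD(1)[OF x] by unfold_locales
  let ?\<omega> = "invariant_differential \<Phi>"
  note \<omega> = invariant_differential_closed
  have sub: "(p, r) \<in> fractions_at \<xi>" if "(p, r) \<in> fractions_at x" for p r using that \<xi>x by (auto simp: fractions_at_def)
  obtain p r where pr: "(p, r) \<in> fractions_at x" "w = germ F \<xi> (p, r) \<odot>\<^bsub>kd.\<Omega>\<^esub> ?\<omega>"
    using w unfolding generated_stalk_def local_functions_def generic rational_differentials_eq by auto
  obtain n where n: "homogeneous n p" "homogeneous n r" "r \<notin> x" using pr(1) by (rule X.fractions_atE)
  have rn: "r \<notin> \<xi>" using n(3) \<xi>x by blast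
  have wc: "w \<in> carrier kd.\<Omega>" unfolding pr(2) by (intro km.smult_closed germ_in_carrier sub pr(1) \<omega>)
  have "\<exists>g. (\<forall>j. g j \<in> carrier (stalk F \<xi>)) \<and> w = finsum kd.\<Omega> (\<lambda>j. g j \<odot>\<^bsub>kd.\<Omega>\<^esub> du i j) (- {i}) \<and>
      (\<forall>f1\<in>ideal_fractions_at F x. \<forall>f2\<in>ideal_fractions_at F x. \<forall>f3\<in>ideal_fractions_at F x.
         wedge_coefficient F i f1 f2 f3 g \<in> local_functions F x)" if ix: "pvar i \<notin> x" for i
  proof -
    have i: "pvar i \<notin> \<xi>" using ix \<xi>x by blast
    note pw = pvar_power_facts[OF i]
    obtain j0 where j0: "\<kappa> i j0 \<notin> \<xi>" by (rule exists_nonzero_\<kappa>[OF i])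
    have ij0: "i \<noteq> j0" using j0 \<kappa>_same ideal_0[OF ideal_pp] by auto
    let ?D = "pvar i ^ 2 * \<Phi> a b"
    have D: "homogeneous 3 ?D" "?D \<notin> \<xi>"
      using homogeneous_mult_eq[OF pw(1)[of 2] homogeneous_entry] pw(2) ab by (simp_all add: mult_mem_iff)
    define t where "t = r * \<kappa> i j0"
    have t: "homogeneous (n + 3) t" "t \<notin> \<xi>"
      unfolding t_def using homogeneous_mult[OF n(2) homogeneous_\<kappa>] rn j0 by (simp_all add: mult_mem_iff)
    \<comment> \<open>The germ of \<open>p * ?D\<close> over \<open>r * \<kappa> i j0\<close> times
      the differential of \<open>ratio i j0\<close> is the fraction of p by r times the invariant
      differential, by solving \<open>du_invariant_differential\<close> for the latter.\<close>
    define B where "B j = (if j = j0 then p * ?D else 0)" for j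
    have B: "homogeneous (n + 3) (B j)" for j unfolding B_def using homogeneous_mult[OF n(1) D(1)] by simp
    define g where "g j = germ F \<xi> (B j, t)" for j
    have gc: "g j \<in> carrier (stalk F \<xi>)" for j unfolding g_def by (intro germ_in_carrier fractions_atI[OF B t])
    have "finsum kd.\<Omega> (\<lambda>j. g j \<odot>\<^bsub>kd.\<Omega>\<^esub> du i j) (- {i}) = finsum kd.\<Omega> (\<lambda>j. if j0 = j then g j \<odot>\<^bsub>kd.\<Omega>\<^esub> du i j else \<zero>\<^bsub>kd.\<Omega>\<^esub>) (- {i})"
    proof (rule km.finsum_cong')
      show "g j \<odot>\<^bsub>kd.\<Omega>\<^esub> du i j = (if j0 = j then g j \<odot>\<^bsub>kd.\<Omega>\<^esub> du i j else \<zero>\<^bsub>kd.\<Omega>\<^esub>)" for j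
        using zero_eq_germ[OF t] km.smult_l_null[OF du_closed[OF i]] by (simp add: g_def B_def)
      show "(\<lambda>j. if j0 = j then g j \<odot>\<^bsub>kd.\<Omega>\<^esub> du i j else \<zero>\<^bsub>kd.\<Omega>\<^esub>) \<in> - {i} \<rightarrow> carrier kd.\<Omega>"
        using km.smult_closed[OF gc du_closed[OF i]] by auto
    qed simp
    also have "\<dots> = g j0 \<odot>\<^bsub>kd.\<Omega>\<^esub> du i j0"
      using km.add.finprod_singleton[of j0 "- {i}" "\<lambda>j. g j \<odot>\<^bsub>kd.\<Omega>\<^esub> du i j"] ij0 km.smult_closed[OF gc du_closed[OF i]] by auto
    also have "\<dots> = w"
      unfolding pr(2) du_invariant_differential[OF i] g_def
      by (rule smult_germ_eq[OF fractions_atI[OF B t] \<kappa>_fraction[OF i] sub[OF pr(1)] \<omega>])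
        (simp add: B_def t_def mult_ac ideal_0[OF ideal_pp])
    finally have sum: "w = finsum kd.\<Omega> (\<lambda>j. g j \<odot>\<^bsub>kd.\<Omega>\<^esub> du i j) (- {i})" by (rule sym)
    have "wedge_coefficient F i (f1, s1) (f2, s2) (f3, s3) g \<in> local_functions F x"
      if fs: "(f1, s1) \<in> ideal_fractions_at F x" "(f2, s2) \<in> ideal_fractions_at F x" "(f3, s3) \<in> ideal_fractions_at F x" for f1 s1 f2 s2 f3 s3
    proof -
      have f: "f1 \<in> ideal_of F" "f2 \<in> ideal_of F" "f3 \<in> ideal_of F"
        and fr: "(f1, s1) \<in> fractions_at x" "(f2, s2) \<in> fractions_at x" "(f3, s3) \<in> fractions_at x"
        using fs by (simp_all add: ideal_fractions_at_def)
      obtain n1 where n1: "homogeneous n1 f1" "homogeneous n1 s1" "s1 \<notin> x" using fr(1) by (rule X.fractions_atE)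
      obtain n2 where n2: "homogeneous n2 f2" "homogeneous n2 s2" "s2 \<notin> x" using fr(2) by (rule X.fractions_atE)
      obtain n3 where n3: "homogeneous n3 f3" "homogeneous n3 s3" "s3 \<notin> x" using fr(3) by (rule X.fractions_atE)
      have s\<xi>: "s1 \<notin> \<xi>" "s2 \<notin> \<xi>" "s3 \<notin> \<xi>" using n1 n2 n3 \<xi>x by auto
      note W = wedge_coefficient_eq[OF f n1(1) n2(1) n3(1) n1(2) n2(2) n3(2) s\<xi> B t g_def, of i]
      let ?A = "\<lambda>b. det (frame i (\<lambda>j. pvar i * pdiff j f1) (\<lambda>j. pvar i * pdiff j f2) (\<lambda>j. pvar i * pdiff j f3) b)"
      obtain H where H: "homogeneous (n1 + (n2 + n3)) H" "\<Phi> a b ^ 3 * ?A (unit_row j0) - \<kappa> i j0 * H \<in> \<xi>"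
        by (rule det_frame_ideal[OF f n1(1) n2(1) n3(1) ij0])
      have AB: "?A B = p * ?D * ?A (unit_row j0)"
        unfolding det_frame_linear[of i _ _ _ B] by (simp add: B_def if_distrib[of "\<lambda>x. x * _"] cong: if_cong)
      have h1: "homogeneous (n + (2 + (n1 + (n2 + n3)))) (p * (pvar i ^ 2 * H))"
        by (intro homogeneous_mult n(1) pw(1) H(1))
      have "homogeneous 2 (\<Phi> a b ^ 2)" using homogeneous_power[OF homogeneous_entry, of 2] by simp
      then have h2: "homogeneous (n + (2 + (n1 + (n2 + n3)))) (r * (\<Phi> a b ^ 2 * (s1 * (s2 * s3))))"
        by (intro homogeneous_mult n(2) n1(2) n2(2) n3(2))
      have fr: "(p * (pvar i ^ 2 * H), r * (\<Phi> a b ^ 2 * (s1 * (s2 * s3)))) \<in> fractions_at x"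
        by (rule X.fractions_atI[OF h1 h2]) (use n(3) abx n1(3) n2(3) n3(3) X.notin_power in \<open>simp add: X.mult_mem_iff\<close>)
      have "wedge_coefficient F i (f1, s1) (f2, s2) (f3, s3) g = germ F \<xi> (p * (pvar i ^ 2 * H), r * (\<Phi> a b ^ 2 * (s1 * (s2 * s3))))"
        unfolding W(1)
      proof (rule germ_eq_generic[OF W(2) sub[OF fr]])
        have "?A B * (r * (\<Phi> a b ^ 2 * (s1 * (s2 * s3)))) - p * (pvar i ^ 2 * H) * (s1 * s2 * s3 * t) =
            (p * pvar i ^ 2 * r * s1 * s2 * s3) * (\<Phi> a b ^ 3 * ?A (unit_row j0) - \<kappa> i j0 * H)"
          unfolding AB t_def power2_eq_square power3_eq_cube by (simp add: right_diff_distrib mult_ac)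
        then show "?A B * (r * (\<Phi> a b ^ 2 * (s1 * (s2 * s3)))) - p * (pvar i ^ 2 * H) * (s1 * s2 * s3 * t) \<in> \<xi>"
          using ideal_mult[OF ideal_pp H(2)] by simp
      qed
      then show ?thesis using fr unfolding local_functions_def generic by blast
    qed
    then have "\<forall>f1\<in>ideal_fractions_at F x. \<forall>f2\<in>ideal_fractions_at F x. \<forall>f3\<in>ideal_fractions_at F x.
         wedge_coefficient F i f1 f2 f3 g \<in> local_functions F x" by (metis surj_pair)
    then show ?thesis using gc sum by blast
  qed
  then show ?thesis
    unfolding canonical_stalk_def function_field_eq rational_differentials_eq rational_d_eq coordinate_ratio_eq using wc by blast
qed

lemma canonical_stalk_eq:
  assumes "x \<in> points F" "\<xi> \<subseteq> x" "\<Phi> a b \<notin> x"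
  shows "canonical_stalk F x = generated_stalk F (invariant_differential \<Phi>) x"
  using canonical_stalk_subset[OF assms] canonical_stalk_superset[OF assms] by blast

end

section \<open>Models over a discrete valuation ring\<close>

text \<open>Over a finite field, 1 plus the product of all linear factors takes the value 1
  everywhere, yet has positive degree.\<close>

lemma infinite_alg_closed: "infinite (UNIV :: 'k::alg_closed_field set)"
proof
  assume fin: "finite (UNIV :: 'k set)"
  define p where "p = (\<Prod>a\<in>(UNIV :: 'k set). [:- a, 1:])"
  have "Polynomial.degree p = (\<Sum>a\<in>(UNIV :: 'k set). Polynomial.degree [:- a, 1:])" unfolding p_def by (rule degree_prod_eq_sum_degree) simp
  then have "Polynomial.degree p = CARD('k)" by simp
  then have "Polynomial.degree p > 0" using fin by (simp add: finite_UNIV_card_ge_0)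
  then have "Polynomial.degree (p + 1) > 0" by (simp add: degree_add_eq_left)
  then obtain x where "poly (p + 1) x = 0" using alg_closed_imp_poly_has_root by blast
  moreover have "poly p x = 0" unfolding p_def poly_prod using fin by (intro prod_zero) (auto intro: bexI[of _ x])
  ultimately show False by simp
qed

text \<open>If a had valuation at least 1, its quotient by \<open>\<pi>\<close> would lie in the
  ring and \<open>\<pi>\<close> would divide a. So the valuation is 0, and the inverse of a lies in
  the ring.\<close>

lemma valuation_unit:
  fixes v :: "'r::idom fract \<Rightarrow> int"
  assumes v: "discrete_valuation v" and R: "range (to_fract :: 'r \<Rightarrow> 'r fract) = valuation_ring v"
    and \<pi>: "v (to_fract \<pi>) = 1" "\<pi> \<noteq> 0" and a: "\<not> \<pi> dvd a"
  shows "a dvd 1"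
proof -
  have vm: "x \<noteq> 0 \<Longrightarrow> y \<noteq> 0 \<Longrightarrow> v (x * y) = v x + v y" for x y using v by (auto simp: discrete_valuation_def)
  have "v 1 = 0" using vm[of 1 1] by simp
  have nz: "to_fract a \<noteq> 0" "to_fract \<pi> \<noteq> 0" using a \<pi>(2) by (auto simp: to_fract_eq_0_iff)
  have "to_fract a \<in> valuation_ring v" using R by blast
  then have "v (to_fract a) \<ge> 0" using nz by (simp add: valuation_ring_def)
  moreover have "\<not> v (to_fract a) \<ge> 1"
  proof
    assume "v (to_fract a) \<ge> 1"
    moreover have "v (to_fract a) = v (to_fract \<pi>) + v (to_fract a / to_fract \<pi>)" using vm[of "to_fract \<pi>" "to_fract a / to_fract \<pi>"] nz by simp
    ultimately have "to_fract a / to_fract \<pi> \<in> valuation_ring v" using \<pi>(1) by (simp add: valuation_ring_def)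
    then obtain b where "to_fract a / to_fract \<pi> = to_fract b" unfolding R[symmetric] by blast
    then have "to_fract a = to_fract (\<pi> * b)" using nz by (simp add: field_simps)
    then have "a = \<pi> * b" by (metis to_fract_eq_iff)
    then show False using a by simp
  qed
  ultimately have "v (to_fract a) = 0" by simp
  then have "v (1 / to_fract a) = 0" using vm[of "to_fract a" "1 / to_fract a"] nz \<open>v 1 = 0\<close> by simp
  then have "1 / to_fract a \<in> valuation_ring v" by (simp add: valuation_ring_def)
  then obtain b where "1 / to_fract a = to_fract b" unfolding R[symmetric] by blast
  then have "to_fract (a * b) = to_fract 1" using nz by (simp add: field_simps)
  then have "1 = a * b" by (metis to_fract_eq_iff)
  then show ?thesis by (rule dvdI)
qed

context coefficient_map
begin

lemma map_model_apply: "map_model g \<Phi> i j = pmap (\<Phi> i j)"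
  by (simp add: map_model_def)

lemma Pf_map_model: "Pf (map_model g \<Phi>) i = pmap (Pf \<Phi> i)"
  by (simp add: Pf_def pf4_def map_model_apply pmap_add pmap_diff pmap_mult pmap_uminus)

lemma pfaffian_scheme_map_model: "pfaffian_scheme (map_model g \<Phi>) = pmap ` pfaffian_scheme \<Phi>"
  by (auto simp: pfaffian_scheme_def Pf_map_model)

lemma Q_form_map_model: "Q_form (map_model g \<Phi>) k l m = pmap (Q_form \<Phi> k l m)"
  by (simp add: Q_form_def Pf_map_model map_model_apply pdiff_pmap pmap_sum pmap_mult)

lemma map_model_X5:
  assumes \<Phi>: "\<Phi> \<in> X5"
  shows "map_model g \<Phi> \<in> X5"
proof -
  have "pmap (\<Phi> j i) = - pmap (\<Phi> i j)" for i j unfolding X5D(3)[OF \<Phi>, of j i] by (rule pmap_uminus)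
  moreover have "pmap (\<Phi> i i) = 0" for i by (simp add: X5D(2)[OF \<Phi>])
  ultimately show ?thesis
    unfolding X5_def mem_Collect_eq map_model_apply using homogeneous_pmap[OF X5D(1)[OF \<Phi>]] by blast
qed

end

lemma linear_form_expansion:
  assumes "homogeneous 1 f"
  shows "f = (\<Sum>j\<in>UNIV. pconst (Poly_Mapping.lookup f (Poly_Mapping.single j 1)) * pvar j)"
  using assms
proof (induction rule: homogeneous_induct)
  case (add f h)
  then show ?case by (simp add: lookup_add pconst_add distrib_right sum.distrib)
next
  case (single m c)
  then obtain k m' where m: "m = Poly_Mapping.single k 1 + m'" using monomial_factor[of m] by auto
  then have "mdeg m' = 0" using single unfolding m mdeg_add mdeg_single by simp
  then have "m' = 0" by (intro poly_mapping_eqI) simp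
  then have m: "m = Poly_Mapping.single k 1" using m by simp
  have single_eq: "Poly_Mapping.single k (1::nat) = Poly_Mapping.single j 1 \<longleftrightarrow> k = j" for j :: 5
    by (metis lookup_single_eq lookup_single_not_eq zero_neq_one)
  have "(\<Sum>j\<in>UNIV. pconst (Poly_Mapping.lookup (Poly_Mapping.single m c) (Poly_Mapping.single j 1)) * pvar j) =
      (\<Sum>j\<in>UNIV. if k = j then pconst c * pvar j else 0)"
    unfolding m by (intro sum.cong refl) (auto simp: lookup_single when_def single_eq[simplified])
  also have "\<dots> = pconst c * pvar k" by simp
  also have "\<dots> = Poly_Mapping.single m c" by (simp add: m pvar_def pconst_def mult_single)
  finally show ?case by simp
qed simp

text \<open>If x contained all entries, its reduction, a subspace because \<open>red\<close> is
  surjective, would contain all variables. Each variable would then lie in x up to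
  \<open>\<pi>\<close> times a linear form, and by Nakayama's lemma x would contain every
  variable.\<close>

lemma (in residue) exists_nonvanishing_entry:
  assumes span: "linear_span {map_model red \<Phi> i j | i j. True} = {l. homogeneous 1 l}"
    and x: "x \<in> points F"
  obtains a b where "\<Phi> a b \<notin> x"
proof -
  have idx: "is_ideal x" by (rule gradedD(1)[OF graded_point[OF x]])
  have "\<exists>a b. \<Phi> a b \<notin> x"
  proof (rule ccontr)
    assume "\<not> (\<exists>a b. \<Phi> a b \<notin> x)"
    then have all: "\<Phi> a b \<in> x" for a b by blast
    have "\<exists>c. s - pconst \<pi> * (\<Sum>t\<in>range pvar. pconst (c t) * t) \<in> x" if s: "s \<in> range pvar" for s
    proof -
      obtain i where i: "s = pvar i" using s by blast
      have "module.subspace (\<lambda>c f. pconst c * f) (pmap ` x)"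
      proof (rule rsubspaceI)
        show "0 \<in> pmap ` x" using ideal_0[OF idx] by (metis imageI pmap_0)
        show "f + h \<in> pmap ` x" if fh: "f \<in> pmap ` x" "h \<in> pmap ` x" for f h
        proof -
          obtain f' h' where "f' \<in> x" "h' \<in> x" "f = pmap f'" "h = pmap h'" using fh by blast
          then show ?thesis using ideal_add[OF idx] by (metis imageI pmap_add)
        qed
        show "pconst c * f \<in> pmap ` x" if f: "f \<in> pmap ` x" for c f
        proof -
          obtain f' where f': "f' \<in> x" "f = pmap f'" using f by blast
          obtain c' where "c = red c'" using surj_red by blast
          then have "pconst c * f = pmap (pconst c' * f')" using f' by (simp add: pmap_mult)
          then show ?thesis using ideal_mult[OF idx f'(1)] by blast
        qed
      qed
      moreover have "{map_model red \<Phi> i j | i j. True} \<subseteq> pmap ` x" using all by (auto simp: map_model_apply)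
      ultimately have "linear_span {map_model red \<Phi> i j | i j. True} \<subseteq> pmap ` x"
        unfolding linear_span_def by (intro rspan_minimal)
      then have "pvar i \<in> pmap ` x" unfolding span using homogeneous_pvar by blast
      then obtain h where h: "h \<in> x" "pmap h = pvar i" by (metis imageE)
      \<comment> \<open>Passing to the component of degree 1 stays inside the graded ideal x and
        makes the error a linear form, so it is \<open>\<pi>\<close> times a combination of the
        variables.\<close>
      define f where "f = pvar i - hcomp 1 h"
      have hf: "homogeneous 1 f" unfolding f_def by (intro homogeneous_diff homogeneous_pvar homogeneous_hcomp)
      have "pmap f = 0"
        unfolding f_def pmap_diff hcomp_pmap[symmetric] h(2) by (simp add: hcomp_homogeneous[OF homogeneous_pvar])
      then have "red (Poly_Mapping.lookup f m) = 0" for m by (metis lookup_pmap lookup_zero)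
      then have "\<exists>c. Poly_Mapping.lookup f m = \<pi> * c" for m using red_eq_0_iff by (metis dvdE)
      then obtain c where c: "\<And>m. Poly_Mapping.lookup f m = \<pi> * c m" by metis
      have inj: "inj (pvar :: 5 \<Rightarrow> 'r poly5)"
        by (rule injI) (metis pdiff_pvar zero_neq_one)
      define c' where "c' t = c (Poly_Mapping.single (inv_into UNIV pvar t) 1)" for t :: "'r poly5"
      have "(\<Sum>t\<in>range pvar. pconst (c' t) * t) = (\<Sum>j\<in>UNIV. pconst (c (Poly_Mapping.single j 1)) * pvar j)"
        unfolding sum.reindex[OF inj] by (simp add: c'_def inv_f_f[OF inj])
      then have "f = pconst \<pi> * (\<Sum>t\<in>range pvar. pconst (c' t) * t)"
        using linear_form_expansion[OF hf] unfolding c by (simp add: pconst_mult sum_distrib_left mult.assoc)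
      then have "s - pconst \<pi> * (\<Sum>t\<in>range pvar. pconst (c' t) * t) = pvar i - f" unfolding i by simp
      then have "s - pconst \<pi> * (\<Sum>t\<in>range pvar. pconst (c' t) * t) = hcomp 1 h" by (simp add: f_def)
      then have "s - pconst \<pi> * (\<Sum>t\<in>range pvar. pconst (c' t) * t) \<in> x"
        using gradedD(2)[OF graded_point[OF x] h(1)] by simp
      then show ?thesis by (rule exI[of _ c'])
    qed
    then have "range pvar \<subseteq> x"
      by (intro nakayama ideal_0[OF idx] ideal_add[OF idx] ideal_mult[OF idx]) auto
    then show False using pointsD(3)[OF x] by blast
  qed
  then show ?thesis using that by blast
qed

theorem theorem7p4:
  fixes v :: "'r::idom fract \<Rightarrow> int"
    and \<pi> :: 'r
    and red :: "'r \<Rightarrow> 'k::alg_closed_field"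
    and \<Phi> :: "'r matrix5"
  assumes "discrete_valuation v"
    and "range (to_fract :: 'r \<Rightarrow> 'r fract) = valuation_ring v"
    and "v (to_fract \<pi>) = 1" and "\<pi> \<noteq> 0"
    and "reduction_map \<pi> red"
    and "\<Phi> \<in> X5"
    and "nonsingular_model (map_model to_fract \<Phi>)"
    and "fibred_surface (pfaffian_scheme \<Phi>)"
    and "linear_span {map_model red \<Phi> i j | i j. True} = {l. homogeneous 1 l}"
  shows "local_complete_intersection (pfaffian_scheme \<Phi>) \<and>
    (\<forall>x \<in> points (pfaffian_scheme \<Phi>).
       canonical_stalk (pfaffian_scheme \<Phi>) x =
       generated_stalk (pfaffian_scheme \<Phi>) (invariant_differential \<Phi>) x)"
proof -
  note \<Phi> = \<open>\<Phi> \<in> X5\<close>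
  let ?F = "pfaffian_scheme \<Phi>" and ?\<Psi> = "map_model to_fract \<Phi>"
  interpret residue \<pi> red
    by unfold_locales (use assms valuation_unit[OF assms(1-4)] infinite_alg_closed in auto)
  interpret K: coefficient_map "to_fract :: 'r \<Rightarrow> 'r fract" by unfold_locales simp_all
  let ?E = "pfaffian_scheme ?\<Psi>"
  have int: "integral_scheme ?F" and dim: "has_krull_dim (zariski ?F) 2" using assms(8) by (simp_all add: fibred_surface_def)
  then have irr: "irreducible_in (zariski ?F) (points ?F)" by (simp add: integral_scheme_def)
  note gen = generic_point_characterisation[OF irr]
  have smooth: "smooth_curve ?E" using assms(7) by (simp add: nonsingular_model_def smooth_genus_one_curve_def)
  then have "irreducible_in (zariski ?E) (points ?E)" by (simp add: smooth_curve_def integral_scheme_def)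
  then have y: "generic_point ?E \<in> points ?E" by (rule generic_point_characterisation)
  define y where "y = generic_point ?E"
  note y = y[folded y_def]
  \<comment> \<open>The image on the surface of the generic point of the generic fibre. As a prime
    it contains the generic point of the surface, so what is outside q is outside that
    point.\<close>
  define q where "q = {f. K.pmap f \<in> y}"
  have q: "q \<in> points ?F" unfolding q_def using y unfolding K.pfaffian_scheme_map_model by (rule K.contraction_point)
  obtain w where w: "w \<in> carrier (omega_stalk ?E y)"
    "bij_betw (\<lambda>a. a \<odot>\<^bsub>omega_stalk ?E y\<^esub> w) (carrier (stalk ?E y)) (carrier (omega_stalk ?E y))"
    using smooth y unfolding smooth_curve_def by blast
  have gens: "\<exists>\<alpha>\<in>carrier (stalk ?E y). u = \<alpha> \<odot>\<^bsub>omega_stalk ?E y\<^esub> w" if "u \<in> carrier (omega_stalk ?E y)" for u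
    using that w(2) unfolding bij_betw_def by blast
  obtain a b where "\<Phi> a b \<notin> q" by (rule exists_nonvanishing_entry[OF assms(9) q])
  then have "?\<Psi> a b \<notin> y" by (simp add: q_def K.map_model_apply)
  then obtain \<sigma> where \<sigma>: "\<sigma> permutes UNIV" "evenperm \<sigma>" "pvar (\<sigma> 0) \<notin> y" "Q_form ?\<Psi> (\<sigma> 2) (\<sigma> 3) (\<sigma> 4) \<notin> y"
    by (rule exists_nonvanishing_Q_form[OF K.map_model_X5[OF \<Phi>] y _ w(1) gens])
  have "pvar (\<sigma> 0) \<notin> q" "Q_form \<Phi> (\<sigma> 2) (\<sigma> 3) (\<sigma> 4) \<notin> q" using \<sigma>(3,4) by (simp_all add: q_def K.Q_form_map_model)
  then have \<sigma>': "pvar (\<sigma> 0) \<notin> generic_point ?F" "Q_form \<Phi> (\<sigma> 2) (\<sigma> 3) (\<sigma> 4) \<notin> generic_point ?F" using gen(2)[OF q] by auto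
  \<comment> \<open>\<open>\<pi>\<close> becomes a unit over the field of fractions, so it cannot
    lie in a prime contracted from there.\<close>
  have "pconst \<pi> \<notin> q"
  proof
    assume "pconst \<pi> \<in> q"
    then have "pconst (to_fract \<pi>) \<in> y" by (simp add: q_def)
    then have "pconst (1 / to_fract \<pi>) * pconst (to_fract \<pi>) \<in> y" by (rule ideal_mult[OF gradedD(1)[OF graded_point[OF y]]])
    moreover have "pconst (1 / to_fract \<pi>) * pconst (to_fract \<pi>) = 1"
      using assms(4) by (simp add: pconst_mult[symmetric] to_fract_eq_0_iff)
    ultimately show False using pointsD(1)[OF y] by (simp add: homogeneous_prime_iff)
  qed
  then have \<pi>: "pconst \<pi> \<notin> generic_point ?F" using gen(2)[OF q] by auto
  interpret G: pfaffian_generic_point \<Phi> "generic_point ?F"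
  proof unfold_locales
    show "homogeneous_prime (generic_point ?F)" "?F \<subseteq> generic_point ?F" using pointsD[OF gen(1)] by auto
    show "homogeneous_point.vanishes ?F (generic_point ?F) f" if "f \<in> generic_point ?F" for f
      by (rule vanishes_at_generic_point[OF homogeneous_pfaffian_scheme[OF \<Phi>] int that])
    show "\<exists>\<sigma>. \<sigma> permutes UNIV \<and> evenperm \<sigma> \<and> pvar (\<sigma> 0) \<notin> generic_point ?F \<and> Q_form \<Phi> (\<sigma> 2) (\<sigma> 3) (\<sigma> 4) \<notin> generic_point ?F"
      using \<sigma>(1,2) \<sigma>' by blast
  qed (use \<Phi> in auto)
  \<comment> \<open>Because \<open>\<pi>\<close> is outside the generic point,
    \<open>no_chain_of_points\<close> excludes chains of three points above \<open>\<pi>\<close>,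
    which is what \<open>exists_parameters\<close> asks for. The coordinates obtained serve all
    points x at once.\<close>
  obtain l l' h k N where params: "coord_change l l'" "h \<noteq> k" "covers (vimage_coords l (ideal_of ?F)) {pvar h, pvar k} N"
    by (rule exists_parameters[OF homogeneous_pfaffian_scheme[OF \<Phi>] no_chain_of_points[OF dim irr \<pi>]])
  have pivot: "\<exists>a b c d e \<epsilon>. pivot \<Phi> a b c d e \<epsilon> \<and> \<Phi> a b \<notin> x" if x: "x \<in> points ?F" for x
  proof -
    obtain a b where ab: "\<Phi> a b \<notin> x" by (rule exists_nonvanishing_entry[OF assms(9) x])
    then have "a \<noteq> b" using X5D(2)[OF \<Phi>] ideal_0[OF gradedD(1)[OF graded_point[OF x]]] by auto
    then show ?thesis using exists_pivot[OF \<Phi>] ab by metis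
  qed
  show ?thesis
    unfolding local_complete_intersection_def
  proof (intro conjI ballI)
    fix x assume x: "x \<in> points ?F"
    obtain a b c d e \<epsilon> where p: "pivot \<Phi> a b c d e \<epsilon>" "\<Phi> a b \<notin> x" using pivot[OF x] by blast
    have Pf: "Pf \<Phi> i \<in> ideal_of ?F" for i by (rule ideal_of_base) (simp add: pfaffian_scheme_def)
    show "\<exists>fs. regular_sequence (stalk {} x) fs \<and> germ {} x ` ideal_fractions_at ?F x = genideal (stalk {} x) (set fs)"
      by (rule regular_sequence_at_point[OF homogeneous_pfaffian_scheme[OF \<Phi>] x params homogeneous_Pf[OF \<Phi>] homogeneous_Pf[OF \<Phi>]
          homogeneous_Pf[OF \<Phi>] Pf Pf Pf p(2) pivot_mult_ideal[OF \<Phi> p(1)]])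
  next
    fix x assume x: "x \<in> points ?F"
    obtain a b c d e \<epsilon> where p: "pivot \<Phi> a b c d e \<epsilon>" "\<Phi> a b \<notin> x" using pivot[OF x] by blast
    interpret P: pfaffian_pivot \<Phi> "generic_point ?F" a b c d e \<epsilon>
      by unfold_locales (use p gen(2)[OF x] in auto)
    show "canonical_stalk ?F x = generated_stalk ?F (invariant_differential \<Phi>) x"
      by (rule P.canonical_stalk_eq[OF x gen(2)[OF x] p(2)])
  qed
qed

end
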